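(* Let $(M,J)$ be a connected almost complex manifold of complex dimension $n$ and let $E$ be a totally real $n$-dimensional submanifold of $M$. Suppose that $K$ is a closed subset of $E$ of non-zero Hausdorff $n$-measure. Then $K$ is not contained in a pluripolar subset of $M$.
   Context: All manifolds and almost complex structures are of class $C^\infty$. An almost complex manifold $(M,J)$ of complex dimension $n$ is a smooth $2n$-dimensional manifold with a smooth field $J$ of endomorphisms of the tangent spaces, $J(p):T_pM\to T_pM$, $J(p)^2=-I$. Hausdorff measures are taken with respect to any Riemannian metric on $M$ (the condition of being non-zero does not depend on it). A submanifold $E$ is totally real if $T_pE\cap J(p)T_pE=\{0\}$ for every $p\in E$. Let $\mathbb{D}=\{\zeta\in\mathbb{C}:|\zeta|<1\}$ with its standard complex structure $J_{st}$. A $J$-complex disc is a $C^1$ map $f:\mathbb{D}\to M$ with $df\circ J_{st}=J\circ df$. An upper semicontinuous function $u:M\to[-\infty,+\infty)$ is plurisubharmonic if $u\circ f$ is subharmonic on $\mathbb{D}$ for every $J$-complex disc $f:\mathbb{D}\to M$ (the function $\equiv-\infty$ is allowed). A function $v$ is plurisuperharmonic if $-v$ is plurisubharmonic. A subset $S\subset M$ is pluripolar if there is a plurisuperharmonic function $u$ on $M$, not identically equal to $+\infty$, such that $u|_S=+\infty$. *)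

theory Defs
  imports "HOL-Analysis.Analysis"
begin

section \<open>Differentiability classes in Euclidean spaces\<close>

text \<open>
  Only used for open \<open>S\<close>.  Since the domain is finite-dimensional, asking all directional
  derivatives to be of class \<open>C^k\<close> amounts to asking this of the total derivative.
\<close>

primrec Ck_on :: "nat \<Rightarrow> 'b::euclidean_space set \<Rightarrow> ('b \<Rightarrow> 'c::real_normed_vector) \<Rightarrow> bool" where
  "Ck_on 0 S f \<longleftrightarrow> continuous_on S f"
| "Ck_on (Suc k) S f \<longleftrightarrow>
     (\<forall>x\<in>S. f differentiable (at x)) \<and>
     (\<forall>v. Ck_on k S (\<lambda>x. frechet_derivative f (at x) v))"

definition smooth_on :: "'b::euclidean_space set \<Rightarrow> ('b \<Rightarrow> 'c::real_normed_vector) \<Rightarrow> bool" where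
  "smooth_on S f \<longleftrightarrow> (\<forall>k. Ck_on k S f)"


section \<open>Smooth manifolds\<close>

text \<open>
  A chart is a pair \<open>(U, \<phi>)\<close>; only the values of \<open>\<phi>\<close> on \<open>U\<close> matter.  Manifolds are given by
  a topology \<open>X\<close>, with underlying set \<open>topspace X\<close>, and a maximal \<open>C^\<infinity>\<close> atlas \<open>\<A>\<close>.
\<close>

type_synonym ('a, 'e) chart = "'a set \<times> ('a \<Rightarrow> 'e)"

definition is_chart :: "'a topology \<Rightarrow> ('a, 'e::euclidean_space) chart \<Rightarrow> bool" where
  "is_chart X = (\<lambda>(U, \<phi>). openin X U \<and> open (\<phi> ` U) \<and>
     homeomorphic_map (subtopology X U) (top_of_set (\<phi> ` U)) \<phi>)"

definition transition :: "('a, 'e) chart \<Rightarrow> ('a, 'e) chart \<Rightarrow> 'e \<Rightarrow> 'e" where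
  "transition = (\<lambda>(U, \<phi>) (V, \<psi>). \<psi> \<circ> inv_into U \<phi>)"

definition compatible :: "('a, 'e::euclidean_space) chart \<Rightarrow> ('a, 'e) chart \<Rightarrow> bool" where
  "compatible = (\<lambda>(U, \<phi>) (V, \<psi>).
     smooth_on (\<phi> ` (U \<inter> V)) (transition (U, \<phi>) (V, \<psi>)) \<and>
     smooth_on (\<psi> ` (U \<inter> V)) (transition (V, \<psi>) (U, \<phi>)))"

definition maximal_smooth_atlas :: "'a topology \<Rightarrow> ('a, 'e::euclidean_space) chart set \<Rightarrow> bool" where
  "maximal_smooth_atlas X \<A> \<longleftrightarrow>
     (\<forall>c\<in>\<A>. is_chart X c) \<and>
     (\<Union>(U, \<phi>)\<in>\<A>. U) = topspace X \<and>
     (\<forall>c\<in>\<A>. \<forall>d\<in>\<A>. compatible c d) \<and>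
     (\<forall>c. is_chart X c \<and> (\<forall>d\<in>\<A>. compatible c d) \<longrightarrow> c \<in> \<A>)"

definition smooth_manifold :: "nat \<Rightarrow> 'a topology \<Rightarrow> ('a, 'e::euclidean_space) chart set \<Rightarrow> bool" where
  "smooth_manifold m X \<A> \<longleftrightarrow>
     DIM('e) = m \<and> Hausdorff_space X \<and> second_countable X \<and> maximal_smooth_atlas X \<A>"


subsection \<open>Tangent vectors\<close>

text \<open>
  A tangent vector at \<open>p\<close> is the family of its coordinate representations in all charts
  around \<open>p\<close>; these transform by the derivatives of the transition maps.  The family is set
  to \<open>0\<close> at the indices that are not charts around \<open>p\<close>, so that equality of tangent vectors
  is equality of functions.  The vector space operations are pointwise.
\<close>

type_synonym ('a, 'e) tvec = "('a, 'e) chart \<Rightarrow> 'e"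

definition charts_at :: "('a, 'e) chart set \<Rightarrow> 'a \<Rightarrow> ('a, 'e) chart set" where
  "charts_at \<A> p = {(U, \<phi>) \<in> \<A>. p \<in> U}"

definition tangent_space ::
    "('a, 'e::euclidean_space) chart set \<Rightarrow> 'a \<Rightarrow> ('a, 'e) tvec set" where
  "tangent_space \<A> p =
     {v. (\<forall>c \<in> charts_at \<A> p. \<forall>d \<in> charts_at \<A> p.
            v d = frechet_derivative (transition c d) (at (snd c p)) (v c)) \<and>
         (\<forall>c. c \<notin> charts_at \<A> p \<longrightarrow> v c = 0)}"

abbreviation tzero :: "('a, 'e::euclidean_space) tvec" where
  "tzero \<equiv> (\<lambda>_. 0)"

abbreviation tlincomb ::
    "real \<Rightarrow> ('a, 'e::euclidean_space) tvec \<Rightarrow> real \<Rightarrow> ('a, 'e) tvec \<Rightarrow> ('a, 'e) tvec" where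
  "tlincomb a v b w \<equiv> (\<lambda>c. a *\<^sub>R v c + b *\<^sub>R w c)"

text \<open>The tangent vector at \<open>p\<close> with coordinates \<open>x\<close> in the chart \<open>c\<close> around \<open>p\<close>:\<close>

definition coord_tvec ::
    "('a, 'e::euclidean_space) chart set \<Rightarrow> ('a, 'e) chart \<Rightarrow> 'a \<Rightarrow> 'e \<Rightarrow> ('a, 'e) tvec" where
  "coord_tvec \<A> c p x = (\<lambda>d. if d \<in> charts_at \<A> p
     then frechet_derivative (transition c d) (at (snd c p)) x else 0)"


subsection \<open>\<open>C^1\<close> maps from Euclidean spaces and submanifolds\<close>

text \<open>Only used for open \<open>W\<close>.\<close>

definition C1_map :: "'a topology \<Rightarrow> ('a, 'e::euclidean_space) chart set \<Rightarrow>
    'b::euclidean_space set \<Rightarrow> ('b \<Rightarrow> 'a) \<Rightarrow> bool" where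
  "C1_map X \<A> W f \<longleftrightarrow> continuous_map (top_of_set W) X f \<and>
     (\<forall>(U, \<phi>)\<in>\<A>. Ck_on 1 {z \<in> W. f z \<in> U} (\<phi> \<circ> f))"

definition differential :: "('a, 'e::euclidean_space) chart set \<Rightarrow>
    ('b::euclidean_space \<Rightarrow> 'a) \<Rightarrow> 'b \<Rightarrow> 'b \<Rightarrow> ('a, 'e) tvec" where
  "differential \<A> f z h = (\<lambda>c. if c \<in> charts_at \<A> (f z)
     then frechet_derivative (snd c \<circ> f) (at z) h else 0)"

text \<open>Embedded \<open>C^\<infinity>\<close> submanifolds without boundary, not necessarily closed in the manifold:\<close>

definition submanifold :: "nat \<Rightarrow> 'a topology \<Rightarrow> ('a, 'e::euclidean_space) chart set \<Rightarrow>
    'a set \<Rightarrow> bool" where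
  "submanifold k X \<A> E \<longleftrightarrow> E \<subseteq> topspace X \<and>
     (\<forall>p\<in>E. \<exists>(U, \<phi>)\<in>charts_at \<A> p. \<exists>S. subspace S \<and> dim S = k \<and> \<phi> ` (U \<inter> E) = \<phi> ` U \<inter> S)"

text \<open>Tangent vectors of a submanifold are the velocities of the curves lying in it.\<close>

definition tangent_space_sub :: "'a topology \<Rightarrow> ('a, 'e::euclidean_space) chart set \<Rightarrow>
    'a set \<Rightarrow> 'a \<Rightarrow> ('a, 'e) tvec set" where
  "tangent_space_sub X \<A> E p =
     {differential \<A> \<gamma> 0 1 | (\<gamma> :: real \<Rightarrow> 'a) I.
        open I \<and> 0 \<in> I \<and> C1_map X \<A> I \<gamma> \<and> \<gamma> ` I \<subseteq> E \<and> \<gamma> 0 = p}"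


section \<open>Almost complex manifolds\<close>

text \<open>
  \<open>J p\<close> matters only on \<open>tangent_space \<A> p\<close>.  Smoothness says that, in each chart, the matrix
  of \<open>J\<close> is a smooth function of the point.
\<close>

definition almost_complex_structure :: "'a topology \<Rightarrow> ('a, 'e::euclidean_space) chart set \<Rightarrow>
    ('a \<Rightarrow> ('a, 'e) tvec \<Rightarrow> ('a, 'e) tvec) \<Rightarrow> bool" where
  "almost_complex_structure X \<A> J \<longleftrightarrow>
     (\<forall>p\<in>topspace X. \<forall>v\<in>tangent_space \<A> p.
        J p v \<in> tangent_space \<A> p \<and> J p (J p v) = (\<lambda>c. - v c)) \<and>
     (\<forall>p\<in>topspace X. \<forall>v\<in>tangent_space \<A> p. \<forall>w\<in>tangent_space \<A> p. \<forall>a b.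
        J p (tlincomb a v b w) = tlincomb a (J p v) b (J p w)) \<and>
     (\<forall>(U, \<phi>)\<in>\<A>. \<forall>x. smooth_on (\<phi> ` U)
        (\<lambda>y. let p = inv_into U \<phi> y in J p (coord_tvec \<A> (U, \<phi>) p x) (U, \<phi>)))"

definition almost_complex_manifold :: "nat \<Rightarrow> 'a topology \<Rightarrow>
    ('a, 'e::euclidean_space) chart set \<Rightarrow>
    ('a \<Rightarrow> ('a, 'e) tvec \<Rightarrow> ('a, 'e) tvec) \<Rightarrow> bool" where
  "almost_complex_manifold n X \<A> J \<longleftrightarrow>
     smooth_manifold (2 * n) X \<A> \<and> almost_complex_structure X \<A> J"

definition totally_real :: "'a topology \<Rightarrow> ('a, 'e::euclidean_space) chart set \<Rightarrow>
    ('a \<Rightarrow> ('a, 'e) tvec \<Rightarrow> ('a, 'e) tvec) \<Rightarrow> 'a set \<Rightarrow> bool" where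
  "totally_real X \<A> J E \<longleftrightarrow>
     (\<forall>p\<in>E. tangent_space_sub X \<A> E p \<inter> J p ` tangent_space_sub X \<A> E p = {tzero})"

definition J_complex_disc :: "'a topology \<Rightarrow> ('a, 'e::euclidean_space) chart set \<Rightarrow>
    ('a \<Rightarrow> ('a, 'e) tvec \<Rightarrow> ('a, 'e) tvec) \<Rightarrow> (complex \<Rightarrow> 'a) \<Rightarrow> bool" where
  "J_complex_disc X \<A> J f \<longleftrightarrow> C1_map X \<A> (ball 0 1) f \<and>
     (\<forall>z\<in>ball 0 1. \<forall>h. differential \<A> f z (\<i> * h) = J (f z) (differential \<A> f z h))"


section \<open>Plurisubharmonic functions and pluripolar sets\<close>

definition upper_semicontinuous :: "'a topology \<Rightarrow> ('a \<Rightarrow> ereal) \<Rightarrow> bool" where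
  "upper_semicontinuous X u \<longleftrightarrow> (\<forall>c. openin X {x \<in> topspace X. u x < c})"

text \<open>
  The integral over \<open>{0..2 * pi}\<close> of an extended real function, as the integral of its positive
  part minus that of its negative part (\<^const>\<open>e2ennreal\<close> sends negative numbers to \<open>0\<close>).
  Below, the positive part is bounded, so the difference is never \<open>\<infinity> - \<infinity>\<close>.
\<close>

definition circle_mean :: "(complex \<Rightarrow> ereal) \<Rightarrow> complex \<Rightarrow> real \<Rightarrow> ereal" where
  "circle_mean u a r =
     (enn2ereal (\<integral>\<^sup>+t\<in>{0..2 * pi}. e2ennreal (u (a + of_real r * cis t)) \<partial>lborel) -
      enn2ereal (\<integral>\<^sup>+t\<in>{0..2 * pi}. e2ennreal (- u (a + of_real r * cis t)) \<partial>lborel))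
     / ereal (2 * pi)"

definition subharmonic_on :: "complex set \<Rightarrow> (complex \<Rightarrow> ereal) \<Rightarrow> bool" where
  "subharmonic_on \<Omega> u \<longleftrightarrow>
     (\<forall>z\<in>\<Omega>. u z < \<infinity>) \<and> upper_semicontinuous (top_of_set \<Omega>) u \<and>
     (\<forall>a r. 0 < r \<and> cball a r \<subseteq> \<Omega> \<longrightarrow> u a \<le> circle_mean u a r)"

definition plurisubharmonic :: "'a topology \<Rightarrow> ('a, 'e::euclidean_space) chart set \<Rightarrow>
    ('a \<Rightarrow> ('a, 'e) tvec \<Rightarrow> ('a, 'e) tvec) \<Rightarrow> ('a \<Rightarrow> ereal) \<Rightarrow> bool" where
  "plurisubharmonic X \<A> J u \<longleftrightarrow>
     (\<forall>p\<in>topspace X. u p < \<infinity>) \<and> upper_semicontinuous X u \<and>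
     (\<forall>f. J_complex_disc X \<A> J f \<longrightarrow> subharmonic_on (ball 0 1) (u \<circ> f))"

definition plurisuperharmonic :: "'a topology \<Rightarrow> ('a, 'e::euclidean_space) chart set \<Rightarrow>
    ('a \<Rightarrow> ('a, 'e) tvec \<Rightarrow> ('a, 'e) tvec) \<Rightarrow> ('a \<Rightarrow> ereal) \<Rightarrow> bool" where
  "plurisuperharmonic X \<A> J v \<longleftrightarrow> plurisubharmonic X \<A> J (\<lambda>p. - v p)"

definition pluripolar :: "'a topology \<Rightarrow> ('a, 'e::euclidean_space) chart set \<Rightarrow>
    ('a \<Rightarrow> ('a, 'e) tvec \<Rightarrow> ('a, 'e) tvec) \<Rightarrow> 'a set \<Rightarrow> bool" where
  "pluripolar X \<A> J S \<longleftrightarrow> S \<subseteq> topspace X \<and>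
     (\<exists>u. plurisuperharmonic X \<A> J u \<and> (\<exists>p\<in>topspace X. u p \<noteq> \<infinity>) \<and> (\<forall>p\<in>S. u p = \<infinity>))"


section \<open>Riemannian metrics and Hausdorff measures\<close>

definition riemannian_metric :: "'a topology \<Rightarrow> ('a, 'e::euclidean_space) chart set \<Rightarrow>
    ('a \<Rightarrow> ('a, 'e) tvec \<Rightarrow> ('a, 'e) tvec \<Rightarrow> real) \<Rightarrow> bool" where
  "riemannian_metric X \<A> g \<longleftrightarrow>
     (\<forall>p\<in>topspace X. \<forall>v\<in>tangent_space \<A> p. \<forall>w\<in>tangent_space \<A> p.
        g p v w = g p w v) \<and>
     (\<forall>p\<in>topspace X. \<forall>v\<in>tangent_space \<A> p. \<forall>w\<in>tangent_space \<A> p.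
        \<forall>z\<in>tangent_space \<A> p. \<forall>a b. g p (tlincomb a v b w) z = a * g p v z + b * g p w z) \<and>
     (\<forall>p\<in>topspace X. \<forall>v\<in>tangent_space \<A> p. v \<noteq> tzero \<longrightarrow> g p v v > 0) \<and>
     (\<forall>(U, \<phi>)\<in>\<A>. \<forall>x x'. smooth_on (\<phi> ` U)
        (\<lambda>y. let p = inv_into U \<phi> y in g p (coord_tvec \<A> (U, \<phi>) p x) (coord_tvec \<A> (U, \<phi>) p x')))"

definition curve_length :: "('a, 'e::euclidean_space) chart set \<Rightarrow>
    ('a \<Rightarrow> ('a, 'e) tvec \<Rightarrow> ('a, 'e) tvec \<Rightarrow> real) \<Rightarrow> (real \<Rightarrow> 'a) \<Rightarrow> ennreal" where
  "curve_length \<A> g \<gamma> = (\<integral>\<^sup>+t\<in>{0..1}.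
     ennreal (sqrt (g (\<gamma> t) (differential \<A> \<gamma> t 1) (differential \<A> \<gamma> t 1))) \<partial>lborel)"

text \<open>
  The curves are not required to be regular, so a piecewise \<open>C^1\<close> curve can be reparametrised,
  with zero velocity at its corners, as a \<open>C^1\<close> curve of the same length: the infimum is the same
  as over piecewise \<open>C^1\<close> curves.
\<close>

definition riemannian_dist :: "'a topology \<Rightarrow> ('a, 'e::euclidean_space) chart set \<Rightarrow>
    ('a \<Rightarrow> ('a, 'e) tvec \<Rightarrow> ('a, 'e) tvec \<Rightarrow> real) \<Rightarrow> 'a \<Rightarrow> 'a \<Rightarrow> ennreal" where
  "riemannian_dist X \<A> g p q =
     Inf {curve_length \<A> g \<gamma> | \<gamma> I. open I \<and> {0..1} \<subseteq> I \<and> C1_map X \<A> I \<gamma> \<and> \<gamma> 0 = p \<and> \<gamma> 1 = q}"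

definition diam_wrt :: "('a \<Rightarrow> 'a \<Rightarrow> ennreal) \<Rightarrow> 'a set \<Rightarrow> ennreal" where
  "diam_wrt d B = (SUP x\<in>B. SUP y\<in>B. d x y)"

text \<open>
  The \<open>k\<close>-dimensional Hausdorff (outer) measure of \<open>S \<subseteq> M\<close> for the distance \<open>d\<close> on \<open>M\<close>,
  normalised to agree with Lebesgue measure on Euclidean \<open>k\<close>-space.
\<close>

definition hausdorff_premeasure ::
    "nat \<Rightarrow> 'a set \<Rightarrow> ('a \<Rightarrow> 'a \<Rightarrow> ennreal) \<Rightarrow> ennreal \<Rightarrow> 'a set \<Rightarrow> ennreal" where
  "hausdorff_premeasure k M d \<delta> S =
     Inf {\<Sum>i. if B i = {} then 0 else ennreal (unit_ball_vol (real k)) * (diam_wrt d (B i) / 2) ^ k | B.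
            (\<forall>i::nat. B i \<subseteq> M \<and> diam_wrt d (B i) \<le> \<delta>) \<and> S \<subseteq> (\<Union>i. B i)}"

definition hausdorff_measure ::
    "nat \<Rightarrow> 'a set \<Rightarrow> ('a \<Rightarrow> 'a \<Rightarrow> ennreal) \<Rightarrow> 'a set \<Rightarrow> ennreal" where
  "hausdorff_measure k M d S = (SUP \<delta>\<in>{0<..}. hausdorff_premeasure k M d \<delta> S)"

end

theory Submission
  imports Defs
begin

text \<open>
  Let \<open>v\<close> be a plurisubharmonic function with \<open>v = -\<infinity>\<close> on \<open>K\<close>, where \<open>K\<close> has positive
  measure in a totally real \<open>E\<close> of half dimension.  The value \<open>-\<infinity>\<close> has to be spread from \<open>K\<close>
  over the whole manifold, and this is done with \<open>J\<close>-complex discs.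

  The discs are built in a chart that straightens \<open>E\<close> to a linear subspace.  Let \<open>J0\<close> be the value of \<open>J\<close>
  at the point considered and \<open>R\<close> the conjugation that fixes the subspace and anticommutes with
  \<open>J0\<close>.  The map \<open>\<Psi> w = y0 + \<sigma> w + J(y0 + \<sigma> w) \<tau> w\<close>, with \<open>\<sigma>\<close> and \<open>\<tau>\<close> the real and the imaginary
  part for \<open>R\<close>, turns \<open>J\<close> into a structure that equals \<open>J0\<close> along the subspace.  For \<open>\<Psi> \<circ> w\<close> to be
  \<open>J\<close>-complex means that \<open>h = w\<^sub>x + J0 w\<^sub>y\<close> satisfies \<open>h = A(w) h + B(w) w\<^sub>y\<close>, where \<open>A\<close> vanishes at
  the origin and \<open>B\<close> on the subspace.  Writing \<open>w\<close> as a Cauchy transform of \<open>h\<close> plus a polynomial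
  map makes this a fixed point equation for \<open>h\<close> in a Hoelder space, and for small data a
  contraction.  Two devices make the solutions useful.  First, as \<open>B\<close> vanishes on the subspace,
  the right-hand side is zero on the real axis as soon as \<open>w\<close> maps the axis into the subspace;
  so a density on the upper half disc may be extended by \<open>h (cnj z) = R (h z)\<close>, and the Cauchy
  transform of a symmetric density does map the axis into the subspace.  Second, the polynomial
  part prescribes the values of \<open>w\<close> at two interior points and leaves a parameter that moves the
  values on the axis.  The outcome is \<open>disc_family_ex\<close>, and, in coordinates, \<open>coordinate_discs_ex\<close>.

  If \<open>v\<close> is \<open>-\<infinity>\<close> on an open set, a disc through a point of this set and any
  point nearby, with the mean value inequality, shows that \<open>v = -\<infinity>\<close> at the latter
  (\<open>interior_lemma\<close>); on a connected manifold \<open>v = -\<infinity>\<close> follows everywhere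
  (\<open>minus_infinity_everywhere\<close>).  If \<open>v\<close> is \<open>-\<infinity>\<close> on a set of positive length of the boundary arc of
  a half disc, Fatou's lemma applied to the mean values over growing circles gives \<open>v = -\<infinity>\<close> at
  the centre (\<open>boundary_lemma\<close>).  Such an arc exists by Fubini's theorem: at each boundary point
  the parameter of the discs can be adjusted to reach every given point of \<open>E\<close> nearby, and the boundary
  value is a Lipschitz function of the parameter, so a part of \<open>K\<close> of positive measure is hit for a
  set of parameters of positive measure (\<open>totally_real_case\<close>).  Hence, if some point of \<open>K\<close> had a
  neighbourhood in which \<open>K\<close>, seen in the straightened chart, has positive measure, then \<open>v\<close> would be
  \<open>-\<infinity>\<close> near this point and so everywhere.

  The measure on the subspace never appears as such: a set \<open>Y\<close> in the subspace counts as
  null if the cylinder over it, \<open>{y \<in> cball 0 1. \<sigma> y \<in> Y}\<close>, is a Lebesgue null set of the whole space.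
  A volume count gives economical coverings of a compact null set by balls (\<open>null_cylinder_cover\<close>), and a
  Riemannian distance is locally bounded by a multiple of the distance in the chart.  So if \<open>K\<close> is null in this sense
  near each of its points, its Hausdorff measure is zero near each of its points and,
  the topology having a countable base, altogether.
\<close>

section \<open>Hoelder continuous functions\<close>

text \<open>
  The exponent is fixed at one half, and a single constant bounds both the supremum and the
  seminorm; with one constant the estimates of products and compositions stay short.
\<close>

definition hoelder :: "complex set \<Rightarrow> real \<Rightarrow> (complex \<Rightarrow> 'b::real_normed_vector) \<Rightarrow> bool" where
  "hoelder P M h \<longleftrightarrow> (\<forall>z\<in>P. norm (h z) \<le> M) \<and>
     (\<forall>z\<in>P. \<forall>z'\<in>P. norm (h z - h z') \<le> M * sqrt (norm (z - z')))"

lemma hoelderI: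
  "(\<And>z. z \<in> P \<Longrightarrow> norm (h z) \<le> M) \<Longrightarrow>
   (\<And>z z'. z \<in> P \<Longrightarrow> z' \<in> P \<Longrightarrow> norm (h z - h z') \<le> M * sqrt (norm (z - z'))) \<Longrightarrow> hoelder P M h"
  by (auto simp: hoelder_def)

lemma hoelderD1: "hoelder P M h \<Longrightarrow> z \<in> P \<Longrightarrow> norm (h z) \<le> M"
  by (auto simp: hoelder_def)

lemma hoelderD2: "hoelder P M h \<Longrightarrow> z \<in> P \<Longrightarrow> z' \<in> P \<Longrightarrow> norm (h z - h z') \<le> M * sqrt (norm (z - z'))"
  by (auto simp: hoelder_def)

lemma hoelder_nonneg: "hoelder P M h \<Longrightarrow> z \<in> P \<Longrightarrow> 0 \<le> M"
  using hoelderD1 norm_ge_zero order_trans by blast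

lemma hoelder_subset: "hoelder P M h \<Longrightarrow> Q \<subseteq> P \<Longrightarrow> hoelder Q M h"
  by (auto simp: hoelder_def)

lemma hoelder_mono: "hoelder P M h \<Longrightarrow> M \<le> N \<Longrightarrow> hoelder P N h"
  unfolding hoelder_def by (meson mult_right_mono order_trans real_sqrt_ge_zero norm_ge_zero)

lemma hoelder_add:
  assumes "hoelder P M f" "hoelder P N g" shows "hoelder P (M + N) (\<lambda>z. f z + g z)"
proof (rule hoelderI)
  fix z assume "z \<in> P" then show "norm (f z + g z) \<le> M + N"
    using hoelderD1[OF assms(1)] hoelderD1[OF assms(2)] norm_triangle_mono by blast
next
  fix z z' assume *: "z \<in> P" "z' \<in> P"
  have "norm ((f z + g z) - (f z' + g z')) \<le> norm (f z - f z') + norm (g z - g z')"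
    by (metis add_diff_add norm_triangle_ineq)
  also have "\<dots> \<le> (M + N) * sqrt (norm (z - z'))"
    using hoelderD2[OF assms(1) *] hoelderD2[OF assms(2) *] by (simp add: algebra_simps)
  finally show "norm ((f z + g z) - (f z' + g z')) \<le> (M + N) * sqrt (norm (z - z'))" .
qed

lemma hoelder_bounded_linear:
  assumes "hoelder P M f" "bounded_linear T" "\<And>v. norm (T v) \<le> C * norm v" "0 \<le> C"
  shows "hoelder P (C * M) (\<lambda>z. T (f z))"
proof (rule hoelderI)
  fix z assume z: "z \<in> P"
  show "norm (T (f z)) \<le> C * M"
    by (rule order_trans[OF assms(3)]) (simp add: mult_left_mono hoelderD1[OF assms(1) z] assms(4))
next
  fix z z' assume *: "z \<in> P" "z' \<in> P"
  have "norm (T (f z) - T (f z')) = norm (T (f z - f z'))"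
    using assms(2) by (simp add: bounded_linear.linear linear_diff)
  also have "\<dots> \<le> C * (M * sqrt (norm (z - z')))"
    by (rule order_trans[OF assms(3)]) (simp add: mult_left_mono hoelderD2[OF assms(1) *] assms(4))
  finally show "norm (T (f z) - T (f z')) \<le> C * M * sqrt (norm (z - z'))" by simp
qed

lemma hoelder_uminus: "hoelder P M f \<Longrightarrow> hoelder P M (\<lambda>z. - f z)"
  using hoelder_bounded_linear[of P M f uminus 1] by (simp add: bounded_linear_minus bounded_linear_ident)

lemma hoelder_diff:
  assumes "hoelder P M f" "hoelder P N g" shows "hoelder P (M + N) (\<lambda>z. f z - g z)"
  using hoelder_add[OF assms(1) hoelder_uminus[OF assms(2)]] by simp

lemma hoelder_bilinear:
  assumes "bounded_bilinear B" "hoelder P M f" "hoelder P N g"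
    "\<And>a b. norm (B a b) \<le> C * norm a * norm b" "0 \<le> C"
  shows "hoelder P (2 * C * M * N) (\<lambda>z. B (f z) (g z))"
proof (rule hoelderI)
  fix z assume z: "z \<in> P"
  have "norm (B (f z) (g z)) \<le> C * norm (f z) * norm (g z)" by (rule assms(4))
  also have "\<dots> \<le> C * M * N"
    by (intro mult_mono mult_left_mono hoelderD1[OF assms(2)] hoelderD1[OF assms(3)] z assms(5)
        mult_nonneg_nonneg hoelder_nonneg[OF assms(2) z]) auto
  also have "\<dots> \<le> 2 * C * M * N"
    using assms(5) hoelder_nonneg[OF assms(2) z] hoelder_nonneg[OF assms(3) z] by simp
  finally show "norm (B (f z) (g z)) \<le> 2 * C * M * N" .
next
  fix z z' assume *: "z \<in> P" "z' \<in> P"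
  interpret bounded_bilinear B by fact
  let ?s = "sqrt (norm (z - z'))"
  have MN: "0 \<le> M" "0 \<le> N" using hoelder_nonneg[OF assms(2)] hoelder_nonneg[OF assms(3)] * by auto
  have "norm (B (f z) (g z) - B (f z') (g z')) = norm (B (f z - f z') (g z) + B (f z') (g z - g z'))"
    by (simp add: diff_left diff_right)
  also have "\<dots> \<le> C * norm (f z - f z') * norm (g z) + C * norm (f z') * norm (g z - g z')"
    using norm_triangle_mono[OF assms(4) assms(4)] .
  also have "\<dots> \<le> C * (M * ?s) * N + C * M * (N * ?s)"
    by (intro add_mono mult_mono mult_left_mono hoelderD1[OF assms(2)] hoelderD1[OF assms(3)]
       hoelderD2[OF assms(2)] hoelderD2[OF assms(3)] * assms(5) mult_nonneg_nonneg MN) auto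
  finally show "norm (B (f z) (g z) - B (f z') (g z')) \<le> 2 * C * M * N * ?s"
    by (simp add: algebra_simps)
qed

lemma hoelder_of_lipschitz:
  assumes "\<And>z. z \<in> P \<Longrightarrow> norm (f z) \<le> M"
    "\<And>z z'. z \<in> P \<Longrightarrow> z' \<in> P \<Longrightarrow> norm (f z - f z') \<le> M * norm (z - z')"
  shows "hoelder P (2 * M) f"
proof (rule hoelderI)
  fix z assume z: "z \<in> P"
  then show "norm (f z) \<le> 2 * M" using assms(1)[OF z] norm_ge_zero[of "f z"] by linarith
next
  fix z z' assume *: "z \<in> P" "z' \<in> P"
  have M: "0 \<le> M" using assms(1)[OF *(1)] norm_ge_zero order_trans by blast
  let ?d = "norm (z - z')"
  show "norm (f z - f z') \<le> 2 * M * sqrt ?d"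
  proof (cases "?d \<le> 1")
    case True
    have "?d^2 \<le> ?d" using True by (simp add: power2_eq_square mult_left_le)
    then have "?d \<le> sqrt ?d" by (rule real_le_rsqrt)
    then have "M * ?d \<le> M * sqrt ?d" using M by (rule mult_left_mono)
    moreover have "0 \<le> M * sqrt ?d" using M by simp
    ultimately show ?thesis using assms(2)[OF *] by linarith
  next
    case False
    then have "1 \<le> sqrt ?d" by simp
    then have "2 * M \<le> 2 * M * sqrt ?d" using M by (simp add: mult_le_cancel_left1)
    moreover have "norm (f z - f z') \<le> M + M"
      using norm_triangle_ineq4[of "f z" "f z'"] assms(1)[OF *(1)] assms(1)[OF *(2)] by linarith
    ultimately show ?thesis by linarith
  qed
qed

lemma hoelder_continuous_on:
  assumes "hoelder P M h" shows "continuous_on P h"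
proof -
  have "(h \<longlongrightarrow> h z) (at z within P)" if z: "z \<in> P" for z
  proof (rule tendstoI)
    fix e :: real assume e: "0 < e"
    have "((\<lambda>x. M * sqrt (norm (x - z))) \<longlongrightarrow> M * sqrt (norm (z - z))) (at z within P)"
      by (intro tendsto_intros)
    then have "\<forall>\<^sub>F x in at z within P. M * sqrt (norm (x - z)) < e"
      using e by (intro order_tendstoD) auto
    moreover have "\<forall>\<^sub>F x in at z within P. x \<in> P"
      by (simp add: eventually_at_topological) blast
    ultimately show "\<forall>\<^sub>F x in at z within P. dist (h x) (h z) < e"
      by eventually_elim (use hoelderD2[OF assms _ z] in \<open>auto simp: dist_norm intro: le_less_trans\<close>)
  qed
  then show ?thesis by (auto simp: continuous_on)
qed

lemma hoelder_limit:
  assumes "\<And>n. hoelder P (M n) (f n)" "\<And>z. z \<in> P \<Longrightarrow> (\<lambda>n. f n z) \<longlonglongrightarrow> g z" "M \<longlonglongrightarrow> M'"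
  shows "hoelder P M' g"
proof (rule hoelderI)
  fix z assume z: "z \<in> P"
  show "norm (g z) \<le> M'"
    by (rule LIMSEQ_le[OF tendsto_norm[OF assms(2)[OF z]] assms(3)]) (use hoelderD1[OF assms(1) z] in auto)
next
  fix z z' assume *: "z \<in> P" "z' \<in> P"
  show "norm (g z - g z') \<le> M' * sqrt (norm (z - z'))"
    by (rule LIMSEQ_le[OF tendsto_norm[OF tendsto_diff[OF assms(2) assms(2)]] tendsto_mult_right[OF assms(3)]])
      (use hoelderD2[OF assms(1) *] * in auto)
qed

section \<open>A regularised Cauchy kernel\<close>

text \<open>
  A regularisation of \<open>1/z\<close>. On the unit circle \<open>cnj z * (2 -
  \<bar>z\<bar>\<^sup>2)\<close> agrees with \<open>1/z\<close> to first order, so the glued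
  function has a Lipschitz differential, given by an explicit formula on both sides of the
  circle.
\<close>

definition kern :: "complex \<Rightarrow> complex" where
  "kern z = (if norm z \<le> 1 then 2 * cnj z - (cnj z)^2 * z else inverse z)"

text \<open>
  The antiholomorphic derivative of the kernel, a nonnegative bump on the unit disc.
\<close>

definition kern_dbar :: "complex \<Rightarrow> real" where "kern_dbar z = 2 * max 0 (1 - (norm z)^2)"

text \<open>
  Minus the square of this Lipschitz function is the holomorphic derivative of the kernel,
  inside the unit disc as well as outside.
\<close>

definition reflection :: "complex \<Rightarrow> complex" where
  "reflection z = (if norm z \<le> 1 then cnj z else inverse z)"

definition dkern :: "complex \<Rightarrow> complex \<Rightarrow> complex" where
  "dkern z \<eta> = of_real (kern_dbar z) * cnj \<eta> - (reflection z)^2 * \<eta>"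

lemma norm_reflection: "norm (reflection z) \<le> 1"
  by (auto simp: reflection_def norm_inverse inverse_le_1_iff)

text \<open>
  By the identity \<open>\<bar>cnj z * z' - 1\<bar>\<^sup>2 = \<bar>z - z'\<bar>\<^sup>2 + (1
  - \<bar>z\<bar>\<^sup>2) * (1 - \<bar>z'\<bar>\<^sup>2)\<close>, whose last product is not
  positive here.
\<close>

lemma inside_outside_lipschitz:
  fixes z z' :: complex
  assumes "norm z \<le> 1" "norm z' > 1" shows "norm (cnj z - inverse z') \<le> norm (z - z')"
proof -
  have z0: "z' \<noteq> 0" using assms by auto
  have "(norm (cnj z * z' - 1))^2 = (norm (z - z'))^2 + (1 - (norm z)^2) * (1 - (norm z')^2)"
    unfolding cmod_power2 by (simp add: power2_eq_square algebra_simps)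
  also have "\<dots> \<le> (norm (z - z'))^2"
    using assms by (simp add: mult_nonneg_nonpos power_le_one)
  finally have "norm (cnj z * z' - 1) \<le> norm (z - z')" by (rule power2_le_imp_le) simp
  moreover have "cnj z - inverse z' = (cnj z * z' - 1) / z'" using z0 by (simp add: diff_divide_distrib inverse_eq_divide)
  moreover have "norm (cnj z * z' - 1) / norm z' \<le> norm (cnj z * z' - 1) / 1"
    using assms by (intro divide_left_mono) auto
  ultimately show ?thesis by (simp add: norm_divide)
qed

lemma reflection_lipschitz: "norm (reflection z - reflection z') \<le> norm (z - z')"
proof -
  consider "norm z \<le> 1" "norm z' \<le> 1" | "norm z \<le> 1" "norm z' > 1" | "norm z > 1" "norm z' \<le> 1"
    | "norm z > 1" "norm z' > 1" by linarith
  then show ?thesis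
  proof cases
    case 1 then show ?thesis by (simp add: reflection_def flip: complex_cnj_diff)
  next
    case 2 then show ?thesis using inside_outside_lipschitz[of z z'] by (simp add: reflection_def)
  next
    case 3 then show ?thesis using inside_outside_lipschitz[of z' z] by (simp add: reflection_def norm_minus_commute)
  next
    case 4
    then have "z \<noteq> 0" "z' \<noteq> 0" by auto
    then have "inverse z - inverse z' = (z' - z) / (z * z')" by (simp add: field_simps)
    moreover have "1 \<le> norm (z * z')" using 4 by (metis less_eq_real_def mult_ge1_I norm_mult)
    ultimately show ?thesis using 4
      by (simp add: reflection_def norm_divide norm_minus_commute divide_le_eq mult_le_cancel_left1 norm_mult)
  qed
qed

lemma kern_dbar_alt: "kern_dbar z = 2 * (1 - (min 1 (norm z))^2)"
proof (cases "norm z \<le> 1")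
  case True
  then show ?thesis using power_le_one[of "norm z" 2] by (simp add: kern_dbar_def min_def max_def)
next
  case False
  then have "1 \<le> (norm z)^2" by simp
  then have "max 0 (1 - (norm z)^2) = 0" by linarith
  then show ?thesis using False by (simp add: kern_dbar_def min_def)
qed

lemma kern_dbar_bounds: "0 \<le> kern_dbar z" "kern_dbar z \<le> 2"
  by (auto simp: kern_dbar_def max_def)

lemma kern_dbar_lipschitz: "\<bar>kern_dbar z - kern_dbar z'\<bar> \<le> 4 * norm (z - z')"
proof -
  let ?a = "min 1 (norm z)" and ?b = "min 1 (norm z')"
  have "kern_dbar z - kern_dbar z' = 2 * ((?b - ?a) * (?b + ?a))" by (simp add: kern_dbar_alt power2_eq_square algebra_simps)
  then have "\<bar>kern_dbar z - kern_dbar z'\<bar> = 2 * (\<bar>?b - ?a\<bar> * (?b + ?a))" by (simp add: abs_mult)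
  also have "\<dots> \<le> 2 * (norm (z - z') * 2)"
  proof -
    have "\<bar>?b - ?a\<bar> \<le> \<bar>norm z - norm z'\<bar>" by (auto simp: min_def)
    also have "\<dots> \<le> norm (z - z')" by (rule norm_triangle_ineq3)
    finally have "\<bar>?b - ?a\<bar> \<le> norm (z - z')" .
    then have "\<bar>?b - ?a\<bar> * (?b + ?a) \<le> norm (z - z') * 2" by (intro mult_mono) auto
    then show ?thesis by linarith
  qed
  finally show ?thesis by simp
qed

lemma norm_dkern: "norm (dkern z \<eta>) \<le> 3 * norm \<eta>"
proof -
  have "norm (dkern z \<eta>) \<le> kern_dbar z * norm \<eta> + (norm (reflection z))^2 * norm \<eta>"
    unfolding dkern_def by (rule order_trans[OF norm_triangle_ineq4]) (simp add: norm_mult norm_power kern_dbar_bounds)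
  also have "\<dots> \<le> 2 * norm \<eta> + 1 * norm \<eta>"
    using kern_dbar_bounds norm_reflection by (intro add_mono mult_right_mono power_le_one) auto
  finally show ?thesis by simp
qed

lemma dkern_lipschitz: "norm (dkern z \<eta> - dkern z' \<eta>) \<le> 6 * norm (z - z') * norm \<eta>"
proof -
  have "dkern z \<eta> - dkern z' \<eta> = of_real (kern_dbar z - kern_dbar z') * cnj \<eta> - (reflection z - reflection z') * (reflection z + reflection z') * \<eta>"
    by (simp add: dkern_def algebra_simps power2_eq_square)
  then have "norm (dkern z \<eta> - dkern z' \<eta>) \<le> \<bar>kern_dbar z - kern_dbar z'\<bar> * norm \<eta> + norm (reflection z - reflection z') * norm (reflection z + reflection z') * norm \<eta>"
    by (metis (no_types, lifting) norm_triangle_ineq4 norm_mult norm_of_real complex_mod_cnj)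
  also have "\<dots> \<le> 4 * norm (z - z') * norm \<eta> + norm (z - z') * 2 * norm \<eta>"
  proof (intro add_mono mult_right_mono mult_mono kern_dbar_lipschitz reflection_lipschitz)
    show "norm (reflection z + reflection z') \<le> 2"
      using norm_triangle_mono[OF norm_reflection norm_reflection, of z z'] by simp
  qed auto
  finally show ?thesis by (simp add: algebra_simps)
qed

lemma dkern_linear: "bounded_linear (dkern z)"
  unfolding dkern_def by (intro bounded_linear_intros bounded_linear_compose[OF bounded_linear_mult_right bounded_linear_cnj]
      bounded_linear_sub bounded_linear_mult_right)

lemma dkern_add: "dkern z (a + b) = dkern z a + dkern z b" by (simp add: dkern_def algebra_simps)

lemma kern_taylor_inside:
  assumes "norm z \<le> 1" "norm z' \<le> 1"
  shows "norm (kern z' - kern z - dkern z (z' - z)) \<le> 5 * (norm (z' - z))^2"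
proof -
  define \<eta> where "\<eta> = z' - z"
  have a: "kern_dbar z = 2 * (1 - (norm z)^2)" using assms by (simp add: kern_dbar_def power_le_one)
  have n: "of_real ((norm z)^2) = z * cnj z" by (metis complex_norm_square)
  have "kern z' - kern z - dkern z (z' - z) = - ((cnj \<eta>)^2 * z + 2 * cnj z * cnj \<eta> * \<eta> + (cnj \<eta>)^2 * \<eta>)"
    using assms unfolding kern_def dkern_def a \<eta>_def reflection_def
    by (simp add: n of_real_diff of_real_mult del: of_real_power) (simp add: algebra_simps power2_eq_square)
  also have "norm \<dots> \<le> norm \<eta>^2 * norm z + 2 * norm z * norm \<eta> * norm \<eta> + norm \<eta>^2 * norm \<eta>"
    unfolding norm_minus_cancel
    by (rule order_trans[OF norm_triangle_ineq] add_mono order_trans[OF norm_triangle_ineq])+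
       (simp_all add: norm_mult norm_power)
  also have "\<dots> \<le> norm \<eta>^2 * 1 + 2 * norm \<eta>^2 * 1 + norm \<eta>^2 * 2"
  proof (intro add_mono mult_left_mono)
    show "2 * norm z * norm \<eta> * norm \<eta> \<le> 2 * norm \<eta>^2 * 1"
      using mult_right_mono[OF assms(1), of "norm \<eta> * norm \<eta>"] by (simp add: power2_eq_square)
    show "norm \<eta> \<le> 2" unfolding \<eta>_def using assms norm_triangle_ineq4[of z' z] by linarith
  qed (use assms in auto)
  finally show ?thesis by (simp add: \<eta>_def)
qed

lemma kern_taylor_outside:
  assumes "norm z \<ge> 1" "norm z' \<ge> 1"
  shows "norm (kern z' - kern z - dkern z (z' - z)) \<le> (norm (z' - z))^2"
proof -
  have in1: "kern x = inverse x" "reflection x = inverse x" "kern_dbar x = 0" if "norm x \<ge> 1" for x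
  proof -
    have "cnj x = inverse x" "2 * cnj x - (cnj x)^2 * x = inverse x" if "norm x = 1"
    proof -
      have "x * cnj x = 1" using that complex_norm_square[of x] by simp
      then show *: "cnj x = inverse x" by (metis inverse_unique)
      then show "2 * cnj x - (cnj x)^2 * x = inverse x"
        using that by (auto simp: power2_eq_square field_simps)
    qed
    then show "kern x = inverse x" "reflection x = inverse x" "kern_dbar x = 0"
      using that by (auto simp: kern_def reflection_def kern_dbar_def)
  qed
  have z0: "z \<noteq> 0" "z' \<noteq> 0" using assms by auto
  have "kern z' - kern z - dkern z (z' - z) = (z' - z)^2 / (z^2 * z')"
    using z0 by (simp add: in1 assms dkern_def field_simps power2_eq_square)
  moreover have "1 \<le> norm (z^2 * z')" using assms by (simp add: norm_mult norm_power mult_ge1_I)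
  ultimately show ?thesis
    by (simp add: norm_divide norm_power divide_le_eq mult_le_cancel_left1)
qed

text \<open>
  Two points on different sides of the unit circle are joined through a point of the circle on
  their segment; the one-sided estimates then add up, at the cost of the Lipschitz constant of
  the differential.
\<close>

lemma kern_taylor: "norm (kern z' - kern z - dkern z (z' - z)) \<le> 16 * (norm (z' - z))^2"
proof -
  have mixed: "norm (kern z' - kern z - dkern z (z' - z)) \<le> 16 * (norm (z' - z))^2"
    if w: "w \<in> closed_segment z z'" "norm w = 1"
     and "(norm z \<le> 1 \<and> norm z' \<ge> 1) \<or> (norm z \<ge> 1 \<and> norm z' \<le> 1)" for w
  proof -
    let ?d = "norm (z' - z)"
    have d: "norm (w - z) \<le> ?d" "norm (z' - w) \<le> ?d"
      using segment_bound[OF w(1)] by (auto simp: norm_minus_commute)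
    have *: "norm (kern b - kern a - dkern a (b - a)) \<le> 5 * ?d^2"
      if "norm (b - a) \<le> ?d" "(norm a \<le> 1 \<and> norm b \<le> 1) \<or> (norm a \<ge> 1 \<and> norm b \<ge> 1)" for a b
    proof -
      have "norm (kern b - kern a - dkern a (b - a)) \<le> 5 * (norm (b - a))^2"
        using kern_taylor_inside[of a b] kern_taylor_outside[of a b] that(2)
        by (smt (verit) zero_le_power2)
      also have "\<dots> \<le> 5 * ?d^2" using that(1) by (simp add: power_mono)
      finally show ?thesis .
    qed
    have "kern z' - kern z - dkern z (z' - z) = (kern z' - kern w - dkern w (z' - w)) +
        (kern w - kern z - dkern z (w - z)) + (dkern w (z' - w) - dkern z (z' - w))"
      using dkern_add[of z "z' - w" "w - z"] by simp
    also have "norm \<dots> \<le> 5 * ?d^2 + 5 * ?d^2 + 6 * ?d * ?d"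
    proof (intro order_trans[OF norm_triangle_ineq] add_mono)
      show "norm (kern z' - kern w - dkern w (z' - w)) \<le> 5 * ?d^2" by (rule *) (use d that in auto)
      show "norm (kern w - kern z - dkern z (w - z)) \<le> 5 * ?d^2" by (rule *) (use d that in auto)
      have "norm (dkern w (z' - w) - dkern z (z' - w)) \<le> 6 * norm (w - z) * norm (z' - w)"
        by (rule dkern_lipschitz)
      also have "\<dots> \<le> 6 * ?d * ?d" using d by (intro mult_mono) auto
      finally show "norm (dkern w (z' - w) - dkern z (z' - w)) \<le> 6 * ?d * ?d" .
    qed
    finally show ?thesis
      by (simp add: power2_eq_square)
  qed
  have conn: "connected (norm ` closed_segment z z')"
    by (intro connected_continuous_image continuous_intros) simp
  have ends: "norm z \<in> norm ` closed_segment z z'" "norm z' \<in> norm ` closed_segment z z'" by auto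
  consider "norm z \<le> 1" "norm z' \<le> 1" | "norm z \<ge> 1" "norm z' \<ge> 1"
    | "norm z \<le> 1 \<and> norm z' \<ge> 1 \<or> norm z \<ge> 1 \<and> norm z' \<le> 1" by (meson linear)
  then show ?thesis
  proof cases
    case 1 then show ?thesis using kern_taylor_inside[of z z'] zero_le_power2[of "norm (z'-z)"] by linarith
  next
    case 2 then show ?thesis using kern_taylor_outside[of z z'] zero_le_power2[of "norm (z'-z)"] by linarith
  next
    case 3
    then have "1 \<in> norm ` closed_segment z z'"
      using connectedD_interval[OF conn] ends by blast
    then show ?thesis using mixed 3 by auto
  qed
qed

section \<open>Convolution with kernels of bounded support\<close>

text \<open>
  Continuity is included, so that these functions are integrable over the plane.
\<close>

definition compactly_supported :: "(complex \<Rightarrow> 'b::real_normed_vector) \<Rightarrow> bool" where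
  "compactly_supported f \<longleftrightarrow> continuous_on UNIV f \<and> (\<exists>R. \<forall>x. R < norm x \<longrightarrow> f x = 0)"

lemma content_square:
  fixes a :: complex assumes "0 \<le> \<rho>"
  shows "measure lborel (cbox (a - Complex \<rho> \<rho>) (a + Complex \<rho> \<rho>)) = 4 * \<rho>^2"
proof -
  have "cbox (a - Complex \<rho> \<rho>) (a + Complex \<rho> \<rho>) \<noteq> {}"
    using assms by (auto simp: box_ne_empty Basis_complex_def)
  then show ?thesis by (simp add: content_cbox_if Basis_complex_def power2_eq_square algebra_simps)
qed

lemma cball_subset_square: "cball a \<rho> \<subseteq> cbox (a - Complex \<rho> \<rho>) (a + Complex \<rho> \<rho>)"
proof
  fix x assume "x \<in> cball a \<rho>"
  then have n: "norm (x - a) \<le> \<rho>" by (simp add: dist_norm norm_minus_commute)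
  have "\<bar>Re (x - a)\<bar> \<le> \<rho>" "\<bar>Im (x - a)\<bar> \<le> \<rho>"
    using abs_Re_le_cmod[of "x - a"] abs_Im_le_cmod[of "x - a"] n by linarith+
  then show "x \<in> cbox (a - Complex \<rho> \<rho>) (a + Complex \<rho> \<rho>)"
    by (auto simp: in_cbox_complex_iff)
qed

lemma local_integral:
  fixes f :: "complex \<Rightarrow> 'b::banach"
  assumes "continuous_on UNIV f" "\<And>x. \<rho> < norm (x - a) \<Longrightarrow> f x = 0" "0 \<le> \<rho>"
  shows "(f has_integral integral (cbox (a - Complex \<rho> \<rho>) (a + Complex \<rho> \<rho>)) f) (cbox (a - Complex \<rho> \<rho>) (a + Complex \<rho> \<rho>))"
    "(f has_integral integral (cbox (a - Complex \<rho> \<rho>) (a + Complex \<rho> \<rho>)) f) UNIV"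
proof -
  show 1: "(f has_integral integral (cbox (a - Complex \<rho> \<rho>) (a + Complex \<rho> \<rho>)) f) (cbox (a - Complex \<rho> \<rho>) (a + Complex \<rho> \<rho>))"
    using assms(1) by (intro integrable_integral integrable_continuous) (auto intro: continuous_on_subset)
  show "(f has_integral integral (cbox (a - Complex \<rho> \<rho>) (a + Complex \<rho> \<rho>)) f) UNIV"
  proof (rule has_integral_on_superset[OF 1])
    fix x assume "x \<notin> cbox (a - Complex \<rho> \<rho>) (a + Complex \<rho> \<rho>)"
    then have "x \<notin> cball a \<rho>" using cball_subset_square[of a \<rho>] by blast
    then show "f x = 0" using assms(2)[of x] by (simp add: dist_norm norm_minus_commute)
  qed simp
qed

text \<open>
  The factor \<open>4 * \<rho>\<^sup>2\<close> is the area of the square around the disc that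
  carries the function; integrals over boxes are easier to handle than integrals over discs.
\<close>

lemma local_integral_bound:
  fixes f :: "complex \<Rightarrow> 'b::banach"
  assumes "continuous_on UNIV f" "\<And>x. \<rho> < norm (x - a) \<Longrightarrow> f x = 0" "0 \<le> \<rho>"
    "\<And>x. norm (x - a) \<le> \<rho> \<Longrightarrow> norm (f x) \<le> B" "0 \<le> B"
  shows "norm (integral UNIV f) \<le> B * (4 * \<rho>^2)"
proof -
  have "norm (f x) \<le> B" for x using assms(2,4,5) by (cases "norm (x - a) \<le> \<rho>") auto
  then have "norm (integral (cbox (a - Complex \<rho> \<rho>) (a + Complex \<rho> \<rho>)) f) \<le> B * (4 * \<rho>^2)"
    using has_integral_bound[OF assms(5) local_integral(1)[OF assms(1-3)]] content_square[OF assms(3)] by simp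
  then show ?thesis using integral_unique[OF local_integral(2)[OF assms(1-3)]] by simp
qed

lemma compactly_supported_support:
  assumes "compactly_supported f" obtains R where "0 < R" "\<And>x. R < norm x \<Longrightarrow> f x = 0"
  using assms unfolding compactly_supported_def
  by (meson le_less_trans less_eq_real_def linorder_le_less_linear max.cobounded1 max_less_iff_conj zero_less_one less_max_iff_disj)

lemma compactly_supported_integrable:
  fixes f :: "complex \<Rightarrow> 'b::banach"
  assumes "compactly_supported f" shows "f integrable_on UNIV"
proof -
  obtain R where R: "0 < R" "\<And>x. R < norm x \<Longrightarrow> f x = 0" using compactly_supported_support[OF assms] by blast
  show ?thesis
    using local_integral(2)[of f R 0] assms R by (auto simp: compactly_supported_def integrable_on_def)
qed

lemma compactly_supportedI: "continuous_on UNIV f \<Longrightarrow> (\<And>x. R < norm x \<Longrightarrow> f x = 0) \<Longrightarrow> compactly_supported f"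
  unfolding compactly_supported_def by blast

lemma compactly_supported_affine:
  fixes f :: "complex \<Rightarrow> 'b::banach"
  assumes "compactly_supported f" shows "compactly_supported (\<lambda>\<zeta>. f (z - \<zeta>))" "compactly_supported (\<lambda>\<zeta>. f (cnj \<zeta>))"
proof -
  obtain R where R: "0 < R" "\<And>x. R < norm x \<Longrightarrow> f x = 0" using compactly_supported_support[OF assms] by blast
  have c: "continuous_on UNIV f" using assms by (simp add: compactly_supported_def)
  show "compactly_supported (\<lambda>\<zeta>. f (z - \<zeta>))"
  proof (rule compactly_supportedI)
    show "continuous_on UNIV (\<lambda>\<zeta>. f (z - \<zeta>))"
      by (rule continuous_on_compose2[OF c]) (auto intro!: continuous_intros)
    show "f (z - x) = 0" if "R + norm z < norm x" for x
      using that R(2)[of "z - x"] norm_triangle_ineq3[of x z] by (simp add: norm_minus_commute)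
  qed
  show "compactly_supported (\<lambda>\<zeta>. f (cnj \<zeta>))"
    by (rule compactly_supportedI[where R = R]) (auto intro!: continuous_on_compose2[OF c] continuous_intros R)
qed

lemma integral_flip:
  fixes f :: "complex \<Rightarrow> 'b::banach"
  assumes "compactly_supported f" shows "integral UNIV (\<lambda>\<zeta>. f (z - \<zeta>)) = integral UNIV f"
proof -
  obtain R where R: "0 < R" "\<And>x. R < norm x \<Longrightarrow> f x = 0" using compactly_supported_support[OF assms] by blast
  have c: "continuous_on UNIV f" using assms by (simp add: compactly_supported_def)
  note L = local_integral[of f R 0, OF c]
  let ?B = "cbox (0 - Complex R R) (0 + Complex R R)"
  have "((\<lambda>x. f ((-1) *\<^sub>R x + z)) has_integral (1 / (\<bar>-1\<bar> ^ DIM(complex))) *\<^sub>R integral ?B f)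
    ((\<lambda>x. (1 / (-1)) *\<^sub>R x + -((1 / (-1)) *\<^sub>R z)) ` ?B)"
    by (rule has_integral_affinity) (use L R in auto)
  then have 1: "((\<lambda>x. f (z - x)) has_integral integral ?B f) ((\<lambda>x. z - x) ` ?B)" by simp
  have "((\<lambda>x. f (z - x)) has_integral integral ?B f) UNIV"
  proof (rule has_integral_on_superset[OF 1])
    fix x assume x: "x \<notin> (\<lambda>x. z - x) ` ?B"
    have "z - x \<notin> ?B" using x by (auto simp: image_iff)
    then have "z - x \<notin> cball 0 R" using cball_subset_square[of 0 R] by blast
    then show "f (z - x) = 0" using R(2)[of "z - x"] by simp
  qed simp
  moreover have "(f has_integral integral ?B f) UNIV" using L R by auto
  ultimately show ?thesis by (metis integral_unique)
qed

lemma integral_cnj: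
  fixes f :: "complex \<Rightarrow> 'b::banach"
  assumes "compactly_supported f" shows "integral UNIV (\<lambda>\<zeta>. f (cnj \<zeta>)) = integral UNIV f"
proof -
  obtain R where R: "0 < R" "\<And>x. R < norm x \<Longrightarrow> f x = 0" using compactly_supported_support[OF assms] by blast
  have c: "continuous_on UNIV f" using assms by (simp add: compactly_supported_def)
  note L = local_integral[of f R 0, OF c]
  let ?B = "cbox (0 - Complex R R) (0 + Complex R R)"
  have im: "cnj ` cbox u v = cbox (Complex (Re u) (- Im v)) (Complex (Re v) (- Im u))" for u v
  proof (intro set_eqI iffI)
    fix x assume "x \<in> cbox (Complex (Re u) (- Im v)) (Complex (Re v) (- Im u))"
    then have "cnj x \<in> cbox u v" by (auto simp: in_cbox_complex_iff)
    then show "x \<in> cnj ` cbox u v" by (metis complex_cnj_cnj image_eqI)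
  qed (auto simp: in_cbox_complex_iff)
  have "((\<lambda>x. f (cnj x)) has_integral (1 / 1) *\<^sub>R integral ?B f) (cnj ` ?B)"
  proof (rule has_integral_twiddle)
    show "measure lborel (cnj ` cbox u v) = 1 * measure lborel (cbox u v)" for u v :: complex
      unfolding im by (simp add: content_cbox_if Basis_complex_def box_ne_empty box_eq_empty algebra_simps)
  qed (use im L R in \<open>auto intro!: continuous_intros\<close>)
  then have 1: "((\<lambda>x. f (cnj x)) has_integral integral ?B f) (cnj ` ?B)" by simp
  have "((\<lambda>x. f (cnj x)) has_integral integral ?B f) UNIV"
  proof (rule has_integral_on_superset[OF 1])
    fix x assume x: "x \<notin> cnj ` ?B"
    have "cnj x \<notin> ?B" using x by (metis complex_cnj_cnj image_eqI)
    then have "cnj x \<notin> cball 0 R" using cball_subset_square[of 0 R] by blast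
    then show "f (cnj x) = 0" using R(2)[of "cnj x"] by simp
  qed simp
  moreover have "(f has_integral integral ?B f) UNIV" using L R by auto
  ultimately show ?thesis by (metis integral_unique)
qed

text \<open>
  A quadratic bound for the remainder survives integration, so convolutions with a kernel that
  has such a bound can be differentiated without any theorem on integrals with a parameter.
\<close>

lemma has_derivative_of_quadratic:
  fixes f :: "'a::real_normed_vector \<Rightarrow> 'b::real_normed_vector"
  assumes "bounded_linear f'" "\<And>y. norm (y - x) < 1 \<Longrightarrow> norm (f y - f x - f' (y - x)) \<le> C * (norm (y - x))^2"
  shows "(f has_derivative f') (at x)"
proof (rule has_derivativeI[OF assms(1)])
  have "((\<lambda>y. C * norm (y - x)) \<longlongrightarrow> C * norm (x - x)) (at x)" by (intro tendsto_intros)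
  then have lim: "((\<lambda>y. C * norm (y - x)) \<longlongrightarrow> 0) (at x)" by simp
  show "((\<lambda>y. (f y - f x - f' (y - x)) /\<^sub>R norm (y - x)) \<longlongrightarrow> 0) (at x)"
  proof (rule Lim_null_comparison[OF _ lim])
    have "\<forall>\<^sub>F y in at x. y \<in> ball x 1 \<and> y \<noteq> x"
      by (intro eventually_conj eventually_at_in_open' eventually_neq_at_within) auto
    then show "\<forall>\<^sub>F y in at x. norm ((f y - f x - f' (y - x)) /\<^sub>R norm (y - x)) \<le> C * norm (y - x)"
    proof eventually_elim
      case (elim y)
      then show ?case using assms(2)[of y]
        by (simp add: dist_norm norm_minus_commute divide_simps power2_eq_square mult.commute mult.left_commute)
    qed
  qed
qed

locale complex_space =
  fixes J0 :: "'e::euclidean_space \<Rightarrow> 'e"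
  assumes J0_linear: "linear J0" and J0_J0: "J0 (J0 v) = - v"
begin

definition cmul :: "complex \<Rightarrow> 'e \<Rightarrow> 'e" where "cmul z v = Re z *\<^sub>R v + Im z *\<^sub>R J0 v"

lemma J0_bounded_linear: "bounded_linear J0"
  using J0_linear linear_conv_bounded_linear by blast

lemmas J0_simps = linear_add[OF J0_linear] linear_diff[OF J0_linear] linear_scale[OF J0_linear]
  linear_0[OF J0_linear] linear_neg[OF J0_linear]

lemma cmul_bilinear: "bounded_bilinear cmul"
proof -
  interpret J: bounded_linear J0 by (rule J0_bounded_linear)
  obtain K where K: "K > 0" "\<And>v. norm (J0 v) \<le> norm v * K" using J.pos_bounded by blast
  show ?thesis
  proof
    show "\<exists>K. \<forall>a b. norm (cmul a b) \<le> norm a * norm b * K"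
    proof (intro exI allI)
      fix z v
      have "norm (cmul z v) \<le> \<bar>Re z\<bar> * norm v + \<bar>Im z\<bar> * norm (J0 v)"
        unfolding cmul_def by (rule order_trans[OF norm_triangle_ineq]) simp
      also have "\<dots> \<le> norm z * norm v + norm z * (norm v * K)"
        by (intro add_mono mult_mono K abs_Re_le_cmod abs_Im_le_cmod) auto
      finally show "norm (cmul z v) \<le> norm z * norm v * (1 + K)" by (simp add: algebra_simps)
    qed
  qed (simp_all add: cmul_def J0_simps algebra_simps)
qed

text \<open>
  \<open>J0\<close> need not be an isometry for the Euclidean norm, so multiplication by
  complex scalars has a norm constant of its own.
\<close>

definition \<kappa> :: real where "\<kappa> = (SOME K. K > 0 \<and> (\<forall>z v. norm (cmul z v) \<le> K * norm z * norm v))"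

lemma \<kappa>: "\<kappa> > 0" "norm (cmul z v) \<le> \<kappa> * norm z * norm v"
proof -
  obtain K where "K > 0" "\<And>z v. norm (cmul z v) \<le> norm z * norm v * K"
    using bounded_bilinear.pos_bounded[OF cmul_bilinear] by blast
  then have "\<exists>K. K > 0 \<and> (\<forall>z v. norm (cmul z v) \<le> K * norm z * norm v)"
    by (metis mult.commute mult.assoc)
  from someI_ex[OF this] show "\<kappa> > 0" "norm (cmul z v) \<le> \<kappa> * norm z * norm v"
    unfolding \<kappa>_def by auto
qed

sublocale cmul: bounded_bilinear cmul by (rule cmul_bilinear)

lemma cmul_simps: "cmul (of_real r) v = r *\<^sub>R v" "cmul 1 v = v" "cmul \<i> v = J0 v" "J0 (cmul a v) = cmul (\<i> * a) v"
  by (auto simp: cmul_def J0_simps J0_J0 algebra_simps)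

definition conv :: "(complex \<Rightarrow> complex) \<Rightarrow> (complex \<Rightarrow> 'e) \<Rightarrow> complex \<Rightarrow> 'e" where
  "conv k h z = integral UNIV (\<lambda>\<zeta>. cmul (k (z - \<zeta>)) (h \<zeta>))"

lemma continuous_conv_kernel:
  fixes k :: "complex \<Rightarrow> complex"
  assumes "continuous_on UNIV k" "continuous_on UNIV h"
  shows "continuous_on UNIV (\<lambda>\<zeta>. cmul (k (z - \<zeta>)) (h \<zeta>))"
  by (intro cmul.continuous_on continuous_on_compose2[OF assms(1), of UNIV "\<lambda>\<zeta>. z - \<zeta>"] assms(2) continuous_on_op_minus) auto

lemma conv_derivative:
  assumes k: "continuous_on UNIV k" and dk: "\<And>\<eta>. continuous_on UNIV (\<lambda>x. dk x \<eta>)"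
    and lin: "\<And>x. bounded_linear (dk x)"
    and T: "\<And>x x'. norm (k x' - k x - dk x (x' - x)) \<le> C * (norm (x' - x))^2"
    and h: "continuous_on UNIV h" "\<And>\<zeta>. norm (h \<zeta>) \<le> M"
    and R: "\<And>z' \<zeta>. norm (z' - z) < 1 \<Longrightarrow> R < norm \<zeta> \<Longrightarrow> k (z' - \<zeta>) = 0 \<or> h \<zeta> = 0"
      "\<And>\<eta> \<zeta>. R < norm \<zeta> \<Longrightarrow> dk (z - \<zeta>) \<eta> = 0 \<or> h \<zeta> = 0" "0 \<le> R"
  shows "(conv k h has_derivative (\<lambda>\<eta>. conv (\<lambda>x. dk x \<eta>) h z)) (at z)"
proof (rule has_derivative_of_quadratic)
  have I1: "compactly_supported (\<lambda>\<zeta>. cmul (k (z' - \<zeta>)) (h \<zeta>))" if "norm (z' - z) < 1" for z'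
  proof (rule compactly_supportedI[where R = R])
    show "cmul (k (z' - x)) (h x) = 0" if "R < norm x" for x
      using R(1)[OF \<open>norm (z' - z) < 1\<close> that] by (auto simp: cmul.zero_left cmul.zero_right)
  qed (intro continuous_conv_kernel k h)
  have I2: "compactly_supported (\<lambda>\<zeta>. cmul (dk (z - \<zeta>) \<eta>) (h \<zeta>))" for \<eta>
  proof (rule compactly_supportedI[where R = R])
    show "cmul (dk (z - x) \<eta>) (h x) = 0" if "R < norm x" for x
      using R(2)[OF that, of \<eta>] by (auto simp: cmul.zero_left cmul.zero_right)
  qed (intro continuous_conv_kernel dk h)
  have "linear (\<lambda>\<eta>. conv (\<lambda>x. dk x \<eta>) h z)"
  proof (rule linearI)
    fix a b show "conv (\<lambda>x. dk x (a + b)) h z = conv (\<lambda>x. dk x a) h z + conv (\<lambda>x. dk x b) h z"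
      unfolding conv_def using integral_add[OF compactly_supported_integrable[OF I2[of a]] compactly_supported_integrable[OF I2[of b]]]
      by (simp add: bounded_linear.linear[OF lin] linear_add cmul.add_left)
  next
    fix r b show "conv (\<lambda>x. dk x (r *\<^sub>R b)) h z = r *\<^sub>R conv (\<lambda>x. dk x b) h z"
      unfolding conv_def by (simp add: bounded_linear.linear[OF lin] linear_scale cmul.scaleR_left flip: integral_cmul)
  qed
  then show "bounded_linear (\<lambda>\<eta>. conv (\<lambda>x. dk x \<eta>) h z)" using linear_conv_bounded_linear by blast
  have M: "0 \<le> M" using h(2)[of 0] norm_ge_zero order_trans by blast
  have C: "0 \<le> C" using order_trans[OF norm_ge_zero T[of 1 0]] by simp
  fix y assume y: "norm (y - z) < 1"
  let ?f = "\<lambda>\<zeta>. cmul (k (y - \<zeta>) - k (z - \<zeta>) - dk (z - \<zeta>) (y - z)) (h \<zeta>)"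
  have eq: "?f = (\<lambda>\<zeta>. cmul (k (y - \<zeta>)) (h \<zeta>) - cmul (k (z - \<zeta>)) (h \<zeta>) - cmul (dk (z - \<zeta>) (y - z)) (h \<zeta>))"
    by (simp add: cmul.diff_left)
  have "conv k h y - conv k h z - conv (\<lambda>x. dk x (y - z)) h z = integral UNIV ?f"
    unfolding conv_def eq
    by (subst integral_diff integral_diff | intro integrable_diff compactly_supported_integrable I1 I2 y | simp)+
  also have "norm \<dots> \<le> (\<kappa> * (C * (norm (y - z))^2) * M) * (4 * R^2)"
  proof (rule local_integral_bound[where a = 0])
    show "continuous_on UNIV ?f"
      by (intro cmul.continuous_on continuous_on_diff continuous_on_compose2[OF k] continuous_on_compose2[OF dk] h(1) continuous_intros) auto
    show "?f x = 0" if "R < norm (x - 0)" for x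
      using R(1)[OF y, of x] R(1)[of z x] R(2)[of x "y - z"] that by (auto simp: cmul.zero_left cmul.zero_right)
    show "norm (?f x) \<le> \<kappa> * (C * (norm (y - z))^2) * M" for x
    proof (rule order_trans[OF \<kappa>(2)], intro mult_mono)
      show "norm (k (y - x) - k (z - x) - dk (z - x) (y - z)) \<le> C * (norm (y - z))\<^sup>2"
        using T[of "y - x" "z - x"] by simp
    qed (use \<kappa>(1) h(2) C in \<open>auto intro!: mult_nonneg_nonneg\<close>)
  qed (use R(3) \<kappa>(1) C M in auto)
  finally show "norm (conv k h y - conv k h z - conv (\<lambda>x. dk x (y - z)) h z) \<le> (\<kappa> * C * M * (4 * R^2)) * (norm (y - z))^2"
    by (simp add: algebra_simps)
qed

end

section \<open>Dyadic rescalings of the kernel\<close>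

lemma sum_geometric_bound:
  fixes s :: real assumes "0 \<le> s" "s < 1" shows "(\<Sum>j<n. s^j) \<le> 1 / (1 - s)"
proof -
  have "(\<Sum>j<n. s^j) = (1 - s^n) / (1 - s)" using assms by (simp add: sum_gp_strict)
  also have "\<dots> \<le> 1 / (1 - s)" using assms by (intro divide_right_mono) auto
  finally show ?thesis .
qed

text \<open>
  On either side of the index at which \<open>s^j\<close> passes \<open>e\<close> the terms
  are dominated by a geometric series that starts at \<open>e\<close>. This is what keeps the
  Hoelder exponent in the sum over all dyadic scales.
\<close>

lemma sum_min_geometric:
  fixes s e :: real
  assumes s: "0 < s" "s < 1" and e: "0 < e"
    and a: "\<And>j. a j \<le> s^j" "\<And>j. e \<le> s^j \<Longrightarrow> a j \<le> e^2 / s^j" "\<And>j. 0 \<le> a j"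
  shows "(\<Sum>j<n. a j) \<le> 2 / (1 - s) * e"
proof -
  have ex: "\<exists>j. s^j < e" using real_arch_pow_inv[OF e s(2)] .
  \<comment> \<open>Below \<open>J\<close> the second bound is summed, from \<open>J\<close> on the first.\<close>
  define J where "J = (LEAST j. s^j < e)"
  have J: "s^J < e" unfolding J_def by (rule LeastI_ex[OF ex])
  have J': "e \<le> s^j" if "j < J" for j using not_less_Least that unfolding J_def by (metis not_le)
  have "(\<Sum>j<n. a j) \<le> (\<Sum>j<J+n. a j)" by (rule sum_mono2) (use a(3) in auto)
  also have "\<dots> = (\<Sum>j<J. a j) + (\<Sum>i<n. a (i + J))"
    by (induction n) (simp_all add: add.commute add.left_commute)
  also have "(\<Sum>i<n. a (i + J)) \<le> (\<Sum>i<n. s^J * s^i)"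
    by (rule sum_mono) (use a(1) in \<open>simp add: power_add[symmetric] add.commute\<close>)
  also have "\<dots> \<le> e * (1 / (1 - s))"
    unfolding sum_distrib_left[symmetric] using s J e by (intro mult_mono sum_geometric_bound sum_nonneg) auto
  also have "(\<Sum>j<J. a j) \<le> e * (1 / (1 - s))"
  proof (cases J)
    case (Suc J1)
    have "(\<Sum>j<J. a j) = (\<Sum>i<J. a (J - Suc i))" by (rule sum.nat_diff_reindex[symmetric])
    also have "\<dots> \<le> (\<Sum>i<J. e * s^i)"
    proof (rule sum_mono)
      fix i assume i: "i \<in> {..<J}"
      have "a (J - Suc i) \<le> e^2 / s^(J - Suc i)" using i by (intro a(2) J') auto
      also have "\<dots> = e * (e * s^i / s^J1)"
      proof -
        have "s^J1 = s^(J - Suc i) * s^i" using i Suc by (auto simp flip: power_add)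
        then show ?thesis using s by (simp add: power2_eq_square)
      qed
      also have "\<dots> \<le> e * s^i"
      proof -
        have "e / s^J1 \<le> 1" using J'[of J1] Suc s by simp
        then have "e / s^J1 * s^i \<le> 1 * s^i" using s by (intro mult_right_mono) auto
        then have "e * (e / s^J1 * s^i) \<le> e * s^i" using e by (intro mult_left_mono) auto
        then show ?thesis by simp
      qed
      finally show "a (J - Suc i) \<le> e * s^i" .
    qed
    also have "\<dots> \<le> e * (1 / (1 - s))"
      unfolding sum_distrib_left[symmetric] using s e by (intro mult_mono sum_geometric_bound sum_nonneg) auto
    finally show ?thesis .
  qed (use e s in simp)
  finally show ?thesis by (simp add: algebra_simps add_divide_distrib)
qed

lemma norm_kern: "norm (kern z) \<le> 3"
proof (cases "norm z \<le> 1")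
  case True
  have "norm (kern z) \<le> 2 * norm z + (norm z)^2 * norm z"
    using True unfolding kern_def by (auto intro!: order_trans[OF norm_triangle_ineq4] simp: norm_mult norm_power)
  also have "\<dots> \<le> 2 * 1 + 1^2 * 1" using True by (intro add_mono mult_mono power_mono) auto
  finally show ?thesis by simp
next
  case False
  then have "norm (inverse z) \<le> 1" by (simp add: norm_inverse inverse_le_1_iff)
  then show ?thesis using False by (simp add: kern_def)
qed

text \<open>
  These kernels converge to \<open>1/z\<close>; the \<open>j\<close>-th one differs from it
  only in the disc of radius \<open>2^(-j)\<close>.
\<close>

definition kern_at :: "nat \<Rightarrow> complex \<Rightarrow> complex" where "kern_at j z = 2^j * kern (2^j * z)"
definition dkern_at :: "nat \<Rightarrow> complex \<Rightarrow> complex \<Rightarrow> complex" where "dkern_at j z \<eta> = 4^j * dkern (2^j * z) \<eta>"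

lemma kern_at_eq_inverse: "1 \<le> 2^j * norm z \<Longrightarrow> kern_at j z = inverse z"
proof -
  assume 1: "1 \<le> 2^j * norm z"
  then have n: "1 \<le> norm (2^j * z)" by (simp add: norm_mult norm_power)
  have "kern x = inverse x" if "norm x \<ge> 1" for x
  proof (cases "norm x = 1")
    case True
    then have "x * cnj x = 1" using complex_norm_square[of x] by simp
    then have "cnj x = inverse x" by (metis inverse_unique)
    then show ?thesis using True by (auto simp: kern_def power2_eq_square field_simps)
  qed (use that in \<open>auto simp: kern_def\<close>)
  from this[OF n] show ?thesis using 1 by (auto simp: kern_at_def field_simps)
qed

lemma dkern_at_eq: "1 \<le> 2^j * norm z \<Longrightarrow> dkern_at j z \<eta> = - ((inverse z)^2 * \<eta>)"
proof -
  assume 1: "1 \<le> 2^j * norm z"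
  then have n: "1 \<le> norm (2^j * z)" by (simp add: norm_mult norm_power)
  have "reflection x = inverse x \<and> kern_dbar x = 0" if "norm x \<ge> 1" for x
  proof (cases "norm x = 1")
    case True
    then have "x * cnj x = 1" using complex_norm_square[of x] by simp
    then have "cnj x = inverse x" by (metis inverse_unique)
    then show ?thesis using True by (auto simp: reflection_def kern_dbar_def)
  qed (use that in \<open>auto simp: reflection_def kern_dbar_def\<close>)
  from this[OF n] have "dkern_at j z \<eta> = 4^j * (- ((inverse (2^j * z))^2 * \<eta>))" by (simp add: dkern_at_def dkern_def)
  moreover have "(4::complex)^j = (2^j)^2" by (simp add: power_mult_distrib power2_eq_square flip: power_mult_distrib)
  ultimately show ?thesis by (simp add: field_simps)
qed

lemma norm_kern_at: "norm (kern_at j z) \<le> 3 * 2^j"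
  using mult_left_mono[OF norm_kern, of "2^j" "2^j * z"] by (simp add: kern_at_def norm_mult norm_power mult.commute)

lemma norm_dkern_at: "norm (dkern_at j z \<eta>) \<le> 3 * 4^j * norm \<eta>"
  using mult_left_mono[OF norm_dkern, of "4^j" "2^j * z" \<eta>] by (simp add: dkern_at_def norm_mult norm_power ac_simps)

lemma dkern_at_lipschitz: "norm (dkern_at j z \<eta> - dkern_at j z' \<eta>) \<le> 6 * 8^j * norm (z - z') * norm \<eta>"
proof -
  have "norm (dkern_at j z \<eta> - dkern_at j z' \<eta>) = 4^j * norm (dkern (2^j * z) \<eta> - dkern (2^j * z') \<eta>)"
    by (simp add: dkern_at_def norm_mult norm_power flip: right_diff_distrib)
  also have "\<dots> \<le> 4^j * (6 * norm (2^j * z - 2^j * z') * norm \<eta>)" by (intro mult_left_mono dkern_lipschitz) auto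
  also have "\<dots> = 6 * (4^j * 2^j) * norm (z - z') * norm \<eta>" by (simp add: norm_mult norm_power flip: right_diff_distrib)
  also have "(4::real)^j * 2^j = 8^j" by (simp flip: power_mult_distrib)
  finally show ?thesis .
qed

lemma dkern_at_linear: "bounded_linear (dkern_at j z)"
  unfolding dkern_at_def by (intro bounded_linear_mult_right[THEN bounded_linear_compose] dkern_linear)

lemma kern_at_taylor: "norm (kern_at j x' - kern_at j x - dkern_at j x (x' - x)) \<le> 16 * 8^j * (norm (x' - x))^2"
proof -
  have 4: "(4::complex)^j = 2^j * 2^j" by (simp flip: power_mult_distrib)
  have "dkern (2^j * x) (2^j * (x' - x)) = 2^j * dkern (2^j * x) (x' - x)"
    by (simp add: dkern_def algebra_simps)
  then have "kern_at j x' - kern_at j x - dkern_at j x (x' - x) = 2^j * (kern (2^j * x') - kern (2^j * x) - dkern (2^j * x) (2^j * x' - 2^j * x))"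
    by (simp add: kern_at_def dkern_at_def 4 algebra_simps)
  also have "norm \<dots> = 2^j * norm (kern (2^j * x') - kern (2^j * x) - dkern (2^j * x) (2^j * x' - 2^j * x))"
    by (simp add: norm_mult norm_power)
  also have "\<dots> \<le> 2^j * (16 * (norm (2^j * x' - 2^j * x))^2)" by (intro mult_left_mono kern_taylor) auto
  also have "\<dots> = 16 * (2^j * (2^j)^2) * (norm (x' - x))^2"
    by (simp add: norm_mult norm_power power_mult_distrib flip: right_diff_distrib)
  also have "(2::real)^j * (2^j)^2 = 8^j" by (simp add: power2_eq_square flip: power_mult_distrib)
  finally show ?thesis .
qed

lemma continuous_of_quadratic:
  assumes "\<And>x x'. norm (k x' - k x - dk x (x' - x)) \<le> C * (norm (x' - x))^2" "\<And>x. bounded_linear (dk x)"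
  shows "continuous_on UNIV k"
  unfolding continuous_on_eq_continuous_at[OF open_UNIV]
  by (intro ballI has_derivative_continuous[OF has_derivative_of_quadratic[OF assms(2) assms(1)]])

lemma kern_at_continuous: "continuous_on UNIV (kern_at j)"
  by (rule continuous_of_quadratic[OF kern_at_taylor dkern_at_linear])

lemma dkern_at_continuous: "continuous_on UNIV (\<lambda>x. dkern_at j x \<eta>)"
proof (rule lipschitz_on_continuous_on)
  show "(6 * 8^j * norm \<eta>)-lipschitz_on UNIV (\<lambda>x. dkern_at j x \<eta>)"
    by (rule lipschitz_onI) (use dkern_at_lipschitz[of j _ \<eta>] in \<open>auto simp: dist_norm ac_simps\<close>)
qed

lemma dkern_at_dbar: "dkern_at j z 1 + \<i> * dkern_at j z \<i> = of_real (2 * 4^j * kern_dbar (2^j * z))"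
  by (simp add: dkern_at_def dkern_def algebra_simps)

text \<open>
  Passing from one scale to the next changes the kernel only in a small disc, so the limit of
  the convolutions can be studied as a sum of local contributions.
\<close>

definition dkern_step :: "nat \<Rightarrow> complex \<Rightarrow> complex \<Rightarrow> complex" where "dkern_step j z \<eta> = dkern_at (Suc j) z \<eta> - dkern_at j z \<eta>"
definition kern_step :: "nat \<Rightarrow> complex \<Rightarrow> complex" where "kern_step j z = kern_at (Suc j) z - kern_at j z"

lemma half_power_less: "(1/2)^j < norm z \<Longrightarrow> 1 \<le> 2^j * norm (z::complex)"
  by (simp add: power_divide divide_less_eq mult.commute less_imp_le)

lemma kern_step_support: "(1/2)^j < norm z \<Longrightarrow> kern_step j z = 0" "(1/2)^j < norm z \<Longrightarrow> dkern_step j z \<eta> = 0"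
proof -
  assume "(1/2)^j < norm z"
  then have 1: "1 \<le> 2^j * norm z" by (rule half_power_less)
  then have 2: "1 \<le> 2^Suc j * norm z" by simp
  show "kern_step j z = 0" "dkern_step j z \<eta> = 0"
    using kern_at_eq_inverse[OF 1] kern_at_eq_inverse[OF 2] dkern_at_eq[OF 1] dkern_at_eq[OF 2] by (simp_all add: kern_step_def dkern_step_def)
qed

lemma norm_kern_step: "norm (kern_step j z) \<le> 9 * 2^j"
  unfolding kern_step_def using norm_triangle_ineq4[of "kern_at (Suc j) z" "kern_at j z"] norm_kern_at[of j z] norm_kern_at[of "Suc j" z] by simp

lemma norm_dkern_step: "norm (dkern_step j z \<eta>) \<le> 15 * 4^j * norm \<eta>"
  unfolding dkern_step_def
  using norm_triangle_ineq4[of "dkern_at (Suc j) z \<eta>" "dkern_at j z \<eta>"] norm_dkern_at[of j z \<eta>] norm_dkern_at[of "Suc j" z \<eta>] by simp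

lemma dkern_step_lipschitz: "norm (dkern_step j z \<eta> - dkern_step j z' \<eta>) \<le> 54 * 8^j * norm (z - z') * norm \<eta>"
proof -
  have "dkern_step j z \<eta> - dkern_step j z' \<eta> = (dkern_at (Suc j) z \<eta> - dkern_at (Suc j) z' \<eta>) - (dkern_at j z \<eta> - dkern_at j z' \<eta>)"
    by (simp add: dkern_step_def)
  then show ?thesis
    using norm_triangle_ineq4[of "dkern_at (Suc j) z \<eta> - dkern_at (Suc j) z' \<eta>" "dkern_at j z \<eta> - dkern_at j z' \<eta>"]
      dkern_at_lipschitz[of j z \<eta> z'] dkern_at_lipschitz[of "Suc j" z \<eta> z'] by simp
qed

lemma dkern_step_linear: "bounded_linear (dkern_step j z)"
  unfolding dkern_step_def by (intro bounded_linear_sub dkern_at_linear)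

lemma kern_step_taylor: "norm (kern_step j x' - kern_step j x - dkern_step j x (x' - x)) \<le> 144 * 8^j * (norm (x' - x))^2"
proof -
  have "kern_step j x' - kern_step j x - dkern_step j x (x' - x) = (kern_at (Suc j) x' - kern_at (Suc j) x - dkern_at (Suc j) x (x' - x)) - (kern_at j x' - kern_at j x - dkern_at j x (x' - x))"
    by (simp add: kern_step_def dkern_step_def)
  then show ?thesis
    using norm_triangle_ineq4[of "kern_at (Suc j) x' - kern_at (Suc j) x - dkern_at (Suc j) x (x' - x)" "kern_at j x' - kern_at j x - dkern_at j x (x' - x)"]
      kern_at_taylor[of j x' x] kern_at_taylor[of "Suc j" x' x] by simp
qed

lemma kern_step_continuous: "continuous_on UNIV (kern_step j)" "continuous_on UNIV (\<lambda>z. dkern_step j z \<eta>)"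
  unfolding kern_step_def dkern_step_def by (intro continuous_intros kern_at_continuous dkern_at_continuous)+

section \<open>Hoelder estimates at a single scale\<close>

text \<open>
  Its \<open>j\<close>-th power is the square root of the radius \<open>2^(-j)\<close>, that
  is, the oscillation of a function of Hoelder exponent one half at the scale
  \<open>j\<close>.
\<close>

definition half_root :: real where "half_root = sqrt (1/2)"

lemma half_root: "0 < half_root" "half_root < 1" "sqrt ((1/2)^j) = half_root^j" "half_root^j * half_root^j = (1/2)^j" "(2::real)^j * half_root^j = 1 / half_root^j"
proof -
  show 1: "0 < half_root" "half_root < 1" "sqrt ((1/2)^j) = half_root^j" by (auto simp: real_sqrt_power half_root_def)
  have "half_root^j * half_root^j = (half_root * half_root)^j" by (rule power_mult_distrib[symmetric])
  then show 2: "half_root^j * half_root^j = (1/2)^j" by (simp add: half_root_def)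
  have "(2::real)^j * half_root^j * half_root^j = 1" using 2 by (simp add: power_divide mult.assoc)
  then show "(2::real)^j * half_root^j = 1 / half_root^j" using 1 by (simp add: divide_simps)
qed

lemma four_power: "(4::real)^j * ((1/2)^j)^2 = 1"
  by (simp add: power2_eq_square flip: power_mult_distrib)

lemma sum_min_geometric':
  fixes C e :: real
  assumes C: "0 \<le> C" and e: "0 < e"
    and a: "\<And>j. a j \<le> C * half_root^j" "\<And>j. e \<le> half_root^j \<Longrightarrow> a j \<le> C * (e^2 / half_root^j)" "\<And>j. 0 \<le> a j"
  shows "(\<Sum>j<n. a j) \<le> C * (2 / (1 - half_root) * e)"
proof (cases "C = 0")
  case True
  then have "(\<Sum>j<n. a j) \<le> (\<Sum>j<n. 0)" using a(1) by (intro sum_mono) simp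
  then show ?thesis using True by simp
next
  case False
  then have C: "0 < C" using C by simp
  have "(\<Sum>j<n. a j / C) \<le> 2 / (1 - half_root) * e"
    by (rule sum_min_geometric[OF half_root(1,2) e]) (use a C in \<open>auto simp: divide_le_eq mult.commute\<close>)
  then show ?thesis using C by (simp add: sum_divide_distrib[symmetric] divide_le_eq mult.commute)
qed

context complex_space
begin

text \<open>
  The densities to which the Cauchy transform is applied. The radius is \<open>2\<close>,
  while the equation for the discs is wanted on the unit disc: the annulus in between is for a
  cut-off.
\<close>

definition hoelder_disc :: "real \<Rightarrow> (complex \<Rightarrow> 'e) \<Rightarrow> bool" where
  "hoelder_disc M h \<longleftrightarrow> hoelder UNIV M h \<and> (\<forall>z. 2 < norm z \<longrightarrow> h z = 0)"

lemma hoelder_discD: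
  assumes "hoelder_disc M h"
  shows "norm (h z) \<le> M" "norm (h z - h z') \<le> M * sqrt (norm (z - z'))" "2 < norm z \<Longrightarrow> h z = 0"
    "continuous_on UNIV h" "0 \<le> M"
  using assms hoelder_nonneg[of UNIV M h] by (auto simp: hoelder_disc_def hoelder_def intro: hoelder_continuous_on)

lemma compactly_supported_const:
  assumes "continuous_on UNIV k" "\<And>z. 1 < norm z \<Longrightarrow> k z = 0"
  shows "compactly_supported (\<lambda>\<zeta>. cmul (k \<zeta>) v)" "compactly_supported (\<lambda>\<zeta>. cmul (k (z - \<zeta>)) v)"
proof -
  show 1: "compactly_supported (\<lambda>\<zeta>. cmul (k \<zeta>) v)"
    by (rule compactly_supportedI[where R = 1]) (use assms in \<open>auto intro!: cmul.continuous_on continuous_intros simp: cmul.zero_left\<close>)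
  show "compactly_supported (\<lambda>\<zeta>. cmul (k (z - \<zeta>)) v)" using compactly_supported_affine(1)[OF 1] by simp
qed

lemma kern_step_support1: "1 < norm z \<Longrightarrow> kern_step j z = 0" "1 < norm z \<Longrightarrow> dkern_step j z \<eta> = 0"
  using kern_step_support[of j z] power_le_one[of "1/2::real" j] by auto

text \<open>
  The convolution of a constant with a kernel of bounded support is constant and so has
  derivative zero.
\<close>

lemma dkern_step_mean: "integral UNIV (\<lambda>\<zeta>. cmul (dkern_step j (z - \<zeta>) \<eta>) v) = 0"
proof -
  have *: "norm z' \<le> norm z + 1" if "norm (z' - z) < 1" for z'
    using norm_triangle_ineq2[of z' z] that by linarith
  have "(conv (kern_step j) (\<lambda>_. v) has_derivative (\<lambda>\<eta>. conv (\<lambda>x. dkern_step j x \<eta>) (\<lambda>_. v) z)) (at z)"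
  proof (rule conv_derivative[where R = "norm z + 2" and M = "norm v", OF kern_step_continuous dkern_step_linear kern_step_taylor])
    fix z' \<zeta> :: complex assume a: "norm (z' - z) < 1" "norm z + 2 < norm \<zeta>"
    have "1 < norm (z' - \<zeta>)" using *[OF a(1)] a(2) norm_triangle_ineq3[of z' \<zeta>] by linarith
    then show "kern_step j (z' - \<zeta>) = 0 \<or> v = 0" using kern_step_support1 by blast
  next
    fix \<eta> \<zeta> :: complex assume a: "norm z + 2 < norm \<zeta>"
    have "1 < norm (z - \<zeta>)" using a norm_triangle_ineq3[of z \<zeta>] by linarith
    then show "dkern_step j (z - \<zeta>) \<eta> = 0 \<or> v = 0" using kern_step_support1 by blast
  qed auto
  moreover have "conv (kern_step j) (\<lambda>_. v) = (\<lambda>z. integral UNIV (\<lambda>\<zeta>. cmul (kern_step j \<zeta>) v))"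
    unfolding conv_def using integral_flip[OF compactly_supported_const(1)[OF kern_step_continuous(1) kern_step_support1(1)]] by metis
  ultimately have "(\<lambda>\<eta>. conv (\<lambda>x. dkern_step j x \<eta>) (\<lambda>_. v) z) = (\<lambda>_. 0)"
    using has_derivative_unique[OF _ has_derivative_const] by metis
  from fun_cong[OF this, of \<eta>] show ?thesis by (simp add: conv_def)
qed

lemma compactly_supported_compact_support:
  assumes "hoelder_disc M h" "continuous_on UNIV k" shows "compactly_supported (\<lambda>\<zeta>. cmul (k (z - \<zeta>)) (h \<zeta>))"
  by (rule compactly_supportedI[where R = 2]) (use hoelder_discD[OF assms(1)] assms(2) in \<open>auto intro!: continuous_conv_kernel simp: cmul.zero_right\<close>)

lemma conv_dkern_step_alt:
  assumes "hoelder_disc M h"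
  shows "conv (\<lambda>x. dkern_step j x \<eta>) h z = integral UNIV (\<lambda>\<zeta>. cmul (dkern_step j (z - \<zeta>) \<eta>) (h \<zeta> - v))"
  unfolding conv_def cmul.diff_right
  by (subst integral_diff) (auto simp: dkern_step_mean intro!: compactly_supported_integrable compactly_supported_compact_support[OF assms kern_step_continuous(2)]
     compactly_supported_const kern_step_continuous kern_step_support1)

text \<open>
  As the kernel has mean zero, \<open>h \<zeta>\<close> may be replaced by \<open>h \<zeta> -
  h z\<close>, which is of the order \<open>half_root^j\<close> on the support; without the
  cancellation the sum over the scales would diverge.
\<close>

lemma conv_dkern_step_bound:
  assumes "hoelder_disc M h"
  shows "norm (conv (\<lambda>x. dkern_step j x \<eta>) h z) \<le> 60 * \<kappa> * M * norm \<eta> * half_root^j"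
proof -
  have "norm (conv (\<lambda>x. dkern_step j x \<eta>) h z) \<le> (\<kappa> * (15 * 4^j * norm \<eta>) * (M * half_root^j)) * (4 * ((1/2)^j)^2)"
    unfolding conv_dkern_step_alt[OF assms, of j \<eta> z "h z"]
  proof (rule local_integral_bound[where a = z])
    show "continuous_on UNIV (\<lambda>\<zeta>. cmul (dkern_step j (z - \<zeta>) \<eta>) (h \<zeta> - h z))"
      by (intro continuous_conv_kernel kern_step_continuous(2) continuous_intros hoelder_discD(4)[OF assms])
    show "cmul (dkern_step j (z - x) \<eta>) (h x - h z) = 0" if "(1/2)^j < norm (x - z)" for x
      using kern_step_support(2)[of j "z - x" \<eta>] that by (simp add: norm_minus_commute cmul.zero_left)
    show "norm (cmul (dkern_step j (z - x) \<eta>) (h x - h z)) \<le> \<kappa> * (15 * 4 ^ j * norm \<eta>) * (M * half_root^j)" if "norm (x - z) \<le> (1/2)^j" for x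
    proof (rule order_trans[OF \<kappa>(2)], intro mult_mono norm_dkern_step)
      have "norm (h x - h z) \<le> M * sqrt (norm (x - z))" by (rule hoelder_discD(2)[OF assms])
      also have "\<dots> \<le> M * half_root^j" using that hoelder_discD(5)[OF assms]
        by (subst half_root(3)[symmetric]) (intro mult_left_mono real_sqrt_le_mono)
      finally show "norm (h x - h z) \<le> M * half_root^j" .
    qed (use \<kappa>(1) half_root(1) in \<open>auto intro!: mult_nonneg_nonneg\<close>)
  qed (use \<kappa>(1) half_root(1) hoelder_discD(5)[OF assms] in \<open>auto intro!: mult_nonneg_nonneg\<close>)
  also have "\<dots> = 60 * \<kappa> * M * norm \<eta> * half_root^j * (4^j * ((1/2)^j)^2)" by simp
  finally show ?thesis unfolding four_power by simp
qed

text \<open>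
  The same cancellation, now used with the Lipschitz bound of the differential of the kernel;
  this is better than the previous bound when the two points are close compared with the
  scale.
\<close>

lemma conv_dkern_step_lipschitz:
  assumes "hoelder_disc M h" "norm (z - z') \<le> (1/2)^j"
  shows "norm (conv (\<lambda>x. dkern_step j x \<eta>) h z - conv (\<lambda>x. dkern_step j x \<eta>) h z') \<le> 1728 * \<kappa> * M * norm \<eta> * (norm (z - z') / half_root^j)"
proof -
  let ?r = "2 * (1/2)^j :: real"
  have M: "0 \<le> M" by (rule hoelder_discD(5)[OF assms(1)])
  let ?f = "\<lambda>\<zeta>. cmul (dkern_step j (z - \<zeta>) \<eta> - dkern_step j (z' - \<zeta>) \<eta>) (h \<zeta> - h z)"
  have cc: "compactly_supported (\<lambda>\<zeta>. cmul (dkern_step j (x - \<zeta>) \<eta>) (h \<zeta> - h z))" for x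
  proof (rule compactly_supportedI[where R = "norm x + 2"])
    show "cmul (dkern_step j (x - \<zeta>) \<eta>) (h \<zeta> - h z) = 0" if "norm x + 2 < norm \<zeta>" for \<zeta>
    proof -
      have "1 < norm (x - \<zeta>)" using that norm_triangle_ineq3[of x \<zeta>] by linarith
      then show ?thesis using kern_step_support1(2)[of "x - \<zeta>"] by (simp add: cmul.zero_left)
    qed
  qed (intro continuous_intros continuous_conv_kernel kern_step_continuous(2) hoelder_discD(4)[OF assms(1)])
  have "conv (\<lambda>x. dkern_step j x \<eta>) h z - conv (\<lambda>x. dkern_step j x \<eta>) h z' = integral UNIV ?f"
    unfolding conv_dkern_step_alt[OF assms(1), of j \<eta> _ "h z"] cmul.diff_left[of "dkern_step j (z - _) \<eta>"]
    by (rule integral_diff[symmetric]) (intro compactly_supported_integrable cc)+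
  also have "norm \<dots> \<le> (\<kappa> * (54 * 8^j * norm (z - z') * norm \<eta>) * (M * (2 * half_root^j))) * (4 * ?r^2)"
  proof (rule local_integral_bound[where a = z])
    show "continuous_on UNIV ?f" unfolding cmul.diff_left
      by (intro continuous_intros continuous_conv_kernel kern_step_continuous(2) hoelder_discD(4)[OF assms(1)])
    show "?f x = 0" if x: "?r < norm (x - z)" for x
    proof -
      have p: "0 < (1/2::real)^j" by simp
      have "(1/2)^j < norm (z - x)" using x p unfolding norm_minus_commute[of z x] by linarith
      moreover have "(1/2)^j < norm (z' - x)"
        using x assms(2) norm_triangle_ineq[of "x - z'" "z' - z"] by (simp add: norm_minus_commute)
      ultimately show ?thesis by (simp add: kern_step_support cmul.zero_left)
    qed
    show "norm (?f x) \<le> \<kappa> * (54 * 8^j * norm (z - z') * norm \<eta>) * (M * (2 * half_root^j))" if "norm (x - z) \<le> ?r" for x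
    proof (rule order_trans[OF \<kappa>(2)], intro mult_mono)
      show "norm (dkern_step j (z - x) \<eta> - dkern_step j (z' - x) \<eta>) \<le> 54 * 8^j * norm (z - z') * norm \<eta>"
        using dkern_step_lipschitz[of j "z - x" \<eta> "z' - x"] by simp
      have "norm (h x - h z) \<le> M * sqrt (norm (x - z))" by (rule hoelder_discD(2)[OF assms(1)])
      also have "\<dots> \<le> M * sqrt (4 * (1/2)^j)" using that M
        by (intro mult_left_mono real_sqrt_le_mono order_trans[OF that]) auto
      also have "\<dots> = M * (2 * half_root^j)" by (simp only: real_sqrt_mult half_root(3)) simp
      finally show "norm (h x - h z) \<le> M * (2 * half_root^j)" .
    qed (use \<kappa>(1) half_root(1) in \<open>auto intro!: mult_nonneg_nonneg\<close>)
  qed (use \<kappa>(1) half_root(1) M in \<open>auto intro!: mult_nonneg_nonneg\<close>)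
  also have "\<dots> = 1728 * \<kappa> * M * norm \<eta> * norm (z - z') * half_root^j * (8^j * ((1/2)^j)^2)"
    by (simp add: power_mult_distrib)
  also have "(8::real)^j * ((1/2)^j)^2 = 2^j" by (simp add: power2_eq_square flip: power_mult_distrib)
  also have "1728 * \<kappa> * M * norm \<eta> * norm (z - z') * half_root^j * 2^j = 1728 * \<kappa> * M * norm \<eta> * norm (z - z') * (2^j * half_root^j)"
    by simp
  finally show ?thesis unfolding half_root(5) by simp
qed

lemma conv_kern_step_bound:
  assumes "hoelder_disc M h" shows "norm (conv (kern_step j) h z) \<le> 36 * \<kappa> * M * (1/2)^j"
proof -
  have M: "0 \<le> M" by (rule hoelder_discD(5)[OF assms(1)])
  have "norm (conv (kern_step j) h z) \<le> (\<kappa> * (9 * 2^j) * M) * (4 * ((1/2)^j)^2)"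
    unfolding conv_def
  proof (rule local_integral_bound[where a = z])
    show "continuous_on UNIV (\<lambda>\<zeta>. cmul (kern_step j (z - \<zeta>)) (h \<zeta>))"
      by (intro continuous_conv_kernel kern_step_continuous hoelder_discD(4)[OF assms])
    show "cmul (kern_step j (z - x)) (h x) = 0" if "(1/2)^j < norm (x - z)" for x
      using kern_step_support(1)[of j "z - x"] that by (simp add: norm_minus_commute cmul.zero_left)
    show "norm (cmul (kern_step j (z - x)) (h x)) \<le> \<kappa> * (9 * 2^j) * M" for x
      by (rule order_trans[OF \<kappa>(2)], intro mult_mono norm_kern_step hoelder_discD(1)[OF assms]) (use \<kappa>(1) in auto)
  qed (use \<kappa>(1) half_root(1) M in \<open>auto intro!: mult_nonneg_nonneg\<close>)
  also have "\<dots> = 36 * \<kappa> * M * (2^j * ((1/2)^j)^2)" by simp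
  also have "(2::real)^j * ((1/2)^j)^2 = (1/2)^j" by (simp add: power2_eq_square flip: power_mult_distrib)
  finally show ?thesis .
qed

lemma conv_add_kernel:
  assumes "hoelder_disc M h" "continuous_on UNIV k" "continuous_on UNIV k'"
  shows "conv (\<lambda>x. k x - k' x) h z = conv k h z - conv k' h z"
  unfolding conv_def cmul.diff_left
  by (intro integral_diff compactly_supported_integrable compactly_supported_compact_support[OF assms(1)] assms)

lemma conv_kern_at_sum:
  assumes "hoelder_disc M h"
  shows "conv (kern_at n) h z = conv (kern_at 0) h z + (\<Sum>j<n. conv (kern_step j) h z)"
    "conv (\<lambda>x. dkern_at n x \<eta>) h z = conv (\<lambda>x. dkern_at 0 x \<eta>) h z + (\<Sum>j<n. conv (\<lambda>x. dkern_step j x \<eta>) h z)"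
proof -
  have "conv (kern_step j) h z = conv (kern_at (Suc j)) h z - conv (kern_at j) h z" for j
    using conv_add_kernel[OF assms kern_at_continuous kern_at_continuous] by (simp add: kern_step_def[abs_def])
  then show "conv (kern_at n) h z = conv (kern_at 0) h z + (\<Sum>j<n. conv (kern_step j) h z)" by (induction n) auto
  have "conv (\<lambda>x. dkern_step j x \<eta>) h z = conv (\<lambda>x. dkern_at (Suc j) x \<eta>) h z - conv (\<lambda>x. dkern_at j x \<eta>) h z" for j
    unfolding dkern_step_def by (rule conv_add_kernel[OF assms dkern_at_continuous dkern_at_continuous])
  then show "conv (\<lambda>x. dkern_at n x \<eta>) h z = conv (\<lambda>x. dkern_at 0 x \<eta>) h z + (\<Sum>j<n. conv (\<lambda>x. dkern_step j x \<eta>) h z)"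
    by (induction n) auto
qed

lemma conv_bound:
  assumes "hoelder_disc M h" "continuous_on UNIV k" "\<And>x. norm (k x) \<le> B"
  shows "norm (conv k h z) \<le> 16 * \<kappa> * B * M"
proof -
  have M: "0 \<le> M" by (rule hoelder_discD(5)[OF assms(1)])
  have B: "0 \<le> B" using assms(3)[of 0] norm_ge_zero order_trans by blast
  have "norm (conv k h z) \<le> (\<kappa> * B * M) * (4 * 2^2)"
    unfolding conv_def
  proof (rule local_integral_bound[where a = 0])
    show "continuous_on UNIV (\<lambda>\<zeta>. cmul (k (z - \<zeta>)) (h \<zeta>))"
      by (intro continuous_conv_kernel hoelder_discD(4)[OF assms(1)] assms)
    show "cmul (k (z - x)) (h x) = 0" if "2 < norm (x - 0)" for x
      using hoelder_discD(3)[OF assms(1), of x] that by (simp add: cmul.zero_right)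
    show "norm (cmul (k (z - x)) (h x)) \<le> \<kappa> * B * M" for x
      by (rule order_trans[OF \<kappa>(2)], intro mult_mono assms hoelder_discD(1)[OF assms(1)]) (use \<kappa>(1) B in auto)
  qed (use \<kappa>(1) M B in \<open>auto intro!: mult_nonneg_nonneg\<close>)
  then show ?thesis by simp
qed

lemma conv_lipschitz:
  assumes "hoelder_disc M h" "continuous_on UNIV k" "\<And>x x'. norm (k x - k x') \<le> B * norm (x - x')"
  shows "norm (conv k h z - conv k h z') \<le> 16 * \<kappa> * B * M * norm (z - z')"
proof -
  have M: "0 \<le> M" by (rule hoelder_discD(5)[OF assms(1)])
  have B: "0 \<le> B" using order_trans[OF norm_ge_zero assms(3)[of 1 0]] by simp
  let ?f = "\<lambda>\<zeta>. cmul (k (z - \<zeta>) - k (z' - \<zeta>)) (h \<zeta>)"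
  have "conv k h z - conv k h z' = integral UNIV ?f"
    unfolding conv_def cmul.diff_left
    by (rule integral_diff[symmetric]) (intro compactly_supported_integrable compactly_supported_compact_support[OF assms(1)] assms)+
  also have "norm \<dots> \<le> (\<kappa> * (B * norm (z - z')) * M) * (4 * 2^2)"
  proof (rule local_integral_bound[where a = 0])
    show "continuous_on UNIV ?f" unfolding cmul.diff_left
      by (intro continuous_intros continuous_conv_kernel hoelder_discD(4)[OF assms(1)] assms)
    show "?f x = 0" if "2 < norm (x - 0)" for x
      using hoelder_discD(3)[OF assms(1), of x] that by (simp add: cmul.zero_right)
    show "norm (?f x) \<le> \<kappa> * (B * norm (z - z')) * M" for x
      by (rule order_trans[OF \<kappa>(2)], intro mult_mono hoelder_discD(1)[OF assms(1)])
        (use \<kappa>(1) B assms(3)[of "z - x" "z' - x"] in auto)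
  qed (use \<kappa>(1) M B in \<open>auto intro!: mult_nonneg_nonneg\<close>)
  finally show ?thesis by (simp add: algebra_simps)
qed

end

section \<open>The Cauchy transform for a complex structure\<close>

context complex_space
begin

text \<open>
  The operator \<open>\<partial>\<^sub>x + J0 \<partial>\<^sub>y\<close> takes twice the
  antiholomorphic derivative, whence the factor.
\<close>

definition kern_mass :: real where "kern_mass = integral UNIV (\<lambda>\<zeta>::complex. 2 * kern_dbar \<zeta>)"

lemma kern_dbar_continuous: "continuous_on UNIV kern_dbar"
  unfolding kern_dbar_def by (intro continuous_intros)

lemma kern_dbar_support: "1 < norm z \<Longrightarrow> kern_dbar z = 0"
  using one_le_power[of "norm z" 2] by (simp add: kern_dbar_def)

lemma compactly_supported_kern_dbar: "compactly_supported (\<lambda>z. 2 * kern_dbar z)"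
  by (rule compactly_supportedI[where R = 1]) (auto intro!: continuous_intros kern_dbar_continuous kern_dbar_support)

lemma kern_mass_pos: "kern_mass > 0"
proof -
  have c: "continuous_on S (\<lambda>z. 2 * kern_dbar z)" for S
    using continuous_on_subset[OF kern_dbar_continuous] by (intro continuous_intros) auto
  let ?B = "cbox (0 - Complex 1 1) (0 + Complex 1 1)"
  have I: "integral ?B (\<lambda>z. 2 * kern_dbar z) = kern_mass"
    unfolding kern_mass_def by (rule integral_unique[OF local_integral(2), symmetric]) (use c kern_dbar_support in auto)
  have nn: "0 \<le> integral ?B (\<lambda>z. 2 * kern_dbar z)"
    by (rule integral_nonneg[OF integrable_continuous[OF c]]) (simp add: kern_dbar_bounds)
  moreover have "integral ?B (\<lambda>z. 2 * kern_dbar z) \<noteq> 0"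
  proof
    assume "integral ?B (\<lambda>z. 2 * kern_dbar z) = 0"
    moreover have ne: "box (0 - Complex 1 1) (0 + Complex 1 1) \<noteq> {}" by (auto simp: box_ne_empty Basis_complex_def)
    ultimately have "2 * kern_dbar 0 = 0"
      using integral_cbox_eq_0_iff[OF c ne] kern_dbar_bounds by (auto simp: in_cbox_complex_iff)
    then show False by (simp add: kern_dbar_def)
  qed
  ultimately show ?thesis unfolding I by linarith
qed

text \<open>
  The kernels of two consecutive scales differ by derivatives of mean zero.
\<close>

lemma kern_mass_at: fixes v :: 'e shows "integral UNIV (\<lambda>\<zeta>. (2 * 4^j * kern_dbar (2^j * (z - \<zeta>))) *\<^sub>R v) = kern_mass *\<^sub>R v"
proof (induction j)
  case 0
  have "integral UNIV (\<lambda>\<zeta>. (2 * kern_dbar (z - \<zeta>)) *\<^sub>R v) = integral UNIV (\<lambda>\<zeta>. (2 * kern_dbar \<zeta>) *\<^sub>R v)"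
    by (rule integral_flip[where f = "\<lambda>\<zeta>. (2 * kern_dbar \<zeta>) *\<^sub>R v"], rule compactly_supportedI[where R = 1])
      (auto intro!: continuous_intros kern_dbar_continuous kern_dbar_support)
  also have "\<dots> = kern_mass *\<^sub>R v"
  proof -
    have "((\<lambda>\<zeta>. 2 * kern_dbar \<zeta>) has_integral kern_mass) UNIV"
      unfolding kern_mass_def using compactly_supported_integrable[OF compactly_supported_kern_dbar] by blast
    from has_integral_scaleR_left[OF this] show ?thesis by (rule integral_unique)
  qed
  finally show ?case by simp
next
  case (Suc j)
  let ?r = "\<lambda>j \<zeta>. (2 * 4^j * kern_dbar (2^j * (z - \<zeta>))) *\<^sub>R v"
  have eq: "?r (Suc j) \<zeta> = ?r j \<zeta> + (cmul (dkern_step j (z - \<zeta>) 1) v + J0 (cmul (dkern_step j (z - \<zeta>) \<i>) v))" for \<zeta>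
  proof -
    have "?r j \<zeta> = cmul (dkern_at j (z - \<zeta>) 1 + \<i> * dkern_at j (z - \<zeta>) \<i>) v" for j
      unfolding dkern_at_dbar cmul_simps ..
    then show ?thesis unfolding dkern_step_def cmul_simps(4)
      by (simp only: cmul.add_left[symmetric]) (simp add: algebra_simps)
  qed
  have cc: "compactly_supported (\<lambda>\<zeta>. cmul (dkern_step j (z - \<zeta>) \<eta>) v)" for \<eta>
    by (intro compactly_supported_const kern_step_continuous kern_step_support1)
  have I1: "((\<lambda>\<zeta>. cmul (dkern_step j (z - \<zeta>) \<eta>) v) has_integral 0) UNIV" for \<eta>
    using integrable_integral[OF compactly_supported_integrable[OF cc[of \<eta>]]] by (simp add: dkern_step_mean)
  have "((\<lambda>\<zeta>. J0 (cmul (dkern_step j (z - \<zeta>) \<i>) v)) has_integral J0 0) UNIV"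
    using has_integral_linear[OF I1[of \<i>] J0_bounded_linear] by (simp add: o_def)
  then have I2: "((\<lambda>\<zeta>. J0 (cmul (dkern_step j (z - \<zeta>) \<i>) v)) has_integral 0) UNIV" by (simp add: J0_simps)
  have ck: "continuous_on UNIV (\<lambda>\<zeta>. kern_dbar (2^j * (z - \<zeta>)))"
    by (rule continuous_on_compose2[OF kern_dbar_continuous]) (auto intro!: continuous_intros)
  have "compactly_supported (?r j)"
  proof (rule compactly_supportedI[where R = "norm z + 1"])
    show "?r j x = 0" if "norm z + 1 < norm x" for x
    proof -
      have "1 < norm (z - x)" using that norm_triangle_ineq3[of z x] by linarith
      moreover have "norm (z - x) \<le> norm (2^j * (z - x))"
        by (simp add: norm_mult norm_power mult_le_cancel_right1)
      ultimately have "1 < norm (2^j * (z - x))" by linarith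
      then show ?thesis by (simp add: kern_dbar_support)
    qed
  qed (intro continuous_intros ck)
  then have "(?r j has_integral kern_mass *\<^sub>R v) UNIV"
    using integrable_integral[OF compactly_supported_integrable] Suc.IH by metis
  from has_integral_add[OF this has_integral_add[OF I1[of 1] I2]] show ?case
    unfolding eq[symmetric] by (intro integral_unique) simp
qed

text \<open>
  The coarsest scale contributes \<open>192\<close>; the other number is a convenient bound
  for the sums over the finer scales.
\<close>

definition grad_const :: real where "grad_const = \<kappa> * (192 + 4000 / (1 - half_root))"

text \<open>
  For each pair of points the fine scales are estimated by their size and the coarse ones by
  their Lipschitz constant, which is the situation of \<open>sum_min_geometric\<close>. The
  bound does not depend on \<open>n\<close>, so it passes to the limit.
\<close>

lemma grad_bounds:
  assumes "hoelder_disc M h"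
  shows "hoelder UNIV (grad_const * norm \<eta> * M) (conv (\<lambda>x. dkern_at n x \<eta>) h)"
proof -
  have M: "0 \<le> M" by (rule hoelder_discD(5)[OF assms])
  let ?g = "\<lambda>j z. conv (\<lambda>x. dkern_step j x \<eta>) h z"
  have 0: "hoelder UNIV (2 * (96 * \<kappa> * M * norm \<eta>)) (conv (\<lambda>x. dkern_at 0 x \<eta>) h)"
  proof (rule hoelder_of_lipschitz)
    fix z z'
    have "norm (conv (\<lambda>x. dkern_at 0 x \<eta>) h z) \<le> 16 * \<kappa> * (3 * norm \<eta>) * M"
      by (rule conv_bound[OF assms dkern_at_continuous]) (use norm_dkern_at[of 0] in simp)
    also have "\<dots> \<le> 96 * \<kappa> * M * norm \<eta>" using \<kappa>(1) M by (simp add: mult_nonneg_nonneg)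
    finally show "norm (conv (\<lambda>x. dkern_at 0 x \<eta>) h z) \<le> 96 * \<kappa> * M * norm \<eta>" .
    have "norm (conv (\<lambda>x. dkern_at 0 x \<eta>) h z - conv (\<lambda>x. dkern_at 0 x \<eta>) h z') \<le> 16 * \<kappa> * (6 * norm \<eta>) * M * norm (z - z')"
      by (rule conv_lipschitz[OF assms dkern_at_continuous]) (use dkern_at_lipschitz[of 0 _ \<eta>] in \<open>simp add: ac_simps\<close>)
    then show "norm (conv (\<lambda>x. dkern_at 0 x \<eta>) h z - conv (\<lambda>x. dkern_at 0 x \<eta>) h z') \<le> 96 * \<kappa> * M * norm \<eta> * norm (z - z')"
      by (simp add: ac_simps)
  qed
  have s: "0 < 1 - half_root" using half_root by simp
  have 1: "hoelder UNIV (3456 * \<kappa> * M * norm \<eta> / (1 - half_root)) (\<lambda>z. \<Sum>j<n. ?g j z)"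
  proof (rule hoelderI)
    fix z
    have "norm (\<Sum>j<n. ?g j z) \<le> (\<Sum>j<n. 60 * \<kappa> * M * norm \<eta> * half_root^j)"
      by (rule order_trans[OF norm_sum sum_mono]) (rule conv_dkern_step_bound[OF assms])
    also have "\<dots> \<le> 60 * \<kappa> * M * norm \<eta> * (1 / (1 - half_root))"
      unfolding sum_distrib_left[symmetric] using sum_geometric_bound[of half_root n] half_root \<kappa>(1) M
      by (intro mult_left_mono) auto
    also have "\<dots> \<le> 3456 * \<kappa> * M * norm \<eta> / (1 - half_root)" using \<kappa>(1) M s
      by (simp add: divide_right_mono mult_nonneg_nonneg)
    finally show "norm (\<Sum>j<n. ?g j z) \<le> 3456 * \<kappa> * M * norm \<eta> / (1 - half_root)" .
  next
    fix z z'
    show "norm ((\<Sum>j<n. ?g j z) - (\<Sum>j<n. ?g j z')) \<le> 3456 * \<kappa> * M * norm \<eta> / (1 - half_root) * sqrt (norm (z - z'))"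
    proof (cases "z = z'")
      case False
      have "norm ((\<Sum>j<n. ?g j z) - (\<Sum>j<n. ?g j z')) \<le> (\<Sum>j<n. norm (?g j z - ?g j z'))"
        by (simp add: sum_subtractf[symmetric] norm_sum)
      also have "\<dots> \<le> (1728 * \<kappa> * M * norm \<eta>) * (2 / (1 - half_root) * sqrt (norm (z - z')))"
      proof (rule sum_min_geometric')
        fix j
        have "norm (?g j z - ?g j z') \<le> 60 * \<kappa> * M * norm \<eta> * half_root^j + 60 * \<kappa> * M * norm \<eta> * half_root^j"
          by (rule order_trans[OF norm_triangle_ineq4 add_mono[OF conv_dkern_step_bound[OF assms] conv_dkern_step_bound[OF assms]]])
        also have "\<dots> = 120 * (\<kappa> * M * norm \<eta> * half_root^j)" by simp
        also have "\<dots> \<le> 1728 * (\<kappa> * M * norm \<eta> * half_root^j)" using \<kappa>(1) M half_root(1) by (intro mult_right_mono) auto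
        finally show "norm (?g j z - ?g j z') \<le> 1728 * \<kappa> * M * norm \<eta> * half_root^j" by simp
        assume "sqrt (norm (z - z')) \<le> half_root^j"
        then have "(sqrt (norm (z - z')))^2 \<le> (half_root^j)^2" by (intro power_mono) auto
        then have "norm (z - z') \<le> (1/2)^j" using half_root(4)[of j] by (simp add: power2_eq_square)
        from conv_dkern_step_lipschitz[OF assms this]
        show "norm (?g j z - ?g j z') \<le> 1728 * \<kappa> * M * norm \<eta> * ((sqrt (norm (z - z')))^2 / half_root^j)"
          by simp
      qed (use \<kappa>(1) M False in auto)
      finally show ?thesis by (simp add: mult.assoc)
    qed (use \<kappa>(1) M s in auto)
  qed
  have "hoelder UNIV (2 * (96 * \<kappa> * M * norm \<eta>) + 3456 * \<kappa> * M * norm \<eta> / (1 - half_root)) (conv (\<lambda>x. dkern_at n x \<eta>) h)"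
    using hoelder_add[OF 0 1] unfolding conv_kern_at_sum(2)[OF assms, of n \<eta>, abs_def] .
  moreover have "2 * (96 * \<kappa> * M * norm \<eta>) + 3456 * \<kappa> * M * norm \<eta> / (1 - half_root) \<le> grad_const * norm \<eta> * M"
  proof -
    have "\<kappa> * M * norm \<eta> * (192 + 3456 / (1 - half_root)) \<le> \<kappa> * M * norm \<eta> * (192 + 4000 / (1 - half_root))"
      using \<kappa>(1) M s by (intro mult_left_mono add_left_mono divide_right_mono) auto
    then show ?thesis unfolding grad_const_def by (simp add: algebra_simps)
  qed
  ultimately show ?thesis by (rule hoelder_mono)
qed

definition dcauchy_lim :: "complex \<Rightarrow> (complex \<Rightarrow> 'e) \<Rightarrow> complex \<Rightarrow> 'e" where
  "dcauchy_lim \<eta> h z = lim (\<lambda>n. conv (\<lambda>x. dkern_at n x \<eta>) h z)"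

definition cauchy_lim :: "(complex \<Rightarrow> 'e) \<Rightarrow> complex \<Rightarrow> 'e" where
  "cauchy_lim h z = lim (\<lambda>n. conv (kern_at n) h z)"

lemma cauchy_lim_lim:
  assumes "hoelder_disc M h"
  shows "(\<lambda>n. conv (kern_at n) h z) \<longlonglongrightarrow> cauchy_lim h z" "norm (cauchy_lim h z) \<le> grad_const * M"
proof -
  have M: "0 \<le> M" by (rule hoelder_discD(5)[OF assms])
  have s: "0 < 1 - half_root" "1 - half_root \<le> 1" using half_root by auto
  have sm: "summable (\<lambda>j. 36 * \<kappa> * M * (1/2)^j)" by (intro summable_mult summable_geometric) auto
  have "summable (\<lambda>j. conv (kern_step j) h z)"
    by (rule summable_comparison_test'[OF sm]) (rule conv_kern_step_bound[OF assms])
  then have "convergent (\<lambda>n. \<Sum>j<n. conv (kern_step j) h z)" by (simp add: summable_iff_convergent)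
  then have "convergent (\<lambda>n. conv (kern_at 0) h z + (\<Sum>j<n. conv (kern_step j) h z))"
    by (intro convergent_add convergent_const)
  then have "convergent (\<lambda>n. conv (kern_at n) h z)" unfolding conv_kern_at_sum(1)[OF assms, symmetric] .
  then show lim: "(\<lambda>n. conv (kern_at n) h z) \<longlonglongrightarrow> cauchy_lim h z" unfolding cauchy_lim_def by (simp add: convergent_LIMSEQ_iff)
  have "norm (conv (kern_at n) h z) \<le> grad_const * M" for n
  proof -
    have "norm (conv (kern_at n) h z) \<le> 16 * \<kappa> * 3 * M + (\<Sum>j<n. 36 * \<kappa> * M * (1/2)^j)"
      unfolding conv_kern_at_sum(1)[OF assms, of n]
      by (intro order_trans[OF norm_triangle_ineq] add_mono order_trans[OF norm_sum] sum_mono conv_kern_step_bound[OF assms]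
        conv_bound[OF assms kern_at_continuous]) (use norm_kern_at[of 0] in simp)
    also have "(\<Sum>j<n. 36 * \<kappa> * M * (1/2)^j) \<le> 36 * \<kappa> * M * (1 / (1 - 1/2))"
      unfolding sum_distrib_left[symmetric] using \<kappa>(1) M by (intro mult_left_mono sum_geometric_bound) auto
    also have "16 * \<kappa> * 3 * M + 36 * \<kappa> * M * (1 / (1 - 1/2)) = (\<kappa> * M) * 120" by simp
    also have "\<dots> \<le> (\<kappa> * M) * (192 + 4000 / (1 - half_root))"
      using \<kappa>(1) M s by (intro mult_left_mono) (auto intro: add_increasing2)
    finally show ?thesis by (simp add: grad_const_def ac_simps)
  qed
  then show "norm (cauchy_lim h z) \<le> grad_const * M" by (intro LIMSEQ_le_const2[OF tendsto_norm[OF lim]]) auto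
qed

lemma dcauchy_lim_lim:
  assumes "hoelder_disc M h"
  shows "(\<lambda>n. conv (\<lambda>x. dkern_at n x \<eta>) h z) \<longlonglongrightarrow> dcauchy_lim \<eta> h z"
    "norm (conv (\<lambda>x. dkern_at n x \<eta>) h z - dcauchy_lim \<eta> h z) \<le> grad_const * M * half_root^n * norm \<eta>"
proof -
  have M: "0 \<le> M" by (rule hoelder_discD(5)[OF assms])
  have s: "0 < 1 - half_root" using half_root by auto
  let ?g = "\<lambda>j. conv (\<lambda>x. dkern_step j x \<eta>) h z"
  have sm: "summable (\<lambda>j. 60 * \<kappa> * M * norm \<eta> * half_root^j)" using half_root by (intro summable_mult summable_geometric) auto
  have smg: "summable ?g"
    by (rule summable_comparison_test'[OF sm]) (rule conv_dkern_step_bound[OF assms])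
  then have "convergent (\<lambda>n. \<Sum>j<n. ?g j)" by (simp add: summable_iff_convergent)
  then have "convergent (\<lambda>n. conv (\<lambda>x. dkern_at 0 x \<eta>) h z + (\<Sum>j<n. ?g j))"
    by (intro convergent_add convergent_const)
  then have "convergent (\<lambda>n. conv (\<lambda>x. dkern_at n x \<eta>) h z)" unfolding conv_kern_at_sum(2)[OF assms, symmetric] .
  then show lim: "(\<lambda>n. conv (\<lambda>x. dkern_at n x \<eta>) h z) \<longlonglongrightarrow> dcauchy_lim \<eta> h z"
    unfolding dcauchy_lim_def by (simp add: convergent_LIMSEQ_iff)
  have step: "norm (conv (\<lambda>x. dkern_at n x \<eta>) h z - conv (\<lambda>x. dkern_at (n + m) x \<eta>) h z) \<le> grad_const * M * half_root^n * norm \<eta>" for m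
  proof -
    have sp: "(\<Sum>j<n+m. ?g j) = (\<Sum>j<n. ?g j) + (\<Sum>i<m. ?g (i + n))"
      by (induction m) (simp_all add: add.commute add.left_commute)
    have "norm (conv (\<lambda>x. dkern_at n x \<eta>) h z - conv (\<lambda>x. dkern_at (n + m) x \<eta>) h z) = norm (\<Sum>i<m. ?g (i + n))"
      unfolding conv_kern_at_sum(2)[OF assms, of n] conv_kern_at_sum(2)[OF assms, of "n + m"] sp by simp
    also have "\<dots> \<le> (\<Sum>i<m. 60 * \<kappa> * M * norm \<eta> * half_root^n * half_root^i)"
    proof (rule order_trans[OF norm_sum sum_mono])
      fix i show "norm (?g (i + n)) \<le> 60 * \<kappa> * M * norm \<eta> * half_root^n * half_root^i"
        using conv_dkern_step_bound[OF assms, of "i + n" \<eta> z] by (simp add: power_add ac_simps)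
    qed
    also have "\<dots> \<le> 60 * \<kappa> * M * norm \<eta> * half_root^n * (1 / (1 - half_root))"
      unfolding sum_distrib_left[symmetric] using \<kappa>(1) M half_root by (intro mult_left_mono sum_geometric_bound) auto
    also have "\<dots> = (M * norm \<eta> * half_root^n) * (\<kappa> * (60 / (1 - half_root)))" by simp
    also have "\<dots> \<le> (M * norm \<eta> * half_root^n) * (\<kappa> * (192 + 4000 / (1 - half_root)))"
    proof (intro mult_left_mono)
      have "60 / (1 - half_root) \<le> 4000 / (1 - half_root)" using s by (intro divide_right_mono) auto
      then show "60 / (1 - half_root) \<le> 192 + 4000 / (1 - half_root)" by simp
    qed (use \<kappa>(1) M half_root(1) in auto)
    finally show ?thesis by (simp add: grad_const_def ac_simps)
  qed
  have l2: "(\<lambda>m. norm (conv (\<lambda>x. dkern_at n x \<eta>) h z - conv (\<lambda>x. dkern_at (n + m) x \<eta>) h z)) \<longlonglongrightarrow> norm (conv (\<lambda>x. dkern_at n x \<eta>) h z - dcauchy_lim \<eta> h z)"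
    using LIMSEQ_ignore_initial_segment[OF lim, of n] by (intro tendsto_intros) (simp add: add.commute)
  show "norm (conv (\<lambda>x. dkern_at n x \<eta>) h z - dcauchy_lim \<eta> h z) \<le> grad_const * M * half_root^n * norm \<eta>"
    by (rule LIMSEQ_le_const2[OF l2]) (use step in auto)
qed

lemma dcauchy_lim_hoelder:
  assumes "hoelder_disc M h" shows "hoelder UNIV (grad_const * norm \<eta> * M) (dcauchy_lim \<eta> h)"
  by (rule hoelder_limit[OF grad_bounds[OF assms] dcauchy_lim_lim(1)[OF assms] tendsto_const])

lemma conv_kern_at_derivative:
  assumes "hoelder_disc M h"
  shows "(conv (kern_at n) h has_derivative (\<lambda>\<eta>. conv (\<lambda>x. dkern_at n x \<eta>) h z)) (at z)"
  by (rule conv_derivative[where R = 2, OF kern_at_continuous dkern_at_continuous dkern_at_linear kern_at_taylor hoelder_discD(4,1)[OF assms]])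
    (use hoelder_discD(3)[OF assms] in auto)

text \<open>
  The derivatives of the approximating convolutions converge uniformly, at a geometric rate.
\<close>

lemma cauchy_lim_derivative:
  assumes "hoelder_disc M h"
  shows "(cauchy_lim h has_derivative (\<lambda>\<eta>. dcauchy_lim \<eta> h z)) (at z)"
proof -
  have M: "0 \<le> M" by (rule hoelder_discD(5)[OF assms])
  have grad_const: "0 \<le> grad_const" unfolding grad_const_def using \<kappa>(1) half_root by (intro mult_nonneg_nonneg add_nonneg_nonneg) auto
  have "\<exists>g. \<forall>x\<in>UNIV. (\<lambda>n. conv (kern_at n) h x) \<longlonglongrightarrow> g x \<and> (g has_derivative (\<lambda>\<eta>. dcauchy_lim \<eta> h x)) (at x within UNIV)"
  proof (rule has_derivative_sequence[OF convex_UNIV conv_kern_at_derivative[OF assms] _ UNIV_I cauchy_lim_lim(1)[OF assms]])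
    fix e :: real assume e: "0 < e"
    have "(\<lambda>n. grad_const * M * half_root^n) \<longlonglongrightarrow> grad_const * M * 0" using half_root by (intro tendsto_intros LIMSEQ_power_zero) auto
    then have "\<forall>\<^sub>F n in sequentially. grad_const * M * half_root^n < e" using e by (intro order_tendstoD) auto
    then show "\<forall>\<^sub>F n in sequentially. \<forall>x\<in>UNIV. \<forall>\<eta>. norm (conv (\<lambda>x. dkern_at n x \<eta>) h x - dcauchy_lim \<eta> h x) \<le> e * norm \<eta>"
    proof eventually_elim
      case (elim n)
      show ?case
      proof (intro ballI allI)
        fix x \<eta>
        have "norm (conv (\<lambda>x. dkern_at n x \<eta>) h x - dcauchy_lim \<eta> h x) \<le> grad_const * M * half_root^n * norm \<eta>" by (rule dcauchy_lim_lim(2)[OF assms])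
        also have "\<dots> \<le> e * norm \<eta>" using elim by (intro mult_right_mono) auto
        finally show "norm (conv (\<lambda>x. dkern_at n x \<eta>) h x - dcauchy_lim \<eta> h x) \<le> e * norm \<eta>" .
      qed
    qed
  qed
  then obtain g where g: "\<And>x. (\<lambda>n. conv (kern_at n) h x) \<longlonglongrightarrow> g x" "\<And>x. (g has_derivative (\<lambda>\<eta>. dcauchy_lim \<eta> h x)) (at x)" by auto
  have "g = cauchy_lim h" using LIMSEQ_unique[OF g(1) cauchy_lim_lim(1)[OF assms]] by auto
  then show ?thesis using g(2) by simp
qed

text \<open>
  Applied to the kernel of scale \<open>n\<close>, the operator gives a nonnegative bump of
  mass \<open>kern_mass\<close> in the disc of radius \<open>2^(-n)\<close>: an approximate
  identity.
\<close>

lemma dcauchy_lim_dbar: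
  assumes "hoelder_disc M h" shows "dcauchy_lim 1 h z + J0 (dcauchy_lim \<i> h z) = kern_mass *\<^sub>R h z"
proof -
  have M: "0 \<le> M" by (rule hoelder_discD(5)[OF assms])
  let ?r = "\<lambda>n \<zeta>. 2 * 4^n * kern_dbar (2^n * (z - \<zeta>))"
  let ?L = "\<lambda>n. conv (\<lambda>x. dkern_at n x 1) h z + J0 (conv (\<lambda>x. dkern_at n x \<i>) h z)"
  have L: "?L \<longlonglongrightarrow> dcauchy_lim 1 h z + J0 (dcauchy_lim \<i> h z)"
    by (intro tendsto_intros dcauchy_lim_lim(1)[OF assms] bounded_linear.tendsto[OF J0_bounded_linear])
  have ck: "continuous_on UNIV (\<lambda>\<zeta>. kern_dbar (2^n * (z - \<zeta>)))" for n
    by (rule continuous_on_compose2[OF kern_dbar_continuous]) (auto intro!: continuous_intros)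
  have supp: "kern_dbar (2^n * (z - \<zeta>)) = 0" if "(1/2)^n < norm (\<zeta> - z)" for n \<zeta>
    by (rule kern_dbar_support) (use that in \<open>simp add: norm_mult norm_power norm_minus_commute power_divide divide_less_eq mult.commute\<close>)
  have b: "norm (?L n - kern_mass *\<^sub>R h z) \<le> 16 * M * half_root^n" for n
  proof -
    have cc: "compactly_supported (\<lambda>\<zeta>. cmul (dkern_at n (z - \<zeta>) \<eta>) (h \<zeta>))" for \<eta> by (rule compactly_supported_compact_support[OF assms dkern_at_continuous])
    have I: "((\<lambda>\<zeta>. cmul (dkern_at n (z - \<zeta>) \<eta>) (h \<zeta>)) has_integral conv (\<lambda>x. dkern_at n x \<eta>) h z) UNIV" for \<eta>
      unfolding conv_def by (rule integrable_integral[OF compactly_supported_integrable[OF cc]])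
    have "((\<lambda>\<zeta>. cmul (dkern_at n (z - \<zeta>) 1) (h \<zeta>) + J0 (cmul (dkern_at n (z - \<zeta>) \<i>) (h \<zeta>))) has_integral ?L n) UNIV"
      using has_integral_add[OF I[of 1] has_integral_linear[OF I[of \<i>] J0_bounded_linear]] by (simp add: o_def)
    then have 1: "((\<lambda>\<zeta>. ?r n \<zeta> *\<^sub>R h \<zeta>) has_integral ?L n) UNIV"
      unfolding cmul_simps(4) cmul.add_left[symmetric] dkern_at_dbar unfolding cmul_simps(1) .
    have "compactly_supported (\<lambda>\<zeta>. ?r n \<zeta> *\<^sub>R h z)"
    proof (rule compactly_supportedI[where R = "norm z + 1"])
      show "?r n x *\<^sub>R h z = 0" if "norm z + 1 < norm x" for x
      proof -
        have "1 < norm (x - z)" using that norm_triangle_ineq2[of x z] by linarith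
        then have "(1/2)^n < norm (x - z)" using power_le_one[of "1/2::real" n] by linarith
        then show ?thesis by (simp add: supp)
      qed
    qed (intro continuous_intros ck)
    then have 2: "((\<lambda>\<zeta>. ?r n \<zeta> *\<^sub>R h z) has_integral kern_mass *\<^sub>R h z) UNIV"
      using integrable_integral[OF compactly_supported_integrable] kern_mass_at by metis
    have "?L n - kern_mass *\<^sub>R h z = integral UNIV (\<lambda>\<zeta>. ?r n \<zeta> *\<^sub>R (h \<zeta> - h z))"
      using integral_unique[OF has_integral_diff[OF 1 2]] by (simp add: scaleR_diff_right)
    also have "norm \<dots> \<le> (4 * 4^n * (M * half_root^n)) * (4 * ((1/2)^n)^2)"
    proof (rule local_integral_bound[where a = z])
      show "continuous_on UNIV (\<lambda>\<zeta>. ?r n \<zeta> *\<^sub>R (h \<zeta> - h z))"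
        by (intro continuous_intros ck hoelder_discD(4)[OF assms])
      show "?r n x *\<^sub>R (h x - h z) = 0" if "(1/2)^n < norm (x - z)" for x using supp[OF that] by simp
      show "norm (?r n x *\<^sub>R (h x - h z)) \<le> 4 * 4^n * (M * half_root^n)" if "norm (x - z) \<le> (1/2)^n" for x
      proof -
        have "norm (h x - h z) \<le> M * sqrt (norm (x - z))" by (rule hoelder_discD(2)[OF assms])
        also have "\<dots> \<le> M * half_root^n" using that M by (subst half_root(3)[symmetric]) (intro mult_left_mono real_sqrt_le_mono)
        finally have "norm (h x - h z) \<le> M * half_root^n" .
        moreover have "\<bar>?r n x\<bar> \<le> 4 * 4^n" using kern_dbar_bounds[of "2^n * (z - x)"] by (simp add: abs_mult)
        ultimately show ?thesis by (simp only: norm_scaleR) (intro mult_mono, auto)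
      qed
    qed (use M half_root(1) in auto)
    also have "\<dots> = 16 * M * half_root^n * (4^n * ((1/2)^n)^2)" by simp
    finally show ?thesis unfolding four_power by simp
  qed
  have "(\<lambda>n. 16 * M * half_root^n) \<longlonglongrightarrow> 16 * M * 0" using half_root by (intro tendsto_intros LIMSEQ_power_zero) auto
  then have l: "(\<lambda>n. 16 * M * half_root^n) \<longlonglongrightarrow> 0" by simp
  have "(\<lambda>n. ?L n - kern_mass *\<^sub>R h z) \<longlonglongrightarrow> 0"
    by (rule Lim_null_comparison[OF always_eventually[OF allI[OF b]] l])
  then have "?L \<longlonglongrightarrow> kern_mass *\<^sub>R h z" by (rule LIM_zero_cancel)
  then show ?thesis by (rule LIMSEQ_unique[OF L])
qed

lemma cauchy_lim_diff:
  assumes "hoelder_disc M h" "hoelder_disc M' h'"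
  shows "cauchy_lim (\<lambda>z. h z - h' z) z = cauchy_lim h z - cauchy_lim h' z" "dcauchy_lim \<eta> (\<lambda>z. h z - h' z) z = dcauchy_lim \<eta> h z - dcauchy_lim \<eta> h' z"
proof -
  have *: "conv k (\<lambda>z. h z - h' z) z = conv k h z - conv k h' z" if "continuous_on UNIV k" for k
    unfolding conv_def cmul.diff_right
    by (intro integral_diff compactly_supported_integrable compactly_supported_compact_support[OF assms(1)] compactly_supported_compact_support[OF assms(2)] that)
  show "cauchy_lim (\<lambda>z. h z - h' z) z = cauchy_lim h z - cauchy_lim h' z"
    unfolding cauchy_lim_def[of "\<lambda>z. h z - h' z"] *[OF kern_at_continuous]
    by (intro limI tendsto_diff cauchy_lim_lim(1)[OF assms(1)] cauchy_lim_lim(1)[OF assms(2)])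
  show "dcauchy_lim \<eta> (\<lambda>z. h z - h' z) z = dcauchy_lim \<eta> h z - dcauchy_lim \<eta> h' z"
    unfolding dcauchy_lim_def[of _ "\<lambda>z. h z - h' z"] *[OF dkern_at_continuous]
    by (intro limI tendsto_diff dcauchy_lim_lim(1)[OF assms(1)] dcauchy_lim_lim(1)[OF assms(2)])
qed

lemma kern_at_cnj: "kern_at j (cnj z) = cnj (kern_at j z)"
  by (simp add: kern_at_def kern_def norm_mult)

text \<open>
  The kernels commute with complex conjugation, so a reflection symmetry of the density is
  inherited.
\<close>

lemma cauchy_lim_cnj:
  assumes "hoelder_disc M h" and R: "bounded_linear R" "\<And>v. R (J0 v) = - J0 (R v)" "\<And>z. h (cnj z) = R (h z)"
  shows "cauchy_lim h (cnj z) = R (cauchy_lim h z)"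
proof -
  have "conv (kern_at n) h (cnj z) = R (conv (kern_at n) h z)" for n
  proof -
    have cmul_cnj: "cmul (cnj a) (R v) = R (cmul a v)" for a v
      using R(2) bounded_linear.linear[OF R(1)] by (simp add: cmul_def linear_add linear_scale)
    have "conv (kern_at n) h (cnj z) = integral UNIV (\<lambda>\<zeta>. cmul (kern_at n (cnj z - cnj \<zeta>)) (h (cnj \<zeta>)))"
      unfolding conv_def using integral_cnj[OF compactly_supported_compact_support[OF assms(1) kern_at_continuous]] by metis
    also have "\<dots> = integral UNIV (\<lambda>\<zeta>. R (cmul (kern_at n (z - \<zeta>)) (h \<zeta>)))"
      unfolding R(3) complex_cnj_diff[symmetric] kern_at_cnj cmul_cnj ..
    also have "\<dots> = R (conv (kern_at n) h z)"
      unfolding conv_def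
      using integral_linear[OF compactly_supported_integrable[OF compactly_supported_compact_support[OF assms(1) kern_at_continuous]] R(1)] by (simp add: o_def)
    finally show ?thesis .
  qed
  then have "(\<lambda>n. R (conv (kern_at n) h z)) \<longlonglongrightarrow> cauchy_lim h (cnj z)" using cauchy_lim_lim(1)[OF assms(1), of "cnj z"] by simp
  moreover have "(\<lambda>n. R (conv (kern_at n) h z)) \<longlonglongrightarrow> R (cauchy_lim h z)"
    by (rule bounded_linear.tendsto[OF R(1) cauchy_lim_lim(1)[OF assms(1)]])
  ultimately show ?thesis by (rule LIMSEQ_unique)
qed

text \<open>
  Normalised so as to be a right inverse of \<open>\<partial>\<^sub>x + J0
  \<partial>\<^sub>y\<close> on densities supported in the disc of radius \<open>2\<close>.
\<close>

definition cauchy_tr :: "(complex \<Rightarrow> 'e) \<Rightarrow> complex \<Rightarrow> 'e" where "cauchy_tr h z = cauchy_lim h z /\<^sub>R kern_mass"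
definition dcauchy_tr :: "complex \<Rightarrow> (complex \<Rightarrow> 'e) \<Rightarrow> complex \<Rightarrow> 'e" where "dcauchy_tr \<eta> h z = dcauchy_lim \<eta> h z /\<^sub>R kern_mass"
text \<open>
  One constant for all bounds of the transform: Hoelder bounds of its values and derivatives,
  and, halved, its Lipschitz constant.
\<close>

definition CT :: real where "CT = 2 * (2 * grad_const / kern_mass)"

lemma CT_pos: "CT > 0"
proof -
  have "0 < grad_const" unfolding grad_const_def using \<kappa>(1) half_root by (intro mult_pos_pos add_pos_nonneg) auto
  then show ?thesis using kern_mass_pos by (simp add: CT_def)
qed

lemma cauchy_tr_derivative: "hoelder_disc M h \<Longrightarrow> (cauchy_tr h has_derivative (\<lambda>\<eta>. dcauchy_tr \<eta> h z)) (at z)"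
  unfolding cauchy_tr_def[abs_def] dcauchy_tr_def by (intro has_derivative_scaleR_right cauchy_lim_derivative)

lemma dcauchy_tr_hoelder: assumes "hoelder_disc M h" "norm \<eta> \<le> 1" shows "hoelder UNIV (CT * M) (dcauchy_tr \<eta> h)"
proof -
  have M: "0 \<le> M" by (rule hoelder_discD(5)[OF assms(1)])
  have grad_const: "0 \<le> grad_const" using CT_pos kern_mass_pos by (simp add: CT_def zero_less_divide_iff)
  have "hoelder UNIV ((1 / kern_mass) * (grad_const * norm \<eta> * M)) (dcauchy_tr \<eta> h)"
    unfolding dcauchy_tr_def[abs_def]
    by (rule hoelder_bounded_linear[OF dcauchy_lim_hoelder[OF assms(1)] bounded_linear_scaleR_right]) (use kern_mass_pos in \<open>auto simp: divide_inverse\<close>)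
  moreover have "(1 / kern_mass) * (grad_const * norm \<eta> * M) \<le> CT * M"
  proof -
    have "(1 / kern_mass) * (grad_const * norm \<eta> * M) = (grad_const * M / kern_mass) * norm \<eta>" by simp
    also have "\<dots> \<le> (grad_const * M / kern_mass) * 1" using assms(2) grad_const M kern_mass_pos by (intro mult_left_mono) auto
    also have "\<dots> \<le> CT * M" unfolding CT_def using grad_const M kern_mass_pos by (simp add: divide_simps mult_nonneg_nonneg)
    finally show ?thesis .
  qed
  ultimately show ?thesis by (rule hoelder_mono)
qed

lemma cauchy_tr_lipschitz:
  assumes "hoelder_disc M h" shows "norm (cauchy_tr h z - cauchy_tr h z') \<le> CT / 2 * M * norm (z - z')"
proof (rule differentiable_bound[of UNIV])
  fix z
  show "(cauchy_tr h has_derivative (\<lambda>\<eta>. dcauchy_tr \<eta> h z)) (at z within UNIV)" using cauchy_tr_derivative[OF assms] by simp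
  have M: "0 \<le> M" by (rule hoelder_discD(5)[OF assms])
  have grad_const: "0 \<le> grad_const" using CT_pos kern_mass_pos by (simp add: CT_def zero_less_divide_iff)
  show "onorm (\<lambda>\<eta>. dcauchy_tr \<eta> h z) \<le> CT / 2 * M"
  proof (rule onorm_le)
    fix \<eta>
    have "norm (dcauchy_tr \<eta> h z) \<le> (grad_const * norm \<eta> * M) / kern_mass"
      using hoelderD1[OF dcauchy_lim_hoelder[OF assms], of z \<eta>] kern_mass_pos by (simp add: dcauchy_tr_def divide_inverse mult.commute)
    also have "\<dots> \<le> CT / 2 * M * norm \<eta>" unfolding CT_def using grad_const M kern_mass_pos by (simp add: divide_simps mult_nonneg_nonneg)
    finally show "norm (dcauchy_tr \<eta> h z) \<le> CT / 2 * M * norm \<eta>" .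
  qed
qed auto

lemma cauchy_tr_hoelder: assumes "hoelder_disc M h" shows "hoelder UNIV (CT * M) (cauchy_tr h)"
proof -
  have M: "0 \<le> M" by (rule hoelder_discD(5)[OF assms])
  have grad_const: "0 \<le> grad_const" using CT_pos kern_mass_pos by (simp add: CT_def zero_less_divide_iff)
  have "hoelder UNIV (2 * (CT / 2 * M)) (cauchy_tr h)"
  proof (rule hoelder_of_lipschitz)
    show "norm (cauchy_tr h z - cauchy_tr h z') \<le> CT / 2 * M * norm (z - z')" for z z' by (rule cauchy_tr_lipschitz[OF assms])
    show "norm (cauchy_tr h z) \<le> CT / 2 * M" for z
    proof -
      have "norm (cauchy_tr h z) \<le> grad_const * M / kern_mass"
        using cauchy_lim_lim(2)[OF assms, of z] kern_mass_pos by (simp add: cauchy_tr_def divide_inverse mult.commute)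
      also have "\<dots> \<le> CT / 2 * M" unfolding CT_def using grad_const M kern_mass_pos by (simp add: divide_simps mult_nonneg_nonneg)
      finally show ?thesis .
    qed
  qed
  then show ?thesis by simp
qed

lemma cauchy_tr_dbar: "hoelder_disc M h \<Longrightarrow> dcauchy_tr 1 h z + J0 (dcauchy_tr \<i> h z) = h z"
  using dcauchy_lim_dbar[of M h z] kern_mass_pos by (simp add: dcauchy_tr_def J0_simps flip: scaleR_add_right)

lemma cauchy_tr_diff: "hoelder_disc M h \<Longrightarrow> hoelder_disc M' h' \<Longrightarrow> cauchy_tr (\<lambda>z. h z - h' z) z = cauchy_tr h z - cauchy_tr h' z"
   "hoelder_disc M h \<Longrightarrow> hoelder_disc M' h' \<Longrightarrow> dcauchy_tr \<eta> (\<lambda>z. h z - h' z) z = dcauchy_tr \<eta> h z - dcauchy_tr \<eta> h' z"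
  by (simp_all add: cauchy_tr_def dcauchy_tr_def cauchy_lim_diff scaleR_diff_right)

lemma cauchy_tr_cnj:
  assumes "hoelder_disc M h" and R: "bounded_linear R" "\<And>v. R (J0 v) = - J0 (R v)" "\<And>z. h (cnj z) = R (h z)"
  shows "cauchy_tr h (cnj z) = R (cauchy_tr h z)"
  using cauchy_lim_cnj[OF assms] bounded_linear.linear[OF R(1)] by (simp add: cauchy_tr_def linear_scale)

end

section \<open>Maps with Lipschitz differential\<close>

lemma poly_lipschitz:
  fixes p :: "complex poly"
  obtains C where "C > 0" "\<And>z. norm z \<le> 2 \<Longrightarrow> norm (poly p z) \<le> C"
    "\<And>z z'. norm z \<le> 2 \<Longrightarrow> norm z' \<le> 2 \<Longrightarrow> norm (poly p z - poly p z') \<le> C * norm (z - z')"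
proof -
  have bd: "\<exists>B>0. \<forall>z\<in>cball 0 2. norm (poly q z) \<le> B" for q :: "complex poly"
  proof -
    have "compact ((\<lambda>z. poly q z) ` cball 0 2)" by (intro compact_continuous_image continuous_intros compact_cball)
    then have "bounded ((\<lambda>z. poly q z) ` cball 0 2)" by (rule compact_imp_bounded)
    then show ?thesis unfolding bounded_pos by auto
  qed
  obtain B1 where B1: "B1 > 0" "\<And>z. z \<in> cball 0 2 \<Longrightarrow> norm (poly p z) \<le> B1" using bd by blast
  obtain B2 where B2: "B2 > 0" "\<And>z. z \<in> cball 0 2 \<Longrightarrow> norm (poly (pderiv p) z) \<le> B2" using bd by blast
  have L: "norm (poly p z - poly p z') \<le> B2 * norm (z - z')" if "norm z \<le> 2" "norm z' \<le> 2" for z z'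
    by (rule field_differentiable_bound[where S = "cball 0 2" and f' = "\<lambda>z. poly (pderiv p) z"])
      (use that B2 in \<open>auto intro: DERIV_subset[OF poly_DERIV]\<close>)
  show thesis
  proof (rule that[of "max B1 B2"])
    show "0 < max B1 B2" using B1 by simp
    show "norm (poly p z) \<le> max B1 B2" if "norm z \<le> 2" for z using B1(2)[of z] that by (simp add: le_max_iff_disj)
    show "norm (poly p z - poly p z') \<le> max B1 B2 * norm (z - z')" if "norm z \<le> 2" "norm z' \<le> 2" for z z'
      using L[OF that] mult_right_mono[of B2 "max B1 B2" "norm (z - z')"] by simp
  qed
qed

definition real_poly :: "complex poly \<Rightarrow> bool" where "real_poly p \<longleftrightarrow> (\<forall>n. coeff p n \<in> \<real>)"

lemma real_poly_pCons: "real_poly (pCons a p) \<longleftrightarrow> a \<in> \<real> \<and> real_poly p"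
  unfolding real_poly_def by (auto simp: coeff_pCons split: nat.splits)

lemma real_poly_0: "real_poly 0" by (simp add: real_poly_def)

definition half_disc :: "complex set" where "half_disc = {z. 0 \<le> Im z \<and> norm z \<le> 2}"

text \<open>
  A quantitative form of having a Lipschitz differential. The second condition compares the
  increments along two opposite sides of an approximate parallelogram; in this form it can be
  applied to values of other maps, and it is stable under products and compositions.
\<close>

definition C11 :: "'a set \<Rightarrow> real \<Rightarrow> ('a::real_normed_vector \<Rightarrow> 'b::real_normed_vector) \<Rightarrow> bool" where
  "C11 X L F \<longleftrightarrow> 0 \<le> L \<and> (\<forall>a\<in>X. \<forall>b\<in>X. norm (F a - F b) \<le> L * norm (a - b)) \<and>
    (\<forall>a\<in>X. \<forall>b\<in>X. \<forall>c\<in>X. \<forall>d\<in>X. \<forall>p q r. norm (a - b) \<le> p \<and> norm (c - d) \<le> p \<and> norm (a - c) \<le> q \<and> norm (b - d) \<le> q \<and>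
      norm ((a - b) - (c - d)) \<le> r \<longrightarrow> norm ((F a - F b) - (F c - F d)) \<le> L * (r + p * q))"

lemma C11D1: "C11 X L F \<Longrightarrow> a \<in> X \<Longrightarrow> b \<in> X \<Longrightarrow> norm (F a - F b) \<le> L * norm (a - b)"
  by (auto simp: C11_def)

lemma C11D2: "C11 X L F \<Longrightarrow> a \<in> X \<Longrightarrow> b \<in> X \<Longrightarrow> c \<in> X \<Longrightarrow> d \<in> X \<Longrightarrow> norm (a - b) \<le> p \<Longrightarrow> norm (c - d) \<le> p \<Longrightarrow>
   norm (a - c) \<le> q \<Longrightarrow> norm (b - d) \<le> q \<Longrightarrow> norm ((a - b) - (c - d)) \<le> r \<Longrightarrow> norm ((F a - F b) - (F c - F d)) \<le> L * (r + p * q)"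
  unfolding C11_def by blast

lemma C11D0: "C11 X L F \<Longrightarrow> 0 \<le> L" by (simp add: C11_def)

lemma sqrt_le_on_half_disc: "z \<in> half_disc \<Longrightarrow> z' \<in> half_disc \<Longrightarrow> norm (z - z') \<le> 2 * sqrt (norm (z - z'))"
proof -
  assume "z \<in> half_disc" "z' \<in> half_disc"
  then have "norm (z - z') \<le> 4" using norm_triangle_ineq4[of z z'] by (simp add: half_disc_def)
  then have "sqrt (norm (z - z')) \<le> 2" using real_sqrt_le_mono[of "norm (z - z')" 4] by simp
  then have "sqrt (norm (z - z')) * sqrt (norm (z - z')) \<le> 2 * sqrt (norm (z - z'))" by (intro mult_right_mono) auto
  then show ?thesis by simp
qed

lemma hoelder_C11_compose:
  assumes "C11 X L F" "hoelder P w W" "\<And>z. z \<in> P \<Longrightarrow> W z \<in> X" "0 \<in> X" "F 0 = 0"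
  shows "hoelder P (L * w) (\<lambda>z. F (W z))"
proof (rule hoelderI)
  fix z assume z: "z \<in> P"
  have "norm (F (W z)) \<le> L * norm (W z)" using C11D1[OF assms(1) assms(3)[OF z] assms(4)] assms(5) by simp
  also have "\<dots> \<le> L * w" by (intro mult_left_mono hoelderD1[OF assms(2) z] C11D0[OF assms(1)])
  finally show "norm (F (W z)) \<le> L * w" .
next
  fix z z' assume *: "z \<in> P" "z' \<in> P"
  have "norm (F (W z) - F (W z')) \<le> L * norm (W z - W z')" using C11D1[OF assms(1) assms(3) assms(3)] * by simp
  also have "\<dots> \<le> L * (w * sqrt (norm (z - z')))" by (intro mult_left_mono hoelderD2[OF assms(2)] * C11D0[OF assms(1)])
  finally show "norm (F (W z) - F (W z')) \<le> L * w * sqrt (norm (z - z'))" by simp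
qed

text \<open>
  The parallelogram has the vertices \<open>W1 z\<close>, \<open>W2 z\<close>, \<open>W1
  z'\<close>, \<open>W2 z'\<close>: two sides are small because \<open>W1\<close> and
  \<open>W2\<close> are close, the others because both maps are Lipschitz.
\<close>

lemma hoelder_C11_compose_diff:
  assumes "C11 X L F" "hoelder half_disc m (\<lambda>z. W1 z - W2 z)"
    "\<And>z. z \<in> half_disc \<Longrightarrow> W1 z \<in> X" "\<And>z. z \<in> half_disc \<Longrightarrow> W2 z \<in> X"
    "\<And>z z'. z \<in> half_disc \<Longrightarrow> z' \<in> half_disc \<Longrightarrow> norm (W1 z - W1 z') \<le> w * norm (z - z')"
    "\<And>z z'. z \<in> half_disc \<Longrightarrow> z' \<in> half_disc \<Longrightarrow> norm (W2 z - W2 z') \<le> w * norm (z - z')"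
    "0 \<le> w"
  shows "hoelder half_disc (L * m * (1 + 2 * w)) (\<lambda>z. F (W1 z) - F (W2 z))"
proof (rule hoelderI)
  note L = C11D0[OF assms(1)]
  fix z assume z: "z \<in> half_disc"
  have m: "0 \<le> m" by (rule hoelder_nonneg[OF assms(2) z])
  have "norm (F (W1 z) - F (W2 z)) \<le> L * norm (W1 z - W2 z)" using C11D1[OF assms(1) assms(3)[OF z] assms(4)[OF z]] .
  also have "\<dots> \<le> L * m" by (intro mult_left_mono hoelderD1[OF assms(2) z] L)
  also have "\<dots> \<le> L * m * (1 + 2 * w)" using m L assms(7) by (simp add: mult_le_cancel_left1 mult_nonneg_nonneg distrib_left)
  finally show "norm (F (W1 z) - F (W2 z)) \<le> L * m * (1 + 2 * w)" .
next
  note L = C11D0[OF assms(1)]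
  fix z z' assume *: "z \<in> half_disc" "z' \<in> half_disc"
  have m: "0 \<le> m" by (rule hoelder_nonneg[OF assms(2) *(1)])
  let ?s = "sqrt (norm (z - z'))"
  have "norm ((F (W1 z) - F (W2 z)) - (F (W1 z') - F (W2 z'))) \<le> L * (m * ?s + m * (w * norm (z - z')))"
    by (rule C11D2[OF assms(1)]) (use assms * hoelderD1[OF assms(2)] hoelderD2[OF assms(2) *] in auto)
  also have "\<dots> \<le> L * (m * ?s + m * (w * (2 * ?s)))"
    using sqrt_le_on_half_disc[OF *] m L assms(7) by (intro mult_left_mono add_left_mono) auto
  finally show "norm ((F (W1 z) - F (W2 z)) - (F (W1 z') - F (W2 z'))) \<le> L * m * (1 + 2 * w) * ?s"
    by (simp add: algebra_simps)
qed

section \<open>Conjugations and interpolating discs\<close>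

text \<open>
  The map \<open>R\<close> is a conjugation for the complex structure \<open>J0\<close>; its
  fixed vectors form a totally real subspace of half dimension, the linear model of a totally
  real submanifold. The values of discs will be prescribed at \<open>\<i> * t0\<close> and
  \<open>\<i> * t1\<close>.
\<close>

locale real_form = complex_space J0 for J0 :: "'e::euclidean_space \<Rightarrow> 'e" +
  fixes R :: "'e \<Rightarrow> 'e" and t0 t1 :: real
  assumes R_linear: "linear R" and RR: "R (R v) = v" and R_J0: "R (J0 v) = - J0 (R v)"
    and t01: "0 < t0" "t0 < t1" "t1 < 1"
begin

lemma R_bl: "bounded_linear R" using R_linear linear_conv_bounded_linear by blast

lemmas R_simps = linear_add[OF R_linear] linear_diff[OF R_linear] linear_scale[OF R_linear]
  linear_0[OF R_linear] linear_neg[OF R_linear]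

definition \<sigma> :: "'e \<Rightarrow> 'e" where "\<sigma> w = (1/2) *\<^sub>R (w + R w)"
definition \<tau> :: "'e \<Rightarrow> 'e" where "\<tau> w = - ((1/2) *\<^sub>R J0 (w - R w))"

lemma split: "\<sigma> w + J0 (\<tau> w) = w"
  by (simp add: \<sigma>_def \<tau>_def J0_simps J0_J0 algebra_simps flip: scaleR_2)

lemma R_\<sigma>: "R (\<sigma> w) = \<sigma> w" by (simp add: \<sigma>_def R_simps RR add.commute)
lemma R_\<tau>: "R (\<tau> w) = \<tau> w" by (simp add: \<tau>_def R_simps RR R_J0 J0_simps algebra_simps)

lemma \<sigma>_linear: "linear \<sigma>" unfolding \<sigma>_def by (rule linearI) (simp_all add: R_simps algebra_simps)
lemma \<tau>_linear: "linear \<tau>" unfolding \<tau>_def by (rule linearI) (simp_all add: R_simps J0_simps algebra_simps)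
lemma \<sigma>_bl: "bounded_linear \<sigma>" using \<sigma>_linear linear_conv_bounded_linear by blast
lemma \<tau>_bl: "bounded_linear \<tau>" using \<tau>_linear linear_conv_bounded_linear by blast

lemma \<sigma>_fix: "R v = v \<Longrightarrow> \<sigma> v = v" by (simp add: \<sigma>_def flip: scaleR_2)
lemma \<tau>_fix: "R v = v \<Longrightarrow> \<tau> v = 0" by (simp add: \<tau>_def J0_simps)

lemma cmul_cnj: "cmul (cnj a) (R v) = R (cmul a v)"
  using R_J0 by (simp add: cmul_def R_simps)

definition "DD = t1^2 - t0^2"
lemma DD: "DD > 0" using t01 by (simp add: DD_def power_strict_mono)

text \<open>
  At \<open>\<i> * t0\<close> the polynomials \<open>pe0\<close>, \<open>po0\<close> take the
  values \<open>1\<close>, \<open>\<i>\<close>, and at \<open>\<i> * t1\<close> they vanish;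
  for \<open>pe1\<close>, \<open>po1\<close> the two points change roles. The polynomial
  \<open>pP = (z\<^sup>2 + t0\<^sup>2) * (z\<^sup>2 + t1\<^sup>2)\<close> vanishes at both
  points and is positive on the real axis. All coefficients are real, so that fixed vectors of
  \<open>R\<close> stay fixed on the axis.
\<close>

definition pe0 :: "complex poly" where "pe0 = [:of_real (t1^2/DD), 0, of_real (1/DD):]"
definition po0 :: "complex poly" where "po0 = [:0, of_real (t1^2/(DD*t0)), 0, of_real (1/(DD*t0)):]"
definition pe1 :: "complex poly" where "pe1 = [:of_real (-(t0^2)/DD), 0, of_real (-1/DD):]"
definition po1 :: "complex poly" where "po1 = [:0, of_real (-(t0^2)/(DD*t1)), 0, of_real (-1/(DD*t1)):]"
definition pP :: "complex poly" where "pP = [:of_real (t0^2*t1^2), 0, of_real (t0^2+t1^2), 0, 1:]"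

lemma real_polys: "real_poly pe0" "real_poly po0" "real_poly pe1" "real_poly po1" "real_poly pP"
  unfolding pe0_def po0_def pe1_def po1_def pP_def real_poly_pCons by (auto simp: real_poly_0 simp del: of_real_divide of_real_mult)

text \<open>
  A holomorphic disc with values \<open>fst \<theta>\<close> and \<open>fst (snd
  \<theta>)\<close> at the two interior points; the last component of the parameter moves the
  disc on the real axis without changing these values.
\<close>

definition \<phi> :: "'e \<times> 'e \<times> 'e \<Rightarrow> complex \<Rightarrow> 'e" where
  "\<phi> \<theta> z = cmul (poly pe0 z) (\<sigma> (fst \<theta>)) + cmul (poly po0 z) (\<tau> (fst \<theta>)) +
     cmul (poly pe1 z) (\<sigma> (fst (snd \<theta>))) + cmul (poly po1 z) (\<tau> (fst (snd \<theta>))) + cmul (poly pP z) (\<sigma> (snd (snd \<theta>)))"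

definition \<phi>d :: "complex \<Rightarrow> 'e \<times> 'e \<times> 'e \<Rightarrow> complex \<Rightarrow> 'e" where
  "\<phi>d \<eta> \<theta> z = cmul (poly (pderiv pe0) z * \<eta>) (\<sigma> (fst \<theta>)) + cmul (poly (pderiv po0) z * \<eta>) (\<tau> (fst \<theta>)) +
     cmul (poly (pderiv pe1) z * \<eta>) (\<sigma> (fst (snd \<theta>))) + cmul (poly (pderiv po1) z * \<eta>) (\<tau> (fst (snd \<theta>))) +
     cmul (poly (pderiv pP) z * \<eta>) (\<sigma> (snd (snd \<theta>)))"

lemma i_i: "\<i> * a * (\<i> * b) = - (a * b)"
proof -
  have "\<i> * a * (\<i> * b) = (\<i> * \<i>) * (a * b)" by (simp only: ac_simps)
  then show ?thesis by simp
qed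

lemma \<phi>_it0: "\<phi> (q, q', c) (\<i> * of_real t0) = q"
proof -
  have 1: "poly pe0 (\<i> * of_real t0) = 1"
    unfolding pe0_def using DD by (simp add: power2_eq_square divide_simps) (simp add: DD_def power2_eq_square algebra_simps)
  have "poly po0 (\<i> * of_real t0) = (\<i> * of_real t0) / of_real t0 * poly pe0 (\<i> * of_real t0)"
    unfolding pe0_def po0_def using t01 by (simp add: algebra_simps power2_eq_square)
  then have 2: "poly po0 (\<i> * of_real t0) = \<i>" using 1 t01 by simp
  have 3: "poly pe1 (\<i> * of_real t0) = 0" "poly po1 (\<i> * of_real t0) = 0"
    unfolding pe1_def po1_def by (simp_all add: power2_eq_square i_i)
  have 4: "poly pP (\<i> * of_real t0) = 0" unfolding pP_def by (simp add: power2_eq_square algebra_simps)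
  show ?thesis by (simp add: \<phi>_def 1 2 3 4 cmul_simps cmul.zero_left split)
qed

lemma \<phi>_it1: "\<phi> (q, q', c) (\<i> * of_real t1) = q'"
proof -
  have 1: "poly pe1 (\<i> * of_real t1) = 1"
    unfolding pe1_def using DD by (simp add: power2_eq_square divide_simps) (simp add: DD_def power2_eq_square algebra_simps)
  have "poly po1 (\<i> * of_real t1) = (\<i> * of_real t1) / of_real t1 * poly pe1 (\<i> * of_real t1)"
    unfolding pe1_def po1_def using t01 by (simp add: algebra_simps power2_eq_square)
  then have 2: "poly po1 (\<i> * of_real t1) = \<i>" using 1 t01 by simp
  have 3: "poly pe0 (\<i> * of_real t1) = 0" "poly po0 (\<i> * of_real t1) = 0"
    unfolding pe0_def po0_def by (simp_all add: power2_eq_square i_i)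
  have 4: "poly pP (\<i> * of_real t1) = 0" unfolding pP_def by (simp add: power2_eq_square algebra_simps)
  show ?thesis by (simp add: \<phi>_def 1 2 3 4 cmul_simps cmul.zero_left split)
qed

lemma \<phi>_diff: "\<phi> (\<theta> - \<theta>') z = \<phi> \<theta> z - \<phi> \<theta>' z" "\<phi>d \<eta> (\<theta> - \<theta>') z = \<phi>d \<eta> \<theta> z - \<phi>d \<eta> \<theta>' z"
  by (simp_all add: \<phi>_def \<phi>d_def linear_diff[OF \<sigma>_linear] linear_diff[OF \<tau>_linear] cmul.diff_right)

lemma \<phi>_cnj: "\<phi> \<theta> (cnj z) = R (\<phi> \<theta> z)"
proof -
  have *: "cmul (poly p (cnj z)) v = R (cmul (poly p z) v)" if "real_poly p" "R v = v" for p v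
    using poly_cnj_real[of p z] that cmul_cnj[of "poly p z" v] by (simp add: real_poly_def)
  show ?thesis by (simp add: \<phi>_def R_simps * real_polys R_\<sigma> R_\<tau>)
qed

lemma \<phi>_real: "\<phi> (q, q', c) (of_real x) - \<phi> (q, q', c') (of_real x) = ((x^2 + t0^2) * (x^2 + t1^2)) *\<^sub>R (\<sigma> c - \<sigma> c')"
proof -
  have "poly pP (of_real x) = of_real ((x^2 + t0^2) * (x^2 + t1^2))"
    unfolding pP_def by (simp add: power2_eq_square algebra_simps)
  then show ?thesis by (simp only: \<phi>_def cmul_simps fst_conv snd_conv) (simp add: algebra_simps)
qed

lemma \<phi>_derivative: "(\<phi> \<theta> has_derivative (\<lambda>\<eta>. \<phi>d \<eta> \<theta> z)) (at z)"
proof -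
  have *: "((\<lambda>z. cmul (poly p z) v) has_derivative (\<lambda>\<eta>. cmul (poly (pderiv p) z * \<eta>) v)) (at z)" for p v
    using bounded_linear.has_derivative[OF cmul.bounded_linear_left[of v] poly_DERIV[of p z, unfolded has_field_derivative_def]] .
  show ?thesis unfolding \<phi>_def[abs_def] \<phi>d_def by (intro has_derivative_add *)
qed

lemma \<phi>d_dbar: "\<phi>d 1 \<theta> z + J0 (\<phi>d \<i> \<theta> z) = 0"
proof -
  have *: "J0 (cmul (a * \<i>) v) = - cmul (a * 1) v" for a v
  proof -
    have "\<i> * (a * \<i>) = a * (\<i> * \<i>)" by (simp only: ac_simps)
    then show ?thesis by (simp add: cmul_simps cmul.minus_left)
  qed
  show ?thesis unfolding \<phi>d_def by (simp only: linear_add[OF J0_linear] *) simp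
qed

end

section \<open>The Cauchy transform with prescribed values, and reflection\<close>

definition lip_bounded :: "real \<Rightarrow> (complex \<Rightarrow> 'b::real_normed_vector) \<Rightarrow> bool" where
  "lip_bounded C f \<longleftrightarrow> (\<forall>z\<in>cball 0 2. norm (f z) \<le> C) \<and> (\<forall>z\<in>cball 0 2. \<forall>z'\<in>cball 0 2. norm (f z - f z') \<le> C * norm (z - z'))"

lemma lip_bounded_add:
  assumes "lip_bounded C f" "lip_bounded D g" shows "lip_bounded (C + D) (\<lambda>z. f z + g z)"
  unfolding lip_bounded_def
proof (intro conjI ballI)
  fix z :: complex assume z: "z \<in> cball 0 2"
  then have "norm (f z) \<le> C" "norm (g z) \<le> D" using assms unfolding lip_bounded_def by blast+
  then show "norm (f z + g z) \<le> C + D" by (rule norm_triangle_mono)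
  fix z' :: complex assume z': "z' \<in> cball 0 2"
  have "norm (f z - f z') \<le> C * norm (z - z')" "norm (g z - g z') \<le> D * norm (z - z')"
    using assms z z' unfolding lip_bounded_def by blast+
  then have "norm ((f z - f z') + (g z - g z')) \<le> C * norm (z - z') + D * norm (z - z')" by (rule norm_triangle_mono)
  then show "norm ((f z + g z) - (f z' + g z')) \<le> (C + D) * norm (z - z')" by (simp add: algebra_simps)
qed

lemma lip_bounded_add_ex:
  fixes f g :: "'x::real_normed_vector \<Rightarrow> complex \<Rightarrow> 'b::real_normed_vector"
  assumes "\<exists>C\<ge>0. \<forall>\<theta>. lip_bounded (C * norm \<theta>) (f \<theta>)" "\<exists>C\<ge>0. \<forall>\<theta>. lip_bounded (C * norm \<theta>) (g \<theta>)"
  shows "\<exists>C\<ge>0. \<forall>\<theta>. lip_bounded (C * norm \<theta>) (\<lambda>z. f \<theta> z + g \<theta> z)"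
proof -
  obtain C D where "0 \<le> C" "\<And>\<theta>. lip_bounded (C * norm \<theta>) (f \<theta>)" "0 \<le> D" "\<And>\<theta>. lip_bounded (D * norm \<theta>) (g \<theta>)" using assms by auto
  then have "lip_bounded ((C + D) * norm \<theta>) (\<lambda>z. f \<theta> z + g \<theta> z)" for \<theta>
    using lip_bounded_add[of "C * norm \<theta>" "f \<theta>" "D * norm \<theta>" "g \<theta>"] by (simp add: algebra_simps)
  then show ?thesis using \<open>0 \<le> C\<close> \<open>0 \<le> D\<close> by (intro exI[of _ "C + D"]) auto
qed

context real_form
begin

lemma lip_bounded_term:
  assumes "bounded_linear a"
  shows "\<exists>C\<ge>0. \<forall>\<theta>. lip_bounded (C * norm \<theta>) (\<lambda>z. cmul (poly p z) (a \<theta>))"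
proof -
  obtain C where C: "C > 0" "\<And>z. norm z \<le> 2 \<Longrightarrow> norm (poly p z) \<le> C"
    "\<And>z z'. norm z \<le> 2 \<Longrightarrow> norm z' \<le> 2 \<Longrightarrow> norm (poly p z - poly p z') \<le> C * norm (z - z')"
    using poly_lipschitz[of p] by blast
  obtain K where K: "K > 0" "\<And>\<theta>. norm (a \<theta>) \<le> norm \<theta> * K" using bounded_linear.pos_bounded[OF assms] by blast
  have b: "norm (cmul x (a \<theta>)) \<le> \<kappa> * C * K * norm \<theta> * d" if "norm x \<le> C * d" "0 \<le> d" for x \<theta> d
  proof -
    have "norm (cmul x (a \<theta>)) \<le> \<kappa> * (C * d) * (norm \<theta> * K)"
      by (rule order_trans[OF \<kappa>(2)], intro mult_mono K that) (use \<kappa>(1) C that in auto)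
    then show ?thesis by (simp add: ac_simps)
  qed
  have "lip_bounded (\<kappa> * C * K * norm \<theta>) (\<lambda>z. cmul (poly p z) (a \<theta>))" for \<theta>
    unfolding lip_bounded_def cmul.diff_left[symmetric] using b[of _ 1] b C(2,3) by auto
  then show ?thesis using \<kappa>(1) C(1) K(1) by (intro exI[of _ "\<kappa> * C * K"]) auto
qed

lemma \<phi>_lip_bounded: "\<exists>C\<ge>0. \<forall>\<theta>. lip_bounded (C * norm \<theta>) (\<phi> \<theta>)" "\<exists>C\<ge>0. \<forall>\<theta>. lip_bounded (C * norm \<theta>) (\<phi>d \<i> \<theta>)"
proof -
  have c: "bounded_linear (\<lambda>\<theta>::'e\<times>'e\<times>'e. \<sigma> (fst \<theta>))" "bounded_linear (\<lambda>\<theta>::'e\<times>'e\<times>'e. \<tau> (fst \<theta>))"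
    "bounded_linear (\<lambda>\<theta>::'e\<times>'e\<times>'e. \<sigma> (fst (snd \<theta>)))" "bounded_linear (\<lambda>\<theta>::'e\<times>'e\<times>'e. \<tau> (fst (snd \<theta>)))"
    "bounded_linear (\<lambda>\<theta>::'e\<times>'e\<times>'e. \<sigma> (snd (snd \<theta>)))"
    by (intro bounded_linear_compose[OF \<sigma>_bl] bounded_linear_compose[OF \<tau>_bl] bounded_linear_fst bounded_linear_snd
      bounded_linear_compose[OF bounded_linear_fst bounded_linear_snd] bounded_linear_compose[OF bounded_linear_snd bounded_linear_snd])+
  show "\<exists>C\<ge>0. \<forall>\<theta>. lip_bounded (C * norm \<theta>) (\<phi> \<theta>)"
    unfolding \<phi>_def[abs_def] by (intro lip_bounded_add_ex lip_bounded_term c)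
  have *: "poly (pderiv p) z * \<i> = poly (smult \<i> (pderiv p)) z" for p z by simp
  show "\<exists>C\<ge>0. \<forall>\<theta>. lip_bounded (C * norm \<theta>) (\<phi>d \<i> \<theta>)"
    unfolding \<phi>d_def[abs_def] * by (intro lip_bounded_add_ex lip_bounded_term c)
qed

definition node_values :: "(complex \<Rightarrow> 'e) \<Rightarrow> 'e \<times> 'e \<times> 'e" where
  "node_values h = (cauchy_tr h (\<i> * of_real t0), cauchy_tr h (\<i> * of_real t1), 0)"

text \<open>
  The Cauchy transform is corrected by an interpolating disc, so that the values at the two
  interior points depend on \<open>\<theta>\<close> alone, whatever the density is.
\<close>

definition W :: "'e \<times> 'e \<times> 'e \<Rightarrow> (complex \<Rightarrow> 'e) \<Rightarrow> complex \<Rightarrow> 'e" where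
  "W \<theta> h z = cauchy_tr h z + \<phi> (\<theta> - node_values h) z"

definition WD :: "complex \<Rightarrow> 'e \<times> 'e \<times> 'e \<Rightarrow> (complex \<Rightarrow> 'e) \<Rightarrow> complex \<Rightarrow> 'e" where
  "WD \<eta> \<theta> h z = dcauchy_tr \<eta> h z + \<phi>d \<eta> (\<theta> - node_values h) z"

lemma node_values_norm: assumes "hoelder_disc M h" shows "norm (node_values h) \<le> 2 * CT * M"
proof -
  have "norm (node_values h) \<le> norm (cauchy_tr h (\<i> * of_real t0)) + (norm (cauchy_tr h (\<i> * of_real t1)) + norm (0::'e))"
    unfolding node_values_def by (rule order_trans[OF norm_Pair_le add_left_mono[OF norm_Pair_le]])
  also have "\<dots> \<le> CT * M + (CT * M + 0)"
    by (intro add_mono hoelderD1[OF cauchy_tr_hoelder[OF assms]]) auto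
  finally show ?thesis by (simp add: ac_simps)
qed

lemma lip_bounded_hoelder: "lip_bounded C f \<Longrightarrow> hoelder half_disc (2 * C) f"
  by (rule hoelder_of_lipschitz) (auto simp: lip_bounded_def half_disc_def)

definition Wbound :: "real \<Rightarrow> bool" where
  "Wbound C0 \<longleftrightarrow> C0 > 0 \<and> (\<forall>M \<epsilon> \<theta> h. hoelder_disc M h \<and> norm \<theta> \<le> \<epsilon> \<longrightarrow>
     hoelder half_disc (C0 * (M + \<epsilon>)) (W \<theta> h) \<and> hoelder half_disc (C0 * (M + \<epsilon>)) (WD \<i> \<theta> h) \<and>
     (\<forall>z\<in>half_disc. \<forall>z'\<in>half_disc. norm (W \<theta> h z - W \<theta> h z') \<le> C0 * (M + \<epsilon>) * norm (z - z')))"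

lemma Wbound_ex: "\<exists>C0. Wbound C0"
proof -
  obtain C D where C: "C \<ge> 0" "\<And>\<theta>. lip_bounded (C * norm \<theta>) (\<phi> \<theta>)" and D: "D \<ge> 0" "\<And>\<theta>. lip_bounded (D * norm \<theta>) (\<phi>d \<i> \<theta>)"
    using \<phi>_lip_bounded by blast
  define C0 where "C0 = CT + 2 * (C + D) * (1 + 2 * CT)"
  have "hoelder half_disc (C0 * (M + \<epsilon>)) (W \<theta> h) \<and> hoelder half_disc (C0 * (M + \<epsilon>)) (WD \<i> \<theta> h) \<and>
     (\<forall>z\<in>half_disc. \<forall>z'\<in>half_disc. norm (W \<theta> h z - W \<theta> h z') \<le> C0 * (M + \<epsilon>) * norm (z - z'))"
    if a: "hoelder_disc M h" and \<theta>: "norm \<theta> \<le> \<epsilon>" for M \<epsilon> \<theta> h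
  proof -
    have M: "0 \<le> M" by (rule hoelder_discD(5)[OF a])
    have e: "0 \<le> \<epsilon>" using \<theta> norm_ge_zero order_trans by blast
    let ?N = "norm (\<theta> - node_values h)"
    have N: "?N \<le> (1 + 2 * CT) * (M + \<epsilon>)"
    proof -
      have "?N \<le> \<epsilon> + 2 * CT * M" using norm_triangle_ineq4[of \<theta> "node_values h"] \<theta> node_values_norm[OF a] by linarith
      also have "\<dots> \<le> (1 + 2 * CT) * (M + \<epsilon>)" using M e CT_pos by (simp add: algebra_simps)
      finally show ?thesis .
    qed
    have 1: "CT * M + 2 * (C * ?N) \<le> C0 * (M + \<epsilon>)" "CT * M + 2 * (D * ?N) \<le> C0 * (M + \<epsilon>)"
      "CT / 2 * M + C * ?N \<le> C0 * (M + \<epsilon>)"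
    proof -
      have cm: "CT * M \<le> CT * (M + \<epsilon>)" using e CT_pos by simp
      have cn: "(C + D) * ?N \<le> (C + D) * ((1 + 2 * CT) * (M + \<epsilon>))" using N C(1) D(1) by (intro mult_left_mono) auto
      have nn: "0 \<le> C * ?N" "0 \<le> D * ?N" "0 \<le> CT * M" using C(1) D(1) M CT_pos by auto
      have eq: "C0 * (M + \<epsilon>) = CT * (M + \<epsilon>) + 2 * ((C + D) * ((1 + 2 * CT) * (M + \<epsilon>)))" by (simp add: C0_def algebra_simps)
      have sp: "(C + D) * ?N = C * ?N + D * ?N" by (simp add: algebra_simps)
      show "CT * M + 2 * (C * ?N) \<le> C0 * (M + \<epsilon>)" using cm cn nn unfolding eq sp by linarith
      show "CT * M + 2 * (D * ?N) \<le> C0 * (M + \<epsilon>)" using cm cn nn unfolding eq sp by linarith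
      have "CT / 2 * M \<le> CT * M" using M CT_pos by simp
      then show "CT / 2 * M + C * ?N \<le> C0 * (M + \<epsilon>)" using cm cn nn unfolding eq sp by linarith
    qed
    have "hoelder half_disc (CT * M + 2 * (C * ?N)) (W \<theta> h)"
      unfolding W_def[abs_def] by (intro hoelder_add lip_bounded_hoelder C hoelder_subset[OF cauchy_tr_hoelder[OF a]]) auto
    moreover have "hoelder half_disc (CT * M + 2 * (D * ?N)) (WD \<i> \<theta> h)"
      unfolding WD_def[abs_def] by (intro hoelder_add lip_bounded_hoelder D hoelder_subset[OF dcauchy_tr_hoelder[OF a]]) auto
    moreover have "norm (W \<theta> h z - W \<theta> h z') \<le> C0 * (M + \<epsilon>) * norm (z - z')" if "z \<in> half_disc" "z' \<in> half_disc" for z z'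
    proof -
      have "W \<theta> h z - W \<theta> h z' = (cauchy_tr h z - cauchy_tr h z') + (\<phi> (\<theta> - node_values h) z - \<phi> (\<theta> - node_values h) z')" by (simp add: W_def)
      also have "norm \<dots> \<le> CT / 2 * M * norm (z - z') + C * ?N * norm (z - z')"
        by (rule norm_triangle_mono[OF cauchy_tr_lipschitz[OF a]]) (use C(2)[of "\<theta> - node_values h"] that in \<open>auto simp: lip_bounded_def half_disc_def\<close>)
      also have "\<dots> = (CT / 2 * M + C * ?N) * norm (z - z')" by (simp add: algebra_simps)
      also have "\<dots> \<le> C0 * (M + \<epsilon>) * norm (z - z')" by (intro mult_right_mono 1) auto
      finally show ?thesis .
    qed
    ultimately show ?thesis using 1 hoelder_mono by blast
  qed
  moreover have "C0 > 0" using CT_pos C(1) D(1) by (simp add: C0_def add_pos_nonneg)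
  ultimately show ?thesis unfolding Wbound_def by blast
qed

lemma node_values_diff: "hoelder_disc M h \<Longrightarrow> hoelder_disc M' h' \<Longrightarrow> node_values (\<lambda>z. h z - h' z) = node_values h - node_values h'"
  by (simp add: node_values_def cauchy_tr_diff)

lemma W_diff:
  assumes "hoelder_disc M h" "hoelder_disc M' h'"
  shows "W \<theta> h z - W \<theta>' h' z = W (\<theta> - \<theta>') (\<lambda>z. h z - h' z) z"
    "WD \<eta> \<theta> h z - WD \<eta> \<theta>' h' z = WD \<eta> (\<theta> - \<theta>') (\<lambda>z. h z - h' z) z"
proof -
  have e: "(\<theta> - \<theta>') - node_values (\<lambda>z. h z - h' z) = (\<theta> - node_values h) - (\<theta>' - node_values h')" by (simp add: node_values_diff[OF assms])
  show "W \<theta> h z - W \<theta>' h' z = W (\<theta> - \<theta>') (\<lambda>z. h z - h' z) z"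
    "WD \<eta> \<theta> h z - WD \<eta> \<theta>' h' z = WD \<eta> (\<theta> - \<theta>') (\<lambda>z. h z - h' z) z"
    unfolding W_def WD_def e \<phi>_diff cauchy_tr_diff[OF assms] by simp_all
qed

lemma W_at: "W (q, q', c) h (\<i> * of_real t0) = q" "W (q, q', c) h (\<i> * of_real t1) = q'"
  by (simp_all add: W_def node_values_def \<phi>_it0 \<phi>_it1)

lemma W_derivative: "hoelder_disc M h \<Longrightarrow> (W \<theta> h has_derivative (\<lambda>\<eta>. WD \<eta> \<theta> h z)) (at z)"
  unfolding W_def[abs_def] WD_def by (intro has_derivative_add cauchy_tr_derivative \<phi>_derivative)

lemma W_dbar: "hoelder_disc M h \<Longrightarrow> WD 1 \<theta> h z + J0 (WD \<i> \<theta> h z) = h z"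
proof -
  assume a: "hoelder_disc M h"
  have 1: "J0 (dcauchy_tr \<i> h z) = h z - dcauchy_tr 1 h z" using cauchy_tr_dbar[OF a, of z] by (simp add: eq_diff_eq add.commute)
  have 2: "J0 (\<phi>d \<i> (\<theta> - node_values h) z) = - \<phi>d 1 (\<theta> - node_values h) z"
    using \<phi>d_dbar[of "\<theta> - node_values h" z] by (simp add: eq_neg_iff_add_eq_0 add.commute)
  show ?thesis by (simp add: WD_def linear_add[OF J0_linear] 1 2)
qed

text \<open>
  The reflection symmetry is the reason why \<open>W\<close> maps the real axis to fixed
  vectors of \<open>R\<close>.
\<close>

definition symmetric_density :: "real \<Rightarrow> (complex \<Rightarrow> 'e) \<Rightarrow> bool" where
  "symmetric_density M h \<longleftrightarrow> hoelder_disc M h \<and> (\<forall>z. h (cnj z) = R (h z)) \<and> (\<forall>z. Im z = 0 \<longrightarrow> h z = 0)"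

lemma W_real:
  assumes "symmetric_density M h" "Im z = 0" shows "R (W \<theta> h z) = W \<theta> h z"
proof -
  have z: "cnj z = z" using assms(2) by (simp add: complex_eq_iff)
  have "R (cauchy_tr h z) = cauchy_tr h z" using cauchy_tr_cnj[OF _ R_bl R_J0, of M h z] assms z by (auto simp: symmetric_density_def)
  moreover have "R (\<phi> \<theta>' z) = \<phi> \<theta>' z" for \<theta>' using \<phi>_cnj[of \<theta>' z] z by simp
  ultimately show ?thesis by (simp add: W_def R_simps)
qed

definition reflection_ext :: "(complex \<Rightarrow> 'e) \<Rightarrow> complex \<Rightarrow> 'e" where
  "reflection_ext F z = (if norm z \<le> 2 then (if 0 \<le> Im z then F z else R (F (cnj z))) else 0)"

text \<open>
  In the reflected extension a point above the axis contributes \<open>1\<close> and a point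
  below it the norm of \<open>R\<close> to the Hoelder constant.
\<close>

definition \<rho> :: real where "\<rho> = 1 + onorm R"

lemma \<rho>: "1 \<le> \<rho>" "norm (R v) \<le> (\<rho> - 1) * norm v"
  using onorm_pos_le[OF R_bl] onorm[OF R_bl, of v] by (auto simp: \<rho>_def)

text \<open>
  The zeros of \<open>F\<close> on the axis and on the circle of radius \<open>2\<close> bound
  \<open>F z\<close> by the square root of the distance of \<open>z\<close> to them; two
  points separated by the axis or by the circle are compared through these zeros.
\<close>

lemma reflection_ext_hoelder:
  assumes F: "hoelder half_disc M F" and Z: "\<And>z. z \<in> half_disc \<Longrightarrow> Im z = 0 \<or> norm z = 2 \<Longrightarrow> F z = 0"
  shows "hoelder_disc (\<rho> * M) (reflection_ext F)"
proof -
  have M: "0 \<le> M" by (rule hoelder_nonneg[OF F, of 0]) (simp add: half_disc_def)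
  have \<rho>M: "M \<le> \<rho> * M" "0 \<le> (\<rho> - 1) * M" "(\<rho> - 1) * M \<le> \<rho> * M" using \<rho>(1) M by (auto simp: mult_le_cancel_right1 mult_right_mono)
  have im: "norm (F z) \<le> M * sqrt (Im z)" if "z \<in> half_disc" for z
  proof -
    have "of_real (Re z) \<in> half_disc" using that abs_Re_le_cmod[of z] by (auto simp: half_disc_def)
    then have "norm (F z - F (of_real (Re z))) \<le> M * sqrt (norm (z - of_real (Re z)))" using hoelderD2[OF F that] by blast
    moreover have "F (of_real (Re z)) = 0" using Z[OF \<open>of_real (Re z) \<in> half_disc\<close>] by simp
    moreover have "norm (z - of_real (Re z)) = Im z" using that by (simp add: cmod_def half_disc_def)
    ultimately show ?thesis by simp
  qed
  have ou: "norm (F z) \<le> M * sqrt (2 - norm z)" if "z \<in> half_disc" for z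
  proof -
    define w where "w = (if z = 0 then 2 else (2 / norm z) *\<^sub>R z)"
    have w: "w \<in> half_disc" "norm w = 2" "norm (z - w) = 2 - norm z"
    proof -
      show "w \<in> half_disc" "norm w = 2" using that by (auto simp: w_def half_disc_def)
      show "norm (z - w) = 2 - norm z"
      proof (cases "z = 0")
        case False
        have "z - w = (1 - 2 / norm z) *\<^sub>R z" using False by (simp add: w_def scaleR_diff_left)
        then have "norm (z - w) = \<bar>1 - 2 / norm z\<bar> * norm z" by simp
        also have "\<bar>1 - 2 / norm z\<bar> = 2 / norm z - 1" using that False by (simp add: half_disc_def)
        finally show ?thesis using False by (simp add: algebra_simps)
      qed (simp add: w_def)
    qed
    then have "norm (F z - F w) \<le> M * sqrt (norm (z - w))" "F w = 0" using hoelderD2[OF F that] Z by blast+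
    then show ?thesis using w by simp
  qed
  have sup: "norm (reflection_ext F z) \<le> \<rho> * M" for z
  proof -
    have "norm (R (F z)) \<le> \<rho> * M" if "z \<in> half_disc" for z
    proof -
      have "norm (R (F z)) \<le> (\<rho> - 1) * M"
        by (rule order_trans[OF \<rho>(2)]) (use \<rho>(1) hoelderD1[OF F that] in \<open>auto intro: mult_left_mono\<close>)
      then show ?thesis using \<rho>M by linarith
    qed
    moreover have "norm (F z) \<le> \<rho> * M" if "z \<in> half_disc" for z using hoelderD1[OF F that] \<rho>M by linarith
    ultimately show ?thesis using \<rho>M M by (auto simp: reflection_ext_def half_disc_def)
  qed
  have sy: "norm (reflection_ext F z - reflection_ext F z') \<le> \<rho> * M * sqrt (norm (z - z'))"
    if c: "norm z \<le> 2 \<and> (norm z' > 2 \<or> Im z \<ge> Im z')" for z z'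
  proof -
    let ?s = "sqrt (norm (z - z'))"
    have mono: "a * sqrt t \<le> a * ?s" if "0 \<le> a" "t \<le> norm (z - z')" for a t
      using that by (intro mult_left_mono real_sqrt_le_mono)
    consider (out) "norm z' > 2" | (uu) "norm z' \<le> 2" "Im z' \<ge> 0" | (ul) "norm z' \<le> 2" "Im z \<ge> 0" "Im z' < 0"
      | (ll) "norm z' \<le> 2" "Im z < 0" using c by linarith
    then show ?thesis
    proof cases
      case out
      have d: "2 - norm z \<le> norm (z - z')" using out norm_triangle_ineq3[of z z'] by linarith
      show ?thesis
      proof (cases "Im z \<ge> 0")
        case True
        then have "norm (F z) \<le> M * ?s" using ou[of z] c mono[OF M d] by (force simp: half_disc_def)
        also have "\<dots> \<le> \<rho> * M * ?s" using \<rho>M by (intro mult_right_mono) auto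
        finally show ?thesis using True c out by (simp add: reflection_ext_def)
      next
        case False
        have u: "cnj z \<in> half_disc" using False c by (simp add: half_disc_def)
        have "norm (R (F (cnj z))) \<le> (\<rho> - 1) * (M * sqrt (2 - norm (cnj z)))"
          by (rule order_trans[OF \<rho>(2)]) (use \<rho>(1) ou[OF u] in \<open>auto intro: mult_left_mono\<close>)
        also have "\<dots> = (\<rho> - 1) * M * sqrt (2 - norm z)" by simp
        also have "\<dots> \<le> (\<rho> - 1) * M * ?s" by (rule mono[OF \<rho>M(2) d])
        also have "\<dots> \<le> \<rho> * M * ?s" by (rule mult_right_mono[OF \<rho>M(3)]) simp
        finally show ?thesis using False c out by (simp add: reflection_ext_def)
      qed
    next
      case uu
      then have u: "z \<in> half_disc" "z' \<in> half_disc" using c by (auto simp: half_disc_def)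
      have "norm (F z - F z') \<le> M * ?s" by (rule hoelderD2[OF F u])
      also have "\<dots> \<le> \<rho> * M * ?s" using \<rho>M by (intro mult_right_mono) auto
      finally show ?thesis using u by (simp add: reflection_ext_def half_disc_def)
    next
      case ul
      have u: "z \<in> half_disc" "cnj z' \<in> half_disc" using c ul by (auto simp: half_disc_def)
      have d: "Im z \<le> norm (z - z')" "- Im z' \<le> norm (z - z')" using abs_Im_le_cmod[of "z - z'"] ul by auto
      have "norm (reflection_ext F z - reflection_ext F z') \<le> norm (F z) + norm (R (F (cnj z')))" using c ul norm_triangle_ineq4 by (simp add: reflection_ext_def)
      also have "\<dots> \<le> M * ?s + (\<rho> - 1) * M * ?s"
      proof (rule add_mono)
        show "norm (F z) \<le> M * ?s" using im[OF u(1)] mono[OF M d(1)] by linarith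
        have "norm (R (F (cnj z'))) \<le> (\<rho> - 1) * (M * sqrt (Im (cnj z')))"
          by (rule order_trans[OF \<rho>(2)]) (use \<rho>(1) im[OF u(2)] in \<open>auto intro: mult_left_mono\<close>)
        also have "\<dots> = (\<rho> - 1) * M * sqrt (- Im z')" by simp
        also have "\<dots> \<le> (\<rho> - 1) * M * ?s" by (rule mono[OF \<rho>M(2) d(2)])
        finally show "norm (R (F (cnj z'))) \<le> (\<rho> - 1) * M * ?s" .
      qed
      also have "\<dots> = \<rho> * M * ?s" by (simp add: algebra_simps)
      finally show ?thesis .
    next
      case ll
      then have u: "cnj z \<in> half_disc" "cnj z' \<in> half_disc" using c by (auto simp: half_disc_def)
      have l: "Im z' < 0" using ll c by linarith
      have "norm (R (F (cnj z)) - R (F (cnj z'))) = norm (R (F (cnj z) - F (cnj z')))" by (simp add: R_simps)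
      also have "\<dots> \<le> (\<rho> - 1) * (M * sqrt (norm (cnj z - cnj z')))"
        by (rule order_trans[OF \<rho>(2)]) (use \<rho>(1) hoelderD2[OF F u] in \<open>auto intro: mult_left_mono\<close>)
      also have "\<dots> = (\<rho> - 1) * M * ?s" by (simp flip: complex_cnj_diff)
      also have "\<dots> \<le> \<rho> * M * ?s" by (rule mult_right_mono[OF \<rho>M(3)]) simp
      finally show ?thesis using ll l c by (simp add: reflection_ext_def)
    qed
  qed
  have "norm (reflection_ext F z - reflection_ext F z') \<le> \<rho> * M * sqrt (norm (z - z'))" for z z'
  proof -
    consider "norm z \<le> 2 \<and> (norm z' > 2 \<or> Im z \<ge> Im z')" | "norm z' \<le> 2 \<and> (norm z > 2 \<or> Im z' \<ge> Im z)" | "norm z > 2 \<and> norm z' > 2"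
      by linarith
    then show ?thesis
    proof cases
      case 1 then show ?thesis by (rule sy)
    next
      case 2 then show ?thesis using sy[of z' z] by (simp add: norm_minus_commute)
    next
      case 3 then show ?thesis using \<rho>M M by (simp add: reflection_ext_def)
    qed
  qed
  then have "hoelder UNIV (\<rho> * M) (reflection_ext F)" using sup by (intro hoelderI)
  then show ?thesis by (simp add: hoelder_disc_def reflection_ext_def)
qed

end

section \<open>Half discs with boundary in a real form\<close>

lemma complex_linear:
  fixes f :: "complex \<Rightarrow> 'b::real_vector"
  assumes "linear f" shows "f \<eta> = Re \<eta> *\<^sub>R f 1 + Im \<eta> *\<^sub>R f \<i>"
proof -
  have "f \<eta> = f (Re \<eta> *\<^sub>R 1 + Im \<eta> *\<^sub>R \<i>)" by (rule arg_cong[of _ _ f]) (simp add: complex_eq_iff)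
  then show ?thesis by (simp only: linear_add[OF assms] linear_scale[OF assms])
qed

text \<open>
  The equation \<open>w\<^sub>x + J0 w\<^sub>y = A(w) (w\<^sub>x + J0 w\<^sub>y) + B(w)
  w\<^sub>y\<close>. As \<open>B\<close> vanishes on the fixed vectors of \<open>R\<close>,
  the right-hand side is zero on the real axis for discs attached to them, which is what
  reflection requires.
\<close>

locale disc_eq = real_form J0 R t0 t1 for J0 R :: "'e::euclidean_space \<Rightarrow> 'e" and t0 t1 +
  fixes A B :: "'e \<Rightarrow> 'e \<Rightarrow>\<^sub>L 'e" and r L :: real
  assumes r: "0 < r" and C11A: "C11 (ball 0 r) L A" and C11B: "C11 (ball 0 r) L B"
    and A0: "A 0 = 0" and BS: "\<And>v. v \<in> ball 0 r \<Longrightarrow> R v = v \<Longrightarrow> B v = 0"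
begin

definition cutoff :: "complex \<Rightarrow> real" where "cutoff z = max 0 (min 1 (2 - norm z))"

lemma cutoff_hoelder: "hoelder half_disc 2 cutoff"
proof -
  have "hoelder half_disc (2 * 1) cutoff"
  proof (rule hoelder_of_lipschitz)
    fix z z'
    have "\<bar>cutoff z - cutoff z'\<bar> \<le> \<bar>norm z - norm z'\<bar>" by (auto simp: cutoff_def)
    then show "norm (cutoff z - cutoff z') \<le> 1 * norm (z - z')" using norm_triangle_ineq3[of z z'] by simp
    show "norm (cutoff z) \<le> 1" by (simp add: cutoff_def)
  qed
  then show ?thesis by simp
qed

definition rhs :: "'e \<times> 'e \<times> 'e \<Rightarrow> (complex \<Rightarrow> 'e) \<Rightarrow> complex \<Rightarrow> 'e" where
  "rhs \<theta> h z = cutoff z *\<^sub>R (blinfun_apply (A (W \<theta> h z)) (h z) + blinfun_apply (B (W \<theta> h z)) (WD \<i> \<theta> h z))"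

text \<open>
  A fixed point \<open>h\<close> of this map is the density of a solution on the upper half of
  the unit disc.
\<close>

definition \<Phi> :: "'e \<times> 'e \<times> 'e \<Rightarrow> (complex \<Rightarrow> 'e) \<Rightarrow> complex \<Rightarrow> 'e" where
  "\<Phi> \<theta> h = reflection_ext (rhs \<theta> h)"

lemma B0: "B 0 = 0" using BS[of 0] r by (simp add: R_simps)

lemma L0: "0 \<le> L" by (rule C11D0[OF C11A])

lemma hoelder_apply: "hoelder P M f \<Longrightarrow> hoelder P M' g \<Longrightarrow> hoelder P (2 * M * M') (\<lambda>z. blinfun_apply (f z) (g z))"
  using hoelder_bilinear[OF bounded_bilinear_blinfun_apply, of P M f M' g 1] by (simp add: norm_blinfun)

text \<open>
  Densities and parameters of size at most \<open>\<delta>\<close> then give maps into the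
  domain of \<open>A\<close> and \<open>B\<close>.
\<close>

definition small :: "real \<Rightarrow> real \<Rightarrow> bool" where
  "small C0 \<delta> \<longleftrightarrow> 0 < \<delta> \<and> 2 * C0 * \<delta> < r \<and> 2 * C0 * \<delta> \<le> 1"

lemma W_in_ball:
  assumes "Wbound C0" "small C0 \<delta>" "hoelder_disc \<delta> h" "norm \<theta> \<le> \<delta>" "z \<in> half_disc"
  shows "W \<theta> h z \<in> ball 0 r"
proof -
  have "hoelder half_disc (C0 * (\<delta> + \<delta>)) (W \<theta> h)" using assms unfolding Wbound_def by blast
  from hoelderD1[OF this assms(5)] show ?thesis using assms(2) by (simp add: small_def)
qed

text \<open>
  \<open>A\<close> and \<open>B\<close> vanish at the origin, so the right-hand side is of
  second order in the data and its Lipschitz constant has the factor \<open>\<delta>\<close>.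
  Each product difference splits into a difference of coefficients and a difference of
  arguments.
\<close>

lemma contraction:
  assumes C0: "Wbound C0" and \<delta>: "small C0 \<delta>" and \<theta>: "norm \<theta>1 \<le> \<delta>" "norm \<theta>2 \<le> \<delta>" "norm (\<theta>1 - \<theta>2) \<le> \<epsilon>"
    and h: "symmetric_density \<delta> h1" "symmetric_density \<delta> h2" "hoelder_disc M (\<lambda>z. h1 z - h2 z)"
  shows "hoelder_disc (\<rho> * (4 * (10 * L * C0 + 16 * L * C0^2)) * \<delta> * (M + \<epsilon>)) (\<lambda>z. \<Phi> \<theta>1 h1 z - \<Phi> \<theta>2 h2 z)"
proof -
  have a: "hoelder_disc \<delta> h1" "hoelder_disc \<delta> h2" using h by (auto simp: symmetric_density_def)
  let ?w = "2 * C0 * \<delta>" and ?m = "C0 * (M + \<epsilon>)"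
  have C0p: "0 < C0" using C0 by (simp add: Wbound_def)
  have \<delta>p: "0 < \<delta>" "?w \<le> 1" "0 \<le> ?w" using \<delta> C0p by (auto simp: small_def)
  have M: "0 \<le> M" by (rule hoelder_discD(5)[OF h(3)])
  have e: "0 \<le> \<epsilon>" using \<theta>(3) norm_ge_zero order_trans by blast
  have m: "0 \<le> ?m" using C0p M e by simp
  have w: "C0 * (\<delta> + \<delta>) = ?w" by simp
  have H: "hoelder half_disc ?w (W \<theta>1 h1)" "hoelder half_disc ?w (W \<theta>2 h2)" "hoelder half_disc ?w (WD \<i> \<theta>1 h1)"
    "\<forall>z\<in>half_disc. \<forall>z'\<in>half_disc. norm (W \<theta>1 h1 z - W \<theta>1 h1 z') \<le> ?w * norm (z - z')"
    "\<forall>z\<in>half_disc. \<forall>z'\<in>half_disc. norm (W \<theta>2 h2 z - W \<theta>2 h2 z') \<le> ?w * norm (z - z')"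
    using C0 a \<theta> unfolding Wbound_def w[symmetric] by blast+
  have D: "hoelder half_disc ?m (\<lambda>z. W \<theta>1 h1 z - W \<theta>2 h2 z)" "hoelder half_disc ?m (\<lambda>z. WD \<i> \<theta>1 h1 z - WD \<i> \<theta>2 h2 z)"
    unfolding W_diff[OF a] using C0 h(3) \<theta>(3) unfolding Wbound_def by blast+
  have ball: "\<And>z. z \<in> half_disc \<Longrightarrow> W \<theta>1 h1 z \<in> ball 0 r" "\<And>z. z \<in> half_disc \<Longrightarrow> W \<theta>2 h2 z \<in> ball 0 r"
    by (intro W_in_ball[OF C0 \<delta>] a \<theta>; assumption)+
  have 0: "0 \<in> ball 0 r" using r by simp
  have hh: "hoelder half_disc \<delta> h1" "hoelder half_disc M (\<lambda>z. h1 z - h2 z)"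
    using a(1) h(3) by (auto simp: hoelder_disc_def intro: hoelder_subset)
  have AD: "hoelder half_disc (L * ?m * (1 + 2 * ?w)) (\<lambda>z. A (W \<theta>1 h1 z) - A (W \<theta>2 h2 z))"
    by (rule hoelder_C11_compose_diff[OF C11A D(1) ball]) (use H \<delta>p in auto)
  have BD: "hoelder half_disc (L * ?m * (1 + 2 * ?w)) (\<lambda>z. B (W \<theta>1 h1 z) - B (W \<theta>2 h2 z))"
    by (rule hoelder_C11_compose_diff[OF C11B D(1) ball]) (use H \<delta>p in auto)
  have A2: "hoelder half_disc (L * ?w) (\<lambda>z. A (W \<theta>2 h2 z))" by (rule hoelder_C11_compose[OF C11A H(2) ball(2) 0 A0])
  have B2: "hoelder half_disc (L * ?w) (\<lambda>z. B (W \<theta>2 h2 z))" by (rule hoelder_C11_compose[OF C11B H(2) ball(2) 0 B0])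
  let ?F = "\<lambda>z. (blinfun_apply (A (W \<theta>1 h1 z) - A (W \<theta>2 h2 z)) (h1 z) + blinfun_apply (A (W \<theta>2 h2 z)) (h1 z - h2 z)) +
    (blinfun_apply (B (W \<theta>1 h1 z) - B (W \<theta>2 h2 z)) (WD \<i> \<theta>1 h1 z) +
     blinfun_apply (B (W \<theta>2 h2 z)) (WD \<i> \<theta>1 h1 z - WD \<i> \<theta>2 h2 z))"
  let ?s = "(2 * (L * ?m * (1 + 2 * ?w)) * \<delta> + 2 * (L * ?w) * M) + (2 * (L * ?m * (1 + 2 * ?w)) * ?w + 2 * (L * ?w) * ?m)"
  have F: "hoelder half_disc ?s ?F"
    by (intro hoelder_add hoelder_apply AD BD A2 B2 H D hh)
  have f1: "hoelder half_disc (2 * 1 * 2 * ?s) (\<lambda>z. cutoff z *\<^sub>R ?F z)"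
    by (rule hoelder_bilinear[OF bounded_bilinear_scaleR cutoff_hoelder F]) auto
  have Neq: "(\<lambda>z. cutoff z *\<^sub>R ?F z) = (\<lambda>z. rhs \<theta>1 h1 z - rhs \<theta>2 h2 z)"
    by (simp add: rhs_def blinfun.diff_left blinfun.diff_right algebra_simps)
  have le: "2 * 1 * 2 * ?s \<le> (4 * (10 * L * C0 + 16 * L * C0^2)) * \<delta> * (M + \<epsilon>)"
  proof -
    have "2 * (L * ?m * (1 + 2 * ?w)) * \<delta> \<le> 2 * (L * ?m * 3) * \<delta>"
      using \<delta>p m L0 by (intro mult_right_mono mult_left_mono) auto
    moreover have "2 * (L * ?m * (1 + 2 * ?w)) * ?w \<le> 2 * (L * ?m * 3) * ?w"
      using \<delta>p m L0 by (intro mult_right_mono mult_left_mono) auto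
    moreover have "2 * (L * ?w) * M \<le> 2 * (L * ?w) * (M + \<epsilon>)"
      using \<delta>p L0 e C0p by (intro mult_left_mono) auto
    ultimately have "?s \<le> 2 * (L * ?m * 3) * \<delta> + 2 * (L * ?w) * (M + \<epsilon>) + 2 * (L * ?m * 3) * ?w + 2 * (L * ?w) * ?m" by linarith
    also have "\<dots> = (10 * L * C0 + 16 * L * C0^2) * \<delta> * (M + \<epsilon>)" by (simp add: algebra_simps power2_eq_square)
    finally have "4 * ?s \<le> 4 * ((10 * L * C0 + 16 * L * C0^2) * \<delta> * (M + \<epsilon>))" by (rule mult_left_mono) simp
    moreover have "2 * 1 * 2 * ?s = 4 * ?s" by simp
    ultimately show ?thesis by (simp only: mult.assoc)
  qed
  have hN: "hoelder half_disc ((4 * (10 * L * C0 + 16 * L * C0^2)) * \<delta> * (M + \<epsilon>)) (\<lambda>z. rhs \<theta>1 h1 z - rhs \<theta>2 h2 z)"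
    using hoelder_mono[OF f1 le] unfolding Neq .
  \<comment> \<open>On the real axis \<open>h\<close> vanishes and \<open>W\<close> takes fixed vectors of
    \<open>R\<close> as values, where \<open>B\<close> vanishes; on the circle of radius
    \<open>2\<close> the cut-off vanishes.\<close>
  have zero: "rhs \<theta> h z = 0" if "z \<in> half_disc" "Im z = 0 \<or> norm z = 2" "symmetric_density \<delta> h" "norm \<theta> \<le> \<delta>" for \<theta> h z
  proof (cases "norm z = 2")
    case False
    then have i: "Im z = 0" using that by simp
    have "W \<theta> h z \<in> ball 0 r" by (rule W_in_ball[OF C0 \<delta>]) (use that in \<open>auto simp: symmetric_density_def\<close>)
    then have "B (W \<theta> h z) = 0" using BS W_real[OF that(3) i] by blast
    moreover have "h z = 0" using that(3) i by (simp add: symmetric_density_def)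
    ultimately show ?thesis by (simp add: rhs_def)
  qed (simp add: rhs_def cutoff_def)
  have "hoelder_disc (\<rho> * ((4 * (10 * L * C0 + 16 * L * C0^2)) * \<delta> * (M + \<epsilon>))) (reflection_ext (\<lambda>z. rhs \<theta>1 h1 z - rhs \<theta>2 h2 z))"
    by (rule reflection_ext_hoelder[OF hN]) (use zero \<theta> h in auto)
  moreover have "reflection_ext (\<lambda>z. rhs \<theta>1 h1 z - rhs \<theta>2 h2 z) = (\<lambda>z. \<Phi> \<theta>1 h1 z - \<Phi> \<theta>2 h2 z)"
    by (auto simp: \<Phi>_def reflection_ext_def R_simps)
  ultimately show ?thesis by (simp add: mult.assoc)
qed

lemma hoelder_disc_mono: "hoelder_disc M h \<Longrightarrow> M \<le> M' \<Longrightarrow> hoelder_disc M' h"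
  by (auto simp: hoelder_disc_def intro: hoelder_mono)

lemma hoelder_disc_0: "0 \<le> M \<Longrightarrow> hoelder_disc M (\<lambda>_. 0)"
  by (auto simp: hoelder_disc_def hoelder_def)

lemma W_00: "W 0 (\<lambda>_. 0) z = 0" "WD \<eta> 0 (\<lambda>_. 0) z = 0"
proof -
  have a: "hoelder_disc 0 (\<lambda>_. 0::'e)" by (rule hoelder_disc_0) simp
  show "W 0 (\<lambda>_. 0) z = 0" "WD \<eta> 0 (\<lambda>_. 0) z = 0"     using W_diff[OF a a, where \<theta> = 0 and \<theta>' = 0 and z = z] by auto
qed

lemma \<Phi>_00: "\<Phi> 0 (\<lambda>_. 0) = (\<lambda>_. 0)"
  by (auto simp: \<Phi>_def reflection_ext_def rhs_def W_00 A0 B0 R_simps)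

lemma symmetric_density_0: "0 \<le> M \<Longrightarrow> symmetric_density M (\<lambda>_. 0)"
  by (auto simp: symmetric_density_def hoelder_disc_0 R_simps)

definition contr_const :: "real \<Rightarrow> real" where "contr_const C0 = \<rho> * (4 * (10 * L * C0 + 16 * L * C0^2))"

lemma \<Phi>_symmetric_density:
  assumes C0: "Wbound C0" and \<delta>: "small C0 \<delta>" and k: "contr_const C0 * \<delta> \<le> 1/4" and \<theta>: "norm \<theta> \<le> \<delta>" and h: "symmetric_density \<delta> h"
  shows "symmetric_density \<delta> (\<Phi> \<theta> h)"
proof -
  have \<delta>p: "0 < \<delta>" using \<delta> by (simp add: small_def)
  have h': "hoelder_disc \<delta> (\<lambda>z. h z - 0)" using h by (simp add: symmetric_density_def)
  have "hoelder_disc (contr_const C0 * \<delta> * (\<delta> + \<delta>)) (\<lambda>z. \<Phi> \<theta> h z - \<Phi> 0 (\<lambda>_. 0) z)"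
    unfolding contr_const_def by (rule contraction[OF C0 \<delta> \<theta> _ _ h symmetric_density_0 h']) (use \<delta>p \<theta> in auto)
  then have "hoelder_disc (contr_const C0 * \<delta> * (\<delta> + \<delta>)) (\<Phi> \<theta> h)" unfolding \<Phi>_00 by simp
  moreover have "contr_const C0 * \<delta> * (\<delta> + \<delta>) \<le> 1/4 * (\<delta> + \<delta>)" using k \<delta>p by (intro mult_right_mono) auto
  ultimately have hoelder_disc: "hoelder_disc \<delta> (\<Phi> \<theta> h)" using \<delta>p by (auto elim!: hoelder_disc_mono)
  have z0: "\<Phi> \<theta> h z = 0" if "Im z = 0" for z
  proof (cases "norm z \<le> 2")
    case True
    have "W \<theta> h z \<in> ball 0 r" by (rule W_in_ball[OF C0 \<delta>]) (use that h \<theta> True in \<open>auto simp: symmetric_density_def half_disc_def\<close>)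
    then have "B (W \<theta> h z) = 0" using BS W_real[OF h that] by blast
    moreover have "h z = 0" using h that by (simp add: symmetric_density_def)
    ultimately show ?thesis using that by (simp add: \<Phi>_def reflection_ext_def rhs_def)
  qed (simp add: \<Phi>_def reflection_ext_def)
  have "\<Phi> \<theta> h (cnj z) = R (\<Phi> \<theta> h z)" for z
  proof (cases "Im z = 0")
    case True
    then show ?thesis using z0 by (simp add: R_simps)
  next
    case False
    then show ?thesis by (auto simp: \<Phi>_def reflection_ext_def RR R_simps)
  qed
  then show ?thesis using hoelder_disc z0 by (simp add: symmetric_density_def)
qed

text \<open>
  Picard iteration from zero. Balls of Hoelder functions are closed under pointwise limits,
  which takes the place of completeness of a function space.
\<close>

lemma fixed_point:
  assumes C0: "Wbound C0" and \<delta>: "small C0 \<delta>" and k: "contr_const C0 * \<delta> \<le> 1/4" and \<theta>: "norm \<theta> \<le> \<delta>"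
  obtains h where "symmetric_density \<delta> h" "\<Phi> \<theta> h = h"
proof -
  have \<delta>p: "0 < \<delta>" using \<delta> by (simp add: small_def)
  define s where "s n = (\<Phi> \<theta> ^^ n) (\<lambda>_. 0)" for n
  have sS: "s (Suc n) = \<Phi> \<theta> (s n)" for n by (simp add: s_def)
  have symmetric_density: "symmetric_density \<delta> (s n)" for n
  proof (induction n)
    case 0 show ?case using \<delta>p by (simp add: s_def symmetric_density_0)
  next
    case (Suc n) then show ?case unfolding sS by (rule \<Phi>_symmetric_density[OF C0 \<delta> k \<theta>])
  qed
  have contr: "hoelder_disc (M/4) (\<lambda>z. \<Phi> \<theta> h1 z - \<Phi> \<theta> h2 z)"
    if "symmetric_density \<delta> h1" "symmetric_density \<delta> h2" "hoelder_disc M (\<lambda>z. h1 z - h2 z)" for h1 h2 M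
  proof -
    have "hoelder_disc (contr_const C0 * \<delta> * (M + 0)) (\<lambda>z. \<Phi> \<theta> h1 z - \<Phi> \<theta> h2 z)"
      unfolding contr_const_def by (rule contraction[OF C0 \<delta> \<theta> \<theta> _ that]) simp
    moreover have "contr_const C0 * \<delta> * (M + 0) \<le> 1/4 * M" using mult_right_mono[OF k hoelder_discD(5)[OF that(3)]] by simp
    ultimately show ?thesis by (auto elim: hoelder_disc_mono)
  qed
  have step: "hoelder_disc (\<delta> * (1/4)^n) (\<lambda>z. s (Suc n) z - s n z)" for n
  proof (induction n)
    case 0
    show ?case using symmetric_density[of 1] by (simp add: s_def symmetric_density_def)
  next
    case (Suc n)
    show ?case using contr[OF symmetric_density symmetric_density Suc.IH] unfolding sS[symmetric] by simp
  qed
  have far: "hoelder_disc (2 * \<delta> * (1/4)^n) (\<lambda>z. s (n + m) z - s n z)" for n m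
  proof -
    have "hoelder UNIV (\<Sum>i<m. \<delta> * (1/4)^(n+i)) (\<lambda>z. s (n + m) z - s n z)"
    proof (induction m)
      case 0 show ?case by (simp add: hoelder_def)
    next
      case (Suc m)
      have "hoelder UNIV (\<delta> * (1/4)^(n+m)) (\<lambda>z. s (Suc (n + m)) z - s (n + m) z)" using step by (simp add: hoelder_disc_def)
      from hoelder_add[OF Suc.IH this] show ?case by (simp add: algebra_simps)
    qed
    moreover have "(\<Sum>i<m. \<delta> * (1/4)^(n+i)) \<le> 2 * \<delta> * (1/4)^n"
    proof -
      have "(\<Sum>i<m. \<delta> * (1/4)^(n+i)) = \<delta> * (1/4)^n * (\<Sum>i<m. (1/4)^i)" by (simp add: power_add sum_distrib_left mult.assoc)
      also have "\<dots> \<le> \<delta> * (1/4)^n * (1 / (1 - 1/4))" using \<delta>p by (intro mult_left_mono sum_geometric_bound) auto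
      also have "\<dots> \<le> \<delta> * (1/4)^n * 2" using \<delta>p by (intro mult_left_mono) auto
      finally show ?thesis by (simp add: ac_simps)
    qed
    ultimately have "hoelder UNIV (2 * \<delta> * (1/4)^n) (\<lambda>z. s (n + m) z - s n z)" by (rule hoelder_mono)
    moreover have "s (n + m) z - s n z = 0" if "2 < norm z" for z
      using symmetric_density[of n] symmetric_density[of "n + m"] that by (simp add: symmetric_density_def hoelder_disc_def)
    ultimately show ?thesis by (simp add: hoelder_disc_def)
  qed
  have null: "(\<lambda>n. 2 * \<delta> * (1/4)^n) \<longlonglongrightarrow> 0"
    using tendsto_mult_right_zero[OF LIMSEQ_power_zero[of "1/4::real"], of "2 * \<delta>"] by simp
  have "Cauchy (\<lambda>n. s n z)" for z
  proof (rule metric_CauchyI)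
    fix e :: real assume e: "0 < e"
    have "\<forall>\<^sub>F n in sequentially. 2 * \<delta> * (1/4)^n < e / 2" using null e by (intro order_tendstoD) auto
    then obtain n where n: "2 * \<delta> * (1/4)^n < e / 2" by (auto simp: eventually_sequentially)
    have d: "dist (s m z) (s n z) < e / 2" if "m \<ge> n" for m
      using hoelder_discD(1)[OF far[of n "m - n"], of z] that n by (simp add: dist_norm)
    show "\<exists>n. \<forall>m\<ge>n. \<forall>k\<ge>n. dist (s m z) (s k z) < e"
    proof (intro exI[of _ n] allI impI)
      fix m k assume "n \<le> m" "n \<le> k"
      then show "dist (s m z) (s k z) < e" using d[of m] d[of k] dist_triangle2[of "s m z" "s k z" "s n z"] by linarith
    qed
  qed
  then have conv: "convergent (\<lambda>n. s n z)" for z by (rule Cauchy_convergent)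
  define h where "h z = lim (\<lambda>n. s n z)" for z
  have lim: "(\<lambda>n. s n z) \<longlonglongrightarrow> h z" for z using conv unfolding h_def by (simp add: convergent_LIMSEQ_iff)
  have hoelder_disc_h: "hoelder_disc \<delta> h"
  proof -
    have "hoelder UNIV \<delta> h" by (rule hoelder_limit[OF _ lim tendsto_const]) (use symmetric_density in \<open>auto simp: symmetric_density_def hoelder_disc_def\<close>)
    moreover have "h z = 0" if "2 < norm z" for z
      using LIMSEQ_unique[OF lim[of z]] symmetric_density that by (simp add: symmetric_density_def hoelder_disc_def)
    ultimately show ?thesis by (simp add: hoelder_disc_def)
  qed
  have cls_h: "symmetric_density \<delta> h"
  proof -
    have "h (cnj z) = R (h z)" for z
    proof -
      have "(\<lambda>n. s n (cnj z)) \<longlonglongrightarrow> R (h z)" using bounded_linear.tendsto[OF R_bl lim[of z]] symmetric_density by (simp add: symmetric_density_def)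
      then show ?thesis using LIMSEQ_unique[OF lim[of "cnj z"]] by blast
    qed
    moreover have "h z = 0" if "Im z = 0" for z
      using LIMSEQ_unique[OF lim[of z]] symmetric_density that by (simp add: symmetric_density_def)
    ultimately show ?thesis using hoelder_disc_h by (simp add: symmetric_density_def)
  qed
  have near: "hoelder_disc (2 * \<delta> * (1/4)^n) (\<lambda>z. h z - s n z)" for n
  proof -
    have "hoelder UNIV (2 * \<delta> * (1/4)^n) (\<lambda>z. h z - s n z)"
    proof (rule hoelder_limit[OF _ _ tendsto_const])
      show "hoelder UNIV (2 * \<delta> * (1/4)^n) (\<lambda>z. s (n + m) z - s n z)" for m using far by (simp add: hoelder_disc_def)
      show "(\<lambda>m. s (n + m) z - s n z) \<longlonglongrightarrow> h z - s n z" for z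
        using LIMSEQ_ignore_initial_segment[OF lim[of z], of n] by (intro tendsto_intros) (simp add: add.commute)
    qed
    then show ?thesis using hoelder_disc_h symmetric_density[of n] by (simp add: hoelder_disc_def symmetric_density_def)
  qed
  have "\<Phi> \<theta> h z = h z" for z
  proof -
    have "(\<lambda>n. \<Phi> \<theta> h z - s (Suc n) z) \<longlonglongrightarrow> 0"
    proof (rule Lim_null_comparison[OF _ null], rule always_eventually, rule allI)
      fix n
      have "norm (\<Phi> \<theta> h z - s (Suc n) z) \<le> 2 * \<delta> * (1/4)^n / 4"
        unfolding sS by (rule hoelder_discD(1)[OF contr[OF cls_h symmetric_density near]])
      also have "\<dots> \<le> 2 * \<delta> * (1/4)^n" using \<delta>p by simp
      finally show "norm (\<Phi> \<theta> h z - s (Suc n) z) \<le> 2 * \<delta> * (1/4)^n" .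
    qed
    moreover have "(\<lambda>n. \<Phi> \<theta> h z - s (Suc n) z) \<longlonglongrightarrow> \<Phi> \<theta> h z - h z"
      using LIMSEQ_Suc[OF lim[of z]] by (intro tendsto_intros)
    ultimately show ?thesis using LIMSEQ_unique by (metis eq_iff_diff_eq_0)
  qed
  then show thesis using that[OF cls_h] by blast
qed

text \<open>
  Start from the trivial bound \<open>2 * \<delta>\<close> for the difference and feed it into
  \<open>contraction\<close> repeatedly: the part that does not come from the parameters
  shrinks to zero.
\<close>

lemma fixed_point_lipschitz:
  assumes C0: "Wbound C0" and \<delta>: "small C0 \<delta>" and k: "contr_const C0 * \<delta> \<le> 1/4"
    and \<theta>: "norm \<theta>1 \<le> \<delta>" "norm \<theta>2 \<le> \<delta>" and h: "symmetric_density \<delta> h1" "symmetric_density \<delta> h2" "\<Phi> \<theta>1 h1 = h1" "\<Phi> \<theta>2 h2 = h2"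
  shows "hoelder_disc (2 * contr_const C0 * \<delta> * norm (\<theta>1 - \<theta>2)) (\<lambda>z. h1 z - h2 z)"
proof -
  have \<delta>p: "0 < \<delta>" using \<delta> by (simp add: small_def)
  have C0p: "0 < C0" using C0 by (simp add: Wbound_def)
  have K0: "0 \<le> contr_const C0" using \<rho>(1) L0 C0p by (simp add: contr_const_def)
  let ?e = "norm (\<theta>1 - \<theta>2)"
  have "hoelder_disc (2 * contr_const C0 * \<delta> * ?e + 2 * \<delta> * (1/4)^n) (\<lambda>z. h1 z - h2 z)" for n
  proof (induction n)
    case 0
    have "hoelder_disc (\<delta> + \<delta>) (\<lambda>z. h1 z - h2 z)" using h(1,2) hoelder_diff[of UNIV \<delta> h1 \<delta> h2] by (simp add: symmetric_density_def hoelder_disc_def)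
    moreover have "0 \<le> 2 * contr_const C0 * \<delta> * ?e" using K0 \<delta>p by simp
    ultimately show ?case by (auto elim!: hoelder_disc_mono)
  next
    case (Suc n)
    let ?M = "2 * contr_const C0 * \<delta> * ?e + 2 * \<delta> * (1/4)^n"
    have "hoelder_disc (contr_const C0 * \<delta> * (?M + ?e)) (\<lambda>z. \<Phi> \<theta>1 h1 z - \<Phi> \<theta>2 h2 z)"
      unfolding contr_const_def by (rule contraction[OF C0 \<delta> \<theta> order_refl h(1,2) Suc.IH[unfolded contr_const_def]])
    then have 1: "hoelder_disc (contr_const C0 * \<delta> * (?M + ?e)) (\<lambda>z. h1 z - h2 z)" unfolding h(3,4) .
    have "contr_const C0 * \<delta> * (2 * \<delta> * (1/4)^n) \<le> 1/4 * (2 * \<delta> * (1/4)^n)" using k \<delta>p by (intro mult_right_mono) auto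
    moreover have "contr_const C0 * \<delta> * (2 * contr_const C0 * \<delta> * ?e) \<le> 1/4 * (2 * contr_const C0 * \<delta> * ?e)" using k \<delta>p K0 by (intro mult_right_mono) auto
    moreover have "0 \<le> contr_const C0 * \<delta> * ?e" using K0 \<delta>p by simp
    ultimately have "contr_const C0 * \<delta> * (?M + ?e) \<le> 2 * contr_const C0 * \<delta> * ?e + 2 * \<delta> * (1/4)^Suc n"
      unfolding distrib_left power_Suc by linarith
    then show ?case by (rule hoelder_disc_mono[OF 1])
  qed
  note A = this
  have "hoelder UNIV (2 * contr_const C0 * \<delta> * ?e) (\<lambda>z. h1 z - h2 z)"
  proof (rule hoelder_limit)
    show "hoelder UNIV (2 * contr_const C0 * \<delta> * ?e + 2 * \<delta> * (1/4)^n) (\<lambda>z. h1 z - h2 z)" for n using A by (simp add: hoelder_disc_def)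
    have "(\<lambda>n. 2 * contr_const C0 * \<delta> * ?e + 2 * \<delta> * (1/4)^n) \<longlonglongrightarrow> 2 * contr_const C0 * \<delta> * ?e + 2 * \<delta> * 0"
      by (intro tendsto_intros LIMSEQ_power_zero) auto
    then show "(\<lambda>n. 2 * contr_const C0 * \<delta> * ?e + 2 * \<delta> * (1/4)^n) \<longlonglongrightarrow> 2 * contr_const C0 * \<delta> * ?e" by simp
  qed auto
  then show ?thesis using A[of 0] by (simp add: hoelder_disc_def)
qed

text \<open>
  The condition on pairs of parameters says that, up to an arbitrarily small Lipschitz error,
  the discs depend on the parameter like the explicit discs \<open>\<phi> \<theta>\<close>.
\<close>

definition disc_family :: "real \<Rightarrow> real \<Rightarrow> ('e \<times> 'e \<times> 'e \<Rightarrow> complex \<Rightarrow> 'e) \<Rightarrow> ('e \<times> 'e \<times> 'e \<Rightarrow> complex \<Rightarrow> complex \<Rightarrow> 'e) \<Rightarrow> bool" where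
  "disc_family e \<delta> w wd \<longleftrightarrow> (\<forall>\<theta>. norm \<theta> \<le> \<delta> \<longrightarrow>
     (\<forall>z. (w \<theta> has_derivative (\<lambda>\<eta>. wd \<theta> \<eta> z)) (at z)) \<and> (\<forall>\<eta>. continuous_on UNIV (wd \<theta> \<eta>)) \<and>
     (\<forall>z\<in>half_disc. w \<theta> z \<in> ball 0 r) \<and>
     (\<forall>z\<in>half_disc. norm z \<le> 1 \<longrightarrow> wd \<theta> 1 z + J0 (wd \<theta> \<i> z) =
          blinfun_apply (A (w \<theta> z)) (wd \<theta> 1 z + J0 (wd \<theta> \<i> z)) + blinfun_apply (B (w \<theta> z)) (wd \<theta> \<i> z)) \<and>
     (\<forall>z. Im z = 0 \<longrightarrow> R (w \<theta> z) = w \<theta> z) \<and>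
     w \<theta> (\<i> * of_real t0) = fst \<theta> \<and> w \<theta> (\<i> * of_real t1) = fst (snd \<theta>) \<and>
     (\<forall>\<theta>'. norm \<theta>' \<le> \<delta> \<longrightarrow> (\<forall>z\<in>half_disc. norm ((w \<theta> z - w \<theta>' z) - (\<phi> \<theta> z - \<phi> \<theta>' z)) \<le> e * norm (\<theta> - \<theta>')))) \<and>
     w 0 = (\<lambda>_. 0)"

text \<open>
  The densities of the solutions have a Lipschitz constant proportional to
  \<open>\<delta>\<close> in the parameter, so shrinking \<open>\<delta>\<close> brings the
  family as close to the explicit one as desired.
\<close>

theorem disc_family_ex:
  assumes "0 < e" shows "\<exists>\<delta> w wd. 0 < \<delta> \<and> disc_family e \<delta> w wd"
proof -
  obtain C0 where C0: "Wbound C0" using Wbound_ex by blast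
  have C0p: "0 < C0" using C0 by (simp add: Wbound_def)
  have K0: "0 \<le> contr_const C0" using \<rho>(1) L0 C0p by (simp add: contr_const_def)
  \<comment> \<open>The first bound keeps the maps in the domain of the coefficients, the second makes their
    Lipschitz constants at most \<open>1\<close>, the third makes the contraction factor at most
    \<open>1/4\<close>, the last gives the error \<open>e\<close>.\<close>
  define \<delta> where "\<delta> = min (min (r / (4 * C0)) (1 / (2 * C0))) (min (1 / (4 * (contr_const C0 + 1))) (e / (C0 * 2 * (contr_const C0 + 1))))"
  have \<delta>p: "0 < \<delta>" using r C0p K0 assms unfolding \<delta>_def by simp
  have d: "\<delta> \<le> r / (4 * C0)" "\<delta> \<le> 1 / (2 * C0)" "\<delta> \<le> 1 / (4 * (contr_const C0 + 1))" "\<delta> \<le> e / (C0 * 2 * (contr_const C0 + 1))"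
    unfolding \<delta>_def by auto
  have "2 * C0 * \<delta> \<le> r / 2" using mult_left_mono[OF d(1), of "2 * C0"] C0p by simp
  moreover have "2 * C0 * \<delta> \<le> 1" using mult_left_mono[OF d(2), of "2 * C0"] C0p by simp
  ultimately have small: "small C0 \<delta>" using \<delta>p r by (simp add: small_def)
  have KK1: "contr_const C0 * \<delta> \<le> (contr_const C0 + 1) * \<delta>" using \<delta>p by simp
  also have "\<dots> \<le> (contr_const C0 + 1) * (1 / (4 * (contr_const C0 + 1)))" using K0 by (intro mult_left_mono d(3)) auto
  also have "\<dots> = 1/4" using K0 by (simp add: field_simps)
  finally have k: "contr_const C0 * \<delta> \<le> 1/4" .
  have ke: "C0 * (2 * contr_const C0 * \<delta>) \<le> e"
  proof -
    have "C0 * (2 * contr_const C0 * \<delta>) \<le> C0 * 2 * ((contr_const C0 + 1) * \<delta>)" using KK1 C0p by simp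
    also have "\<dots> = C0 * 2 * (contr_const C0 + 1) * \<delta>" by simp
    also have "\<dots> \<le> e" using mult_left_mono[OF d(4), of "C0 * 2 * (contr_const C0 + 1)"] K0 C0p by simp
    finally show ?thesis .
  qed
  have "\<exists>H. \<forall>\<theta>. norm \<theta> \<le> \<delta> \<longrightarrow> symmetric_density \<delta> (H \<theta>) \<and> \<Phi> \<theta> (H \<theta>) = H \<theta>"
    using fixed_point[OF C0 small k] by (intro choice) metis
  then obtain H where H: "\<And>\<theta>. norm \<theta> \<le> \<delta> \<Longrightarrow> symmetric_density \<delta> (H \<theta>)" "\<And>\<theta>. norm \<theta> \<le> \<delta> \<Longrightarrow> \<Phi> \<theta> (H \<theta>) = H \<theta>" by blast
  have hoelder_disc: "hoelder_disc \<delta> (H \<theta>)" if "norm \<theta> \<le> \<delta>" for \<theta> using H(1)[OF that] by (simp add: symmetric_density_def)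
  have H0: "H 0 = (\<lambda>_. 0)"
  proof -
    have "hoelder_disc (2 * contr_const C0 * \<delta> * norm (0 - 0 :: 'e\<times>'e\<times>'e)) (\<lambda>z. H 0 z - 0)"
      by (rule fixed_point_lipschitz[OF C0 small k _ _ H(1) symmetric_density_0 H(2) \<Phi>_00]) (use \<delta>p in auto)
    then show ?thesis by (auto simp: hoelder_disc_def hoelder_def)
  qed
  let ?w = "\<lambda>\<theta>. W \<theta> (H \<theta>)" and ?wd = "\<lambda>\<theta> \<eta>. WD \<eta> \<theta> (H \<theta>)"
  have "disc_family e \<delta> ?w ?wd"
    unfolding disc_family_def
  proof (intro conjI allI impI ballI)
    fix \<theta> :: "'e \<times> 'e \<times> 'e" assume \<theta>: "norm \<theta> \<le> \<delta>"
    note a = hoelder_disc[OF \<theta>]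
    show "(?w \<theta> has_derivative (\<lambda>\<eta>. ?wd \<theta> \<eta> z)) (at z)" for z by (rule W_derivative[OF a])
    show "continuous_on UNIV (?wd \<theta> \<eta>)" for \<eta>
    proof -
      have "linear (\<lambda>\<eta>. dcauchy_tr \<eta> (H \<theta>) z)" for z using cauchy_tr_derivative[OF a] has_derivative_linear by blast
      then have "dcauchy_tr \<eta> (H \<theta>) = (\<lambda>z. Re \<eta> *\<^sub>R dcauchy_tr 1 (H \<theta>) z + Im \<eta> *\<^sub>R dcauchy_tr \<i> (H \<theta>) z)"
        using complex_linear by blast
      moreover have "continuous_on UNIV (dcauchy_tr 1 (H \<theta>))" "continuous_on UNIV (dcauchy_tr \<i> (H \<theta>))"
        by (auto intro!: hoelder_continuous_on[OF dcauchy_tr_hoelder[OF a]])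
      ultimately have "continuous_on UNIV (dcauchy_tr \<eta> (H \<theta>))" by (simp add: continuous_intros)
      then show ?thesis unfolding WD_def[abs_def] \<phi>d_def
        by (intro continuous_intros cmul.continuous_on) auto
    qed
    show "?w \<theta> z \<in> ball 0 r" if "z \<in> half_disc" for z by (rule W_in_ball[OF C0 small a \<theta> that])
    show "R (?w \<theta> z) = ?w \<theta> z" if "Im z = 0" for z by (rule W_real[OF H(1)[OF \<theta>] that])
    show "?w \<theta> (\<i> * of_real t0) = fst \<theta>" "?w \<theta> (\<i> * of_real t1) = fst (snd \<theta>)"
      using W_at[of "fst \<theta>" "fst (snd \<theta>)" "snd (snd \<theta>)" "H \<theta>"] by auto
    show "?wd \<theta> 1 z + J0 (?wd \<theta> \<i> z) =
          blinfun_apply (A (?w \<theta> z)) (?wd \<theta> 1 z + J0 (?wd \<theta> \<i> z)) + blinfun_apply (B (?w \<theta> z)) (?wd \<theta> \<i> z)"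
      if "z \<in> half_disc" "norm z \<le> 1" for z
    proof -
      have "\<Phi> \<theta> (H \<theta>) z = rhs \<theta> (H \<theta>) z" using that by (simp add: \<Phi>_def reflection_ext_def half_disc_def)
      then have "H \<theta> z = rhs \<theta> (H \<theta>) z" by (simp only: H(2)[OF \<theta>])
      moreover have "cutoff z = 1" using that by (simp add: cutoff_def)
      ultimately show ?thesis using W_dbar[OF a, of \<theta> z] by (simp add: rhs_def)
    qed
    fix \<theta>' :: "'e \<times> 'e \<times> 'e" and z assume \<theta>': "norm \<theta>' \<le> \<delta>" and z: "z \<in> half_disc"
    let ?d = "\<lambda>z. H \<theta> z - H \<theta>' z"
    have ad: "hoelder_disc (2 * contr_const C0 * \<delta> * norm (\<theta> - \<theta>')) ?d"
      by (rule fixed_point_lipschitz[OF C0 small k \<theta> \<theta>' H(1)[OF \<theta>] H(1)[OF \<theta>'] H(2)[OF \<theta>] H(2)[OF \<theta>']])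
    have "(?w \<theta> z - ?w \<theta>' z) - (\<phi> \<theta> z - \<phi> \<theta>' z) = W 0 ?d z"
      unfolding W_diff[OF a hoelder_disc[OF \<theta>']] using \<phi>_diff(1)[of 0 "node_values ?d" z] \<phi>_diff(1)[of 0 0 z]
      by (simp add: W_def \<phi>_diff)
    moreover have Wb: "hoelder half_disc (C0 * (M + \<epsilon>)) (W \<theta> h)" if "hoelder_disc M h" "norm \<theta> \<le> \<epsilon>" for M \<epsilon> \<theta> h
      using C0 that unfolding Wbound_def by blast
    have "hoelder half_disc (C0 * (2 * contr_const C0 * \<delta> * norm (\<theta> - \<theta>') + 0)) (W 0 ?d)"
      by (rule Wb[OF ad]) simp
    from hoelderD1[OF this z] have "norm (W 0 ?d z) \<le> C0 * (2 * contr_const C0 * \<delta>) * norm (\<theta> - \<theta>')" by (simp add: mult.assoc)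
    ultimately have "norm ((?w \<theta> z - ?w \<theta>' z) - (\<phi> \<theta> z - \<phi> \<theta>' z)) \<le> C0 * (2 * contr_const C0 * \<delta>) * norm (\<theta> - \<theta>')"
      by simp
    also have "\<dots> \<le> e * norm (\<theta> - \<theta>')" using ke by (intro mult_right_mono) auto
    finally show "norm ((?w \<theta> z - ?w \<theta>' z) - (\<phi> \<theta> z - \<phi> \<theta>' z)) \<le> e * norm (\<theta> - \<theta>')" .
  next
    show "W 0 (H 0) = (\<lambda>_. 0)" unfolding H0 using W_00 by auto
  qed
  then show ?thesis using \<delta>p by blast
qed

end

section \<open>Calculus of maps with Lipschitz differential\<close>

lemma C11I:
  assumes "0 \<le> L" "\<And>a b. a \<in> X \<Longrightarrow> b \<in> X \<Longrightarrow> norm (F a - F b) \<le> L * norm (a - b)"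
    "\<And>a b c d p q r. a \<in> X \<Longrightarrow> b \<in> X \<Longrightarrow> c \<in> X \<Longrightarrow> d \<in> X \<Longrightarrow> norm (a - b) \<le> p \<Longrightarrow> norm (c - d) \<le> p \<Longrightarrow>
      norm (a - c) \<le> q \<Longrightarrow> norm (b - d) \<le> q \<Longrightarrow> norm ((a - b) - (c - d)) \<le> r \<Longrightarrow>
      norm ((F a - F b) - (F c - F d)) \<le> L * (r + p * q)"
  shows "C11 X L F"
  unfolding C11_def using assms by blast

lemma C11_mono:
  assumes "C11 X L F" "L \<le> L'" shows "C11 X L' F"
proof (rule C11I)
  show "0 \<le> L'" using assms C11D0 by (meson order_trans)
  show "norm (F a - F b) \<le> L' * norm (a - b)" if "a \<in> X" "b \<in> X" for a b
    using C11D1[OF assms(1) that] mult_right_mono[OF assms(2), of "norm (a - b)"] by simp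
  fix a b c d p q r assume *: "a \<in> X" "b \<in> X" "c \<in> X" "d \<in> X" "norm (a - b) \<le> p" "norm (c - d) \<le> p"
      "norm (a - c) \<le> q" "norm (b - d) \<le> q" "norm ((a - b) - (c - d)) \<le> r"
  have "0 \<le> p" "0 \<le> q" "0 \<le> r" using *(5,7,9) norm_ge_zero order_trans by blast+
  then show "norm ((F a - F b) - (F c - F d)) \<le> L' * (r + p * q)"
    using C11D2[OF assms(1) *] mult_right_mono[OF assms(2), of "r + p * q"] by simp
qed

lemma C11_subset: "C11 X L F \<Longrightarrow> Y \<subseteq> X \<Longrightarrow> C11 Y L F"
  unfolding C11_def by blast

lemma C11_cong: "C11 X L F \<Longrightarrow> (\<And>x. x \<in> X \<Longrightarrow> F x = G x) \<Longrightarrow> C11 X L G"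
  unfolding C11_def by simp

lemma C11_const: "C11 X 0 (\<lambda>_. c)"
  by (auto simp: C11_def)

lemma C11_add:
  assumes "C11 X L F" "C11 X M G" shows "C11 X (L + M) (\<lambda>x. F x + G x)"
proof (rule C11I)
  show "0 \<le> L + M" using assms C11D0 by (meson add_nonneg_nonneg)
  show "norm (F a + G a - (F b + G b)) \<le> (L + M) * norm (a - b)" if "a \<in> X" "b \<in> X" for a b
    using norm_triangle_mono[OF C11D1[OF assms(1) that] C11D1[OF assms(2) that]] by (simp add: algebra_simps)
  fix a b c d p q r assume *: "a \<in> X" "b \<in> X" "c \<in> X" "d \<in> X" "norm (a - b) \<le> p" "norm (c - d) \<le> p"
      "norm (a - c) \<le> q" "norm (b - d) \<le> q" "norm ((a - b) - (c - d)) \<le> r"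
  show "norm ((F a + G a - (F b + G b)) - (F c + G c - (F d + G d))) \<le> (L + M) * (r + p * q)"
    using norm_triangle_mono[OF C11D2[OF assms(1) *] C11D2[OF assms(2) *]] by (simp add: algebra_simps)
qed

lemma C11_linear:
  assumes "bounded_linear T" "\<And>x. norm (T x) \<le> C * norm x" "0 \<le> C" "C11 X L F"
  shows "C11 X (C * L) (\<lambda>x. T (F x))"
proof (rule C11I)
  note T = linear_diff[OF bounded_linear.linear[OF assms(1)], symmetric]
  show "0 \<le> C * L" using assms(3) C11D0[OF assms(4)] by simp
  show "norm (T (F a) - T (F b)) \<le> C * L * norm (a - b)" if "a \<in> X" "b \<in> X" for a b
    unfolding T using order_trans[OF assms(2) mult_left_mono[OF C11D1[OF assms(4) that] assms(3)]] by (simp add: mult.assoc)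
  fix a b c d p q r assume *: "a \<in> X" "b \<in> X" "c \<in> X" "d \<in> X" "norm (a - b) \<le> p" "norm (c - d) \<le> p"
      "norm (a - c) \<le> q" "norm (b - d) \<le> q" "norm ((a - b) - (c - d)) \<le> r"
  show "norm ((T (F a) - T (F b)) - (T (F c) - T (F d))) \<le> C * L * (r + p * q)"
    unfolding T using order_trans[OF assms(2) mult_left_mono[OF C11D2[OF assms(4) *] assms(3)]] by (simp add: mult.assoc)
qed

text \<open>
  For the coefficients of the equation only the existence of a constant matters.
\<close>

definition C11_ex :: "'a set \<Rightarrow> ('a::real_normed_vector \<Rightarrow> 'b::real_normed_vector) \<Rightarrow> bool" where
  "C11_ex X F \<longleftrightarrow> (\<exists>L. C11 X L F)"

lemma C11_ex_const: "C11_ex X (\<lambda>_. c)" unfolding C11_ex_def using C11_const by blast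

lemma C11_ex_add: "C11_ex X F \<Longrightarrow> C11_ex X G \<Longrightarrow> C11_ex X (\<lambda>x. F x + G x)"
  unfolding C11_ex_def using C11_add by blast

lemma C11_ex_linear: fixes T :: "'b::real_normed_vector \<Rightarrow> 'c::real_normed_vector" shows "bounded_linear T \<Longrightarrow> C11_ex X F \<Longrightarrow> C11_ex X (\<lambda>x. T (F x))"
proof -
  assume T: "bounded_linear T" and F: "C11_ex X F"
  obtain C where "C > 0" "\<And>x. norm (T x) \<le> norm x * C" using bounded_linear.pos_bounded[OF T] by blast
  then show ?thesis using F C11_linear[OF T, of C] unfolding C11_ex_def by (metis less_imp_le mult.commute)
qed

lemma C11_ex_id: "C11_ex X (\<lambda>x. x)"
proof -
  have "C11 X 1 (\<lambda>x. x)"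
  proof (rule C11I)
    fix a b c d :: 'a and p q r assume *: "norm (a - b) \<le> p" "norm (a - c) \<le> q" "norm ((a - b) - (c - d)) \<le> r"
    have "0 \<le> p" "0 \<le> q" using *(1,2) norm_ge_zero order_trans by blast+
    then show "norm ((a - b) - (c - d)) \<le> 1 * (r + p * q)" using *(3) by (simp add: add_increasing2)
  qed auto
  then show ?thesis by (auto simp: C11_ex_def)
qed

lemma C11_ex_minus: "C11_ex X F \<Longrightarrow> C11_ex X G \<Longrightarrow> C11_ex X (\<lambda>x. F x - G x)"
  using C11_ex_add[of X F "\<lambda>x. - G x"] C11_ex_linear[of uminus X G] by (simp add: bounded_linear_minus bounded_linear_ident)

lemma C11_ex_sum: "(\<And>i. i \<in> I \<Longrightarrow> C11_ex X (F i)) \<Longrightarrow> C11_ex X (\<lambda>x. \<Sum>i\<in>I. F i x)"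
  by (induction I rule: infinite_finite_induct) (auto intro: C11_ex_const C11_ex_add)

lemma C11_ex_bounded:
  assumes "C11_ex X F" "bounded X" shows "\<exists>B\<ge>0. \<forall>x\<in>X. norm (F x) \<le> B"
proof (cases "X = {}")
  case False
  obtain L where L: "C11 X L F" using assms by (auto simp: C11_ex_def)
  obtain x0 where x0: "x0 \<in> X" using False by blast
  obtain K where K: "\<And>x. x \<in> X \<Longrightarrow> norm x \<le> K" using assms(2) by (auto simp: bounded_iff)
  have "norm (F x) \<le> norm (F x0) + L * (K + K)" if "x \<in> X" for x
  proof -
    have "norm (F x) \<le> norm (F x0) + norm (F x - F x0)" by (metis add.commute norm_triangle_sub)
    also have "norm (F x - F x0) \<le> L * norm (x - x0)" by (rule C11D1[OF L that x0])
    also have "\<dots> \<le> L * (K + K)" using K[OF that] K[OF x0] norm_triangle_ineq4[of x x0] C11D0[OF L] by (intro mult_left_mono) auto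
    finally show ?thesis by simp
  qed
  then have "\<forall>x\<in>X. norm (F x) \<le> max 0 (norm (F x0) + L * (K + K))" by (auto simp: le_max_iff_disj)
  then show ?thesis by (intro exI[of _ "max 0 (norm (F x0) + L * (K + K))"]) auto
qed auto

lemma C11_ex_bilinear:
  assumes B: "bounded_bilinear pr" and F: "C11_ex X F" and G: "C11_ex X G" and X: "bounded X"
  shows "C11_ex X (\<lambda>x. pr (F x) (G x))"
proof -
  interpret bounded_bilinear pr by fact
  obtain L M where L: "C11 X L F" and M: "C11 X M G" using F G by (auto simp: C11_ex_def)
  obtain K where K: "K \<ge> 0" "\<And>x. x \<in> X \<Longrightarrow> norm (F x) \<le> K" using C11_ex_bounded[OF F X] by blast
  obtain K' where K': "K' \<ge> 0" "\<And>x. x \<in> X \<Longrightarrow> norm (G x) \<le> K'" using C11_ex_bounded[OF G X] by blast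
  obtain C where C: "C > 0" "\<And>a b. norm (pr a b) \<le> norm a * norm b * C" using pos_bounded by blast
  have bd: "norm (pr u v) \<le> C * (s * t)" if "norm u \<le> s" "norm v \<le> t" for u v s t
  proof -
    have "norm u * norm v \<le> s * t" using that norm_ge_zero order_trans by (intro mult_mono) (auto intro: order_trans[OF norm_ge_zero])
    then have "norm u * norm v * C \<le> s * t * C" using C by (intro mult_right_mono) auto
    then show ?thesis using C(2)[of u v] by (simp add: mult.commute)
  qed
  note L0 = C11D0[OF L] and M0 = C11D0[OF M]
  have "C11 X (C * (L * K' + K * M + L * M + L * M)) (\<lambda>x. pr (F x) (G x))"
  proof (rule C11I)
    show "0 \<le> C * (L * K' + K * M + L * M + L * M)" using C L0 M0 K(1) K'(1) by simp
    fix a b assume ab: "a \<in> X" "b \<in> X"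
    have "pr (F a) (G a) - pr (F b) (G b) = pr (F a - F b) (G a) + pr (F b) (G a - G b)" by (simp add: diff_left diff_right)
    also have "norm \<dots> \<le> C * (L * norm (a - b) * K') + C * (K * (M * norm (a - b)))"
      by (rule norm_triangle_mono[OF bd bd]) (use ab K K' C11D1[OF L] C11D1[OF M] in auto)
    also have "\<dots> = C * (L * K' + K * M) * norm (a - b)" by (simp add: algebra_simps)
    also have "\<dots> \<le> C * (L * K' + K * M + L * M + L * M) * norm (a - b)"
      using C L0 M0 by (intro mult_right_mono mult_left_mono) auto
    finally show "norm (pr (F a) (G a) - pr (F b) (G b)) \<le> C * (L * K' + K * M + L * M + L * M) * norm (a - b)" .
  next
    fix a b c d p q r assume *: "a \<in> X" "b \<in> X" "c \<in> X" "d \<in> X" "norm (a - b) \<le> p" "norm (c - d) \<le> p"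
      "norm (a - c) \<le> q" "norm (b - d) \<le> q" "norm ((a - b) - (c - d)) \<le> r"
    have nn: "0 \<le> p" "0 \<le> q" "0 \<le> r" using *(5,7,9) norm_ge_zero order_trans by blast+
    have lip: "norm (F x - F y) \<le> L * s" "norm (G x - G y) \<le> M * s" if "x \<in> X" "y \<in> X" "norm (x - y) \<le> s" for x y s
      using order_trans[OF C11D1[OF L that(1,2)] mult_left_mono[OF that(3) L0]]
        order_trans[OF C11D1[OF M that(1,2)] mult_left_mono[OF that(3) M0]] by auto
    \<comment> \<open>The second difference of a product: two terms with a second difference of one factor, two
      with first differences of both.\<close>
    have "(pr (F a) (G a) - pr (F b) (G b)) - (pr (F c) (G c) - pr (F d) (G d)) =
      (pr ((F a - F b) - (F c - F d)) (G a) + pr (F d) ((G a - G b) - (G c - G d))) +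
      (pr (F b - F d) (G a - G b) + pr (F c - F d) (G a - G c))"
      by (simp add: diff_left diff_right)
    also have "norm \<dots> \<le> (C * ((L * (r + p * q)) * K') + C * (K * (M * (r + p * q)))) + (C * ((L * q) * (M * p)) + C * ((L * p) * (M * q)))"
      by (intro norm_triangle_mono bd lip * C11D2[OF L *] C11D2[OF M *] K K')
    also have "\<dots> = C * ((L * K' + K * M) * (r + p * q) + (L * M + L * M) * (p * q))" by (simp add: algebra_simps)
    also have "\<dots> \<le> C * ((L * K' + K * M) * (r + p * q) + (L * M + L * M) * (r + p * q))"
      using C L0 M0 nn by (intro mult_left_mono add_left_mono) auto
    also have "\<dots> = C * (L * K' + K * M + L * M + L * M) * (r + p * q)" by (simp add: algebra_simps)
    finally show "norm ((pr (F a) (G a) - pr (F b) (G b)) - (pr (F c) (G c) - pr (F d) (G d))) \<le> \<dots>" .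
  qed
  then show ?thesis by (auto simp: C11_ex_def)
qed

lemma C11_ex_compose:
  assumes F: "C11_ex Y F" and G: "C11_ex X G" and "\<And>x. x \<in> X \<Longrightarrow> G x \<in> Y"
  shows "C11_ex X (\<lambda>x. F (G x))"
proof -
  obtain L M where L: "C11 Y L F" and M: "C11 X M G" using F G by (auto simp: C11_ex_def)
  note L0 = C11D0[OF L] and M0 = C11D0[OF M]
  have "C11 X (L * M + L * M * M) (\<lambda>x. F (G x))"
  proof (rule C11I)
    show "0 \<le> L * M + L * M * M" using L0 M0 by simp
    fix a b assume ab: "a \<in> X" "b \<in> X"
    have "norm (F (G a) - F (G b)) \<le> L * norm (G a - G b)" by (rule C11D1[OF L]) (use ab assms in auto)
    also have "\<dots> \<le> L * (M * norm (a - b))" by (intro mult_left_mono C11D1[OF M] ab L0)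
    also have "\<dots> \<le> (L * M + L * M * M) * norm (a - b)" using L0 M0 by (simp add: algebra_simps)
    finally show "norm (F (G a) - F (G b)) \<le> (L * M + L * M * M) * norm (a - b)" .
  next
    fix a b c d p q r assume *: "a \<in> X" "b \<in> X" "c \<in> X" "d \<in> X" "norm (a - b) \<le> p" "norm (c - d) \<le> p"
      "norm (a - c) \<le> q" "norm (b - d) \<le> q" "norm ((a - b) - (c - d)) \<le> r"
    have nn: "0 \<le> p" "0 \<le> q" "0 \<le> r" using *(5,7,9) norm_ge_zero order_trans by blast+
    have lip: "norm (G x - G y) \<le> M * s" if "x \<in> X" "y \<in> X" "norm (x - y) \<le> s" for x y s
      using order_trans[OF C11D1[OF M that(1,2)] mult_left_mono[OF that(3) M0]] .
    have "norm ((F (G a) - F (G b)) - (F (G c) - F (G d))) \<le> L * (M * (r + p * q) + (M * p) * (M * q))"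
      by (rule C11D2[OF L]) (use * assms(3) lip C11D2[OF M *] in auto)
    also have "\<dots> = (L * M) * (r + p * q) + (L * M * M) * (p * q)" by (simp add: algebra_simps)
    also have "\<dots> \<le> (L * M) * (r + p * q) + (L * M * M) * (r + p * q)"
      using L0 M0 nn by (intro add_left_mono mult_left_mono) auto
    finally show "norm ((F (G a) - F (G b)) - (F (G c) - F (G d))) \<le> (L * M + L * M * M) * (r + p * q)" by (simp add: algebra_simps)
  qed
  then show ?thesis by (auto simp: C11_ex_def)
qed

lemma norm_blinfun_Basis:
  fixes T :: "'e::euclidean_space \<Rightarrow>\<^sub>L 'b::real_normed_vector"
  shows "norm T \<le> (\<Sum>b\<in>Basis. norm (blinfun_apply T b))"
proof (rule norm_blinfun_bound)
  fix x :: 'e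
  have "blinfun_apply T x = (\<Sum>b\<in>Basis. (x \<bullet> b) *\<^sub>R blinfun_apply T b)"
    by (metis (no_types, lifting) blinfun.scaleR_right blinfun.sum_right euclidean_representation sum.cong)
  also have "norm \<dots> \<le> (\<Sum>b\<in>Basis. norm x * norm (blinfun_apply T b))"
    by (rule order_trans[OF norm_sum sum_mono]) (auto intro!: mult_right_mono Basis_le_norm)
  finally show "norm (blinfun_apply T x) \<le> (\<Sum>b\<in>Basis. norm (blinfun_apply T b)) * norm x"
    by (simp add: sum_distrib_left mult.commute)
qed (simp add: sum_nonneg)

lemma C11_ex_blinfun:
  fixes F :: "'x::real_normed_vector \<Rightarrow> 'e::euclidean_space \<Rightarrow>\<^sub>L 'b::real_normed_vector"
  assumes "\<And>v. C11_ex X (\<lambda>x. blinfun_apply (F x) v)"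
  shows "C11_ex X F"
proof -
  obtain L where L: "\<And>v. C11 X (L v) (\<lambda>x. blinfun_apply (F x) v)" using assms unfolding C11_ex_def by metis
  have "C11 X (\<Sum>b\<in>Basis. L b) F"
  proof (rule C11I)
    show "0 \<le> (\<Sum>b\<in>Basis. L b)" using C11D0[OF L] by (intro sum_nonneg) auto
    show "norm (F a - F b) \<le> (\<Sum>b\<in>Basis. L b) * norm (a - b)" if "a \<in> X" "b \<in> X" for a b
    proof -
      have "norm (F a - F b) \<le> (\<Sum>v\<in>Basis. norm (blinfun_apply (F a - F b) v))" by (rule norm_blinfun_Basis)
      also have "\<dots> \<le> (\<Sum>v\<in>Basis. L v * norm (a - b))"
        using C11D1[OF L that] by (intro sum_mono) (simp add: blinfun.diff_left)
      finally show ?thesis by (simp add: sum_distrib_right)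
    qed
    fix a b c d p q r assume *: "a \<in> X" "b \<in> X" "c \<in> X" "d \<in> X" "norm (a - b) \<le> p" "norm (c - d) \<le> p"
      "norm (a - c) \<le> q" "norm (b - d) \<le> q" "norm ((a - b) - (c - d)) \<le> r"
    have "norm ((F a - F b) - (F c - F d)) \<le> (\<Sum>v\<in>Basis. norm (blinfun_apply ((F a - F b) - (F c - F d)) v))" by (rule norm_blinfun_Basis)
    also have "\<dots> \<le> (\<Sum>v\<in>Basis. L v * (r + p * q))"
      using C11D2[OF L *] by (intro sum_mono) (simp add: blinfun.diff_left)
    finally show "norm ((F a - F b) - (F c - F d)) \<le> (\<Sum>b\<in>Basis. L b) * (r + p * q)" by (simp add: sum_distrib_right)
  qed
  then show ?thesis by (auto simp: C11_ex_def)
qed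

lemma linear_Basis_expansion:
  fixes f :: "'e::euclidean_space \<Rightarrow> 'b::real_vector"
  assumes "linear f" shows "f v = (\<Sum>b\<in>Basis. (v \<bullet> b) *\<^sub>R f b)"
proof -
  have "f v = f (\<Sum>b\<in>Basis. (v \<bullet> b) *\<^sub>R b)" by (simp add: euclidean_representation)
  then show ?thesis by (simp only: linear_sum[OF assms] linear_scale[OF assms])
qed

lemma C1_lipschitz_on_cball:
  fixes f :: "'e::euclidean_space \<Rightarrow> 'b::real_normed_vector"
  assumes "Ck_on 1 S f" "open S" "cball y \<rho> \<subseteq> S"
  obtains L where "0 \<le> L" "\<And>x v. x \<in> cball y \<rho> \<Longrightarrow> norm (frechet_derivative f (at x) v) \<le> L * norm v"
    "\<And>a b. a \<in> cball y \<rho> \<Longrightarrow> b \<in> cball y \<rho> \<Longrightarrow> norm (f a - f b) \<le> L * norm (a - b)"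
proof -
  have d: "(f has_derivative frechet_derivative f (at x)) (at x)" if "x \<in> cball y \<rho>" for x
    using assms(1,3) that by (auto simp flip: frechet_derivative_works)
  have "\<exists>B. \<forall>x\<in>cball y \<rho>. norm (frechet_derivative f (at x) v) \<le> B" for v
  proof -
    have "continuous_on (cball y \<rho>) (\<lambda>x. frechet_derivative f (at x) v)"
      using assms(1,3) by (auto intro: continuous_on_subset)
    then have "bounded ((\<lambda>x. frechet_derivative f (at x) v) ` cball y \<rho>)"
      using compact_continuous_image compact_imp_bounded compact_cball by blast
    then show ?thesis by (auto simp: bounded_iff)
  qed
  then obtain B where B: "\<And>v x. x \<in> cball y \<rho> \<Longrightarrow> norm (frechet_derivative f (at x) v) \<le> B v" by metis
  define L where "L = (\<Sum>b\<in>Basis. max 0 (B b))"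
  have L: "norm (frechet_derivative f (at x) v) \<le> L * norm v" if x: "x \<in> cball y \<rho>" for x v
  proof -
    have "frechet_derivative f (at x) v = (\<Sum>b\<in>Basis. (v \<bullet> b) *\<^sub>R frechet_derivative f (at x) b)"
      by (rule linear_Basis_expansion[OF has_derivative_linear[OF d[OF x]]])
    also have "norm \<dots> \<le> (\<Sum>b\<in>Basis. norm v * max 0 (B b))"
    proof (rule order_trans[OF norm_sum sum_mono])
      fix b :: 'e assume b: "b \<in> Basis"
      show "norm ((v \<bullet> b) *\<^sub>R frechet_derivative f (at x) b) \<le> norm v * max 0 (B b)"
        using Basis_le_norm[OF b, of v] B[OF x, of b] by (simp add: mult_mono le_max_iff_disj)
    qed
    finally show ?thesis by (simp add: L_def sum_distrib_left mult.commute)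
  qed
  show thesis
  proof (rule that[OF _ L])
    show "0 \<le> L" by (simp add: L_def sum_nonneg)
    show "norm (f a - f b) \<le> L * norm (a - b)" if "a \<in> cball y \<rho>" "b \<in> cball y \<rho>" for a b
    proof (rule differentiable_bound[where S = "cball y \<rho>" and f' = "\<lambda>x. frechet_derivative f (at x)"])
      show "(f has_derivative frechet_derivative f (at x)) (at x within cball y \<rho>)" if "x \<in> cball y \<rho>" for x
        using d[OF that] by (rule has_derivative_at_withinI)
      show "onorm (frechet_derivative f (at x)) \<le> L" if "x \<in> cball y \<rho>" for x
        by (rule onorm_le) (rule L[OF that])
    qed (use that in auto)
  qed
qed

text \<open>
  The mean value theorem is applied to the difference of \<open>f\<close> along the segments
  from \<open>b\<close> to \<open>a\<close> and from \<open>d'\<close> to \<open>c\<close>.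
\<close>

lemma C2_C11_ex:
  fixes f :: "'e::euclidean_space \<Rightarrow> 'b::real_normed_vector"
  assumes f: "Ck_on 2 S f" and S: "open S" "cball y \<rho> \<subseteq> S"
  shows "C11_ex (cball y \<rho>) f"
proof -
  have two: "(2::nat) = Suc 1" by simp
  have Suc: "\<forall>x\<in>S. f differentiable (at x)" "Ck_on 1 S (\<lambda>x. frechet_derivative f (at x) v)" for v
    using f unfolding two Ck_on.simps(2)[of 1] by blast+
  note f1 = Suc(2)
  have c1: "Ck_on 1 S f" using f1 Suc by (auto simp: numeral_2_eq_2 intro!: differentiable_imp_continuous_on differentiable_at_imp_differentiable_on)
  have d: "(f has_derivative frechet_derivative f (at x)) (at x)" if "x \<in> cball y \<rho>" for x
    using Suc S(2) that by (auto simp flip: frechet_derivative_works)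
  obtain L1 where L1: "0 \<le> L1" "\<And>x v. x \<in> cball y \<rho> \<Longrightarrow> norm (frechet_derivative f (at x) v) \<le> L1 * norm v"
    "\<And>a b. a \<in> cball y \<rho> \<Longrightarrow> b \<in> cball y \<rho> \<Longrightarrow> norm (f a - f b) \<le> L1 * norm (a - b)"
    using C1_lipschitz_on_cball[OF c1 S] by blast
  have "\<exists>L\<ge>0. \<forall>a\<in>cball y \<rho>. \<forall>b\<in>cball y \<rho>. norm (frechet_derivative f (at a) v - frechet_derivative f (at b) v) \<le> L * norm (a - b)" for v
    using C1_lipschitz_on_cball[OF f1[of v] S] by metis
  then obtain M where M: "\<And>v. 0 \<le> M v" "\<And>v a b. a \<in> cball y \<rho> \<Longrightarrow> b \<in> cball y \<rho> \<Longrightarrow>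
      norm (frechet_derivative f (at a) v - frechet_derivative f (at b) v) \<le> M v * norm (a - b)" by metis
  define L2 where "L2 = (\<Sum>b\<in>Basis. M b)"
  have L2: "norm (frechet_derivative f (at a) v - frechet_derivative f (at b) v) \<le> L2 * norm (a - b) * norm v"
    if ab: "a \<in> cball y \<rho>" "b \<in> cball y \<rho>" for a b v
  proof -
    have "linear (\<lambda>v. frechet_derivative f (at a) v - frechet_derivative f (at b) v)"
      using has_derivative_linear[OF d[OF ab(1)]] has_derivative_linear[OF d[OF ab(2)]] by (rule linear_compose_sub)
    then have "frechet_derivative f (at a) v - frechet_derivative f (at b) v =
       (\<Sum>e\<in>Basis. (v \<bullet> e) *\<^sub>R (frechet_derivative f (at a) e - frechet_derivative f (at b) e))"
      by (rule linear_Basis_expansion)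
    also have "norm \<dots> \<le> (\<Sum>e\<in>Basis. norm v * (M e * norm (a - b)))"
    proof (rule order_trans[OF norm_sum sum_mono])
      fix e :: 'e assume e: "e \<in> Basis"
      show "norm ((v \<bullet> e) *\<^sub>R (frechet_derivative f (at a) e - frechet_derivative f (at b) e)) \<le> norm v * (M e * norm (a - b))"
        using Basis_le_norm[OF e, of v] M(2)[OF ab, of e] by (simp add: mult_mono)
    qed
    finally show ?thesis by (simp add: L2_def sum_distrib_left sum_distrib_right ac_simps)
  qed
  have L20: "0 \<le> L2" using M(1) by (simp add: L2_def sum_nonneg)
  have "C11 (cball y \<rho>) (L1 + L2) f"
  proof (rule C11I)
    show "0 \<le> L1 + L2" using L1 L20 by simp
    show "norm (f a - f b) \<le> (L1 + L2) * norm (a - b)" if "a \<in> cball y \<rho>" "b \<in> cball y \<rho>" for a b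
      using L1(3)[OF that] L20 by (simp add: distrib_right add_increasing2)
    fix a b c d' p q r assume *: "a \<in> cball y \<rho>" "b \<in> cball y \<rho>" "c \<in> cball y \<rho>" "d' \<in> cball y \<rho>"
      "norm (a - b) \<le> p" "norm (c - d') \<le> p"
      "norm (a - c) \<le> q" "norm (b - d') \<le> q" "norm ((a - b) - (c - d')) \<le> r"
    have nn: "0 \<le> p" "0 \<le> q" "0 \<le> r" using *(5,7,9) norm_ge_zero order_trans by blast+
    let ?X = "\<lambda>t::real. b + t *\<^sub>R (a - b)" and ?Y = "\<lambda>t::real. d' + t *\<^sub>R (c - d')"
    let ?g = "\<lambda>t. f (?X t) - f (?Y t)"
    have inX: "?X t \<in> cball y \<rho>" "?Y t \<in> cball y \<rho>" if "t \<in> {0..1}" for t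
    proof -
      have "?X t = (1 - t) *\<^sub>R b + t *\<^sub>R a" "?Y t = (1 - t) *\<^sub>R d' + t *\<^sub>R c" by (simp_all add: algebra_simps)
      then show "?X t \<in> cball y \<rho>" "?Y t \<in> cball y \<rho>"
        using convexD[OF convex_cball *(2,1), of "1 - t" t] convexD[OF convex_cball *(4,3), of "1 - t" t] that by auto
    qed
    have main: "norm (?g 1 - ?g 0) \<le> (L1 * r + L2 * q * p) * norm (1 - 0 :: real)"
    proof (rule differentiable_bound[where S = "{0..1::real}" and f' = "\<lambda>t s. frechet_derivative f (at (?X t)) (s *\<^sub>R (a - b)) - frechet_derivative f (at (?Y t)) (s *\<^sub>R (c - d'))"])
      fix t :: real assume t: "t \<in> {0..1}"
      have "((\<lambda>t. f (?X t)) has_derivative (\<lambda>s. frechet_derivative f (at (?X t)) (s *\<^sub>R (a - b)))) (at t within {0..1})"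
        by (rule has_derivative_compose[of ?X "\<lambda>s. s *\<^sub>R (a - b)", OF _ d[OF inX(1)[OF t]]]) (auto intro!: derivative_eq_intros)
      moreover have "((\<lambda>t. f (?Y t)) has_derivative (\<lambda>s. frechet_derivative f (at (?Y t)) (s *\<^sub>R (c - d')))) (at t within {0..1})"
        by (rule has_derivative_compose[of ?Y "\<lambda>s. s *\<^sub>R (c - d')", OF _ d[OF inX(2)[OF t]]]) (auto intro!: derivative_eq_intros)
      ultimately show "(?g has_derivative (\<lambda>s. frechet_derivative f (at (?X t)) (s *\<^sub>R (a - b)) - frechet_derivative f (at (?Y t)) (s *\<^sub>R (c - d')))) (at t within {0..1})"
        by (rule has_derivative_diff)
      have lin: "linear (frechet_derivative f (at (?X t)))" "linear (frechet_derivative f (at (?Y t)))"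
        using has_derivative_linear[OF d[OF inX(1)[OF t]]] has_derivative_linear[OF d[OF inX(2)[OF t]]] by auto
      have XY: "norm (?X t - ?Y t) \<le> q"
      proof -
        have "?X t - ?Y t = (1 - t) *\<^sub>R (b - d') + t *\<^sub>R (a - c)" by (simp add: algebra_simps)
        also have "norm \<dots> \<le> (1 - t) * q + t * q"
          by (rule norm_triangle_mono) (use t * in \<open>auto intro!: mult_left_mono\<close>)
        finally show ?thesis by (simp add: algebra_simps)
      qed
      show "onorm (\<lambda>s. frechet_derivative f (at (?X t)) (s *\<^sub>R (a - b)) - frechet_derivative f (at (?Y t)) (s *\<^sub>R (c - d'))) \<le> L1 * r + L2 * q * p"
      proof (rule onorm_le)
        fix s :: real
        have "frechet_derivative f (at (?X t)) (s *\<^sub>R (a - b)) - frechet_derivative f (at (?Y t)) (s *\<^sub>R (c - d')) =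
          s *\<^sub>R (frechet_derivative f (at (?X t)) ((a - b) - (c - d')) + (frechet_derivative f (at (?X t)) (c - d') - frechet_derivative f (at (?Y t)) (c - d')))"
          by (simp only: linear_scale[OF lin(1)] linear_scale[OF lin(2)] linear_diff[OF lin(1)]) (simp add: algebra_simps)
        also have "norm \<dots> \<le> norm s * (L1 * r + L2 * q * p)"
          unfolding norm_scaleR
        proof (intro mult_mono norm_triangle_mono)
          show "norm (frechet_derivative f (at (?X t)) ((a - b) - (c - d'))) \<le> L1 * r"
            by (rule order_trans[OF L1(2)[OF inX(1)[OF t]] mult_left_mono[OF *(9) L1(1)]])
          have "norm (frechet_derivative f (at (?X t)) (c - d') - frechet_derivative f (at (?Y t)) (c - d')) \<le> L2 * norm (?X t - ?Y t) * norm (c - d')"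
            by (rule L2[OF inX[OF t]])
          also have "\<dots> \<le> L2 * q * p" using XY *(6) L20 nn by (intro mult_mono mult_left_mono) auto
          finally show "norm (frechet_derivative f (at (?X t)) (c - d') - frechet_derivative f (at (?Y t)) (c - d')) \<le> L2 * q * p" .
        qed auto
        finally show "norm (frechet_derivative f (at (?X t)) (s *\<^sub>R (a - b)) - frechet_derivative f (at (?Y t)) (s *\<^sub>R (c - d'))) \<le> (L1 * r + L2 * q * p) * norm s"
          by (simp add: mult.commute)
      qed
    qed auto
    have eq: "?g 1 - ?g 0 = (f a - f b) - (f c - f d')" by simp
    have "L1 * r + L2 * q * p \<le> (L1 + L2) * (r + p * q)" using L1(1) L20 nn by (simp add: algebra_simps)
    then show "norm ((f a - f b) - (f c - f d')) \<le> (L1 + L2) * (r + p * q)" using main unfolding eq by simp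
  qed
  then show ?thesis by (auto simp: C11_ex_def)
qed

section \<open>Pseudoholomorphic half discs in coordinates\<close>

lemma C11_ex_cong: "C11_ex X F \<Longrightarrow> (\<And>x. x \<in> X \<Longrightarrow> F x = G x) \<Longrightarrow> C11_ex X G"
  unfolding C11_ex_def using C11_cong by blast

lemma C11_ex_subset: "C11_ex X F \<Longrightarrow> Y \<subseteq> X \<Longrightarrow> C11_ex Y F"
  unfolding C11_ex_def using C11_subset by blast

lemma C11_ex_continuous_on: "C11_ex X F \<Longrightarrow> continuous_on X F"
proof -
  assume "C11_ex X F"
  then obtain L where L: "C11 X L F" by (auto simp: C11_ex_def)
  have "L-lipschitz_on X F" by (rule lipschitz_onI) (use C11D0[OF L] C11D1[OF L] in \<open>auto simp: dist_norm\<close>)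
  then show ?thesis by (rule lipschitz_on_continuous_on)
qed

lemma smooth_on_C11_ex:
  assumes "smooth_on S f" "open S" "cball y \<rho> \<subseteq> S"
  shows "C11_ex (cball y \<rho>) f" "C11_ex (cball y \<rho>) (\<lambda>x. frechet_derivative f (at x) v)"
    "\<And>x. x \<in> S \<Longrightarrow> (f has_derivative frechet_derivative f (at x)) (at x)"
proof -
  have "Ck_on 2 S f" using assms(1) by (simp only: smooth_on_def)
  then show "C11_ex (cball y \<rho>) f" by (rule C2_C11_ex[OF _ assms(2,3)])
  have 3: "Ck_on (Suc 2) S f" using assms(1) by (simp only: smooth_on_def)
  then have "Ck_on 2 S (\<lambda>x. frechet_derivative f (at x) v)" unfolding Ck_on.simps(2)[of 2] by blast
  then show "C11_ex (cball y \<rho>) (\<lambda>x. frechet_derivative f (at x) v)" by (rule C2_C11_ex[OF _ assms(2,3)])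
  show "(f has_derivative frechet_derivative f (at x)) (at x)" if "x \<in> S" for x
    using 3 that unfolding Ck_on.simps(2)[of 2] frechet_derivative_works by blast
qed

context real_form
begin

lemma \<sigma>_J0: "\<sigma> (J0 v) = - \<tau> v" and \<tau>_J0: "\<tau> (J0 v) = \<sigma> v"
  by (simp_all add: \<sigma>_def \<tau>_def R_J0 J0_simps J0_J0 algebra_simps)

text \<open>
  \<open>F1\<close> and \<open>F2\<close> are the partial derivatives of the discs
  \<open>\<Psi> \<circ> w \<theta>\<close> in the two coordinate directions. The last
  condition says that on the axis the third component of the parameter acts like
  multiplication by a positive weight, up to a small error.
\<close>

definition attached_discs :: "('e \<Rightarrow> 'e \<Rightarrow> 'e) \<Rightarrow> real \<Rightarrow> ('e \<Rightarrow> 'e) \<Rightarrow> real \<Rightarrow> real \<Rightarrow> real \<Rightarrow>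
    ('e \<times> 'e \<times> 'e \<Rightarrow> complex \<Rightarrow> 'e) \<Rightarrow> ('e \<times> 'e \<times> 'e \<Rightarrow> complex \<Rightarrow> 'e) \<Rightarrow> ('e \<times> 'e \<times> 'e \<Rightarrow> complex \<Rightarrow> 'e) \<Rightarrow> bool" where
  "attached_discs Jc r \<Psi> K e \<delta> w F1 F2 \<longleftrightarrow> w 0 = (\<lambda>_. 0) \<and> (\<forall>\<theta>. norm \<theta> \<le> \<delta> \<longrightarrow>
    continuous_on half_disc (w \<theta>) \<and> w \<theta> ` half_disc \<subseteq> ball 0 r \<and>
    continuous_on half_disc (F1 \<theta>) \<and> continuous_on half_disc (F2 \<theta>) \<and>
    (\<forall>z\<in>half_disc. norm z \<le> 1 \<longrightarrow> ((\<lambda>z. \<Psi> (w \<theta> z)) has_derivative (\<lambda>\<eta>. Re \<eta> *\<^sub>R F1 \<theta> z + Im \<eta> *\<^sub>R F2 \<theta> z)) (at z) \<and>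
        F2 \<theta> z = Jc (\<Psi> (w \<theta> z)) (F1 \<theta> z)) \<and>
    (\<forall>z. Im z = 0 \<longrightarrow> R (w \<theta> z) = w \<theta> z) \<and>
    w \<theta> (\<i> * of_real t0) = fst \<theta> \<and> w \<theta> (\<i> * of_real t1) = fst (snd \<theta>) \<and>
    (\<forall>\<theta>'. norm \<theta>' \<le> \<delta> \<longrightarrow> (\<forall>z\<in>half_disc. norm (w \<theta> z - w \<theta>' z) \<le> (K + e) * norm (\<theta> - \<theta>')))) \<and>
    (\<forall>q q' c c' x. norm (q, q', c) \<le> \<delta> \<and> norm (q, q', c') \<le> \<delta> \<and> \<bar>x\<bar> \<le> 2 \<longrightarrow>
      norm ((w (q, q', c) (of_real x) - w (q, q', c') (of_real x)) - ((x^2 + t0^2) * (x^2 + t1^2)) *\<^sub>R (\<sigma> c - \<sigma> c')) \<le> e * norm (c - c'))"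

text \<open>
  \<open>\<Psi>\<close>, its radius and \<open>K\<close> do not depend on the error
  \<open>e\<close>, which may therefore be chosen in terms of them.
\<close>

definition coordinate_discs :: "'e set \<Rightarrow> ('e \<Rightarrow> 'e \<Rightarrow> 'e) \<Rightarrow> 'e \<Rightarrow> real \<Rightarrow> ('e \<Rightarrow> 'e) \<Rightarrow> real \<Rightarrow> bool" where
  "coordinate_discs V Jc y0 r \<Psi> K \<longleftrightarrow> 0 < r \<and> 0 \<le> K \<and> continuous_on (ball 0 r) \<Psi> \<and> \<Psi> ` ball 0 r \<subseteq> V \<and> \<Psi> 0 = y0 \<and>
     (\<Psi> has_derivative (\<lambda>v. v)) (at 0) \<and> (\<forall>v\<in>ball 0 r. R v = v \<longrightarrow> \<Psi> v = y0 + v) \<and>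
     (\<forall>e>0. \<exists>\<delta>>0. \<exists>w F1 F2. attached_discs Jc r \<Psi> K e \<delta> w F1 F2)"

text \<open>
  With \<open>\<Psi> w = y0 + \<sigma> w + Jc (y0 + \<sigma> w) (\<tau> w)\<close> the
  differential of \<open>\<Psi>\<close> at a fixed vector \<open>w\<close> of \<open>R\<close>
  is \<open>\<sigma> + Jc (y0 + w) \<circ> \<tau>\<close>, which intertwines \<open>J0\<close>
  and \<open>Jc (y0 + w)\<close>. Hence the defect \<open>B = D\<Psi> J0 - Jc D\<Psi>\<close>
  vanishes at these points and \<open>disc_eq\<close> applies, with \<open>A = 1 -
  D\<Psi>\<close>.
\<close>

theorem coordinate_discs_ex:
  assumes V: "open V" "y0 \<in> V" and lin: "\<And>y. y \<in> V \<Longrightarrow> linear (Jc y)" and sq: "\<And>y v. y \<in> V \<Longrightarrow> Jc y (Jc y v) = - v"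
    and J0: "Jc y0 = J0" and sm: "\<And>x. smooth_on V (\<lambda>y. Jc y x)"
  shows "\<exists>r \<Psi> K. coordinate_discs V Jc y0 r \<Psi> K"
proof -
  obtain \<rho> where \<rho>: "0 < \<rho>" "cball y0 \<rho> \<subseteq> V" using V open_contains_cball by blast
  define d where "d b b' y = frechet_derivative (\<lambda>y. Jc y b') (at y) b" for b b' y
  note S = smooth_on_C11_ex[OF sm V(1) \<rho>(2)]
  have dsdx: "C11_ex (cball y0 \<rho>) (d b b')" for b b' unfolding d_def[abs_def] by (rule S(2))
  have dder: "((\<lambda>y. Jc y b') has_derivative (\<lambda>v. \<Sum>b\<in>Basis. (v \<bullet> b) *\<^sub>R d b b' y)) (at y)" if "y \<in> V" for y b'
    unfolding d_def
    by (rule has_derivative_eq_rhs[OF S(3)[OF that, of b']], rule ext, rule linear_Basis_expansion[OF has_derivative_linear[OF S(3)[OF that, of b']]])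
  obtain K\<sigma> where K\<sigma>: "K\<sigma> > 0" "\<And>x. norm (\<sigma> x) \<le> norm x * K\<sigma>" using bounded_linear.pos_bounded[OF \<sigma>_bl] by blast
  define r1 where "r1 = \<rho> / K\<sigma>"
  have r1: "0 < r1" using \<rho> K\<sigma> by (simp add: r1_def)
  have in1: "y0 + \<sigma> w \<in> cball y0 \<rho>" if "w \<in> ball 0 r1" for w
  proof -
    have "norm (\<sigma> w) \<le> norm w * K\<sigma>" by (rule K\<sigma>(2))
    also have "\<dots> \<le> r1 * K\<sigma>" using that K\<sigma> by simp
    finally show ?thesis using K\<sigma> by (simp add: r1_def dist_norm)
  qed
  define \<Psi> where "\<Psi> w = y0 + \<sigma> w + (\<Sum>b'\<in>Basis. (\<tau> w \<bullet> b') *\<^sub>R Jc (y0 + \<sigma> w) b')" for w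
  define Mv where "Mv w v = \<sigma> v + (\<Sum>b'\<in>Basis. (\<tau> v \<bullet> b') *\<^sub>R Jc (y0 + \<sigma> w) b') +
      (\<Sum>b'\<in>Basis. (\<tau> w \<bullet> b') *\<^sub>R (\<Sum>b\<in>Basis. (\<sigma> v \<bullet> b) *\<^sub>R d b b' (y0 + \<sigma> w)))" for w v
  have aff: "C11_ex X (\<lambda>w. y0 + \<sigma> w)" for X by (intro C11_ex_add C11_ex_const C11_ex_linear[OF \<sigma>_bl] C11_ex_id)
  have t: "C11_ex X (\<lambda>w. \<tau> w \<bullet> b)" for X b by (rule C11_ex_linear[OF bounded_linear_inner_left]) (rule C11_ex_linear[OF \<tau>_bl C11_ex_id])
  have Jaff: "C11_ex (ball 0 r1) (\<lambda>w. Jc (y0 + \<sigma> w) b)" for b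
    by (rule C11_ex_compose[where Y = "cball y0 \<rho>", OF S(1) aff]) (rule in1)
  have daff: "C11_ex (ball 0 r1) (\<lambda>w. d b b' (y0 + \<sigma> w))" for b b'
    by (rule C11_ex_compose[where Y = "cball y0 \<rho>", OF dsdx aff]) (rule in1)
  note sR = C11_ex_bilinear[OF bounded_bilinear_scaleR _ _ bounded_ball]
  have \<Psi>C11_ex: "C11_ex (ball 0 r1) \<Psi>" unfolding \<Psi>_def[abs_def] by (intro C11_ex_add aff C11_ex_sum sR t Jaff)
  have Msdx: "C11_ex (ball 0 r1) (\<lambda>w. Mv w v)" for v
    unfolding Mv_def by (intro C11_ex_add C11_ex_const C11_ex_sum sR t Jaff daff)
  have \<Psi>0: "\<Psi> 0 = y0" by (simp add: \<Psi>_def linear_0[OF \<sigma>_linear] linear_0[OF \<tau>_linear])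
  have \<Psi>der: "(\<Psi> has_derivative Mv w) (at w)" if w: "w \<in> ball 0 r1" for w
  proof -
    have y: "y0 + \<sigma> w \<in> V" using in1[OF w] \<rho> by blast
    have s: "((\<lambda>w. y0 + \<sigma> w) has_derivative \<sigma>) (at w)"
      using has_derivative_add[OF has_derivative_const bounded_linear_imp_has_derivative[OF \<sigma>_bl], of y0 "at w"] by simp
    have j: "((\<lambda>w. Jc (y0 + \<sigma> w) b') has_derivative (\<lambda>v. \<Sum>b\<in>Basis. (\<sigma> v \<bullet> b) *\<^sub>R d b b' (y0 + \<sigma> w))) (at w)" for b'
      by (rule has_derivative_compose[OF s dder[OF y]])
    have tt: "((\<lambda>w. \<tau> w \<bullet> b') has_derivative (\<lambda>v. \<tau> v \<bullet> b')) (at w)" for b'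
      by (intro bounded_linear_imp_has_derivative bounded_linear_compose[OF bounded_linear_inner_left \<tau>_bl])
    have "(\<Psi> has_derivative (\<lambda>v. \<sigma> v + (\<Sum>b'\<in>Basis. (\<tau> w \<bullet> b') *\<^sub>R (\<Sum>b\<in>Basis. (\<sigma> v \<bullet> b) *\<^sub>R d b b' (y0 + \<sigma> w)) +
        (\<tau> v \<bullet> b') *\<^sub>R Jc (y0 + \<sigma> w) b'))) (at w)"
      unfolding \<Psi>_def[abs_def] by (intro has_derivative_add has_derivative_sum has_derivative_scaleR s j tt)
    then show ?thesis by (rule has_derivative_eq_rhs) (simp add: Mv_def sum.distrib fun_eq_iff)
  qed
  obtain L\<Psi> where L\<Psi>: "C11 (ball 0 r1) L\<Psi> \<Psi>" using \<Psi>C11_ex by (auto simp: C11_ex_def)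
  define r where "r = min r1 (\<rho> / (L\<Psi> + 1))"
  have r: "0 < r" "r \<le> r1" using r1 \<rho> C11D0[OF L\<Psi>] by (auto simp: r_def)
  have in2: "\<Psi> w \<in> cball y0 \<rho>" if w: "w \<in> ball 0 r" for w
  proof -
    have "norm (\<Psi> w - \<Psi> 0) \<le> L\<Psi> * norm (w - 0)" by (rule C11D1[OF L\<Psi>]) (use w r r1 in auto)
    also have "\<dots> \<le> (L\<Psi> + 1) * (\<rho> / (L\<Psi> + 1))" using w C11D0[OF L\<Psi>] by (intro mult_mono) (auto simp: r_def)
    also have "\<dots> = \<rho>" using C11D0[OF L\<Psi>] by simp
    finally show ?thesis by (simp add: \<Psi>0 dist_norm norm_minus_commute)
  qed
  have sub: "ball 0 r \<subseteq> ball 0 r1" using r by auto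
  have Mlin: "bounded_linear (Mv w)" if "w \<in> ball 0 r" for w using has_derivative_bounded_linear[OF \<Psi>der] that sub by blast
  have Jlin: "bounded_linear (Jc y)" if "y \<in> V" for y using lin[OF that] linear_conv_bounded_linear by blast
  have in3: "\<Psi> w \<in> V" if "w \<in> ball 0 r" for w using in2[OF that] \<rho> by blast
  define M where "M w = Blinfun (Mv w)" for w
  define JJ where "JJ w = Blinfun (Jc (\<Psi> w))" for w
  have M: "blinfun_apply (M w) v = Mv w v" if "w \<in> ball 0 r" for w v by (simp add: M_def bounded_linear_Blinfun_apply[OF Mlin[OF that]])
  have JJ: "blinfun_apply (JJ w) v = Jc (\<Psi> w) v" if "w \<in> ball 0 r" for w v
    by (simp add: JJ_def bounded_linear_Blinfun_apply[OF Jlin[OF in3[OF that]]])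
  have J0b: "blinfun_apply (Blinfun J0) v = J0 v" for v by (simp add: bounded_linear_Blinfun_apply[OF J0_bounded_linear])
  have Msd: "C11_ex (ball 0 r) M"
    by (rule C11_ex_blinfun, rule C11_ex_cong[OF C11_ex_subset[OF Msdx sub]]) (simp add: M)
  have JJsd: "C11_ex (ball 0 r) JJ"
  proof (rule C11_ex_blinfun)
    fix v
    have "C11_ex (ball 0 r) (\<lambda>w. Jc (\<Psi> w) v)"
      by (rule C11_ex_compose[where Y = "cball y0 \<rho>", OF S(1) C11_ex_subset[OF \<Psi>C11_ex sub]]) (rule in2)
    then show "C11_ex (ball 0 r) (\<lambda>w. blinfun_apply (JJ w) v)" by (rule C11_ex_cong) (simp add: JJ)
  qed
  define A where "A w = id_blinfun - M w" for w
  define B where "B w = (M w o\<^sub>L Blinfun J0) - (JJ w o\<^sub>L M w)" for w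
  have Asd: "C11_ex (ball 0 r) A" unfolding A_def[abs_def] by (intro C11_ex_minus C11_ex_const Msd)
  have Bsd: "C11_ex (ball 0 r) B" unfolding B_def[abs_def]
    by (intro C11_ex_minus C11_ex_bilinear[OF bounded_bilinear_blinfun_compose _ _ bounded_ball] C11_ex_const Msd JJsd)
  have Jexp: "(\<Sum>b\<in>Basis. (v \<bullet> b) *\<^sub>R Jc y b) = Jc y v" if "y \<in> V" for y v
    using linear_Basis_expansion[OF lin[OF that], of v] by simp
  have MS: "Mv w v = \<sigma> v + Jc (y0 + w) (\<tau> v)" "\<Psi> w = y0 + w" if "w \<in> ball 0 r" "R w = w" for w v
  proof -
    have "y0 + \<sigma> w \<in> V" using in1[of w] that sub \<rho> by blast
    then show "Mv w v = \<sigma> v + Jc (y0 + w) (\<tau> v)" "\<Psi> w = y0 + w"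
      by (simp_all add: Mv_def \<Psi>_def \<sigma>_fix[OF that(2)] \<tau>_fix[OF that(2)] Jexp)
  qed
  have A0: "A 0 = 0"
  proof (rule blinfun_eqI)
    fix v
    have "Mv 0 v = v" using MS(1)[of 0 v] r split[of v] by (simp add: R_simps J0)
    then show "blinfun_apply (A 0) v = blinfun_apply 0 v" using r by (simp add: A_def blinfun.diff_left M)
  qed
  have BS: "B w = 0" if w: "w \<in> ball 0 r" "R w = w" for w
  proof (rule blinfun_eqI)
    fix v
    have y: "y0 + w \<in> V" using in3[OF w(1)] MS(2)[OF w] by simp
    have "Mv w (J0 v) = Jc (\<Psi> w) (Mv w v)"
      unfolding MS[OF w] using lin[OF y] sq[OF y] by (simp add: \<sigma>_J0 \<tau>_J0 linear_add)
    then show "blinfun_apply (B w) v = blinfun_apply 0 v"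
      by (simp add: B_def blinfun.diff_left M[OF w(1)] JJ[OF w(1)] J0b)
  qed
  obtain LA LB where LA: "C11 (ball 0 r) LA A" and LB: "C11 (ball 0 r) LB B" using Asd Bsd by (auto simp: C11_ex_def)
  interpret disc_eq J0 R t0 t1 A B r "max LA LB"
    by unfold_locales (use r A0 BS C11_mono[OF LA] C11_mono[OF LB] in auto)
  obtain K where K: "K \<ge> 0" "\<And>\<theta>. lip_bounded (K * norm \<theta>) (\<phi> \<theta>)" using \<phi>_lip_bounded(1) by blast
  have "\<exists>\<delta>>0. \<exists>w F1 F2. attached_discs Jc r \<Psi> K e \<delta> w F1 F2" if e: "0 < e" for e
  proof -
    obtain \<delta> w wd where D: "0 < \<delta>" "disc_family e \<delta> w wd" using disc_family_ex[OF e] by blast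
    let ?F = "\<lambda>\<eta> \<theta> z. blinfun_apply (M (w \<theta> z)) (wd \<theta> \<eta> z)"
    have "attached_discs Jc r \<Psi> K e \<delta> w (?F 1) (?F \<i>)"
      unfolding attached_discs_def
    proof (intro conjI allI impI ballI)
      show "w 0 = (\<lambda>_. 0)" using D(2) by (simp add: disc_family_def)
    next
      fix \<theta> :: "'e \<times> 'e \<times> 'e" assume \<theta>: "norm \<theta> \<le> \<delta>"
      have der: "\<And>z. (w \<theta> has_derivative (\<lambda>\<eta>. wd \<theta> \<eta> z)) (at z)" and cont: "\<And>\<eta>. continuous_on UNIV (wd \<theta> \<eta>)"
        and inb: "\<And>z. z \<in> half_disc \<Longrightarrow> w \<theta> z \<in> ball 0 r"
        and eq: "\<And>z. z \<in> half_disc \<Longrightarrow> norm z \<le> 1 \<Longrightarrow> wd \<theta> 1 z + J0 (wd \<theta> \<i> z) =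
          blinfun_apply (A (w \<theta> z)) (wd \<theta> 1 z + J0 (wd \<theta> \<i> z)) + blinfun_apply (B (w \<theta> z)) (wd \<theta> \<i> z)"
        and re: "\<And>z. Im z = 0 \<Longrightarrow> R (w \<theta> z) = w \<theta> z"
        and at: "w \<theta> (\<i> * of_real t0) = fst \<theta>" "w \<theta> (\<i> * of_real t1) = fst (snd \<theta>)"
        using D(2) \<theta> unfolding disc_family_def by blast+
      have wc: "continuous_on X (w \<theta>)" for X
        using has_derivative_continuous[OF der] by (auto simp: continuous_on_eq_continuous_within intro: continuous_at_imp_continuous_at_within)
      show "continuous_on half_disc (w \<theta>)" by (rule wc)
      show "w \<theta> ` half_disc \<subseteq> ball 0 r" using inb by blast
      have Mc: "continuous_on half_disc (\<lambda>z. M (w \<theta> z))"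
        by (rule continuous_on_compose2[OF C11_ex_continuous_on[OF Msd] wc]) (use inb in blast)
      show "continuous_on half_disc (?F 1 \<theta>)" "continuous_on half_disc (?F \<i> \<theta>)"
        by (intro bounded_bilinear.continuous_on[OF bounded_bilinear_blinfun_apply] Mc continuous_on_subset[OF cont] subset_UNIV)+
      show "R (w \<theta> z) = w \<theta> z" if "Im z = 0" for z by (rule re[OF that])
      show "w \<theta> (\<i> * of_real t0) = fst \<theta>" "w \<theta> (\<i> * of_real t1) = fst (snd \<theta>)" by (rule at)+
    next
      fix \<theta> :: "'e \<times> 'e \<times> 'e" and z assume \<theta>: "norm \<theta> \<le> \<delta>" and z: "z \<in> half_disc" "norm z \<le> 1"
      have der: "(w \<theta> has_derivative (\<lambda>\<eta>. wd \<theta> \<eta> z)) (at z)" and inb: "w \<theta> z \<in> ball 0 r"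
        and eq: "wd \<theta> 1 z + J0 (wd \<theta> \<i> z) =
          blinfun_apply (A (w \<theta> z)) (wd \<theta> 1 z + J0 (wd \<theta> \<i> z)) + blinfun_apply (B (w \<theta> z)) (wd \<theta> \<i> z)"
        using D(2) \<theta> z unfolding disc_family_def by blast+
      have d1: "((\<lambda>z. \<Psi> (w \<theta> z)) has_derivative (\<lambda>\<eta>. Mv (w \<theta> z) (wd \<theta> \<eta> z))) (at z)"
        by (rule has_derivative_compose[OF der \<Psi>der]) (use inb sub in blast)
      have "(\<lambda>\<eta>. Mv (w \<theta> z) (wd \<theta> \<eta> z)) = (\<lambda>\<eta>. Re \<eta> *\<^sub>R ?F 1 \<theta> z + Im \<eta> *\<^sub>R ?F \<i> \<theta> z)"
        unfolding M[OF inb] by (rule ext) (rule complex_linear[OF has_derivative_linear[OF d1]])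
      then show "((\<lambda>z. \<Psi> (w \<theta> z)) has_derivative (\<lambda>\<eta>. Re \<eta> *\<^sub>R ?F 1 \<theta> z + Im \<eta> *\<^sub>R ?F \<i> \<theta> z)) (at z)" using d1 by simp
      let ?x = "wd \<theta> 1 z" and ?y = "wd \<theta> \<i> z"
      note yV = in3[OF inb]
      have ml: "linear (Mv (w \<theta> z))" using bounded_linear.linear[OF Mlin[OF inb]] .
      have "?x + J0 ?y = (?x + J0 ?y - Mv (w \<theta> z) (?x + J0 ?y)) + (Mv (w \<theta> z) (J0 ?y) - Jc (\<Psi> (w \<theta> z)) (Mv (w \<theta> z) ?y))"
        using eq by (simp add: A_def B_def blinfun.diff_left M[OF inb] JJ[OF inb] J0b)
      then have "- Mv (w \<theta> z) ?x = Jc (\<Psi> (w \<theta> z)) (Mv (w \<theta> z) ?y)" by (simp add: linear_add[OF ml])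
      then have "Mv (w \<theta> z) ?x = - Jc (\<Psi> (w \<theta> z)) (Mv (w \<theta> z) ?y)" by (metis minus_minus)
      then have "Jc (\<Psi> (w \<theta> z)) (Mv (w \<theta> z) ?x) = Mv (w \<theta> z) ?y"
        using sq[OF yV] lin[OF yV] by (simp add: linear_neg)
      then show "?F \<i> \<theta> z = Jc (\<Psi> (w \<theta> z)) (?F 1 \<theta> z)" by (simp add: M[OF inb])
    next
      fix \<theta> \<theta>' :: "'e \<times> 'e \<times> 'e" and z assume \<theta>: "norm \<theta> \<le> \<delta>" and \<theta>': "norm \<theta>' \<le> \<delta>" and z: "z \<in> half_disc"
      have 1: "norm ((w \<theta> z - w \<theta>' z) - (\<phi> \<theta> z - \<phi> \<theta>' z)) \<le> e * norm (\<theta> - \<theta>')"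
        using D(2) \<theta> \<theta>' z unfolding disc_family_def by blast
      have 2: "norm (\<phi> \<theta> z - \<phi> \<theta>' z) \<le> K * norm (\<theta> - \<theta>')"
        using K(2)[of "\<theta> - \<theta>'"] z unfolding \<phi>_diff(1)[symmetric] by (auto simp: lip_bounded_def half_disc_def)
      have "w \<theta> z - w \<theta>' z = ((w \<theta> z - w \<theta>' z) - (\<phi> \<theta> z - \<phi> \<theta>' z)) + (\<phi> \<theta> z - \<phi> \<theta>' z)" by simp
      then have "norm (w \<theta> z - w \<theta>' z) \<le> e * norm (\<theta> - \<theta>') + K * norm (\<theta> - \<theta>')"
        using norm_triangle_mono[OF 1 2] by presburger
      then show "norm (w \<theta> z - w \<theta>' z) \<le> (K + e) * norm (\<theta> - \<theta>')" by (simp add: algebra_simps)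
    next
      fix q q' c c' :: 'e and x :: real
      assume a: "norm (q, q', c) \<le> \<delta> \<and> norm (q, q', c') \<le> \<delta> \<and> \<bar>x\<bar> \<le> 2"
      then have "of_real x \<in> half_disc" by (simp add: half_disc_def)
      then have "norm ((w (q,q',c) (of_real x) - w (q,q',c') (of_real x)) - (\<phi> (q,q',c) (of_real x) - \<phi> (q,q',c') (of_real x))) \<le> e * norm ((q,q',c) - (q,q',c'))"
        using D(2) a unfolding disc_family_def by blast
      then show "norm ((w (q,q',c) (of_real x) - w (q,q',c') (of_real x)) - ((x^2 + t0^2) * (x^2 + t1^2)) *\<^sub>R (\<sigma> c - \<sigma> c')) \<le> e * norm (c - c')"
        unfolding \<phi>_real by (simp add: norm_Pair)
    qed
    then show ?thesis using D(1) by blast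
  qed
  moreover have "(\<Psi> has_derivative (\<lambda>v. v)) (at 0)"
  proof -
    have "Mv 0 = (\<lambda>v. v)" using MS(1)[of 0] r split by (simp add: R_simps J0 fun_eq_iff)
    then show ?thesis using \<Psi>der[of 0] r1 by simp
  qed
  moreover have "continuous_on (ball 0 r) \<Psi>" by (rule C11_ex_continuous_on[OF C11_ex_subset[OF \<Psi>C11_ex sub]])
  ultimately have "coordinate_discs V Jc y0 r \<Psi> K"
    unfolding coordinate_discs_def using r K(1) in3 \<Psi>0 MS(2) by blast
  then show ?thesis by blast
qed

end

section \<open>Manifolds and almost complex structures in charts\<close>

lemma inj_on_chart:
  assumes "homeomorphic_map (subtopology X U) (top_of_set (\<phi> ` U)) \<phi>" "openin X U"
  shows "inj_on \<phi> U"
proof -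
  have "topspace (subtopology X U) = U" using openin_subset[OF assms(2)] by (simp add: topspace_subtopology_subset Int_absorb1)
  then show ?thesis using homeomorphic_imp_injective_map[OF assms(1)] by simp
qed

locale smooth_atlas =
  fixes X :: "'a topology" and \<A> :: "('a, 'e::euclidean_space) chart set"
  assumes atlas: "maximal_smooth_atlas X \<A>"
begin

context
  fixes U \<phi> assumes c: "(U, \<phi>) \<in> \<A>"
begin

lemma chart: "openin X U" "open (\<phi> ` U)" "homeomorphic_map (subtopology X U) (top_of_set (\<phi> ` U)) \<phi>"
proof -
  have "is_chart X (U, \<phi>)" using c atlas unfolding maximal_smooth_atlas_def by blast
  then show "openin X U" "open (\<phi> ` U)" "homeomorphic_map (subtopology X U) (top_of_set (\<phi> ` U)) \<phi>"
    by (simp_all add: is_chart_def)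
qed

lemma chart_subset: "U \<subseteq> topspace X" using openin_subset[OF chart(1)] .

lemma chart_topspace: "topspace (subtopology X U) = U" using chart_subset by (simp add: topspace_subtopology_subset Int_absorb1)

lemma chart_inj: "inj_on \<phi> U" by (rule inj_on_chart[OF chart(3,1)])

lemma inv_chart[simp]: "p \<in> U \<Longrightarrow> inv_into U \<phi> (\<phi> p) = p" by (rule inv_into_f_f[OF chart_inj])

lemma chart_inv: "y \<in> \<phi> ` U \<Longrightarrow> \<phi> (inv_into U \<phi> y) = y" by (rule f_inv_into_f)

lemma inv_in: "y \<in> \<phi> ` U \<Longrightarrow> inv_into U \<phi> y \<in> U" by (rule inv_into_into)

lemma chart_continuous: "continuous_map (subtopology X U) (top_of_set (\<phi> ` U)) \<phi>"
  using homeomorphic_imp_continuous_map[OF chart(3)] .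

lemma inv_continuous: "continuous_map (top_of_set (\<phi> ` U)) X (inv_into U \<phi>)"
proof -
  obtain g where g: "homeomorphic_maps (subtopology X U) (top_of_set (\<phi> ` U)) \<phi> g"
    using chart(3) homeomorphic_map_maps by blast
  then have gc: "continuous_map (top_of_set (\<phi> ` U)) (subtopology X U) g"
    and gi: "\<And>p. p \<in> U \<Longrightarrow> g (\<phi> p) = p" using chart_topspace by (auto simp: homeomorphic_maps_def)
  have "continuous_map (top_of_set (\<phi> ` U)) X g" using gc continuous_map_in_subtopology by blast
  then show ?thesis by (rule continuous_map_eq) (use gi in auto)
qed

lemma chart_image_open:
  assumes "openin X W" shows "open (\<phi> ` (U \<inter> W))"
proof -
  have "openin (subtopology X U) (U \<inter> W)" using assms by (metis Int_commute openin_subtopology)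
  then have "openin (top_of_set (\<phi> ` U)) (\<phi> ` (U \<inter> W))"
    using homeomorphic_imp_open_map[OF chart(3)] by (simp add: open_map_def)
  then show ?thesis using chart(2) openin_open_trans by blast
qed

lemma inv_image_open:
  assumes "open Y" "Y \<subseteq> \<phi> ` U" shows "openin X (inv_into U \<phi> ` Y)"
proof -
  have "openin (subtopology X U) {x \<in> topspace (subtopology X U). \<phi> x \<in> Y}"
    by (rule openin_continuous_map_preimage[OF chart_continuous]) (use assms in \<open>auto simp: openin_open\<close>)
  moreover have "{x \<in> topspace (subtopology X U). \<phi> x \<in> Y} = inv_into U \<phi> ` Y"
  proof (intro set_eqI iffI)
    fix x assume "x \<in> {x \<in> topspace (subtopology X U). \<phi> x \<in> Y}"
    then show "x \<in> inv_into U \<phi> ` Y" using chart_topspace by (auto intro!: image_eqI[of _ _ "\<phi> x"])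
  next
    fix x assume "x \<in> inv_into U \<phi> ` Y"
    then obtain y where "y \<in> Y" "x = inv_into U \<phi> y" by blast
    then show "x \<in> {x \<in> topspace (subtopology X U). \<phi> x \<in> Y}" using assms chart_topspace chart_inv inv_in by auto
  qed
  ultimately show ?thesis using openin_trans_full[OF _ chart(1)] by simp
qed

end

lemma transition_smooth:
  assumes "(U, \<phi>) \<in> \<A>" "(V, \<psi>) \<in> \<A>"
  shows "smooth_on (\<phi> ` (U \<inter> V)) (transition (U, \<phi>) (V, \<psi>))"
  using assms atlas unfolding maximal_smooth_atlas_def compatible_def by fast

lemma overlap_open: "(U, \<phi>) \<in> \<A> \<Longrightarrow> (V, \<psi>) \<in> \<A> \<Longrightarrow> open (\<phi> ` (U \<inter> V))"
  using chart_image_open chart(1) by blast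

lemma transition_derivative:
  assumes "(U, \<phi>) \<in> \<A>" "(V, \<psi>) \<in> \<A>" "p \<in> U" "p \<in> V"
  shows "(transition (U, \<phi>) (V, \<psi>) has_derivative frechet_derivative (transition (U, \<phi>) (V, \<psi>)) (at (\<phi> p))) (at (\<phi> p))"
proof -
  have "Ck_on (Suc 0) (\<phi> ` (U \<inter> V)) (transition (U, \<phi>) (V, \<psi>))"
    using transition_smooth[OF assms(1,2)] unfolding smooth_on_def by blast
  then show ?thesis using assms(3,4) unfolding frechet_derivative_works[symmetric] Ck_on.simps(2) by blast
qed

lemma chart_of_curve_derivative:
  assumes c: "(U, \<phi>) \<in> \<A>" and d: "(V, \<psi>) \<in> \<A>" and "open W" "z \<in> W" and FU: "\<And>z. z \<in> W \<Longrightarrow> F z \<in> \<phi> ` U"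
    and F: "(F has_derivative F') (at z)" and V: "inv_into U \<phi> (F z) \<in> V"
  shows "((\<lambda>z. \<psi> (inv_into U \<phi> (F z))) has_derivative
     (\<lambda>h. frechet_derivative (transition (U, \<phi>) (V, \<psi>)) (at (F z)) (F' h))) (at z)"
proof -
  have "(transition (U, \<phi>) (V, \<psi>) has_derivative frechet_derivative (transition (U, \<phi>) (V, \<psi>)) (at (F z))) (at (F z))"
    using transition_derivative[OF c d inv_in[OF c FU[OF \<open>z \<in> W\<close>]] V] chart_inv[OF c FU[OF \<open>z \<in> W\<close>]] by simp
  from has_derivative_compose[OF F this] show ?thesis by (simp add: transition_def)
qed

lemma transition_chain:
  assumes "(U, \<phi>) \<in> \<A>" "(V, \<psi>) \<in> \<A>" "(V', \<psi>') \<in> \<A>" "p \<in> U" "p \<in> V" "p \<in> V'"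
  shows "frechet_derivative (transition (V, \<psi>) (V', \<psi>')) (at (\<psi> p)) (frechet_derivative (transition (U, \<phi>) (V, \<psi>)) (at (\<phi> p)) x)
     = frechet_derivative (transition (U, \<phi>) (V', \<psi>')) (at (\<phi> p)) x"
proof -
  let ?t1 = "transition (U, \<phi>) (V, \<psi>)" and ?t2 = "transition (V, \<psi>) (V', \<psi>')" and ?t = "transition (U, \<phi>) (V', \<psi>')"
  have t1p: "?t1 (\<phi> p) = \<psi> p" using assms by (simp add: transition_def inv_chart)
  have d2: "(?t2 has_derivative frechet_derivative ?t2 (at (\<psi> p))) (at (?t1 (\<phi> p)))"
    unfolding t1p by (rule transition_derivative[OF assms(2,3,5,6)])
  have "((\<lambda>y. ?t2 (?t1 y)) has_derivative (\<lambda>x. frechet_derivative ?t2 (at (\<psi> p)) (frechet_derivative ?t1 (at (\<phi> p)) x))) (at (\<phi> p))"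
    by (rule has_derivative_compose[OF transition_derivative[OF assms(1,2,4,5)] d2])
  moreover have "?t2 (?t1 y) = ?t y" if y: "y \<in> \<phi> ` (U \<inter> V)" for y
  proof -
    have "inv_into U \<phi> y \<in> V" using y assms(1) by (auto simp: inv_chart)
    then show ?thesis using assms(2) by (simp add: transition_def inv_chart)
  qed
  ultimately have "(?t has_derivative (\<lambda>x. frechet_derivative ?t2 (at (\<psi> p)) (frechet_derivative ?t1 (at (\<phi> p)) x))) (at (\<phi> p))"
    using overlap_open[OF assms(1,2)] assms(4,5) by (auto elim!: has_derivative_transform_within_open)
  then show ?thesis using frechet_derivative_at by metis
qed

lemma transition_self:
  assumes "(U, \<phi>) \<in> \<A>" "p \<in> U"
  shows "frechet_derivative (transition (U, \<phi>) (U, \<phi>)) (at (\<phi> p)) x = x"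
proof -
  have "((\<lambda>y. y) has_derivative (\<lambda>x. x)) (at (\<phi> p))" by (rule has_derivative_ident)
  then have "(transition (U, \<phi>) (U, \<phi>) has_derivative (\<lambda>x. x)) (at (\<phi> p))"
    by (rule has_derivative_transform_within_open[OF _ chart(2)[OF assms(1)]]) (use assms chart_inv in \<open>auto simp: transition_def\<close>)
  then show ?thesis using frechet_derivative_at by metis
qed

lemma charts_atI: "(U, \<phi>) \<in> \<A> \<Longrightarrow> p \<in> U \<Longrightarrow> (U, \<phi>) \<in> charts_at \<A> p"
  by (simp add: charts_at_def)

lemma coord_tvec_tangent:
  assumes "(U, \<phi>) \<in> \<A>" "p \<in> U"
  shows "coord_tvec \<A> (U, \<phi>) p x \<in> tangent_space \<A> p" "coord_tvec \<A> (U, \<phi>) p x (U, \<phi>) = x"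
proof -
  show "coord_tvec \<A> (U, \<phi>) p x (U, \<phi>) = x"
    using assms transition_self by (simp add: coord_tvec_def charts_atI)
  show "coord_tvec \<A> (U, \<phi>) p x \<in> tangent_space \<A> p"
    unfolding tangent_space_def coord_tvec_def charts_at_def using assms transition_chain by auto
qed

lemma tangent_coord:
  assumes "(U, \<phi>) \<in> \<A>" "p \<in> U" "v \<in> tangent_space \<A> p"
  shows "coord_tvec \<A> (U, \<phi>) p (v (U, \<phi>)) = v"
proof
  fix d :: "'a set \<times> ('a \<Rightarrow> 'e)"
  have v: "\<forall>c \<in> charts_at \<A> p. \<forall>d \<in> charts_at \<A> p. v d = frechet_derivative (transition c d) (at (snd c p)) (v c)"
    "\<forall>c. c \<notin> charts_at \<A> p \<longrightarrow> v c = 0" using assms(3) unfolding tangent_space_def mem_Collect_eq by blast+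
  show "coord_tvec \<A> (U, \<phi>) p (v (U, \<phi>)) d = v d"
  proof (cases "d \<in> charts_at \<A> p")
    case True
    then show ?thesis using v(1)[rule_format, OF charts_atI[OF assms(1,2)] True] unfolding coord_tvec_def by simp
  next
    case False
    then show ?thesis using v(2)[rule_format, OF False] unfolding coord_tvec_def by simp
  qed
qed

lemma coord_tvec_lincomb:
  assumes "(U, \<phi>) \<in> \<A>" "p \<in> U"
  shows "coord_tvec \<A> (U, \<phi>) p (a *\<^sub>R x + b *\<^sub>R y) = tlincomb a (coord_tvec \<A> (U, \<phi>) p x) b (coord_tvec \<A> (U, \<phi>) p y)"
proof
  fix d :: "'a set \<times> ('a \<Rightarrow> 'e)"
  show "coord_tvec \<A> (U, \<phi>) p (a *\<^sub>R x + b *\<^sub>R y) d = tlincomb a (coord_tvec \<A> (U, \<phi>) p x) b (coord_tvec \<A> (U, \<phi>) p y) d"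
  proof (cases "d \<in> charts_at \<A> p")
    case True
    obtain V \<psi> where d: "d = (V, \<psi>)" by (cases d)
    have "linear (frechet_derivative (transition (U, \<phi>) (V, \<psi>)) (at (\<phi> p)))"
      using has_derivative_linear[OF transition_derivative[OF assms(1) _ assms(2)]] True d by (auto simp: charts_at_def)
    then show ?thesis using True d by (simp add: coord_tvec_def linear_add linear_scale)
  qed (simp add: coord_tvec_def)
qed

text \<open>
  All curves and discs in the manifold will be obtained from maps into the image of a single
  chart.
\<close>

lemma C1_map_through_chart:
  fixes F :: "'b::euclidean_space \<Rightarrow> 'e"
  assumes c: "(U, \<phi>) \<in> \<A>" and W: "open W" and FU: "\<And>z. z \<in> W \<Longrightarrow> F z \<in> \<phi> ` U"
    and F: "\<And>z. z \<in> W \<Longrightarrow> (F has_derivative F' z) (at z)" and cont: "\<And>h. continuous_on W (\<lambda>z. F' z h)"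
  shows "C1_map X \<A> W (\<lambda>z. inv_into U \<phi> (F z))"
    "z \<in> W \<Longrightarrow> differential \<A> (\<lambda>z. inv_into U \<phi> (F z)) z h = coord_tvec \<A> (U, \<phi>) (inv_into U \<phi> (F z)) (F' z h)"
proof -
  let ?f = "\<lambda>z. inv_into U \<phi> (F z)"
  have Fc: "continuous_on W F" using F has_derivative_continuous continuous_at_imp_continuous_on by blast
  have Fm: "continuous_map (top_of_set W) (top_of_set (\<phi> ` U)) F" using Fc FU by (auto simp: continuous_map_iff_continuous2)
  have fc: "continuous_map (top_of_set W) X ?f"
    using continuous_map_compose[OF Fm inv_continuous[OF c]] by (simp add: o_def)
  have der: "((\<psi> \<circ> ?f) has_derivative (\<lambda>h. frechet_derivative (transition (U, \<phi>) (V, \<psi>)) (at (F z)) (F' z h))) (at z)"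
    if "(V, \<psi>) \<in> \<A>" "z \<in> W" "?f z \<in> V" for V \<psi> z
    using chart_of_curve_derivative[OF c that(1) W that(2) FU F[OF that(2)] that(3)] by (simp add: o_def)
  show "C1_map X \<A> W ?f"
    unfolding C1_map_def
  proof (intro conjI fc ballI, clarify)
    fix V \<psi> assume d: "(V, \<psi>) \<in> \<A>"
    let ?S = "{z \<in> W. ?f z \<in> V}"
    have FS: "F z \<in> \<phi> ` (U \<inter> V)" if "z \<in> ?S" for z
      using that inv_in[OF c FU] chart_inv[OF c FU] by (intro image_eqI[of _ _ "?f z"]) auto
    have "Ck_on (Suc (Suc 0)) (\<phi> ` (U \<inter> V)) (transition (U, \<phi>) (V, \<psi>))"
      using transition_smooth[OF c d] unfolding smooth_on_def by blast
    then have "Ck_on (Suc 0) (\<phi> ` (U \<inter> V)) (\<lambda>y. frechet_derivative (transition (U, \<phi>) (V, \<psi>)) (at y) b)" for b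
      unfolding Ck_on.simps(2)[of "Suc 0"] by blast
    then have tc: "continuous_on (\<phi> ` (U \<inter> V)) (\<lambda>y. frechet_derivative (transition (U, \<phi>) (V, \<psi>)) (at y) b)" for b
      unfolding Ck_on.simps(2)[of 0]
      by (intro differentiable_imp_continuous_on differentiable_at_imp_differentiable_on) blast
    have "continuous_on ?S (\<lambda>z. frechet_derivative (\<psi> \<circ> ?f) (at z) h)" for h
    proof -
      have 1: "continuous_on ?S (\<lambda>z. \<Sum>b\<in>Basis. (F' z h \<bullet> b) *\<^sub>R frechet_derivative (transition (U, \<phi>) (V, \<psi>)) (at (F z)) b)"
      proof (intro continuous_intros)
        show "continuous_on ?S (\<lambda>z. F' z h)" by (rule continuous_on_subset[OF cont]) auto
        fix b
        show "continuous_on ?S (\<lambda>z. frechet_derivative (transition (U, \<phi>) (V, \<psi>)) (at (F z)) b)"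
          by (rule continuous_on_compose2[OF tc continuous_on_subset[OF Fc]]) (use FS in auto)
      qed
      have 2: "frechet_derivative (\<psi> \<circ> ?f) (at z) h = (\<Sum>b\<in>Basis. (F' z h \<bullet> b) *\<^sub>R frechet_derivative (transition (U, \<phi>) (V, \<psi>)) (at (F z)) b)"
        if "z \<in> ?S" for z
      proof -
        have "(transition (U, \<phi>) (V, \<psi>) has_derivative frechet_derivative (transition (U, \<phi>) (V, \<psi>)) (at (F z))) (at (F z))"
          using transition_derivative[OF c d, of "?f z"] that inv_in[OF c FU] chart_inv[OF c FU] by simp
        then have l: "linear (frechet_derivative (transition (U, \<phi>) (V, \<psi>)) (at (F z)))" by (rule has_derivative_linear)
        have zV: "z \<in> W" "?f z \<in> V" using that by auto
        have "frechet_derivative (\<psi> \<circ> ?f) (at z) = (\<lambda>h. frechet_derivative (transition (U, \<phi>) (V, \<psi>)) (at (F z)) (F' z h))"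
          by (rule frechet_derivative_at[OF der[OF d zV], symmetric])
        then have "frechet_derivative (\<psi> \<circ> ?f) (at z) h = frechet_derivative (transition (U, \<phi>) (V, \<psi>)) (at (F z)) (F' z h)"
          by (rule fun_cong)
        also have "\<dots> = (\<Sum>b\<in>Basis. (F' z h \<bullet> b) *\<^sub>R frechet_derivative (transition (U, \<phi>) (V, \<psi>)) (at (F z)) b)"
          by (rule linear_Basis_expansion[OF l])
        finally show ?thesis .
      qed
      show ?thesis by (rule continuous_on_eq[OF 1]) (rule 2[symmetric])
    qed
    moreover have "(\<psi> \<circ> ?f) differentiable (at z)" if "z \<in> ?S" for z
      using der[OF d] that by (auto simp: differentiable_def)
    ultimately have "Ck_on (Suc 0) ?S (\<psi> \<circ> ?f)" unfolding Ck_on.simps by blast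
    then show "Ck_on 1 ?S (\<psi> \<circ> ?f)" by simp
  qed
  show "differential \<A> ?f z h = coord_tvec \<A> (U, \<phi>) (?f z) (F' z h)" if z: "z \<in> W"
  proof
    fix d :: "'a set \<times> ('a \<Rightarrow> 'e)"
    obtain V \<psi> where d: "d = (V, \<psi>)" by (cases d)
    show "differential \<A> ?f z h d = coord_tvec \<A> (U, \<phi>) (?f z) (F' z h) d"
    proof (cases "d \<in> charts_at \<A> (?f z)")
      case True
      then have "(V, \<psi>) \<in> \<A>" "?f z \<in> V" using d by (auto simp: charts_at_def)
      from frechet_derivative_at[OF der[OF this(1) z this(2)]] show ?thesis
        using True d chart_inv[OF c FU[OF z]] by (simp add: differential_def coord_tvec_def fun_eq_iff)
    qed (simp add: differential_def coord_tvec_def)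
  qed
qed

end

definition chart_J :: "('a, 'e::euclidean_space) chart set \<Rightarrow> ('a \<Rightarrow> ('a, 'e) tvec \<Rightarrow> ('a, 'e) tvec) \<Rightarrow> ('a, 'e) chart \<Rightarrow> 'e \<Rightarrow> 'e \<Rightarrow> 'e" where
  "chart_J \<A> J c y x = (let p = inv_into (fst c) (snd c) y in J p (coord_tvec \<A> c p x) c)"

locale almost_complex = smooth_atlas X \<A> for X :: "'a topology" and \<A> :: "('a, 'e::euclidean_space) chart set" +
  fixes J :: "'a \<Rightarrow> ('a, 'e) tvec \<Rightarrow> ('a, 'e) tvec"
  assumes acs: "almost_complex_structure X \<A> J"
begin

context fixes U \<phi> assumes c: "(U, \<phi>) \<in> \<A>"
begin

lemma J_coord: "p \<in> U \<Longrightarrow> J p (coord_tvec \<A> (U, \<phi>) p x) = coord_tvec \<A> (U, \<phi>) p (chart_J \<A> J (U, \<phi>) (\<phi> p) x)"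
proof -
  assume p: "p \<in> U"
  have pX: "p \<in> topspace X" using p chart_subset[OF c] by blast
  have "J p (coord_tvec \<A> (U, \<phi>) p x) \<in> tangent_space \<A> p"
    using acs pX coord_tvec_tangent[OF c p] unfolding almost_complex_structure_def by blast
  from tangent_coord[OF c p this] show ?thesis using p c by (simp add: chart_J_def inv_chart)
qed

lemma chart_J_linear: assumes "y \<in> \<phi> ` U" shows "linear (chart_J \<A> J (U, \<phi>) y)"
proof -
  let ?p = "inv_into U \<phi> y"
  have p: "?p \<in> U" using inv_in[OF c assms] .
  have pX: "?p \<in> topspace X" using p chart_subset[OF c] by blast
  have L: "\<forall>v\<in>tangent_space \<A> ?p. \<forall>w\<in>tangent_space \<A> ?p. \<forall>a b. J ?p (tlincomb a v b w) = tlincomb a (J ?p v) b (J ?p w)"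
    using acs pX unfolding almost_complex_structure_def by blast
  have *: "chart_J \<A> J (U, \<phi>) y (a *\<^sub>R x + b *\<^sub>R x') = a *\<^sub>R chart_J \<A> J (U, \<phi>) y x + b *\<^sub>R chart_J \<A> J (U, \<phi>) y x'" for a b x x'
    using L coord_tvec_tangent(1)[OF c p] by (simp add: chart_J_def coord_tvec_lincomb[OF c p] Let_def)
  show ?thesis
  proof (rule linearI)
    show "chart_J \<A> J (U, \<phi>) y (x + x') = chart_J \<A> J (U, \<phi>) y x + chart_J \<A> J (U, \<phi>) y x'" for x x'
      using *[of 1 x 1 x'] by simp
    show "chart_J \<A> J (U, \<phi>) y (a *\<^sub>R x) = a *\<^sub>R chart_J \<A> J (U, \<phi>) y x" for a x
      using *[of a x 0 x] by simp
  qed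
qed

lemma chart_J_sq: assumes "y \<in> \<phi> ` U" shows "chart_J \<A> J (U, \<phi>) y (chart_J \<A> J (U, \<phi>) y x) = - x"
proof -
  let ?p = "inv_into U \<phi> y"
  have p: "?p \<in> U" using inv_in[OF c assms] .
  have pX: "?p \<in> topspace X" using p chart_subset[OF c] by blast
  have y: "\<phi> ?p = y" using chart_inv[OF c assms] .
  have "J ?p (J ?p (coord_tvec \<A> (U, \<phi>) ?p x)) = (\<lambda>d. - coord_tvec \<A> (U, \<phi>) ?p x d)"
    using acs pX coord_tvec_tangent[OF c p] unfolding almost_complex_structure_def by blast
  then have "coord_tvec \<A> (U, \<phi>) ?p (chart_J \<A> J (U, \<phi>) y (chart_J \<A> J (U, \<phi>) y x)) = (\<lambda>d. - coord_tvec \<A> (U, \<phi>) ?p x d)"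
    unfolding J_coord[OF p] y .
  from fun_cong[OF this, of "(U, \<phi>)"] show ?thesis by (simp add: coord_tvec_tangent(2)[OF c p])
qed

lemma chart_J_smooth: "smooth_on (\<phi> ` U) (\<lambda>y. chart_J \<A> J (U, \<phi>) y x)"
  using acs c unfolding almost_complex_structure_def chart_J_def by fastforce

lemma J_disc_through_chart:
  assumes FU: "\<And>z. z \<in> ball 0 1 \<Longrightarrow> F z \<in> \<phi> ` U"
    and F: "\<And>z. z \<in> ball 0 1 \<Longrightarrow> (F has_derivative F' z) (at z)" and cont: "\<And>h. continuous_on (ball 0 1) (\<lambda>z. F' z h)"
    and hol: "\<And>z h. z \<in> ball 0 1 \<Longrightarrow> F' z (\<i> * h) = chart_J \<A> J (U, \<phi>) (F z) (F' z h)"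
  shows "J_complex_disc X \<A> J (\<lambda>z. inv_into U \<phi> (F z))"
  unfolding J_complex_disc_def
proof (intro conjI ballI allI)
  show "C1_map X \<A> (ball 0 1) (\<lambda>z. inv_into U \<phi> (F z))"
    by (rule C1_map_through_chart(1)[OF c open_ball, where F' = F']) (use FU F cont in auto)
  have D: "differential \<A> (\<lambda>z. inv_into U \<phi> (F z)) z h = coord_tvec \<A> (U, \<phi>) (inv_into U \<phi> (F z)) (F' z h)"
    if "z \<in> ball 0 1" for z h
    by (rule C1_map_through_chart(2)[OF c open_ball, where F' = F', OF _ _ _ that]) (use FU F cont in auto)
  fix z h assume z: "z \<in> ball (0::complex) 1"
  let ?p = "inv_into U \<phi> (F z)"
  have p: "?p \<in> U" "\<phi> ?p = F z" using inv_in[OF c FU[OF z]] chart_inv[OF c FU[OF z]] .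
  show "differential \<A> (\<lambda>z. inv_into U \<phi> (F z)) z (\<i> * h) = J ?p (differential \<A> (\<lambda>z. inv_into U \<phi> (F z)) z h)"
    unfolding D[OF z] J_coord[OF p(1)] p(2) hol[OF z] ..
qed

text \<open>
  The straight line in the direction \<open>x\<close> stays in the slice, so it is a curve in
  the submanifold.
\<close>

lemma tangent_sub_slice:
  assumes S: "subspace S" "\<phi> ` (U \<inter> E) = \<phi> ` U \<inter> S" and p: "p \<in> E" "p \<in> U" and x: "x \<in> S"
  shows "coord_tvec \<A> (U, \<phi>) p x \<in> tangent_space_sub X \<A> E p"
proof -
  define I where "I = {t::real. \<phi> p + t *\<^sub>R x \<in> \<phi> ` U}"
  have I: "open I" "0 \<in> I"
  proof -
    have "open ((\<lambda>t. \<phi> p + t *\<^sub>R x) -` (\<phi> ` U))"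
      by (rule open_vimage[OF chart(2)[OF c]]) (intro continuous_intros)
    then show "open I" by (simp add: I_def vimage_def)
    show "0 \<in> I" using p by (simp add: I_def)
  qed
  let ?F = "\<lambda>t. \<phi> p + t *\<^sub>R x" and ?F' = "\<lambda>t h::real. h *\<^sub>R x"
  let ?g = "\<lambda>t. inv_into U \<phi> (?F t)"
  have IF: "?F t \<in> \<phi> ` U" if "t \<in> I" for t using that by (simp add: I_def)
  have dF: "(?F has_derivative ?F' t) (at t)" for t by (auto intro!: derivative_eq_intros)
  have cF: "continuous_on I (\<lambda>t. ?F' t h)" for h by (intro continuous_intros)
  have C: "C1_map X \<A> I ?g" by (rule C1_map_through_chart(1)[OF c I(1) IF dF cF])
  have D: "differential \<A> ?g 0 1 = coord_tvec \<A> (U, \<phi>) (?g 0) (?F' 0 1)"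
    by (rule C1_map_through_chart(2)[OF c I(1) IF dF cF I(2)])
  have "?g ` I \<subseteq> E"
  proof
    fix q assume "q \<in> ?g ` I"
    then obtain t where t: "\<phi> p + t *\<^sub>R x \<in> \<phi> ` U" "q = ?g t" by (auto simp: I_def)
    have "\<phi> p \<in> S" using S(2) p by blast
    then have "\<phi> p + t *\<^sub>R x \<in> \<phi> ` (U \<inter> E)" using S t x by (simp add: subspace_add subspace_scale)
    then show "q \<in> E" using t(2) c by (auto simp: inv_chart)
  qed
  moreover have g0: "?g 0 = p" using p c by (simp add: inv_chart)
  ultimately have "differential \<A> ?g 0 1 \<in> tangent_space_sub X \<A> E p"
    unfolding tangent_space_sub_def using I C by blast
  then show ?thesis using D g0 by simp
qed

lemma totally_real_slice:
  assumes S: "subspace S" "\<phi> ` (U \<inter> E) = \<phi> ` U \<inter> S" and p: "p \<in> E" "p \<in> U" and E: "totally_real X \<A> J E"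
    and x: "x \<in> S" "chart_J \<A> J (U, \<phi>) (\<phi> p) x \<in> S"
  shows "x = 0"
proof -
  let ?y = "chart_J \<A> J (U, \<phi>) (\<phi> p) x"
  have "coord_tvec \<A> (U, \<phi>) p ?y \<in> tangent_space_sub X \<A> E p \<inter> J p ` tangent_space_sub X \<A> E p"
    using tangent_sub_slice[OF S p x(1)] tangent_sub_slice[OF S p x(2)] J_coord[OF p(2), of x, symmetric] by auto
  then have "coord_tvec \<A> (U, \<phi>) p ?y = tzero" using E p(1) unfolding totally_real_def by blast
  then have "?y = 0" using coord_tvec_tangent(2)[OF c p(2), of ?y] by simp
  then have "chart_J \<A> J (U, \<phi>) (\<phi> p) ?y = 0" using linear_0[OF chart_J_linear] p by simp
  then show ?thesis using chart_J_sq[of "\<phi> p" x] p by simp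
qed

end

end

section \<open>Subharmonic functions and the value minus infinity\<close>

lemma usc_measurable:
  fixes h :: "complex \<Rightarrow> ereal"
  assumes "subharmonic_on (ball 0 1) h" "0 < r" "r < 1"
  shows "(\<lambda>t. h (of_real r * cis t)) \<in> borel_measurable lborel"
proof (rule borel_measurableI_less)
  fix y
  have "openin (top_of_set (ball 0 1)) {z \<in> ball 0 1. h z < y}"
    using assms(1) by (simp add: subharmonic_on_def upper_semicontinuous_def)
  then have o: "open {z \<in> ball 0 1. h z < y}" using openin_open_trans open_ball by blast
  have c: "continuous_on UNIV (\<lambda>t. of_real r * cis t)" by (intro continuous_intros)
  have "open ((\<lambda>t. of_real r * cis t) -` {z \<in> ball 0 1. h z < y})" by (rule open_vimage[OF o c])
  moreover have "(\<lambda>t. of_real r * cis t) -` {z \<in> ball 0 1. h z < y} = {t. h (of_real r * cis t) < y}"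
    using assms by (auto simp: norm_mult)
  ultimately show "{x \<in> space lborel. h (complex_of_real r * cis x) < y} \<in> sets lborel" by simp
qed

text \<open>
  The mean value inequality with positive part \<open>P\<close> and negative part
  \<open>I\<close>, solved for \<open>I\<close>; finiteness of \<open>P\<close> excludes the
  undefined difference.
\<close>

lemma ereal_mean_bound:
  fixes P I :: ennreal
  assumes P: "P \<le> ennreal p" and c: "ereal c \<le> (enn2ereal P - enn2ereal I) / ereal (2 * pi)" and "0 \<le> p"
  shows "I \<le> ennreal (max 0 (p - 2 * pi * c))"
proof -
  have "P < top" using P by (auto intro: le_less_trans)
  then obtain p' where p': "P = ennreal p'" "0 \<le> p'" by (cases P) auto
  have pp: "p' \<le> p" using P p' assms(3) by (simp add: ennreal_le_iff)
  show ?thesis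
  proof (cases I)
    case (real i)
    have "ereal c \<le> ereal ((p' - i) / (2 * pi))" using c p' real by (simp add: enn2ereal_ennreal)
    then have "c \<le> (p' - i) / (2 * pi)" by simp
    then have "i \<le> p - 2 * pi * c" using pp by (simp add: field_simps)
    then show ?thesis using real by (simp add: ennreal_leI)
  next
    case top
    then have "ereal c \<le> (ereal p' - \<infinity>) / ereal (2 * pi)" using c p' by (simp add: enn2ereal_ennreal)
    then have False by simp
    then show ?thesis ..
  qed
qed

text \<open>
  If \<open>h 0\<close> were finite, the mean value inequality on the circles of radius
  \<open>r k\<close> would bound the integrals of the negative parts, as the positive parts
  are bounded by \<open>M\<close>. By Fatou's lemma the integral of the lower limit would be
  finite, but this limit is infinite on the set \<open>T\<close> of positive length.
\<close>

lemma subharmonic_minus_infinity: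
  fixes h :: "complex \<Rightarrow> ereal"
  assumes h: "subharmonic_on (ball 0 1) h" and r: "\<And>k. 0 < r k" "\<And>k. r k < 1"
    and M: "\<And>k t. h (of_real (r k) * cis t) \<le> ereal M"
    and T: "T \<in> sets lborel" "T \<subseteq> {0..2*pi}" "emeasure lborel T \<noteq> 0"
    and lim: "\<And>t. t \<in> T \<Longrightarrow> (\<lambda>k. h (of_real (r k) * cis t)) \<longlonglongrightarrow> -\<infinity>"
  shows "h 0 = -\<infinity>"
proof (rule ccontr)
  assume n: "h 0 \<noteq> -\<infinity>"
  obtain c where c: "ereal c \<le> h 0" using n by (cases "h 0") auto
  define p where "p = max 0 M * (2 * pi)"
  let ?I = "\<lambda>k. \<integral>\<^sup>+t\<in>{0..2 * pi}. e2ennreal (- h (0 + of_real (r k) * cis t)) \<partial>lborel"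
  let ?P = "\<lambda>k. \<integral>\<^sup>+t\<in>{0..2 * pi}. e2ennreal (h (0 + of_real (r k) * cis t)) \<partial>lborel"
  have bound: "?I k \<le> ennreal (max 0 (p - 2 * pi * c))" for k
  proof (rule ereal_mean_bound)
    have "?P k \<le> (\<integral>\<^sup>+t. ennreal (max 0 M) * indicator {0..2 * pi} t \<partial>lborel)"
    proof (intro nn_integral_mono mult_right_mono)
      fix t
      have "e2ennreal (h (0 + of_real (r k) * cis t)) \<le> e2ennreal (ereal M)" using M[of k t] by (intro e2ennreal_mono) simp
      also have "\<dots> \<le> ennreal (max 0 M)" by (simp add: e2ennreal_ereal ennreal_leI)
      finally show "e2ennreal (h (0 + of_real (r k) * cis t)) \<le> ennreal (max 0 M)" .
    qed simp
    also have "\<dots> = ennreal p"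
      by (simp add: nn_integral_cmult_indicator p_def ennreal_mult)
    finally show "?P k \<le> ennreal p" .
    have "cball 0 (r k) \<subseteq> ball (0::complex) 1" using r(2)[of k] by auto
    then have "h 0 \<le> circle_mean h 0 (r k)" using h r(1)[of k] by (simp add: subharmonic_on_def)
    then show "ereal c \<le> (enn2ereal (?P k) - enn2ereal (?I k)) / ereal (2 * pi)"
      using c order_trans unfolding circle_mean_def by blast
  qed (simp add: p_def)
  let ?f = "\<lambda>k t. e2ennreal (- h (of_real (r k) * cis t)) * indicator {0..2 * pi} t"
  have meas: "?f k \<in> borel_measurable lborel" for k
    by (intro borel_measurable_times_ennreal borel_measurable_indicator measurable_compose[OF _ measurable_e2ennreal]
      borel_measurable_uminus_ereal usc_measurable[OF h r]) simp
  have "(\<integral>\<^sup>+t. \<infinity> * indicator T t \<partial>lborel) \<le> (\<integral>\<^sup>+t. liminf (\<lambda>k. ?f k t) \<partial>lborel)"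
  proof (intro nn_integral_mono)
    fix t
    show "\<infinity> * indicator T t \<le> liminf (\<lambda>k. ?f k t)"
    proof (cases "t \<in> T")
      case True
      have "(\<lambda>k. - h (of_real (r k) * cis t)) \<longlonglongrightarrow> - (-\<infinity>)" by (intro tendsto_uminus_ereal lim True)
      then have "(\<lambda>k. e2ennreal (- h (of_real (r k) * cis t))) \<longlonglongrightarrow> e2ennreal \<infinity>" by (intro tendsto_e2ennrealI) simp
      then have "liminf (\<lambda>k. e2ennreal (- h (of_real (r k) * cis t))) = e2ennreal \<infinity>" by (intro lim_imp_Liminf) auto
      moreover have "t \<in> {0..2*pi}" using True T by blast
      ultimately show ?thesis by (simp add: e2ennreal_infty)
    qed simp
  qed
  also have "\<dots> \<le> liminf (\<lambda>k. \<integral>\<^sup>+t. ?f k t \<partial>lborel)" by (rule nn_integral_liminf[OF meas])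
  also have "\<dots> \<le> liminf (\<lambda>k. ennreal (max 0 (p - 2 * pi * c)))"
    using bound by (intro Liminf_mono always_eventually) simp
  also have "\<dots> = ennreal (max 0 (p - 2 * pi * c))" by (rule Liminf_const) simp
  finally have "(\<integral>\<^sup>+t. \<infinity> * indicator T t \<partial>lborel) < \<infinity>" by (rule le_less_trans) simp
  moreover have "(\<integral>\<^sup>+t. \<infinity> * indicator T t \<partial>lborel) = \<infinity>" using T by (simp add: nn_integral_cmult_indicator)
  ultimately show False by simp
qed

lemma usc_bounded_above:
  fixes k :: "'a::topological_space \<Rightarrow> ereal"
  assumes "compact S" "\<And>c. openin (top_of_set S) {z \<in> S. k z < c}" "\<And>z. z \<in> S \<Longrightarrow> k z < \<infinity>"
  obtains M where "\<And>z. z \<in> S \<Longrightarrow> k z \<le> ereal M"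
proof -
  let ?C = "range (\<lambda>n::nat. {z \<in> S. k z < ereal (real n)})"
  have "\<forall>c\<in>?C. openin (top_of_set S) c" using assms(2) by blast
  moreover have "S \<subseteq> \<Union>?C"
  proof
    fix z assume z: "z \<in> S"
    have "\<exists>n::nat. k z < ereal (real n)"
    proof (cases "k z")
      case (real x) then show ?thesis using reals_Archimedean2[of x] by auto
    qed (use assms(3)[OF z] in auto)
    then show "z \<in> \<Union>?C" using z by auto
  qed
  ultimately obtain D where D: "D \<subseteq> ?C" "finite D" "S \<subseteq> \<Union>D"
    using assms(1) unfolding compact_eq_openin_cover by meson
  then obtain N where N: "finite N" "D = (\<lambda>n::nat. {z \<in> S. k z < ereal (real n)}) ` N"
    by (meson finite_subset_image)
  show thesis
  proof (rule that[of "real (Max (insert 0 N))"])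
    fix z assume "z \<in> S"
    then obtain n where n: "n \<in> N" "k z < ereal (real n)" using D(3) N(2) by auto
    have "n \<le> Max (insert 0 N)" using n(1) N(1) by simp
    then show "k z \<le> ereal (real (Max (insert 0 N)))" using n(2) by (meson less_eq_ereal_def ereal_less_eq(3) of_nat_mono order_trans less_imp_le)
  qed
qed

text \<open>
  The open set contains an arc of the circle of radius \<open>s\<close> around the centre.
\<close>

lemma subharmonic_minus_infinity_interior:
  fixes h :: "complex \<Rightarrow> ereal"
  assumes h: "subharmonic_on (ball 0 1) h" and s: "0 < s" "s < 1" and O: "open W" "\<i> * of_real s \<in> W" "\<And>z. z \<in> W \<Longrightarrow> h z = -\<infinity>"
  shows "h 0 = -\<infinity>"
proof -
  have usc: "openin (top_of_set (ball 0 1)) {z \<in> ball 0 1. h z < c}" for c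
    using h by (simp add: subharmonic_on_def upper_semicontinuous_def)
  have sub: "sphere 0 s \<subseteq> ball (0::complex) 1" using s by auto
  have usc': "openin (top_of_set (sphere 0 s)) {z \<in> sphere 0 s. h z < c}" for c
  proof -
    have "openin (top_of_set (sphere 0 s)) (sphere 0 s \<inter> {z \<in> ball 0 1. h z < c})"
      using usc sub by (metis openin_Int_open openin_open_trans open_ball openin_open_Int)
    moreover have "sphere 0 s \<inter> {z \<in> ball 0 1. h z < c} = {z \<in> sphere 0 s. h z < c}" using sub by blast
    ultimately show ?thesis by simp
  qed
  have fin: "h z < \<infinity>" if "z \<in> sphere 0 s" for z using h sub that by (auto simp: subharmonic_on_def)
  obtain M where M: "\<And>z. z \<in> sphere 0 s \<Longrightarrow> h z \<le> ereal M"
    using usc_bounded_above[OF compact_sphere usc' fin] by blast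
  define T where "T = {0<..<2*pi} \<inter> (\<lambda>t. of_real s * cis t) -` W"
  have oT: "open T" unfolding T_def by (intro open_Int open_vimage O continuous_intros open_greaterThanLessThan)
  have "pi/2 \<in> T" using O(2) by (simp add: T_def cis_pi_half mult.commute)
  show ?thesis
  proof (rule subharmonic_minus_infinity[OF h, where r = "\<lambda>_. s" and M = M and T = T])
    show "h (of_real s * cis t) \<le> ereal M" for t using M s by (simp add: norm_mult)
    show "T \<in> sets lborel" using oT by simp
    show "T \<subseteq> {0..2*pi}" by (auto simp: T_def)
    show "emeasure lborel T \<noteq> 0"
    proof -
      obtain e where e: "e > 0" "ball (pi/2) e \<subseteq> T" using oT \<open>pi/2 \<in> T\<close> open_contains_ball by blast
      have "emeasure lborel (ball (pi/2) e) \<le> emeasure lborel T" using e oT by (intro emeasure_mono) auto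
      moreover have "emeasure lborel (ball (pi/2) e) = ennreal (2 * e)" using e by (simp add: ball_eq_greaterThanLessThan)
      ultimately show ?thesis using e by auto
    qed
    show "(\<lambda>k. h (of_real s * cis t)) \<longlonglongrightarrow> -\<infinity>" if "t \<in> T" for t using that O(3) by (simp add: T_def)
  qed (use s in auto)
qed

section \<open>A conformal map onto the half disc\<close>

definition cayley :: "complex \<Rightarrow> complex" where "cayley \<zeta> = \<i> * (1 + \<zeta>) / (1 - \<zeta>)"
text \<open>
  A conformal map of the unit disc onto the upper half of the unit disc: first to the upper
  half plane, by the square root to a quadrant, and by a Moebius map to the half disc. The
  lower half of the unit circle goes to the real segment.
\<close>

definition \<psi> :: "complex \<Rightarrow> complex" where "\<psi> \<zeta> = (csqrt (cayley \<zeta>) - 1) / (csqrt (cayley \<zeta>) + 1)"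
definition \<psi>' :: "complex \<Rightarrow> complex" where
  "\<psi>' \<zeta> = (2 / (csqrt (cayley \<zeta>) + 1)^2) * (inverse (2 * csqrt (cayley \<zeta>)) * (2 * \<i> / (1 - \<zeta>)^2))"

lemma cayley_parts:
  assumes "\<zeta> \<noteq> 1"
  shows "Re (cayley \<zeta>) = - 2 * Im \<zeta> / (norm (1 - \<zeta>))^2" "Im (cayley \<zeta>) = (1 - (norm \<zeta>)^2) / (norm (1 - \<zeta>))^2"
proof -
  have "cayley \<zeta> = \<i> * (1 + \<zeta>) * cnj (1 - \<zeta>) / of_real ((norm (1 - \<zeta>))^2)"
    unfolding cayley_def using assms by (simp only: complex_div_cnj[of _ "1 - \<zeta>"])
  then have *: "cayley \<zeta> = (1 / (norm (1 - \<zeta>))^2) *\<^sub>R (\<i> * (1 + \<zeta>) * cnj (1 - \<zeta>))"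
    by (simp add: scaleR_conv_of_real divide_inverse mult.commute)
  show "Re (cayley \<zeta>) = - 2 * Im \<zeta> / (norm (1 - \<zeta>))^2"
    unfolding * by (simp add: algebra_simps)
  show "Im (cayley \<zeta>) = (1 - (norm \<zeta>)^2) / (norm (1 - \<zeta>))^2"
    unfolding * cmod_power2[of \<zeta>] by (simp add: algebra_simps power2_eq_square add_divide_distrib diff_divide_distrib)
qed

lemma csqrt_quadrant:
  assumes "0 \<le> Im w" "w \<notin> \<real>\<^sub>\<le>\<^sub>0" shows "0 < Re (csqrt w)" "0 \<le> Im (csqrt w)" "0 < Im w \<Longrightarrow> 0 < Im (csqrt w)" "Im w = 0 \<Longrightarrow> Im (csqrt w) = 0"
proof -
  have sq: "csqrt w * csqrt w = w" using power2_csqrt[of w] by (simp add: power2_eq_square)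
  have gen: "2 * Re s * Im s = Im w \<and> (Re s)^2 - (Im s)^2 = Re w" if "s * s = w" for s
    using that by (auto simp: power2_eq_square)
  have im: "2 * Re (csqrt w) * Im (csqrt w) = Im w" and re: "(Re (csqrt w))^2 - (Im (csqrt w))^2 = Re w"
    using gen[OF sq] by blast+
  have p: "0 \<le> Re (csqrt w)" using csqrt_principal[of w] by auto
  show r: "0 < Re (csqrt w)"
  proof (rule ccontr)
    assume "\<not> 0 < Re (csqrt w)"
    then have z: "Re (csqrt w) = 0" using p by simp
    have "Im w = 0" "Re w = - ((Im (csqrt w))^2)" using im re unfolding z by (simp_all del: csqrt.sel)
    then have "Im w = 0" "Re w \<le> 0" using zero_le_power2[of "Im (csqrt w)"] by linarith+
    then show False using assms(2) by (simp add: complex_nonpos_Reals_iff)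
  qed
  show "0 \<le> Im (csqrt w)" using im r assms(1) by (metis mult_less_0_iff not_le zero_less_mult_iff zero_less_numeral)
  show "0 < Im w \<Longrightarrow> 0 < Im (csqrt w)" using im r by (metis zero_less_mult_pos zero_less_mult_iff zero_less_numeral)
  show "Im w = 0 \<Longrightarrow> Im (csqrt w) = 0" using im r by simp
qed

lemma cayley_quadrant:
  assumes "0 < Re s"
  shows "norm ((s - 1) / (s + 1)) < 1" "Im ((s - 1) / (s + 1)) = 2 * Im s / (norm (s + 1))^2"
    "Re ((s - 1) / (s + 1)) = ((norm s)^2 - 1) / (norm (s + 1))^2" "s + 1 \<noteq> 0"
proof -
  show n0: "s + 1 \<noteq> 0" using assms by (auto simp: complex_eq_iff)
  have "(norm (s - 1))^2 < (norm (s + 1))^2" using assms unfolding cmod_power2 by (simp add: power2_eq_square algebra_simps)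
  then have "norm (s - 1) < norm (s + 1)" by (rule power_less_imp_less_base) simp
  then show "norm ((s - 1) / (s + 1)) < 1" using n0 by (simp add: norm_divide)
  have *: "(s - 1) / (s + 1) = (1 / (norm (s + 1))^2) *\<^sub>R ((s - 1) * cnj (s + 1))"
    using n0 complex_div_cnj[of "s - 1" "s + 1"] by (simp add: scaleR_conv_of_real divide_inverse mult.commute)
  show "Im ((s - 1) / (s + 1)) = 2 * Im s / (norm (s + 1))^2" unfolding * by (simp add: algebra_simps)
  show "Re ((s - 1) / (s + 1)) = ((norm s)^2 - 1) / (norm (s + 1))^2"
    unfolding * cmod_power2[of s] by (simp add: algebra_simps power2_eq_square add_divide_distrib diff_divide_distrib)
qed

lemma cayley_notin:
  assumes "\<zeta> \<noteq> 1" "norm \<zeta> < 1 \<or> (norm \<zeta> = 1 \<and> Im \<zeta> < 0)"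
  shows "cayley \<zeta> \<notin> \<real>\<^sub>\<le>\<^sub>0" "0 \<le> Im (cayley \<zeta>)"
proof -
  have p: "0 < (norm (1 - \<zeta>))^2" using assms(1) by simp
  have n: "(norm \<zeta>)^2 \<le> 1" using assms(2) by (auto simp: power_le_one)
  show "0 \<le> Im (cayley \<zeta>)" unfolding cayley_parts[OF assms(1)] using n by simp
  show "cayley \<zeta> \<notin> \<real>\<^sub>\<le>\<^sub>0"
  proof
    assume "cayley \<zeta> \<in> \<real>\<^sub>\<le>\<^sub>0"
    then have a: "Im (cayley \<zeta>) = 0" "Re (cayley \<zeta>) \<le> 0" by (auto simp: complex_nonpos_Reals_iff)
    have "(norm \<zeta>)^2 = 1" using a(1) p unfolding cayley_parts[OF assms(1)] by simp
    then have "norm \<zeta> = 1 \<or> norm \<zeta> = -1" by (simp only: power2_eq_1_iff)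
    then have "norm \<zeta> = 1" using norm_ge_zero[of \<zeta>] by linarith
    then have "Im \<zeta> < 0" using assms(2) by simp
    then have "0 < Re (cayley \<zeta>)" using p unfolding cayley_parts[OF assms(1)] by (intro divide_pos_pos) auto
    then show False using a by simp
  qed
qed

lemma \<psi>_half_disc:
  assumes "norm \<zeta> < 1" shows "0 < Im (\<psi> \<zeta>)" "norm (\<psi> \<zeta>) < 1"
proof -
  have z1: "\<zeta> \<noteq> 1" using assms by auto
  note c = cayley_notin[OF z1 disjI1[OF assms]]
  have "(norm \<zeta>)^2 < 1" using assms by (simp add: power_less_one_iff abs_square_less_1)
  then have "0 < Im (cayley \<zeta>)" using z1 unfolding cayley_parts(2)[OF z1] by simp
  note q = csqrt_quadrant[OF c(2,1)]
  show "norm (\<psi> \<zeta>) < 1" unfolding \<psi>_def by (rule cayley_quadrant(1)[OF q(1)])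
  show "0 < Im (\<psi> \<zeta>)" unfolding \<psi>_def cayley_quadrant(2)[OF q(1)]
    using q(3)[OF \<open>0 < Im (cayley \<zeta>)\<close>] cayley_quadrant(4)[OF q(1)] by simp
qed

lemma \<psi>_0: "\<psi> 0 = \<i> * of_real (Im (\<psi> 0))" "0 < Im (\<psi> 0)" "Im (\<psi> 0) < 1"
proof -
  have z1: "(0::complex) \<noteq> 1" by simp
  note q = csqrt_quadrant[OF cayley_notin(2,1)[OF z1], simplified]
  have "norm (csqrt (cayley 0)) = 1" unfolding norm_csqrt cayley_def by simp
  then have "Re (\<psi> 0) = 0" unfolding \<psi>_def by (subst cayley_quadrant(3)) (use q(1) in auto)
  then show "\<psi> 0 = \<i> * of_real (Im (\<psi> 0))" by (simp add: complex_eq_iff)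
  show "0 < Im (\<psi> 0)" using \<psi>_half_disc[of 0] by simp
  show "Im (\<psi> 0) < 1" using \<psi>_half_disc[of 0] abs_Im_le_cmod[of "\<psi> 0"] by simp
qed

lemma \<psi>_boundary:
  assumes "pi < t" "t < 2 * pi"
  shows "Im (\<psi> (cis t)) = 0" "norm (\<psi> (cis t)) < 1" "isCont \<psi> (cis t)"
proof -
  have im: "Im (cis t) < 0" using assms sin_lt_zero[of t] by simp
  then have z1: "cis t \<noteq> 1" by (auto simp: complex_eq_iff)
  have d: "norm (cis t) < 1 \<or> (norm (cis t) = 1 \<and> Im (cis t) < 0)" using im by simp
  note c = cayley_notin[OF z1 d]
  note q = csqrt_quadrant[OF c(2,1)]
  have i0: "Im (cayley (cis t)) = 0" unfolding cayley_parts[OF z1] by simp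
  show "Im (\<psi> (cis t)) = 0" unfolding \<psi>_def cayley_quadrant(2)[OF q(1)] using q(4)[OF i0] by simp
  show "norm (\<psi> (cis t)) < 1" unfolding \<psi>_def by (rule cayley_quadrant(1)[OF q(1)])
  have "isCont cayley (cis t)" unfolding cayley_def using z1 by (intro continuous_intros) auto
  then have "isCont (\<lambda>z. csqrt (cayley z)) (cis t)"
    using continuous_at_csqrt[OF c(1)] isCont_o2 by blast
  then show "isCont \<psi> (cis t)" unfolding \<psi>_def[abs_def] using cayley_quadrant(4)[OF q(1)] by (intro continuous_intros) auto
qed

lemma \<psi>_derivative:
  assumes "norm \<zeta> < 1" shows "(\<psi> has_field_derivative \<psi>' \<zeta>) (at \<zeta>)"
proof -
  have z1: "\<zeta> \<noteq> 1" using assms by auto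
  note c = cayley_notin[OF z1 disjI1[OF assms]]
  note q = csqrt_quadrant[OF c(2,1)]
  have 1: "(cayley has_field_derivative 2 * \<i> / (1 - \<zeta>)^2) (at \<zeta>)"
    unfolding cayley_def[abs_def] using z1
    by (auto intro!: derivative_eq_intros simp: power2_eq_square divide_simps algebra_simps)
  have 2: "((\<lambda>z. csqrt (cayley z)) has_field_derivative inverse (2 * csqrt (cayley \<zeta>)) * (2 * \<i> / (1 - \<zeta>)^2)) (at \<zeta>)"
    using DERIV_chain2[OF has_field_derivative_csqrt[OF c(1)] 1] by simp
  have 3: "((\<lambda>s. (s - 1) / (s + 1)) has_field_derivative 2 / (csqrt (cayley \<zeta>) + 1)^2) (at (csqrt (cayley \<zeta>)))"
    using cayley_quadrant(4)[OF q(1)]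
    by (auto intro!: derivative_eq_intros simp: power2_eq_square divide_simps)
  show ?thesis unfolding \<psi>_def[abs_def] \<psi>'_def by (rule DERIV_chain2[OF 3 2])
qed

lemma \<psi>'_continuous: "continuous_on (ball 0 1) \<psi>'"
proof -
  have z1: "\<zeta> \<noteq> 1" if "\<zeta> \<in> ball 0 1" for \<zeta> :: complex using that by auto
  have c: "cayley \<zeta> \<notin> \<real>\<^sub>\<le>\<^sub>0" "0 \<le> Im (cayley \<zeta>)" if "\<zeta> \<in> ball 0 1" for \<zeta> using cayley_notin[OF z1[OF that]] that by auto
  have "continuous_on (ball 0 1) cayley" unfolding cayley_def[abs_def] using z1 by (intro continuous_intros) auto
  then have s: "continuous_on (ball 0 1) (\<lambda>\<zeta>. csqrt (cayley \<zeta>))"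
    by (rule continuous_on_compose2[OF continuous_on_csqrt]) (use c in auto)
  have n: "csqrt (cayley \<zeta>) + 1 \<noteq> 0" "csqrt (cayley \<zeta>) \<noteq> 0" if "\<zeta> \<in> ball 0 1" for \<zeta>
  proof -
    have p: "0 < Re (csqrt (cayley \<zeta>))" by (rule csqrt_quadrant(1)[OF c(2)[OF that] c(1)[OF that]])
    show "csqrt (cayley \<zeta>) + 1 \<noteq> 0" by (rule cayley_quadrant(4)[OF p])
    show "csqrt (cayley \<zeta>) \<noteq> 0" using p by (metis less_irrefl zero_complex.sel(1))
  qed
  show ?thesis unfolding \<psi>'_def[abs_def] using n z1 by (intro continuous_intros s) auto
qed

section \<open>Half discs in the manifold\<close>

lemma borel_negligible_iff: "S \<in> sets borel \<Longrightarrow> negligible S \<longleftrightarrow> (AE x in lborel. x \<notin> S)"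
  unfolding negligible_iff_null_sets using null_sets_completion_iff[of S lborel] AE_iff_null_sets[of S lborel] by simp

text \<open>
  The centre of the unit disc is mapped to \<open>\<i> * t0\<close> by \<open>\<psi>\<close>
  and also by the affine map onto the disc of radius \<open>min t0 (1 - t0)\<close> around
  \<open>\<i> * t0\<close>; the affine map sends \<open>\<i> / 2\<close> to \<open>\<i> *
  t1\<close>.
\<close>

locale local_discs = almost_complex X \<A> J + real_form J0 R t0 t1
  for X :: "'a topology" and \<A> :: "('a, 'e::euclidean_space) chart set" and J and J0 R :: "'e \<Rightarrow> 'e" and t0 t1 +
  fixes U ch y0 r \<Psi> K
  assumes ch: "(U, ch) \<in> \<A>" and cd: "coordinate_discs (ch ` U) (chart_J \<A> J (U, ch)) y0 r \<Psi> K"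
    and t0: "t0 = Im (\<psi> 0)" and t1: "t1 = t0 + min t0 (1 - t0) / 2"
begin

abbreviation "Jc \<equiv> chart_J \<A> J (U, ch)"

definition pt :: "'e \<Rightarrow> 'a" where "pt y = inv_into U ch (\<Psi> y)"

definition unit_half_disc :: "complex set" where "unit_half_disc = {z \<in> half_disc. norm z \<le> 1}"

lemma \<Psi>: "0 < r" "continuous_on (ball 0 r) \<Psi>" "\<Psi> ` ball 0 r \<subseteq> ch ` U"
  using cd by (auto simp: coordinate_discs_def)

lemma unit_half_disc_compact: "compact unit_half_disc"
proof -
  have "unit_half_disc = {z. 0 \<le> Im z} \<inter> cball 0 1" by (auto simp: unit_half_disc_def half_disc_def)
  moreover have "compact ({z. 0 \<le> Im z} \<inter> cball 0 1)"
    by (rule closed_Int_compact[OF closed_halfspace_Im_ge[of 0] compact_cball])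
  ultimately show ?thesis by (simp only:)
qed

lemma pt_continuous:
  assumes "continuous_on S w" "w ` S \<subseteq> ball 0 r" shows "continuous_map (top_of_set S) X (\<lambda>z. pt (w z))"
proof -
  have "continuous_on S (\<lambda>z. \<Psi> (w z))" by (rule continuous_on_compose2[OF \<Psi>(2) assms])
  then have "continuous_map (top_of_set S) (top_of_set (ch ` U)) (\<lambda>z. \<Psi> (w z))"
    using assms(2) \<Psi>(3) by (auto simp: continuous_map_iff_continuous2)
  from continuous_map_compose[OF this inv_continuous[OF ch]] show ?thesis by (simp add: o_def pt_def)
qed

lemma pt_in: "y \<in> ball 0 r \<Longrightarrow> pt y \<in> U" unfolding pt_def using inv_in[OF ch] \<Psi>(3) by blast

context
  fixes e \<delta> w F1 F2 assumes fam: "attached_discs Jc r \<Psi> K e \<delta> w F1 F2"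
begin

lemma fam_D:
  assumes "norm \<theta> \<le> \<delta>"
  shows "continuous_on half_disc (w \<theta>)" "w \<theta> ` half_disc \<subseteq> ball 0 r" "continuous_on half_disc (F1 \<theta>)" "continuous_on half_disc (F2 \<theta>)"
    "\<And>z. z \<in> unit_half_disc \<Longrightarrow> ((\<lambda>z. \<Psi> (w \<theta> z)) has_derivative (\<lambda>\<eta>. Re \<eta> *\<^sub>R F1 \<theta> z + Im \<eta> *\<^sub>R F2 \<theta> z)) (at z)"
    "\<And>z. z \<in> unit_half_disc \<Longrightarrow> F2 \<theta> z = Jc (\<Psi> (w \<theta> z)) (F1 \<theta> z)"
    "\<And>z. Im z = 0 \<Longrightarrow> R (w \<theta> z) = w \<theta> z"
    "w \<theta> (\<i> * of_real t0) = fst \<theta>" "w \<theta> (\<i> * of_real t1) = fst (snd \<theta>)"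
    "\<And>\<theta>' z. norm \<theta>' \<le> \<delta> \<Longrightarrow> z \<in> half_disc \<Longrightarrow> norm (w \<theta> z - w \<theta>' z) \<le> (K + e) * norm (\<theta> - \<theta>')"
  using fam assms unfolding attached_discs_def unit_half_disc_def by blast+

text \<open>
  Holomorphic reparametrisations of the half discs give the round discs to which
  plurisubharmonicity refers.
\<close>

lemma fam_disc:
  assumes \<theta>: "norm \<theta> \<le> \<delta>" and g: "\<And>\<zeta>. \<zeta> \<in> ball 0 1 \<Longrightarrow> g \<zeta> \<in> unit_half_disc"
    "\<And>\<zeta>. \<zeta> \<in> ball 0 1 \<Longrightarrow> (g has_field_derivative g' \<zeta>) (at \<zeta>)" "continuous_on (ball 0 1) g'"
  shows "J_complex_disc X \<A> J (\<lambda>\<zeta>. pt (w \<theta> (g \<zeta>)))"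
  unfolding pt_def
proof (rule J_disc_through_chart[OF ch])
  note D = fam_D[OF \<theta>]
  let ?F' = "\<lambda>\<zeta> h. Re (g' \<zeta> * h) *\<^sub>R F1 \<theta> (g \<zeta>) + Im (g' \<zeta> * h) *\<^sub>R F2 \<theta> (g \<zeta>)"
  have HU: "unit_half_disc \<subseteq> half_disc" by (auto simp: unit_half_disc_def)
  fix \<zeta> :: complex assume z: "\<zeta> \<in> ball 0 1"
  have inb: "w \<theta> (g \<zeta>) \<in> ball 0 r" using D(2) g(1)[OF z] HU by blast
  show "\<Psi> (w \<theta> (g \<zeta>)) \<in> ch ` U" using inb \<Psi>(3) by blast
  show "((\<lambda>\<zeta>. \<Psi> (w \<theta> (g \<zeta>))) has_derivative ?F' \<zeta>) (at \<zeta>)"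
    using has_derivative_compose[OF g(2)[OF z, unfolded has_field_derivative_def] D(5)[OF g(1)[OF z]]] .
  have V: "\<Psi> (w \<theta> (g \<zeta>)) \<in> ch ` U" using inb \<Psi>(3) by blast
  note l = chart_J_linear[OF ch V]
  have J1: "Jc (\<Psi> (w \<theta> (g \<zeta>))) (F1 \<theta> (g \<zeta>)) = F2 \<theta> (g \<zeta>)" using D(6)[OF g(1)[OF z]] by simp
  have J2: "Jc (\<Psi> (w \<theta> (g \<zeta>))) (F2 \<theta> (g \<zeta>)) = - F1 \<theta> (g \<zeta>)" unfolding J1[symmetric] by (rule chart_J_sq[OF ch V])
  fix h
  show "?F' \<zeta> (\<i> * h) = Jc (\<Psi> (w \<theta> (g \<zeta>))) (?F' \<zeta> h)"
    unfolding linear_add[OF l] linear_scale[OF l] J1 J2 by (simp add: algebra_simps)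
next
  note D = fam_D[OF \<theta>]
  have HU: "unit_half_disc \<subseteq> half_disc" by (auto simp: unit_half_disc_def)
  have gc: "continuous_on (ball 0 1) g" using g(2) DERIV_continuous continuous_at_imp_continuous_on by blast
  fix h
  have 1: "continuous_on (ball 0 1) (\<lambda>\<zeta>. F1 \<theta> (g \<zeta>))" "continuous_on (ball 0 1) (\<lambda>\<zeta>. F2 \<theta> (g \<zeta>))"
    by (rule continuous_on_compose2[OF D(3) gc] continuous_on_compose2[OF D(4) gc], use g(1) HU in blast)+
  show "continuous_on (ball 0 1) (\<lambda>\<zeta>. Re (g' \<zeta> * h) *\<^sub>R F1 \<theta> (g \<zeta>) + Im (g' \<zeta> * h) *\<^sub>R F2 \<theta> (g \<zeta>))"
    by (intro continuous_intros 1 g(3))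
qed

context
  fixes v assumes psh: "plurisubharmonic X \<A> J v"
begin

lemma usc_unit_half_disc:
  assumes "norm \<theta> \<le> \<delta>"
  shows "openin (top_of_set unit_half_disc) {z \<in> unit_half_disc. v (pt (w \<theta> z)) < c}" "z \<in> unit_half_disc \<Longrightarrow> v (pt (w \<theta> z)) < \<infinity>"
proof -
  note D = fam_D[OF assms]
  have HU: "unit_half_disc \<subseteq> half_disc" by (auto simp: unit_half_disc_def)
  have cm: "continuous_map (top_of_set unit_half_disc) X (\<lambda>z. pt (w \<theta> z))"
    by (rule pt_continuous[OF continuous_on_subset[OF D(1) HU]]) (use D(2) HU in blast)
  have "openin X {x \<in> topspace X. v x < c}" using psh by (simp add: plurisubharmonic_def upper_semicontinuous_def)
  from openin_continuous_map_preimage[OF cm this]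
  have o: "openin (top_of_set unit_half_disc) {z \<in> unit_half_disc. pt (w \<theta> z) \<in> {x \<in> topspace X. v x < c}}"
    unfolding topspace_euclidean_subtopology .
  have top: "pt (w \<theta> z) \<in> topspace X" if "z \<in> unit_half_disc" for z
  proof -
    have "w \<theta> z \<in> ball 0 r" using D(2) HU that by blast
    then show ?thesis using pt_in chart_subset[OF ch] by blast
  qed
  have "{z \<in> unit_half_disc. pt (w \<theta> z) \<in> {x \<in> topspace X. v x < c}} = {z \<in> unit_half_disc. v (pt (w \<theta> z)) < c}" using top by auto
  then show "openin (top_of_set unit_half_disc) {z \<in> unit_half_disc. v (pt (w \<theta> z)) < c}" using o by (simp only:)
  show "z \<in> unit_half_disc \<Longrightarrow> v (pt (w \<theta> z)) < \<infinity>"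
    using top psh by (simp add: plurisubharmonic_def)
qed

lemma \<psi>_unit_half_disc: "norm \<zeta> < 1 \<Longrightarrow> \<psi> \<zeta> \<in> unit_half_disc" "pi < t \<Longrightarrow> t < 2 * pi \<Longrightarrow> \<psi> (cis t) \<in> unit_half_disc"
  using \<psi>_half_disc[of \<zeta>] \<psi>_boundary[of t] by (auto simp: unit_half_disc_def half_disc_def)

text \<open>
  Upper semicontinuity makes \<open>v\<close> tend to \<open>-\<infinity>\<close> along the
  radii that end in \<open>TT\<close>, and bounds \<open>v\<close> on the compact half disc.
\<close>

lemma boundary_lemma:
  assumes \<theta>: "norm \<theta> \<le> \<delta>" and TT: "TT \<in> sets lborel" "TT \<subseteq> {pi<..<2*pi}" "emeasure lborel TT \<noteq> 0"
    and inf: "\<And>t. t \<in> TT \<Longrightarrow> v (pt (w \<theta> (\<psi> (cis t)))) = -\<infinity>"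
  shows "v (pt (fst \<theta>)) = -\<infinity>"
proof -
  let ?h = "\<lambda>\<zeta>. v (pt (w \<theta> (\<psi> \<zeta>)))"
  have "J_complex_disc X \<A> J (\<lambda>\<zeta>. pt (w \<theta> (\<psi> \<zeta>)))"
    by (rule fam_disc[OF \<theta>]) (use \<psi>_unit_half_disc \<psi>_derivative \<psi>'_continuous in auto)
  then have sh: "subharmonic_on (ball 0 1) ?h" using psh by (auto simp: plurisubharmonic_def o_def)
  obtain M where M: "\<And>z. z \<in> unit_half_disc \<Longrightarrow> v (pt (w \<theta> z)) \<le> ereal M"
    by (rule usc_bounded_above[OF unit_half_disc_compact usc_unit_half_disc(1)[OF \<theta>] usc_unit_half_disc(2)[OF \<theta>]]) (assumption, rule that)
  have rk: "0 < 1 - 1 / (real k + 2)" "1 - 1 / (real k + 2) < 1" for k by (auto simp: field_simps)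
  have sn: "norm (of_real (1 - 1 / (real k + 2)) * cis t) < 1" for k t
    using rk[of k] by (simp only: norm_mult norm_cis norm_of_real mult_1_right abs_of_pos)
  have "?h 0 = -\<infinity>"
  proof (rule subharmonic_minus_infinity[OF sh, where r = "\<lambda>k. 1 - 1 / (real k + 2)" and M = M and T = TT])
    show "0 < 1 - 1 / (real k + 2)" "1 - 1 / (real k + 2) < 1" for k by (rule rk)+
    show "?h (of_real (1 - 1 / (real k + 2)) * cis t) \<le> ereal M" for k t
      by (rule M[OF \<psi>_unit_half_disc(1)[OF sn]])
    show "TT \<subseteq> {0..2 * pi}"
    proof
      fix t assume "t \<in> TT"
      then show "t \<in> {0..2*pi}" using TT(2) pi_gt_zero by (auto simp: subset_iff)
    qed
    fix t assume t: "t \<in> TT"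
    then have tp: "pi < t" "t < 2 * pi" using TT(2) by auto
    let ?s = "\<lambda>k. of_real (1 - 1 / (real k + 2)) * cis t"
    have "(\<lambda>k. 1 / (real k + 2)) \<longlonglongrightarrow> 0"
      using LIMSEQ_ignore_initial_segment[OF lim_inverse_n', of 2] by (simp add: add.commute)
    then have "?s \<longlonglongrightarrow> of_real (1 - 0) * cis t" by (intro tendsto_intros)
    then have "(\<lambda>k. \<psi> (?s k)) \<longlonglongrightarrow> \<psi> (cis t)" using isCont_tendsto_compose[OF \<psi>_boundary(3)[OF tp]] by simp
    show "(\<lambda>k. ?h (?s k)) \<longlonglongrightarrow> -\<infinity>"
      unfolding tendsto_MInfty
    proof
      fix c
      have "openin (top_of_set unit_half_disc) {z \<in> unit_half_disc. v (pt (w \<theta> z)) < ereal c}" by (rule usc_unit_half_disc(1)[OF \<theta>])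
      then obtain W where W: "open W" "{z \<in> unit_half_disc. v (pt (w \<theta> z)) < ereal c} = unit_half_disc \<inter> W" by (auto simp: openin_open)
      have "\<psi> (cis t) \<in> {z \<in> unit_half_disc. v (pt (w \<theta> z)) < ereal c}" using \<psi>_unit_half_disc(2)[OF tp] inf[OF t] by simp
      then have "\<psi> (cis t) \<in> W" unfolding W(2) by (rule IntD2)
      then have "\<forall>\<^sub>F k in sequentially. \<psi> (?s k) \<in> W"
        by (rule topological_tendstoD[OF \<open>(\<lambda>k. \<psi> (?s k)) \<longlonglongrightarrow> \<psi> (cis t)\<close> W(1)])
      then show "\<forall>\<^sub>F k in sequentially. ?h (?s k) < ereal c"
      proof eventually_elim
        case (elim k)
        then have "\<psi> (?s k) \<in> unit_half_disc \<inter> W" using \<psi>_unit_half_disc(1)[OF sn] by blast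
        then show ?case unfolding W(2)[symmetric] by blast
      qed
    qed
  qed (use TT in auto)
  moreover have "w \<theta> (\<psi> 0) = fst \<theta>" using fam_D(8)[OF \<theta>] \<psi>_0(1) t0 by simp
  ultimately show ?thesis by simp
qed

text \<open>
  The disc around \<open>\<i> * t0\<close> contains \<open>\<i> * t1\<close>, where the values
  of the discs are prescribed too.
\<close>

lemma interior_lemma:
  fixes \<theta> :: "'e \<times> 'e \<times> 'e"
  assumes \<theta>: "norm \<theta> \<le> \<delta>" and W0: "open W0" "fst (snd \<theta>) \<in> W0"
    and inf: "\<And>y. y \<in> W0 \<Longrightarrow> y \<in> ball 0 r \<Longrightarrow> v (pt y) = -\<infinity>"
  shows "v (pt (fst \<theta>)) = -\<infinity>"
proof -
  define \<rho>' where "\<rho>' = min t0 (1 - t0)"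
  have t0p: "0 < t0" "t0 < 1" using t01 by auto
  have \<rho>': "0 < \<rho>'" "\<rho>' \<le> t0" "\<rho>' \<le> 1 - t0" using t0p by (auto simp: \<rho>'_def)
  define g where "g \<zeta> = \<i> * of_real t0 + of_real \<rho>' * \<zeta>" for \<zeta> :: complex
  have gH: "g \<zeta> \<in> unit_half_disc" if "\<zeta> \<in> ball 0 1" for \<zeta>
  proof -
    have n: "norm \<zeta> \<le> 1" using that by simp
    have "\<bar>Im \<zeta>\<bar> \<le> 1" using abs_Im_le_cmod[of \<zeta>] n by linarith
    then have "\<rho>' * (- 1) \<le> \<rho>' * Im \<zeta>" using \<rho>' by (intro mult_left_mono) auto
    then have "0 \<le> Im (g \<zeta>)" using \<rho>' by (simp add: g_def)
    moreover have "norm (g \<zeta>) \<le> t0 + \<rho>' * norm \<zeta>"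
      unfolding g_def by (rule order_trans[OF norm_triangle_ineq]) (use t0p \<rho>' in \<open>simp add: norm_mult\<close>)
    moreover have "\<rho>' * norm \<zeta> \<le> \<rho>' * 1" using \<rho>' n by (intro mult_left_mono) auto
    ultimately have "0 \<le> Im (g \<zeta>)" "norm (g \<zeta>) \<le> 1" using \<rho>' by linarith+
    then show ?thesis by (simp add: unit_half_disc_def half_disc_def)
  qed
  have gd: "(g has_field_derivative of_real \<rho>') (at \<zeta>)" for \<zeta> unfolding g_def by (auto intro!: derivative_eq_intros)
  have "J_complex_disc X \<A> J (\<lambda>\<zeta>. pt (w \<theta> (g \<zeta>)))"
    by (rule fam_disc[OF \<theta> gH gd]) auto
  then have sh: "subharmonic_on (ball 0 1) (\<lambda>\<zeta>. v (pt (w \<theta> (g \<zeta>))))" using psh by (auto simp: plurisubharmonic_def o_def)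
  have gc: "continuous_on (ball 0 1) g" unfolding g_def by (intro continuous_intros)
  have HU: "unit_half_disc \<subseteq> half_disc" by (auto simp: unit_half_disc_def)
  have wg: "continuous_on (ball 0 1) (\<lambda>\<zeta>. w \<theta> (g \<zeta>))"
    by (rule continuous_on_compose2[OF fam_D(1)[OF \<theta>] gc]) (use gH HU in blast)
  define W where "W = ball 0 1 \<inter> (\<lambda>\<zeta>. w \<theta> (g \<zeta>)) -` W0"
  have oW: "open W" unfolding W_def by (rule continuous_open_preimage[OF wg open_ball W0(1)])
  have "g (\<i> * of_real (1/2)) = \<i> * of_real t1" by (simp add: g_def t1 \<rho>'_def algebra_simps)
  then have "w \<theta> (g (\<i> * of_real (1/2))) = fst (snd \<theta>)" using fam_D(9)[OF \<theta>] by simp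
  then have inW: "\<i> * of_real (1/2) \<in> W" using W0(2) by (simp add: W_def norm_mult)
  have "v (pt (w \<theta> (g 0))) = -\<infinity>"
  proof (rule subharmonic_minus_infinity_interior[OF sh _ _ oW inW])
    fix z assume "z \<in> W"
    then have gz: "z \<in> ball 0 1" "w \<theta> (g z) \<in> W0" by (auto simp: W_def)
    then have "g z \<in> half_disc" using gH[OF gz(1)] HU by blast
    then have "w \<theta> (g z) \<in> ball 0 r" using fam_D(2)[OF \<theta>] by blast
    with gz(2) have "w \<theta> (g z) \<in> W0" "w \<theta> (g z) \<in> ball 0 r" by auto
    then show "v (pt (w \<theta> (g z))) = -\<infinity>" by (rule inf)
  qed auto
  moreover have "w \<theta> (g 0) = fst \<theta>" using fam_D(8)[OF \<theta>] by (simp add: g_def)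
  ultimately show ?thesis by simp
qed

end

end

end

section \<open>Spreading the value minus infinity\<close>

context local_discs
begin

text \<open>
  The least value on the real axis of the weight with which the third component of the
  parameter moves the discs.
\<close>

definition m0 :: real where "m0 = t0^2 * t1^2"

lemma m0: "0 < m0" "m0 \<le> 1"
  using t01 by (auto simp: m0_def intro!: mult_le_one power_le_one)

lemma m_lower: "m0 \<le> (x^2 + t0^2) * (x^2 + t1^2)"
  unfolding m0_def by (intro mult_mono) auto

lemma attached_discs_small:
  assumes fam: "attached_discs Jc r \<Psi> K e \<delta> w F1 F2" and \<theta>: "norm \<theta> \<le> \<delta>" and z: "z \<in> half_disc"
  shows "norm (w \<theta> z) \<le> (K + e) * norm \<theta>"
proof -
  have "0 \<le> \<delta>" using \<theta> norm_ge_zero order_trans by blast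
  then have "norm (0::'e\<times>'e\<times>'e) \<le> \<delta>" by simp
  from fam_D(10)[OF fam \<theta> this z] have "norm (w \<theta> z - w 0 z) \<le> (K + e) * norm \<theta>" by simp
  moreover have "w 0 = (\<lambda>_. 0)" using fam by (simp add: attached_discs_def)
  ultimately show ?thesis by simp
qed

lemma norm_triple: "norm (q :: 'e, 0 :: 'e, s :: 'e) \<le> norm q + norm s"
  using norm_Pair_le[of q "(0,s)"] by (simp add: norm_Pair)

text \<open>
  After division by its weight, the dependence on the third component is a perturbation of the
  identity with Lipschitz constant one half; Banach's fixed point theorem finds the component
  that leads to \<open>y\<close>.
\<close>

lemma surjectivity:
  assumes fam: "attached_discs Jc r \<Psi> K (m0/2) \<delta> w F1 F2" and \<delta>: "0 < \<delta>"
    and \<eta>: "\<eta> \<le> m0 * \<delta> / (4 * (K + m0/2 + 1))" and q: "norm q \<le> \<eta>" and y: "R y = y" "norm y \<le> \<eta>" and x: "\<bar>x\<bar> \<le> 1"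
  obtains s where "R s = s" "norm s \<le> \<delta>/2" "w (q, 0, s) (of_real x) = y"
proof -
  have K: "0 \<le> K" using cd by (simp add: coordinate_discs_def)
  define S where "S = {s. R s = s} \<inter> cball 0 (\<delta>/2)"
  let ?m = "(x^2 + t0^2) * (x^2 + t1^2)"
  have m: "0 < ?m" "m0 \<le> ?m" "1 / ?m \<le> 1 / m0" using m_lower[of x] m0 by (auto intro: divide_left_mono)
  have up: "of_real x \<in> half_disc" using x by (simp add: half_disc_def)
  have \<eta>2: "(K + m0/2 + 1) * \<eta> \<le> m0 * \<delta> / 4"
  proof -
    have "(K + m0/2 + 1) * \<eta> \<le> (K + m0/2 + 1) * (m0 * \<delta> / (4 * (K + m0/2 + 1)))" using K m0 by (intro mult_left_mono \<eta>) auto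
    also have "\<dots> = m0 * \<delta> / 4"
    proof -
      have gen: "a * (b / (4 * a)) = b / 4" if "a \<noteq> 0" for a b :: real using that by simp
      show ?thesis by (rule gen) (use K m0 in auto)
    qed
    finally show ?thesis .
  qed
  have \<eta>0: "0 \<le> \<eta>" using q norm_ge_zero order_trans by blast
  have \<eta>\<delta>: "\<eta> \<le> \<delta>/4"
  proof -
    have "1 * \<eta> \<le> (K + m0/2 + 1) * \<eta>" using K m0 \<eta>0 by (intro mult_right_mono) auto
    moreover have "m0 * \<delta> \<le> 1 * \<delta>" using m0 \<delta> by (intro mult_right_mono) auto
    ultimately show ?thesis using \<eta>2 by linarith
  qed
  have n\<theta>: "norm (q, 0::'e, s) \<le> \<delta>" if "s \<in> S" for s
    using norm_triple[of q s] that q \<eta>\<delta> \<delta> by (simp add: S_def)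
  have re: "R (w (q, 0, s) (of_real x)) = w (q, 0, s) (of_real x)" if "s \<in> S" for s
    by (rule fam_D(7)[OF fam n\<theta>[OF that]]) simp
  define G where "G s = s - (1 / ?m) *\<^sub>R (w (q, 0, s) (of_real x) - y)" for s
  have lip: "norm (G s - G s') \<le> 1/2 * norm (s - s')" if s: "s \<in> S" "s' \<in> S" for s s'
  proof -
    have \<sigma>: "\<sigma> s = s" "\<sigma> s' = s'" using s by (auto simp: S_def \<sigma>_fix)
    have "norm ((w (q, 0, s) (of_real x) - w (q, 0, s') (of_real x)) - ?m *\<^sub>R (\<sigma> s - \<sigma> s')) \<le> m0/2 * norm (s - s')"
      using fam n\<theta>[OF s(1)] n\<theta>[OF s(2)] x unfolding attached_discs_def by force
    then have 1: "norm ((w (q, 0, s) (of_real x) - w (q, 0, s') (of_real x)) - ?m *\<^sub>R (s - s')) \<le> m0/2 * norm (s - s')" by (simp add: \<sigma>)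
    have "G s - G s' = - ((1 / ?m) *\<^sub>R ((w (q, 0, s) (of_real x) - w (q, 0, s') (of_real x)) - ?m *\<^sub>R (s - s')))"
    proof -
      have gen: "(s - (1 / k) *\<^sub>R (a - y)) - (s' - (1 / k) *\<^sub>R (b - y)) = - ((1 / k) *\<^sub>R ((a - b) - k *\<^sub>R (s - s')))"
        if "k \<noteq> 0" for k :: real and a b :: 'e
        using that by (simp add: scaleR_diff_right)
      show ?thesis unfolding G_def by (rule gen) (metis m(1) less_irrefl)
    qed
    then have "norm (G s - G s') = (1 / ?m) * norm ((w (q, 0, s) (of_real x) - w (q, 0, s') (of_real x)) - ?m *\<^sub>R (s - s'))"
      using m(1) by (simp only: norm_minus_cancel norm_scaleR) simp
    also have "\<dots> \<le> (1 / m0) * (m0/2 * norm (s - s'))" using m m0 1 by (intro mult_mono) auto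
    finally show ?thesis using m0 by simp
  qed
  have zS: "0 \<in> S" using \<delta> by (simp add: S_def R_simps)
  have G0: "norm (G 0) \<le> \<delta>/4"
  proof -
    have "norm (w (q, 0, 0) (of_real x)) \<le> (K + m0/2) * norm (q, 0::'e, 0::'e)" by (rule attached_discs_small[OF fam n\<theta>[OF zS] up])
    also have "\<dots> \<le> (K + m0/2) * \<eta>" using K m0 q by (intro mult_left_mono) (auto simp: norm_Pair)
    finally have a: "norm (w (q, 0, 0) (of_real x) - y) \<le> (K + m0/2 + 1) * \<eta>"
      using norm_triangle_ineq4[of "w (q, 0, 0) (of_real x)" y] y(2) by (simp add: algebra_simps)
    have "norm (G 0) = (1 / ?m) * norm (w (q, 0, 0) (of_real x) - y)" using m(1) by (simp add: G_def)
    also have "\<dots> \<le> (1 / m0) * (m0 * \<delta> / 4)" using m m0 a \<eta>2 by (intro mult_mono) auto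
    finally show ?thesis using m0 by simp
  qed
  have "\<exists>!s. s \<in> S \<and> G s = s"
  proof (rule Banach_fix[where c = "1/2"])
    have "closed {s. R s = s}" by (intro closed_Collect_eq linear_continuous_on[OF R_bl] continuous_on_id)
    then show "complete S" unfolding S_def by (intro closed_Int closed_cball complete_eq_closed[THEN iffD2])
    show "S \<noteq> {}" using zS by blast
    show "G ` S \<subseteq> S"
    proof (rule image_subsetI)
      fix s assume s: "s \<in> S"
      have "norm (G s) \<le> norm (G s - G 0) + norm (G 0)" by (metis add.commute norm_triangle_sub)
      also have "\<dots> \<le> 1/2 * (\<delta>/2) + \<delta>/4" using lip[OF s zS] G0 s by (intro add_mono) (auto simp: S_def)
      finally have "norm (G s) \<le> \<delta>/2" by simp
      moreover have "R (G s) = G s" using re[OF s] y(1) s by (simp add: G_def R_simps S_def)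
      ultimately show "G s \<in> S" by (simp add: S_def)
    qed
    show "dist (G s) (G s') \<le> 1/2 * dist s s'" if "s \<in> S" "s' \<in> S" for s s' using lip[OF that] by (simp add: dist_norm)
  qed auto
  then obtain s where s: "s \<in> S" "G s = s" by blast
  have gen: "u = y" if "s - (1 / k) *\<^sub>R (u - y) = s" "k \<noteq> 0" for k :: real and u :: 'e
    using that by simp
  have "w (q, 0, s) (of_real x) = y"
    by (rule gen[OF s(2)[unfolded G_def]]) (metis m(1) less_irrefl)
  moreover have "R s = s" "norm s \<le> \<delta>/2" using s(1) by (auto simp: S_def)
  ultimately show thesis using that by blast
qed

lemma \<sigma>_idem: "\<sigma> (\<sigma> y) = \<sigma> y" by (rule \<sigma>_fix[OF R_\<sigma>])

text \<open>
  Let \<open>Q\<close> consist of the pairs of a parameter \<open>c\<close> and a boundary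
  point at which the disc with parameter \<open>c\<close> meets \<open>Z\<close>. For a fixed
  boundary point the map from parameters to boundary values is Lipschitz and, by
  \<open>surjectivity\<close>, reaches all of \<open>Z\<close>; Lipschitz maps preserve null
  sets, so the slice of \<open>Q\<close> is not null. By Fubini's theorem some parameter has a
  slice of positive length, and \<open>boundary_lemma\<close> applies to its disc. In order to
  work with Lebesgue measure on the whole space, \<open>c\<close> ranges over a full
  neighbourhood; its component \<open>c - \<sigma> c\<close> has no influence on the disc and
  is added to the boundary value.
\<close>

lemma totally_real_case:
  assumes fam: "attached_discs Jc r \<Psi> K (m0/2) \<delta> w F1 F2" and \<delta>: "0 < \<delta>"
    and \<eta>: "0 < \<eta>" "\<eta> \<le> m0 * \<delta> / (4 * (K + m0/2 + 1))" and q: "norm q \<le> \<eta>" and psh: "plurisubharmonic X \<A> J v"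
    and Z: "compact Z" "\<And>y. y \<in> Z \<Longrightarrow> R y = y \<and> norm y \<le> \<eta> \<and> v (pt y) = -\<infinity>"
    and nn: "\<not> negligible {y \<in> cball 0 1. \<sigma> y \<in> Z}"
  shows "v (pt q) = -\<infinity>"
proof -
  have K: "0 \<le> K" using cd by (simp add: coordinate_discs_def)
  have \<eta>\<delta>: "\<eta> \<le> \<delta>/4"
  proof -
    have "m0 * \<delta> / (4 * (K + m0/2 + 1)) \<le> (1 * \<delta>) / (4 * 1)" using K m0 \<delta> by (intro frac_le mult_right_mono) auto
    with \<eta>(2) have "\<eta> \<le> (1 * \<delta>) / (4 * 1)" by (rule order_trans)
    then show ?thesis by simp
  qed
  obtain C\<sigma> where C\<sigma>: "C\<sigma> > 0" "\<And>x. norm (\<sigma> x) \<le> norm x * C\<sigma>" using bounded_linear.pos_bounded[OF \<sigma>_bl] by blast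
  \<comment> \<open>The first bound keeps the parameter small; the second makes room for \<open>y - \<sigma>
    y\<close> with \<open>y\<close> in the unit ball.\<close>
  define D where "D = {c. norm (\<sigma> c) \<le> \<delta>/2 \<and> norm (c - \<sigma> c) \<le> 1 + C\<sigma>}"
  have \<sigma>c: "continuous_on A \<sigma>" for A by (rule linear_continuous_on[OF \<sigma>_bl])
  have D: "compact D"
  proof -
    have "closed D" unfolding D_def by (intro closed_Collect_conj closed_Collect_le continuous_intros \<sigma>c)
    moreover have "bounded D"
    proof (rule boundedI)
      fix c assume "c \<in> D"
      then show "norm c \<le> \<delta>/2 + (1 + C\<sigma>)" using norm_triangle_ineq[of "\<sigma> c" "c - \<sigma> c"] by (simp add: D_def)
    qed
    ultimately show ?thesis by (simp add: compact_eq_bounded_closed)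
  qed
  let ?\<theta> = "\<lambda>c. (q, 0::'e, \<sigma> c)"
  have n\<theta>: "norm (?\<theta> c) \<le> \<delta>" if "c \<in> D" for c
    using norm_triple[of q "\<sigma> c"] that q \<eta>\<delta> \<delta> by (simp add: D_def)
  \<comment> \<open>A compact interval inside the open lower arc \<open>(pi, 2 * pi)\<close>.\<close>
  define I where "I = {4..6::real}"
  have Ipi: "pi < t" "t < 2 * pi" if "t \<in> I" for t using that pi_approx by (auto simp: I_def)
  define zz where "zz t = \<psi> (cis t)" for t
  have zzH: "zz t \<in> half_disc" if "t \<in> I" for t using \<psi>_boundary(1,2)[OF Ipi[OF that]] by (simp add: zz_def half_disc_def)
  have zzc: "continuous_on I zz"
  proof -
    have "isCont zz t" if "t \<in> I" for t
    proof -
      have "continuous_on UNIV (\<lambda>t. cis t)" by (intro continuous_intros)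
      then have "isCont cis t" by (simp add: continuous_on_eq_continuous_at)
      then show ?thesis unfolding zz_def by (rule isCont_o2[where f = cis and g = \<psi>, OF _ \<psi>_boundary(3)[OF Ipi[OF that]]])
    qed
    then show ?thesis by (simp add: continuous_at_imp_continuous_on)
  qed
  let ?W = "\<lambda>(c, t). w (?\<theta> c) (zz t)"
  have Wlip: "norm (w (?\<theta> c) z - w (?\<theta> c') z) \<le> (K + m0/2) * norm (\<sigma> c - \<sigma> c')" if "c \<in> D" "c' \<in> D" "z \<in> half_disc" for c c' z
    using fam_D(10)[OF fam n\<theta>[OF that(1)] n\<theta>[OF that(2)] that(3)] by (simp add: norm_Pair)
  have Wc: "continuous_on (D \<times> I) ?W"
    unfolding continuous_on
  proof
    fix p assume p: "p \<in> D \<times> I"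
    obtain c t where ct: "p = (c, t)" "c \<in> D" "t \<in> I" using p by blast
    have ev: "\<forall>\<^sub>F p' in at p within D \<times> I. p' \<in> D \<times> I" by (simp add: eventually_at_filter)
    have l1: "((\<lambda>p'. (K + m0/2) * norm (\<sigma> (fst p') - \<sigma> c)) \<longlongrightarrow> (K + m0/2) * norm (\<sigma> c - \<sigma> c)) (at p within D \<times> I)"
      unfolding ct(1) by (intro tendsto_intros bounded_linear.tendsto[OF \<sigma>_bl]) (auto intro!: tendsto_eq_intros)
    have "continuous_on (D \<times> I) (\<lambda>p'. w (?\<theta> c) (zz (snd p')))"
      by (rule continuous_on_compose2[OF fam_D(1)[OF fam n\<theta>[OF ct(2)]] continuous_on_compose2[OF zzc continuous_on_snd[OF continuous_on_id]]])
         (use zzH in auto)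
    then have l2: "((\<lambda>p'. w (?\<theta> c) (zz (snd p'))) \<longlongrightarrow> w (?\<theta> c) (zz t)) (at p within D \<times> I)"
      using p ct by (auto simp: continuous_on)
    have "((\<lambda>p'. w (?\<theta> (fst p')) (zz (snd p')) - w (?\<theta> c) (zz (snd p'))) \<longlongrightarrow> 0) (at p within D \<times> I)"
    proof (rule Lim_null_comparison[where g = "\<lambda>p'. (K + m0/2) * norm (\<sigma> (fst p') - \<sigma> c)"])
      show "\<forall>\<^sub>F p' in at p within D \<times> I. norm (w (?\<theta> (fst p')) (zz (snd p')) - w (?\<theta> c) (zz (snd p'))) \<le> (K + m0/2) * norm (\<sigma> (fst p') - \<sigma> c)"
        using ev by eventually_elim (use Wlip ct zzH in auto)
    qed (use l1 in simp)
    from tendsto_add[OF this l2] show "(?W \<longlongrightarrow> ?W p) (at p within D \<times> I)" by (simp add: ct case_prod_unfold)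
  qed
  define Q where "Q = {p \<in> D \<times> I. ?W p \<in> Z}"
  have Qc: "compact Q"
  proof -
    have "closedin (top_of_set (D \<times> I)) ((D \<times> I) \<inter> ?W -` Z)"
      by (rule continuous_closedin_preimage[OF Wc compact_imp_closed[OF Z(1)]])
    moreover have "(D \<times> I) \<inter> ?W -` Z = Q" by (auto simp: Q_def)
    moreover have "compact (D \<times> I)" using D by (simp add: I_def compact_Times)
    ultimately show ?thesis using closedin_compact by metis
  qed
  then have Qb: "Q \<in> sets borel" by (simp add: compact_imp_closed)
  have slice: "\<not> (AE c in lborel. (c, t) \<notin> Q)" if t: "t \<in> I" for t
  proof
    assume ae: "AE c in lborel. (c, t) \<notin> Q"
    let ?N = "{c. (c, t) \<in> Q}"
    have "?N = (\<lambda>c. (c, t)) -` Q" by auto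
    then have "closed ?N" using compact_imp_closed[OF Qc] by (simp add: closed_vimage continuous_intros)
    then have Nn: "negligible ?N" using borel_negligible_iff[of ?N] ae by simp
    obtain x where x: "zz t = of_real x" "\<bar>x\<bar> \<le> 1"
    proof -
      have "zz t = of_real (Re (zz t))" using \<psi>_boundary(1)[OF Ipi[OF t]] by (simp add: zz_def complex_eq_iff)
      moreover have "\<bar>Re (zz t)\<bar> \<le> 1" using \<psi>_boundary(2)[OF Ipi[OF t]] abs_Re_le_cmod[of "zz t"] by (simp add: zz_def)
      ultimately show ?thesis using that by blast
    qed
    let ?F = "\<lambda>c. w (?\<theta> c) (zz t) + (c - \<sigma> c)"
    have "negligible (?F ` ?N)"
    proof (rule negligible_locally_Lipschitz_image[OF order_refl Nn])
      fix c assume c: "c \<in> ?N"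
      have "norm (?F c' - ?F c) \<le> ((K + m0/2) * C\<sigma> + (1 + C\<sigma>)) * norm (c' - c)" if c': "c' \<in> ?N" for c'
      proof -
        have cD: "c \<in> D" "c' \<in> D" using c c' by (auto simp: Q_def)
        have s: "norm (\<sigma> c' - \<sigma> c) \<le> norm (c' - c) * C\<sigma>" using C\<sigma>(2)[of "c' - c"] by (simp add: linear_diff[OF \<sigma>_linear])
        have "norm (w (?\<theta> c') (zz t) - w (?\<theta> c) (zz t)) \<le> (K + m0/2) * norm (\<sigma> c' - \<sigma> c)" by (rule Wlip[OF cD(2,1) zzH[OF t]])
        also have "\<dots> \<le> (K + m0/2) * (norm (c' - c) * C\<sigma>)" using K m0 by (intro mult_left_mono s) auto
        finally have 1: "norm (w (?\<theta> c') (zz t) - w (?\<theta> c) (zz t)) \<le> (K + m0/2) * (norm (c' - c) * C\<sigma>)" .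
        have "norm ((c' - c) - (\<sigma> c' - \<sigma> c)) \<le> norm (c' - c) + norm (c' - c) * C\<sigma>"
          by (rule order_trans[OF norm_triangle_ineq4]) (use s in simp)
        from norm_triangle_mono[OF 1 this] have "norm ((w (?\<theta> c') (zz t) - w (?\<theta> c) (zz t)) + ((c' - c) - (\<sigma> c' - \<sigma> c))) \<le>
          (K + m0/2) * (norm (c' - c) * C\<sigma>) + (norm (c' - c) + norm (c' - c) * C\<sigma>)" .
        moreover have "?F c' - ?F c = (w (?\<theta> c') (zz t) - w (?\<theta> c) (zz t)) + ((c' - c) - (\<sigma> c' - \<sigma> c))" by simp
        ultimately show ?thesis by (simp add: algebra_simps)
      qed
      then show "\<exists>T B. open T \<and> c \<in> T \<and> (\<forall>y\<in>?N \<inter> T. norm (?F y - ?F c) \<le> B * norm (y - c))"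
        by (intro exI[of _ UNIV] exI[of _ "(K + m0/2) * C\<sigma> + (1 + C\<sigma>)"]) auto
    qed
    moreover have "{y \<in> cball 0 1. \<sigma> y \<in> Z} \<subseteq> ?F ` ?N"
    proof
      fix y assume y: "y \<in> {y \<in> cball 0 1. \<sigma> y \<in> Z}"
      then have ys: "R (\<sigma> y) = \<sigma> y" "norm (\<sigma> y) \<le> \<eta>" "\<sigma> y \<in> Z" using Z(2)[of "\<sigma> y"] by auto
      obtain s where s: "R s = s" "norm s \<le> \<delta>/2" "w (q, 0, s) (of_real x) = \<sigma> y"
        by (rule surjectivity[OF fam \<delta> \<eta>(2) q ys(1,2) x(2)])
      define c where "c = s + (y - \<sigma> y)"
      have \<sigma>cmul: "\<sigma> c = s" using \<sigma>_fix[OF s(1)] by (simp add: c_def linear_add[OF \<sigma>_linear] linear_diff[OF \<sigma>_linear] \<sigma>_idem)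
      have "norm (y - \<sigma> y) \<le> norm y + norm (\<sigma> y)" by (rule norm_triangle_ineq4)
      also have "\<dots> \<le> 1 + 1 * C\<sigma>" using y C\<sigma> by (intro add_mono order_trans[OF C\<sigma>(2)] mult_right_mono) auto
      finally have "c \<in> D" using s by (simp add: D_def \<sigma>cmul) (simp add: c_def)
      then have "c \<in> ?N" using t ys s by (simp add: Q_def \<sigma>cmul x)
      moreover have "?F c = y" by (simp add: \<sigma>cmul x s) (simp add: c_def)
      ultimately show "y \<in> ?F ` ?N" by (metis (no_types, lifting) image_eqI)
    qed
    ultimately show False using nn negligible_subset by blast
  qed
  have "\<exists>c\<in>D. emeasure lborel {t. (c, t) \<in> Q} \<noteq> 0"
  proof (rule ccontr)
    assume a: "\<not> (\<exists>c\<in>D. emeasure lborel {t. (c, t) \<in> Q} \<noteq> 0)"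
    have "AE t in lborel. (c, t) \<notin> Q" for c
    proof (cases "c \<in> D")
      case True
      have "{t. (c, t) \<in> Q} = (\<lambda>t. (c, t)) -` Q" by auto
      then have cl: "closed {t. (c, t) \<in> Q}" using compact_imp_closed[OF Qc] by (simp add: closed_vimage continuous_intros)
      then have "{t. (c, t) \<in> Q} \<in> null_sets lborel" using a True by (auto simp: null_sets_def)
      then show ?thesis using AE_not_in by fastforce
    qed (auto simp: Q_def)
    then have "AE c in lborel. AE t in lborel. (c, t) \<notin> Q" by simp
    moreover have "{x \<in> space (lborel \<Otimes>\<^sub>M lborel). (fst x, snd x) \<notin> Q} \<in> sets (lborel \<Otimes>\<^sub>M lborel)"
    proof -
      have "{x \<in> space (lborel \<Otimes>\<^sub>M lborel). (fst x, snd x) \<notin> Q} = - Q" by (auto simp: space_pair_measure)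
      moreover have "- Q \<in> sets (lborel \<Otimes>\<^sub>M lborel)" using Qb unfolding lborel_prod by (simp add: Compl_eq_Diff_UNIV)
      ultimately show ?thesis by simp
    qed
    ultimately have "AE t in lborel. AE c in lborel. (c, t) \<notin> Q" using lborel_pair.AE_commute[of "\<lambda>c t. (c, t) \<notin> Q"] by blast
    then have "AE t in lborel. t \<notin> I" by (rule eventually_mono) (use slice in blast)
    then have "I \<in> null_sets lborel" using AE_iff_null_sets[of I lborel] by (simp add: I_def)
    then show False by (simp add: I_def null_sets_def)
  qed
  then obtain c where c: "c \<in> D" "emeasure lborel {t. (c, t) \<in> Q} \<noteq> 0" by blast
  have "v (pt (fst (?\<theta> c))) = -\<infinity>"
  proof (rule boundary_lemma[OF fam psh n\<theta>[OF c(1)] _ _ c(2)])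
    have "{t. (c, t) \<in> Q} = (\<lambda>t. (c, t)) -` Q" by auto
    then have cl: "closed {t. (c, t) \<in> Q}" using compact_imp_closed[OF Qc] by (simp add: closed_vimage continuous_intros)
    then show "{t. (c, t) \<in> Q} \<in> sets lborel" by simp
    show "{t. (c, t) \<in> Q} \<subseteq> {pi<..<2*pi}" using Ipi by (auto simp: Q_def)
    fix t assume "t \<in> {t. (c, t) \<in> Q}"
    then have "w (?\<theta> c) (zz t) \<in> Z" by (simp add: Q_def)
    then show "v (pt (w (?\<theta> c) (\<psi> (cis t)))) = -\<infinity>" using Z(2) by (simp add: zz_def)
  qed
  then show ?thesis by simp
qed

text \<open>
  As the differential of \<open>\<Psi>\<close> at the origin is the identity, small balls have
  images that are neighbourhoods of \<open>y0\<close>; the points of such an image are points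
  at which the value at \<open>\<i> * t0\<close> can be placed.
\<close>

theorem neighbourhood:
  obtains N \<eta> where "openin X N" "inv_into U ch y0 \<in> N" "0 < \<eta>"
    "\<forall>v \<Omega>. plurisubharmonic X \<A> J v \<longrightarrow> openin X \<Omega> \<longrightarrow> \<Omega> \<inter> N \<noteq> {} \<longrightarrow> (\<forall>x\<in>\<Omega>. v x = -\<infinity>) \<longrightarrow> (\<forall>x\<in>N. v x = -\<infinity>)"
    "\<forall>v Z. plurisubharmonic X \<A> J v \<longrightarrow> compact Z \<longrightarrow>
       (\<forall>y\<in>Z. R y = y \<and> norm y \<le> \<eta> \<and> v (inv_into U ch (y0 + y)) = -\<infinity>) \<longrightarrow>
       \<not> negligible {y \<in> cball 0 1. \<sigma> y \<in> Z} \<longrightarrow> (\<forall>x\<in>N. v x = -\<infinity>)"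
proof -
  have cd': "0 < r" "0 \<le> K" "\<Psi> 0 = y0" "(\<Psi> has_derivative (\<lambda>v. v)) (at 0)" "\<And>v. v \<in> ball 0 r \<Longrightarrow> R v = v \<Longrightarrow> \<Psi> v = y0 + v"
    "\<And>e. e > 0 \<Longrightarrow> \<exists>\<delta>>0. \<exists>w F1 F2. attached_discs Jc r \<Psi> K e \<delta> w F1 F2"
    using cd unfolding coordinate_discs_def by blast+
  obtain \<delta> w F1 F2 where fam: "0 < \<delta>" "attached_discs Jc r \<Psi> K (m0/2) \<delta> w F1 F2" using cd'(6)[of "m0/2"] m0 by auto
  define \<eta> where "\<eta> = min (r/2) (min (\<delta>/2) (m0 * \<delta> / (4 * (K + m0/2 + 1))))"
  have "0 < \<eta>" using fam(1) cd'(1,2) m0 by (auto simp: \<eta>_def intro!: divide_pos_pos mult_pos_pos)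
  moreover have \<eta>r: "\<eta> \<le> r/2" unfolding \<eta>_def by (rule min.cobounded1)
  moreover have "\<eta> \<le> \<delta>/2" unfolding \<eta>_def by (rule min.coboundedI2[OF min.cobounded1])
  moreover have "\<eta> \<le> m0 * \<delta> / (4 * (K + m0/2 + 1))" unfolding \<eta>_def by (rule min.coboundedI2[OF min.cobounded2])
  moreover have "\<eta> < r" using \<eta>r cd'(1) by linarith
  ultimately have \<eta>: "0 < \<eta>" "\<eta> < r" "\<eta> \<le> \<delta>/2" "\<eta> \<le> m0 * \<delta> / (4 * (K + m0/2 + 1))" by blast+
  have sub: "ball 0 \<eta> \<subseteq> ball (0::'e) r" using \<eta> by auto
  define Y where "Y = interior (\<Psi> ` ball 0 \<eta>)"
  have YU: "Y \<subseteq> ch ` U" using interior_subset \<Psi>(3) sub unfolding Y_def by blast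
  have yY: "y0 \<in> Y"
  proof -
    have "\<Psi> 0 \<in> interior (\<Psi> ` ball 0 \<eta>)"
      by (rule sussmann_open_mapping[OF open_ball \<Psi>(2) _ cd'(4) bounded_linear_ident _ sub]) (use \<eta> cd' in \<open>auto simp: o_def interior_open\<close>)
    then show ?thesis by (simp add: Y_def cd')
  qed
  define N where "N = inv_into U ch ` Y"
  have oN: "openin X N" unfolding N_def by (rule inv_image_open[OF ch _ YU]) (simp add: Y_def)
  have NP: "\<exists>q. norm q < \<eta> \<and> x = pt q" if "x \<in> N" for x
    using that interior_subset unfolding N_def Y_def pt_def by fastforce
  show thesis
  proof (rule that[OF oN])
    show "inv_into U ch y0 \<in> N" using yY by (simp add: N_def)
    show "0 < \<eta>" by (rule \<eta>)
    show "\<forall>v \<Omega>. plurisubharmonic X \<A> J v \<longrightarrow> openin X \<Omega> \<longrightarrow> \<Omega> \<inter> N \<noteq> {} \<longrightarrow> (\<forall>x\<in>\<Omega>. v x = -\<infinity>) \<longrightarrow> (\<forall>x\<in>N. v x = -\<infinity>)"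
    proof (intro allI impI ballI)
    fix v \<Omega> x assume psh: "plurisubharmonic X \<A> J v" and \<Omega>: "openin X \<Omega>" "\<Omega> \<inter> N \<noteq> {}" "\<forall>x\<in>\<Omega>. v x = -\<infinity>" and x: "x \<in> N"
    obtain q where q: "norm q < \<eta>" "x = pt q" using NP[OF x] by blast
    obtain q' where q': "norm q' < \<eta>" "pt q' \<in> \<Omega>" using \<Omega>(2) NP by blast
    have "continuous_map (top_of_set (ball 0 r)) X pt" using pt_continuous[OF continuous_on_id, of "ball 0 r"] by simp
    from openin_continuous_map_preimage[OF this \<Omega>(1)]
    have "openin (top_of_set (ball 0 r)) {y \<in> ball 0 r. pt y \<in> \<Omega>}" by simp
    then have W0: "open {y \<in> ball 0 r. pt y \<in> \<Omega>}" using openin_open_trans open_ball by blast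
    have "norm (q, q', 0::'e) \<le> norm q + norm q'" using norm_Pair_le[of q "(q',0)"] by (simp add: norm_Pair)
    then have n: "norm (q, q', 0::'e) \<le> \<delta>" using q q' \<eta>(3) by linarith
    have "v (pt (fst (q, q', 0::'e))) = -\<infinity>"
      by (rule interior_lemma[OF fam(2) psh n W0]) (use q' \<eta> \<Omega>(3) in auto)
    then show "v x = -\<infinity>" using q by simp
    qed
    show "\<forall>v Z. plurisubharmonic X \<A> J v \<longrightarrow> compact Z \<longrightarrow>
       (\<forall>y\<in>Z. R y = y \<and> norm y \<le> \<eta> \<and> v (inv_into U ch (y0 + y)) = -\<infinity>) \<longrightarrow>
       \<not> negligible {y \<in> cball 0 1. \<sigma> y \<in> Z} \<longrightarrow> (\<forall>x\<in>N. v x = -\<infinity>)"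
    proof (intro allI impI ballI)
    fix v Z x assume psh: "plurisubharmonic X \<A> J v" and Z: "compact Z"
       "\<forall>y\<in>Z. R y = y \<and> norm y \<le> \<eta> \<and> v (inv_into U ch (y0 + y)) = -\<infinity>"
       "\<not> negligible {y \<in> cball 0 1. \<sigma> y \<in> Z}" and x: "x \<in> N"
    obtain q where q: "norm q < \<eta>" "x = pt q" using NP[OF x] by blast
    have Z': "R y = y \<and> norm y \<le> \<eta> \<and> v (pt y) = -\<infinity>" if "y \<in> Z" for y
    proof -
      have "y \<in> ball 0 r" using bspec[OF Z(2) that] \<eta> by auto
      then show ?thesis using bspec[OF Z(2) that] cd'(5) by (simp add: pt_def)
    qed
    have "v (pt q) = -\<infinity>"
      by (rule totally_real_case[OF fam(2,1) \<eta>(1,4) _ psh Z(1) Z' Z(3)]) (use q in auto)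
    then show "v x = -\<infinity>" using q by simp
    qed
  qed
qed

end

section \<open>Totally real subspaces and conjugations\<close>

context complex_space
begin

definition totally_real_subspace :: "'e set \<Rightarrow> bool" where
  "totally_real_subspace S \<longleftrightarrow> subspace S \<and> (\<forall>x\<in>S. J0 x \<in> S \<longrightarrow> x = 0)"

lemma totally_real_subspace_unique:
  assumes "totally_real_subspace S" "a \<in> S" "b \<in> S" "a' \<in> S" "b' \<in> S" "a + J0 b = a' + J0 b'"
  shows "a = a' \<and> b = b'"
proof -
  have S: "subspace S" using assms(1) by (simp add: totally_real_subspace_def)
  have "J0 (b' - b) = a - a'" using assms(6) by (simp add: J0_simps algebra_simps)
  moreover have "b' - b \<in> S" "a - a' \<in> S" using S assms by (auto intro: subspace_diff)
  ultimately have "b' - b = 0" using assms(1) by (auto simp: totally_real_subspace_def)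
  then show ?thesis using assms(6) by simp
qed

text \<open>
  Every vector is \<open>s + J0 s'\<close> with unique \<open>s\<close> and \<open>s'\<close>
  in the subspace, and the conjugation sends it to \<open>s - J0 s'\<close>.
\<close>

lemma conjugation_exists:
  assumes S: "totally_real_subspace S" and full: "\<And>w. \<exists>s\<in>S. \<exists>s'\<in>S. w = s + J0 s'"
  obtains R where "linear R" "\<And>v. R (R v) = v" "\<And>v. R (J0 v) = - J0 (R v)" "\<And>v. R v = v \<longleftrightarrow> v \<in> S"
proof -
  have sub: "subspace S" using S by (simp add: totally_real_subspace_def)
  obtain s t where st: "\<And>w. s w \<in> S" "\<And>w. t w \<in> S" "\<And>w. w = s w + J0 (t w)" using full by metis
  define R where "R w = s w - J0 (t w)" for w
  have R: "R (a + J0 b) = a - J0 b" if "a \<in> S" "b \<in> S" for a b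
  proof -
    have "s (a + J0 b) = a \<and> t (a + J0 b) = b"
      by (rule totally_real_subspace_unique[OF S st(1) st(2) that(1) that(2)]) (rule st(3)[symmetric])
    then show ?thesis by (simp add: R_def)
  qed
  show thesis
  proof (rule that)
    show "linear R"
    proof (rule linearI)
      fix x y
      have "x + y = (s x + s y) + J0 (t x + t y)" using st(3)[of x] st(3)[of y] by (simp add: J0_simps algebra_simps)
      then have "R (x + y) = (s x + s y) - J0 (t x + t y)" using R[of "s x + s y" "t x + t y"] st sub by (simp add: subspace_add)
      then show "R (x + y) = R x + R y" by (simp add: R_def J0_simps)
    next
      fix c x
      have "c *\<^sub>R x = c *\<^sub>R s x + J0 (c *\<^sub>R t x)" using st(3)[of x] by (simp add: J0_simps flip: scaleR_add_right)
      then have "R (c *\<^sub>R x) = c *\<^sub>R s x - J0 (c *\<^sub>R t x)" using R[of "c *\<^sub>R s x" "c *\<^sub>R t x"] st sub by (simp add: subspace_scale)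
      then show "R (c *\<^sub>R x) = c *\<^sub>R R x" by (simp add: R_def J0_simps scaleR_diff_right)
    qed
    fix v
    have "R v = s v + J0 (- t v)" by (simp add: R_def J0_simps)
    then have "R (R v) = s v - J0 (- t v)" using R[of "s v" "- t v"] st sub by (simp add: subspace_neg)
    then show "R (R v) = v" using st(3)[of v] by (simp add: J0_simps)
    have J: "J0 v = - t v + J0 (s v)" using st(3)[of v] by (metis J0_simps(1) J0_J0 add.commute)
    have "R (J0 v) = - t v - J0 (s v)" unfolding J using R[of "- t v" "s v"] st sub by (simp add: subspace_neg)
    also have "\<dots> = - J0 (R v)" by (simp add: R_def J0_simps J0_J0)
    finally show "R (J0 v) = - J0 (R v)" .
    show "R v = v \<longleftrightarrow> v \<in> S"
    proof
      assume "v \<in> S"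
      then show "R v = v" using R[of v 0] subspace_0[OF sub] by (simp add: J0_simps)
    next
      assume "R v = v"
      then have "s v - J0 (t v) = s v + J0 (t v)" using st(3)[of v] by (simp add: R_def)
      then have "J0 (t v) + J0 (t v) = 0" by (simp add: algebra_simps)
      then have "J0 (t v) = 0" by (simp add: scaleR_2[symmetric] del: scaleR_2)
      then show "v \<in> S" using st(1)[of v] st(3)[of v] by simp
    qed
  qed
qed

text \<open>
  A totally real subspace of maximal dimension; adding any vector outside its complex span
  would keep it totally real. At points off the given submanifold any conjugation will do, and
  this one is used.
\<close>

lemma maximal_totally_real_subspace:
  obtains S where "totally_real_subspace S" "\<And>w. \<exists>s\<in>S. \<exists>s'\<in>S. w = s + J0 s'"
proof -
  have "totally_real_subspace {0}" by (simp add: totally_real_subspace_def subspace_single_0)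
  moreover have "\<forall>S. totally_real_subspace S \<longrightarrow> dim S < Suc DIM('e)" by (simp add: dim_subset_UNIV less_Suc_eq_le)
  ultimately obtain S where S: "totally_real_subspace S" "\<And>S'. totally_real_subspace S' \<Longrightarrow> dim S' \<le> dim S"
    using ex_has_greatest_nat[of totally_real_subspace "{0}" dim "Suc DIM('e)"] by auto
  have sub: "subspace S" using S by (simp add: totally_real_subspace_def)
  have "\<exists>s\<in>S. \<exists>s'\<in>S. w = s + J0 s'" for w
  proof (rule ccontr)
    assume w: "\<not> (\<exists>s\<in>S. \<exists>s'\<in>S. w = s + J0 s')"
    have wS: "w \<notin> S" using w subspace_0[OF sub] by (force simp: J0_simps)
    have spS: "span S = S" using sub by (simp add: span_eq_iff)
    have "totally_real_subspace (span (insert w S))"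
      unfolding totally_real_subspace_def
    proof (intro conjI ballI impI subspace_span)
      fix x assume "x \<in> span (insert w S)" "J0 x \<in> span (insert w S)"
      then obtain k k2 where k: "x - k *\<^sub>R w \<in> S" "J0 x - k2 *\<^sub>R w \<in> S" by (auto simp: span_breakdown_eq spS)
      define s where "s = x - k *\<^sub>R w"
      define s2 where "s2 = J0 x - k2 *\<^sub>R w"
      have x: "x = s + k *\<^sub>R w" "J0 x = s2 + k2 *\<^sub>R w" by (simp_all add: s_def s2_def)
      have e1: "J0 s + k *\<^sub>R J0 w = s2 + k2 *\<^sub>R w" using x by (simp add: J0_simps)
      have e2: "- s - k *\<^sub>R w = J0 s2 + k2 *\<^sub>R J0 w" using arg_cong[OF e1, of J0] by (simp add: J0_simps J0_J0)
      have "k2 *\<^sub>R (k2 *\<^sub>R w) + k *\<^sub>R (k *\<^sub>R w) = (- k2 *\<^sub>R s2 - k *\<^sub>R s) + J0 (k2 *\<^sub>R s - k *\<^sub>R s2)"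
      proof -
        have a: "k2 *\<^sub>R w = J0 s + k *\<^sub>R J0 w - s2" using e1 by (simp add: algebra_simps)
        have b: "k *\<^sub>R w = - s - (J0 s2 + k2 *\<^sub>R J0 w)" using e2 by (simp add: algebra_simps)
        show ?thesis unfolding a b by (simp add: J0_simps algebra_simps)
      qed
      then have e3: "(k2 * k2 + k * k) *\<^sub>R w = (- k2 *\<^sub>R s2 - k *\<^sub>R s) + J0 (k2 *\<^sub>R s - k *\<^sub>R s2)"
        by (simp add: algebra_simps)
      have "k2 * k2 + k * k = 0"
      proof (rule ccontr)
        assume n: "k2 * k2 + k * k \<noteq> 0"
        define c where "c = 1 / (k2 * k2 + k * k)"
        have "c * (k2 * k2 + k * k) = 1" unfolding c_def using n by (metis nonzero_eq_divide_eq)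
        then have "w = c *\<^sub>R ((k2 * k2 + k * k) *\<^sub>R w)" by (metis scaleR_scaleR scaleR_one)
        also have "\<dots> = c *\<^sub>R (- k2 *\<^sub>R s2 - k *\<^sub>R s) + J0 (c *\<^sub>R (k2 *\<^sub>R s - k *\<^sub>R s2))" unfolding e3 by (simp add: J0_simps scaleR_add_right)
        finally show False using w k s_def s2_def sub
          by (metis subspace_diff subspace_scale)
      qed
      then have "k = 0" "k2 = 0" by (auto simp: sum_squares_eq_zero_iff)
      then show "x = 0" using S(1) k by (simp add: totally_real_subspace_def)
    qed
    from S(2)[OF this] have "dim (insert w S) \<le> dim S" by simp
    then show False using wS by (simp add: dim_insert spS)
  qed
  then show thesis using that S by blast
qed

lemma half_dim_totally_real_subspace:
  assumes S: "totally_real_subspace S" "dim S = n" and D: "DIM('e) = 2 * n"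
  shows "\<exists>s\<in>S. \<exists>s'\<in>S. w = s + J0 s'"
proof -
  have sub: "subspace S" using S by (simp add: totally_real_subspace_def)
  have inj: "inj J0" by (rule injI) (metis J0_J0 neg_equal_iff_equal)
  have sJ: "subspace (J0 ` S)" by (rule linear_subspace_image[OF J0_linear sub])
  have dJ: "dim (J0 ` S) = n" using dim_image_eq[OF J0_linear, of S] inj S by (simp add: inj_on_subset)
  have "S \<inter> J0 ` S = {0}"
  proof -
    have "x = 0" if x: "x \<in> S" "x \<in> J0 ` S" for x
    proof -
      obtain y where y: "y \<in> S" "x = J0 y" using x by blast
      then have "y = 0" using S(1) x by (auto simp: totally_real_subspace_def)
      then show ?thesis using y by (simp add: J0_simps)
    qed
    moreover have "0 \<in> J0 ` S" using subspace_0[OF sJ] .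
    ultimately show ?thesis using subspace_0[OF sub] by blast
  qed
  moreover define Z where "Z = {x + y |x y. x \<in> S \<and> y \<in> J0 ` S}"
  ultimately have "dim Z = DIM('e)" using dim_sums_Int[OF sub sJ] S(2) dJ D by simp
  moreover have "subspace Z" unfolding Z_def by (rule subspace_sums[OF sub sJ])
  ultimately have "Z = UNIV" using dim_eq_full[of Z] span_eq_iff[of Z] by simp
  then have "w \<in> Z" by simp
  then obtain x y where "w = x + y" "x \<in> S" "y \<in> J0 ` S" unfolding Z_def by (elim CollectE exE conjE)
  then show ?thesis by (metis imageE)
qed

end

context real_form
begin

text \<open>
  Let \<open>F\<close> be a maximal \<open>\<eta>\<close>-separated subset of
  \<open>Y\<close>. Add to its points \<open>J0\<close> times the points of a grid of mesh
  \<open>\<eta>\<close> in the fixed space of \<open>R\<close>: the points obtained are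
  separated by a multiple of \<open>\<eta>\<close> and lie in the cylinder, so balls around
  them are disjoint and, for small \<open>\<eta>\<close>, contained in a neighbourhood of the
  cylinder of small volume. There are of the order of \<open>\<eta>^(-n)\<close> grid points,
  and each ball has a volume of the order of \<open>\<eta>^(2 * n)\<close>; this bounds
  \<open>card F * \<eta>^n\<close>.
\<close>

lemma null_cylinder_cover:
  assumes n: "dim {v. R v = v} = n" "DIM('e) = 2 * n"
    and Y: "compact Y" "\<And>y. y \<in> Y \<Longrightarrow> R y = y" "\<And>y. y \<in> Y \<Longrightarrow> norm y \<le> 1/2"
    and null: "negligible {y \<in> cball 0 1. \<sigma> y \<in> Y}" and \<epsilon>: "0 < \<epsilon>" and \<eta>0: "0 < \<eta>0"
  shows "\<exists>F \<eta>. finite F \<and> F \<subseteq> Y \<and> 0 < \<eta> \<and> \<eta> \<le> \<eta>0 \<and> Y \<subseteq> (\<Union>y\<in>F. cball y \<eta>) \<and> real (card F) * \<eta>^n \<le> \<epsilon>"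
proof -
  let ?S = "{v. R v = v}"
  let ?Y = "{y \<in> cball 0 1. \<sigma> y \<in> Y}"
  have S: "subspace ?S" by (auto simp: subspace_def R_simps)
  obtain B where B: "B \<subseteq> ?S" "pairwise orthogonal B" "\<And>x. x \<in> B \<Longrightarrow> norm x = 1" "card B = n" "independent B"
    using orthonormal_basis_subspace[OF S] n(1) by metis
  have finB: "finite B" using B(5) independent_imp_finite by blast
  obtain C1 where C1: "C1 > 0" "\<And>x. norm (\<sigma> x) \<le> norm x * C1" using bounded_linear.pos_bounded[OF \<sigma>_bl] by blast
  obtain C2 where C2: "C2 > 0" "\<And>x. norm (J0 x) \<le> norm x * C2" using bounded_linear.pos_bounded[OF J0_bounded_linear] by blast
  define Q where "Q = 1 + C1 + C2 * (1 + C1)"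
  have Q: "Q > 0" using C1 C2 by (simp add: Q_def add_pos_pos)
  have \<sigma>J: "\<sigma> (y + J0 s) = y" if "R y = y" "R s = s" for y s
    using that by (simp add: linear_add[OF \<sigma>_linear] \<sigma>_fix \<sigma>_J0 \<tau>_fix)
  have sep: "norm (y - y') \<le> Q * norm ((y + J0 s) - (y' + J0 s'))" "norm (s - s') \<le> Q * norm ((y + J0 s) - (y' + J0 s'))"
    if "R y = y" "R y' = y'" "R s = s" "R s' = s'" for y y' s s'
  proof -
    let ?u = "(y + J0 s) - (y' + J0 s')"
    have su: "\<sigma> ?u = y - y'" using \<sigma>J that by (simp add: linear_diff[OF \<sigma>_linear])
    have 1: "norm (y - y') \<le> norm ?u * C1" using C1(2)[of ?u] unfolding su .
    have "norm ?u * C1 \<le> Q * norm ?u" using C1 C2 by (simp add: Q_def algebra_simps add_nonneg_nonneg)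
    with 1 show "norm (y - y') \<le> Q * norm ?u" by linarith
    have Js: "J0 (s - s') = ?u - (y - y')" by (simp add: J0_simps)
    have "norm (s - s') = norm (J0 (J0 (s - s')))" by (simp add: J0_J0 norm_minus_commute)
    also have "\<dots> \<le> norm (J0 (s - s')) * C2" by (rule C2)
    also have "\<dots> \<le> (norm ?u + norm ?u * C1) * C2" unfolding Js
      using C2 1 norm_triangle_ineq4[of ?u "y - y'"] by (intro mult_right_mono) auto
    also have "\<dots> \<le> Q * norm ?u" using C1 C2 by (simp add: Q_def algebra_simps add_nonneg_nonneg)
    finally show "norm (s - s') \<le> Q * norm ?u" .
  qed
  \<comment> \<open>With this mesh constant the grid points, of size at most \<open>n * \<kappa>0\<close>, are
    moved by \<open>J0\<close> to vectors of norm at most one half.\<close>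
  define \<kappa>0 where "\<kappa>0 = 1 / (2 * (real n + 1) * (C2 + 1))"
  have \<kappa>0: "\<kappa>0 > 0" using C2 by (simp add: \<kappa>0_def)
  define u where "u = unit_ball_vol (real (2 * n))"
  have u: "u > 0" by (simp add: u_def unit_ball_vol_pos)
  define cst where "cst = \<kappa>0^n * u / (2 * Q)^(2 * n)"
  have cst: "cst > 0" using \<kappa>0 u Q by (simp add: cst_def)
  have cY: "closed ?Y"
  proof -
    have "?Y = cball 0 1 \<inter> \<sigma> -` Y" by auto
    moreover have "closed (\<sigma> -` Y)" by (rule closed_vimage[OF compact_imp_closed[OF Y(1)] linear_continuous_on[OF \<sigma>_bl]])
    ultimately show ?thesis by (simp add: closed_Int)
  qed
  have "?Y \<subseteq> cball 0 1" by blast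
  then have bY: "compact ?Y" using cY bounded_subset[OF bounded_cball] by (simp add: compact_eq_bounded_closed)
  obtain Ob where Ob: "open Ob" "?Y \<subseteq> Ob" "emeasure lborel (Ob - ?Y) < ennreal (\<epsilon> * cst)"
    using outer_regular_lborel[of ?Y "\<epsilon> * cst"] borel_closed[OF cY] mult_pos_pos[OF \<epsilon> cst] by blast
  have "?Y \<in> null_sets lborel" using null cY by (simp add: negligible_iff_null_sets null_sets_completion_iff)
  then have Om: "emeasure lborel Ob < ennreal (\<epsilon> * cst)"
    using emeasure_Un_null_set[of "Ob - ?Y" lborel ?Y] Ob borel_closed[OF cY] by (simp add: Un_absorb2 Un_commute)
  obtain d where d: "d > 0" "(\<Union>x\<in>?Y. ball x d) \<subseteq> Ob" using compact_subset_open_imp_ball_epsilon_subset[OF bY Ob(1,2)] .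
  obtain m :: nat where m: "m > 0" "\<kappa>0 / real m \<le> \<eta>0" "\<kappa>0 / real m / (2 * Q) \<le> d"
  proof -
    obtain m :: nat where m: "real m > max 1 (max (\<kappa>0 / \<eta>0) (\<kappa>0 / (2 * Q * d)))" using reals_Archimedean2 by blast
    then have "\<kappa>0 / \<eta>0 < real m" "\<kappa>0 / (2 * Q * d) < real m" "1 < real m" by auto
    then show ?thesis using \<eta>0 d(1) Q by (intro that[of m]) (auto simp: field_simps)
  qed
  define \<eta> where "\<eta> = \<kappa>0 / real m"
  have \<eta>: "\<eta> > 0" "\<eta> \<le> \<eta>0" "\<eta> / (2 * Q) \<le> d" using m \<kappa>0 by (auto simp: \<eta>_def)
  define \<rho>' where "\<rho>' = \<eta> / (2 * Q)"
  have \<rho>': "0 < \<rho>'" "\<rho>' \<le> d" "2 * Q * \<rho>' = \<eta>" using \<eta> Q by (auto simp: \<rho>'_def)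
  define G where "G = PiE B (\<lambda>_. {1..m})"
  have G: "finite G" "card G = m^n" using finB B(4) by (auto simp: G_def card_PiE intro!: finite_PiE)
  define p where "p k = (\<Sum>b\<in>B. (real (k b) * \<eta>) *\<^sub>R b)" for k :: "'e \<Rightarrow> nat"
  have pS: "R (p k) = p k" for k
  proof -
    have "p k \<in> ?S" unfolding p_def by (rule subspace_sum[OF S]) (use B(1) subspace_scale[OF S] in blast)
    then show ?thesis by simp
  qed
  have pin: "p k \<bullet> b = real (k b) * \<eta>" if "b \<in> B" for k b
  proof -
    have "p k \<bullet> b = (\<Sum>b'\<in>B. real (k b') * \<eta> * (b' \<bullet> b))" by (simp add: p_def inner_sum_left)
    also have "\<dots> = (\<Sum>b'\<in>B. if b' = b then real (k b) * \<eta> else 0)"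
    proof (rule sum.cong[OF refl])
      fix b' assume b': "b' \<in> B"
      show "real (k b') * \<eta> * (b' \<bullet> b) = (if b' = b then real (k b) * \<eta> else 0)"
        using B(2,3) b' that by (auto simp: pairwise_def orthogonal_def norm_eq_1)
    qed
    finally show ?thesis using that finB by simp
  qed
  have pnorm: "norm (J0 (p k)) \<le> 1/2" if "k \<in> G" for k
  proof -
    have "norm (p k) \<le> (\<Sum>b\<in>B. real m * \<eta>)"
      unfolding p_def
    proof (rule order_trans[OF norm_sum sum_mono])
      fix b assume b: "b \<in> B"
      have "k b \<le> m" using that b by (auto simp: G_def PiE_def)
      then show "norm ((real (k b) * \<eta>) *\<^sub>R b) \<le> real m * \<eta>" using B(3)[OF b] \<eta> by simp
    qed
    also have "\<dots> = real n * \<kappa>0" using m by (simp add: B(4) \<eta>_def)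
    finally have "norm (J0 (p k)) \<le> real n * \<kappa>0 * C2" using C2 by (meson mult_right_mono less_imp_le order_trans)
    also have "\<dots> \<le> (real n + 1) * (C2 + 1) * \<kappa>0" using C2 \<kappa>0 by (simp add: algebra_simps)
    also have "\<dots> = 1/2"
    proof -
      have "x * y * (1 / (2 * x * y)) = 1/2" if "x \<noteq> 0" "y \<noteq> 0" for x y :: real using that by simp
      moreover have "real n + 1 \<noteq> 0" "C2 + 1 \<noteq> 0" using C2 by auto
      ultimately show ?thesis unfolding \<kappa>0_def by blast
    qed
    finally show ?thesis .
  qed
  have psep: "\<eta> \<le> norm (p k - p k')" if "k \<in> G" "k' \<in> G" "k \<noteq> k'" for k k'
  proof -
    have "\<not> (\<forall>b\<in>B. k b = k' b)" using PiE_ext[of k B "\<lambda>_. {1..m}" k'] that unfolding G_def by blast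
    then obtain b where b: "b \<in> B" "k b \<noteq> k' b" by blast
    have "(p k - p k') \<bullet> b = (real (k b) - real (k' b)) * \<eta>" using pin[OF b(1)] by (simp add: inner_diff_left algebra_simps)
    then have "\<bar>(p k - p k') \<bullet> b\<bar> = \<bar>real (k b) - real (k' b)\<bar> * \<eta>" using \<eta> by (simp add: abs_mult)
    moreover have "1 \<le> \<bar>real (k b) - real (k' b)\<bar>" using b(2) by linarith
    ultimately have "1 * \<eta> \<le> \<bar>(p k - p k') \<bullet> b\<bar>" using \<eta>(1) mult_right_mono[of 1 "\<bar>real (k b) - real (k' b)\<bar>" \<eta>] by simp
    also have "\<dots> \<le> norm (p k - p k') * norm b" by (rule Cauchy_Schwarz_ineq2)
    finally show ?thesis using B(3)[OF b(1)] by simp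
  qed
  \<comment> \<open>The volume count for an arbitrary separated set; it also shows that separated sets have
    bounded cardinality.\<close>
  have bound: "real (card F) * \<eta>^n \<le> \<epsilon>"
    if F: "finite F" "F \<subseteq> Y" "\<And>y y'. y \<in> F \<Longrightarrow> y' \<in> F \<Longrightarrow> y \<noteq> y' \<Longrightarrow> \<eta> \<le> norm (y - y')" for F
  proof -
    let ?b = "\<lambda>(y, k). ball (y + J0 (p k)) \<rho>'"
    have far: "2 * \<rho>' \<le> norm ((y + J0 (p k)) - (y' + J0 (p k')))" if "y \<in> F" "k \<in> G" "y' \<in> F" "k' \<in> G" "(y, k) \<noteq> (y', k')" for y k y' k'
    proof -
      have RR: "R y = y" "R y' = y'" using that F(2) Y(2) by blast+
      have "\<eta> \<le> Q * norm ((y + J0 (p k)) - (y' + J0 (p k')))"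
      proof (cases "y = y'")
        case True
        then have "\<eta> \<le> norm (p k - p k')" using psep that by blast
        then show ?thesis using sep(2)[OF RR pS pS, of k k'] by linarith
      next
        case False
        then have "\<eta> \<le> norm (y - y')" using F(3) that by blast
        then show ?thesis using sep(1)[OF RR pS pS, of k k'] by linarith
      qed
      then have "Q * (2 * \<rho>') \<le> Q * norm ((y + J0 (p k)) - (y' + J0 (p k')))" using \<rho>'(3) by (simp add: ac_simps)
      then show ?thesis using Q by simp
    qed
    have disj: "disjoint_family_on ?b (F \<times> G)"
      unfolding disjoint_family_on_def
    proof (intro ballI impI)
      fix i i' assume i: "i \<in> F \<times> G" "i' \<in> F \<times> G" "i \<noteq> i'"
      obtain y k y' k' where e: "i = (y, k)" "i' = (y', k')" by (meson surj_pair)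
      have *: "y \<in> F" "k \<in> G" "y' \<in> F" "k' \<in> G" "(y, k) \<noteq> (y', k')" using i by (auto simp: e)
      have "2 * \<rho>' \<le> dist (y + J0 (p k)) (y' + J0 (p k'))" using far[OF *] by (simp add: dist_norm)
      then have "ball (y + J0 (p k)) \<rho>' \<inter> ball (y' + J0 (p k')) \<rho>' = {}" by (simp add: disjoint_ballI)
      then show "?b i \<inter> ?b i' = {}" by (simp add: e)
    qed
    have "(\<Union>i\<in>F \<times> G. ?b i) \<subseteq> Ob"
    proof (clarify)
      fix y k x assume a: "y \<in> F" "k \<in> G" "x \<in> ball (y + J0 (p k)) \<rho>'"
      have y: "R y = y" "norm y \<le> 1/2" "y \<in> Y" using a F(2) Y by blast+
      have "y + J0 (p k) \<in> ?Y" using \<sigma>J[OF y(1) pS] y pnorm[OF a(2)] norm_triangle_ineq[of y "J0 (p k)"] by simp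
      then show "x \<in> Ob" using d(2) a(3) \<rho>'(2) by (force intro: less_le_trans)
    qed
    then have "emeasure lborel (\<Union>i\<in>F \<times> G. ?b i) \<le> emeasure lborel Ob" using Ob(1) by (intro emeasure_mono) auto
    moreover have "(\<Sum>i\<in>F \<times> G. emeasure lborel (?b i)) = emeasure lborel (\<Union>i\<in>F \<times> G. ?b i)"
      by (rule sum_emeasure[OF _ disj]) (use F(1) G(1) in auto)
    moreover have "(\<Sum>i\<in>F \<times> G. emeasure lborel (?b i)) = ennreal (real (card F * m^n) * (u * \<rho>'^(2*n)))"
    proof -
      have "(\<Sum>i\<in>F \<times> G. emeasure lborel (?b i)) = (\<Sum>i\<in>F \<times> G. ennreal (u * \<rho>'^(2*n)))"
        using \<rho>' n(2) by (intro sum.cong refl) (auto simp: emeasure_ball u_def)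
      also have "\<dots> = ennreal (real (card F * m^n) * (u * \<rho>'^(2*n)))"
        using G(2) u \<rho>' by (simp add: card_cartesian_product ennreal_mult' ennreal_of_nat_eq_real_of_nat)
      finally show ?thesis .
    qed
    ultimately have "ennreal (real (card F * m^n) * (u * \<rho>'^(2*n))) \<le> ennreal (\<epsilon> * cst)" using Om by simp
    then have le: "real (card F * m^n) * (u * \<rho>'^(2*n)) \<le> \<epsilon> * cst" using \<epsilon> cst by (simp add: ennreal_le_iff)
    have "real (card F * m^n) * (u * \<rho>'^(2*n)) = real (card F) * \<eta>^n * cst"
    proof -
      have e1: "\<rho>'^(2*n) = \<eta>^n * \<eta>^n / (2 * Q)^(2*n)" by (simp only: \<rho>'_def power_divide power_add[symmetric] mult_2[of n])
      have "real m * \<eta> = \<kappa>0" using m(1) by (simp add: \<eta>_def)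
      then have e2: "real m^n * \<eta>^n = \<kappa>0^n" by (metis power_mult_distrib)
      have "real (card F * m^n) * (u * \<rho>'^(2*n)) = real (card F) * (real m^n * \<eta>^n) * \<eta>^n * u / (2 * Q)^(2*n)"
        unfolding e1 by simp
      then show ?thesis unfolding e2 cst_def by simp
    qed
    then have "real (card F) * \<eta>^n * cst \<le> \<epsilon> * cst" using le by metis
    then show ?thesis using cst by simp
  qed
  define Sep where "Sep F \<longleftrightarrow> finite F \<and> F \<subseteq> Y \<and> (\<forall>y\<in>F. \<forall>y'\<in>F. y \<noteq> y' \<longrightarrow> \<eta> \<le> norm (y - y'))" for F
  have "Sep {}" by (simp add: Sep_def)
  moreover have "\<forall>F. Sep F \<longrightarrow> card F < Suc (nat \<lceil>\<epsilon> / \<eta>^n\<rceil>)"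
  proof (intro allI impI)
    fix F assume "Sep F"
    then have "real (card F) * \<eta>^n \<le> \<epsilon>" unfolding Sep_def by (intro bound) auto
    then have "real (card F) \<le> \<epsilon> / \<eta>^n" using \<eta> by (simp add: field_simps)
    then show "card F < Suc (nat \<lceil>\<epsilon> / \<eta>^n\<rceil>)" by linarith
  qed
  ultimately obtain F where F: "Sep F" "\<And>F'. Sep F' \<Longrightarrow> card F' \<le> card F"
    using ex_has_greatest_nat[of Sep "{}" card "Suc (nat \<lceil>\<epsilon> / \<eta>^n\<rceil>)"] by blast
  have "Y \<subseteq> (\<Union>y\<in>F. cball y \<eta>)"
  proof
    fix y assume y: "y \<in> Y"
    show "y \<in> (\<Union>y\<in>F. cball y \<eta>)"
    proof (rule ccontr)
      assume "y \<notin> (\<Union>y\<in>F. cball y \<eta>)"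
      then have f: "\<eta> < norm (y' - y)" if "y' \<in> F" for y' using that by (auto simp: dist_norm)
      have "Sep (insert y F)" using F(1) y f unfolding Sep_def by (auto simp: norm_minus_commute intro: less_imp_le)
      from F(2)[OF this] have "y \<in> F" using F(1) card_insert_disjoint[of F y] unfolding Sep_def by fastforce
      then show False using f[of y] \<eta> by simp
    qed
  qed
  then show ?thesis using F(1) \<eta> bound[of F] unfolding Sep_def by blast
qed

end

section \<open>Sets of Hausdorff measure zero\<close>

definition cover_sum :: "nat \<Rightarrow> ('a \<Rightarrow> 'a \<Rightarrow> ennreal) \<Rightarrow> (nat \<Rightarrow> 'a set) \<Rightarrow> ennreal" where
  "cover_sum k d B = (\<Sum>i. if B i = {} then 0 else ennreal (unit_ball_vol (real k)) * (diam_wrt d (B i) / 2) ^ k)"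

lemma hausdorff_null_iff:
  "hausdorff_measure k M d S = 0 \<longleftrightarrow>
    (\<forall>\<delta>>0. \<forall>\<epsilon>>0. \<exists>B. (\<forall>i. B i \<subseteq> M \<and> diam_wrt d (B i) \<le> \<delta>) \<and> S \<subseteq> (\<Union>i. B i) \<and> cover_sum k d B < \<epsilon>)"
proof -
  have "hausdorff_measure k M d S = 0 \<longleftrightarrow> (\<forall>\<delta>>0. hausdorff_premeasure k M d \<delta> S = 0)"
    unfolding hausdorff_measure_def by (auto simp: SUP_eq_iff simp flip: bot_ennreal)
  also have "\<dots> \<longleftrightarrow> (\<forall>\<delta>>0. \<forall>\<epsilon>>0. hausdorff_premeasure k M d \<delta> S < \<epsilon>)"
    by (metis not_gr_zero order_less_irrefl)
  also have "\<dots> \<longleftrightarrow> (\<forall>\<delta>>0. \<forall>\<epsilon>>0. \<exists>B. (\<forall>i. B i \<subseteq> M \<and> diam_wrt d (B i) \<le> \<delta>) \<and> S \<subseteq> (\<Union>i. B i) \<and> cover_sum k d B < \<epsilon>)"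
    unfolding hausdorff_premeasure_def cover_sum_def[symmetric] setcompr_eq_image INF_less_iff
    by (simp add: Bex_def conj_assoc)
  finally show ?thesis .
qed

lemma hausdorff_null_mono:
  assumes "hausdorff_measure k M d S = 0" "S' \<subseteq> S"
  shows "hausdorff_measure k M d S' = 0"
  unfolding hausdorff_null_iff
proof (intro allI impI)
  fix \<delta> \<epsilon> :: ennreal assume "0 < \<delta>" "0 < \<epsilon>"
  with assms(1) obtain B where "(\<forall>i. B i \<subseteq> M \<and> diam_wrt d (B i) \<le> \<delta>)" "S \<subseteq> (\<Union>i. B i)" "cover_sum k d B < \<epsilon>"
    unfolding hausdorff_null_iff by meson
  then show "\<exists>B. (\<forall>i. B i \<subseteq> M \<and> diam_wrt d (B i) \<le> \<delta>) \<and> S' \<subseteq> (\<Union>i. B i) \<and> cover_sum k d B < \<epsilon>"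
    using assms(2) by (intro exI[of _ B]) auto
qed

text \<open>
  The coverings of the sets, with sums below \<open>e * 2^(-j-1)\<close>, are merged into one
  sequence by the pairing function.
\<close>

lemma hausdorff_null_UN:
  fixes S :: "nat \<Rightarrow> 'a set"
  assumes "\<And>i. hausdorff_measure k M d (S i) = 0"
  shows "hausdorff_measure k M d (\<Union>i. S i) = 0"
  unfolding hausdorff_null_iff
proof (intro allI impI)
  fix \<delta> \<epsilon> :: ennreal assume \<delta>: "0 < \<delta>" and \<epsilon>: "0 < \<epsilon>"
  obtain e :: real where e: "0 < e" "ennreal e < \<epsilon>"
  proof -
    obtain r where "0 < r" "r < \<epsilon>" using dense[OF \<epsilon>] by blast
    then show ?thesis by (cases r) (auto intro!: that)
  qed
  have "\<exists>B. (\<forall>i. B i \<subseteq> M \<and> diam_wrt d (B i) \<le> \<delta>) \<and> S j \<subseteq> (\<Union>i. B i) \<and> cover_sum k d B < ennreal (e * (1/2)^Suc j)" for j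
    using assms[of j] \<delta> e unfolding hausdorff_null_iff by (simp del: power_Suc)
  then obtain B where B: "\<And>j i. B j i \<subseteq> M" "\<And>j i. diam_wrt d (B j i) \<le> \<delta>" "\<And>j. S j \<subseteq> (\<Union>i. B j i)"
    "\<And>j. cover_sum k d (B j) < ennreal (e * (1/2)^Suc j)" by metis
  define C where "C i = B (fst (prod_decode i)) (snd (prod_decode i))" for i
  have "cover_sum k d C = (\<Sum>j. cover_sum k d (B j))"
    unfolding cover_sum_def C_def
    using suminf_ennreal_2dimen[where f="\<lambda>(j, i). if B j i = {} then 0 else ennreal (unit_ball_vol (real k)) * (diam_wrt d (B j i) / 2) ^ k", OF refl]
    by (simp add: case_prod_beta comp_def cong: if_cong)
  also have "\<dots> \<le> (\<Sum>j. ennreal (e * (1/2)^Suc j))"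
    using B(4) by (intro suminf_le) (auto intro: less_imp_le)
  also have "\<dots> = ennreal e"
    using power_half_series e(1) by (intro suminf_ennreal_eq) (auto dest: sums_mult[where c=e])
  finally have "cover_sum k d C < \<epsilon>" using e(2) by simp
  moreover have "(\<Union>j. S j) \<subseteq> (\<Union>i. C i)"
  proof
    fix x assume "x \<in> (\<Union>j. S j)"
    then obtain j i where "x \<in> B j i" using B(3) by blast
    then have "x \<in> C (prod_encode (j, i))" by (simp add: C_def)
    then show "x \<in> (\<Union>i. C i)" by blast
  qed
  moreover have "\<forall>i. C i \<subseteq> M \<and> diam_wrt d (C i) \<le> \<delta>" using B by (simp add: C_def)
  ultimately show "\<exists>B. (\<forall>i. B i \<subseteq> M \<and> diam_wrt d (B i) \<le> \<delta>) \<and> (\<Union>j. S j) \<subseteq> (\<Union>i. B i) \<and> cover_sum k d B < \<epsilon>" by blast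
qed

lemma hausdorff_null_Union:
  assumes "countable \<F>" "\<And>S. S \<in> \<F> \<Longrightarrow> hausdorff_measure k M d S = 0" "K \<subseteq> \<Union>\<F>" "K \<noteq> {}"
  shows "hausdorff_measure k M d K = 0"
proof -
  have "\<F> \<noteq> {}" using assms(3,4) by blast
  then have "\<Union>\<F> = (\<Union>i. from_nat_into \<F> i)" using assms(1) by (metis range_from_nat_into)
  moreover have "hausdorff_measure k M d (\<Union>i. from_nat_into \<F> i) = 0"
    by (rule hausdorff_null_UN) (rule assms(2)[OF from_nat_into[OF \<open>\<F> \<noteq> {}\<close>]])
  ultimately show ?thesis using assms(3) hausdorff_null_mono by metis
qed

context smooth_atlas
begin

section \<open>The Riemannian distance in a chart\<close>

text \<open>
  The coefficients of the metric in the chart are continuous, hence bounded on compact sets.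
\<close>

lemma metric_bound:
  assumes c: "(U, \<phi>) \<in> \<A>" and g: "riemannian_metric X \<A> g" and Q: "compact Q" "Q \<subseteq> \<phi> ` U"
  obtains C where "0 \<le> C"
    "\<And>y x. y \<in> Q \<Longrightarrow> g (inv_into U \<phi> y) (coord_tvec \<A> (U, \<phi>) (inv_into U \<phi> y) x) (coord_tvec \<A> (U, \<phi>) (inv_into U \<phi> y) x) \<le> C * (norm x)\<^sup>2"
proof -
  define G where "G y x x' = g (inv_into U \<phi> y) (coord_tvec \<A> (U, \<phi>) (inv_into U \<phi> y) x) (coord_tvec \<A> (U, \<phi>) (inv_into U \<phi> y) x')" for y x x'
  have gsym: "\<And>p v w. p \<in> topspace X \<Longrightarrow> v \<in> tangent_space \<A> p \<Longrightarrow> w \<in> tangent_space \<A> p \<Longrightarrow> g p v w = g p w v"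
    and glin: "\<And>p v w z a b. p \<in> topspace X \<Longrightarrow> v \<in> tangent_space \<A> p \<Longrightarrow> w \<in> tangent_space \<A> p \<Longrightarrow> z \<in> tangent_space \<A> p \<Longrightarrow>
       g p (tlincomb a v b w) z = a * g p v z + b * g p w z"
    using g unfolding riemannian_metric_def by blast+
  have gsm: "smooth_on (\<phi> ` U) (\<lambda>y. G y x x')" for x x'
    using g c unfolding riemannian_metric_def G_def Let_def by fast
  have Gc: "continuous_on (\<phi> ` U) (\<lambda>y. G y x x')" for x x'
    using gsm[of x x'] unfolding smooth_on_def by (metis Ck_on.simps(1))
  have "\<exists>b. \<forall>y\<in>Q. \<bar>G y x x'\<bar> \<le> b" for x x'
  proof -
    have "compact ((\<lambda>y. G y x x') ` Q)" by (rule compact_continuous_image[OF continuous_on_subset[OF Gc Q(2)] Q(1)])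
    then have "bounded ((\<lambda>y. G y x x') ` Q)" by (rule compact_imp_bounded)
    then show ?thesis by (auto simp: bounded_iff)
  qed
  then obtain b where b: "\<And>x x' y. y \<in> Q \<Longrightarrow> \<bar>G y x x'\<bar> \<le> b x x'" by metis
  define C where "C = (\<Sum>i\<in>Basis. \<Sum>j\<in>Basis. \<bar>b i j\<bar>)"
  have C0: "0 \<le> C" by (auto simp: C_def intro!: sum_nonneg)
  have "G y x x \<le> C * (norm x)\<^sup>2" if y: "y \<in> Q" for y x
  proof -
    have p: "inv_into U \<phi> y \<in> U" using y Q(2) inv_in[OF c] by blast
    have pX: "inv_into U \<phi> y \<in> topspace X" using p chart_subset[OF c] by blast
    note tg = coord_tvec_tangent(1)[OF c p]
    have G1: "G y (r *\<^sub>R v + s *\<^sub>R w) z = r * G y v z + s * G y w z" for r s v w z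
      unfolding G_def coord_tvec_lincomb[OF c p] by (rule glin[OF pX tg tg tg])
    have Gs: "G y v w = G y w v" for v w unfolding G_def by (rule gsym[OF pX tg tg])
    have lin: "linear (\<lambda>v. G y v z)" for z
    proof (rule linearI)
      show "G y (v + w) z = G y v z + G y w z" for v w using G1[of 1 v 1 w z] by simp
      show "G y (r *\<^sub>R v) z = r *\<^sub>R G y v z" for r v using G1[of r v 0 0 z] by simp
    qed
    have ex: "G y v z = (\<Sum>i\<in>Basis. (v \<bullet> i) * G y i z)" for v z
      using linear_Basis_expansion[OF lin, of v z] by simp
    have "G y x x = (\<Sum>i\<in>Basis. (x \<bullet> i) * (\<Sum>j\<in>Basis. (x \<bullet> j) * G y j i))"
    proof -
      have "G y i x = (\<Sum>j\<in>Basis. (x \<bullet> j) * G y j i)" for i using Gs[of i x] ex[of x i] by simp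
      then show ?thesis using ex[of x x] by simp
    qed
    also have "\<dots> = (\<Sum>i\<in>Basis. \<Sum>j\<in>Basis. (x \<bullet> i) * (x \<bullet> j) * G y j i)" by (simp add: sum_distrib_left mult.assoc)
    also have "\<dots> \<le> (\<Sum>i\<in>Basis. \<Sum>j\<in>Basis. (norm x)\<^sup>2 * \<bar>b j i\<bar>)"
    proof (intro sum_mono)
      fix i j :: 'e assume "i \<in> Basis" "j \<in> Basis"
      then have "\<bar>x \<bullet> i\<bar> \<le> norm x" "\<bar>x \<bullet> j\<bar> \<le> norm x" by (simp_all add: Basis_le_norm)
      moreover have "\<bar>G y j i\<bar> \<le> \<bar>b j i\<bar>" using b[OF y, of j i] by linarith
      ultimately have "\<bar>x \<bullet> i\<bar> * \<bar>x \<bullet> j\<bar> * \<bar>G y j i\<bar> \<le> norm x * norm x * \<bar>b j i\<bar>" by (intro mult_mono) auto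
      then show "(x \<bullet> i) * (x \<bullet> j) * G y j i \<le> (norm x)\<^sup>2 * \<bar>b j i\<bar>"
        using abs_ge_self[of "(x \<bullet> i) * (x \<bullet> j) * G y j i"] by (simp add: abs_mult power2_eq_square)
    qed
    also have "\<dots> = (\<Sum>j\<in>Basis. \<Sum>i\<in>Basis. (norm x)\<^sup>2 * \<bar>b j i\<bar>)" by (rule sum.swap)
    also have "\<dots> = C * (norm x)\<^sup>2" by (simp add: C_def sum_distrib_left[symmetric])
    finally show ?thesis .
  qed
  then show thesis using that[OF C0] unfolding G_def by blast
qed

text \<open>
  Compare with the length of the curve that is a straight segment in the chart.
\<close>

lemma riemannian_dist_chart:
  assumes c: "(U, \<phi>) \<in> \<A>" and g: "riemannian_metric X \<A> g" and cb: "cball y0 \<rho> \<subseteq> \<phi> ` U"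
  obtains C where "0 \<le> C"
    "\<And>x y. x \<in> cball y0 \<rho> \<Longrightarrow> y \<in> cball y0 \<rho> \<Longrightarrow> riemannian_dist X \<A> g (inv_into U \<phi> x) (inv_into U \<phi> y) \<le> ennreal (C * norm (x - y))"
proof -
  obtain C where C: "0 \<le> C" "\<And>y x. y \<in> cball y0 \<rho> \<Longrightarrow>
     g (inv_into U \<phi> y) (coord_tvec \<A> (U, \<phi>) (inv_into U \<phi> y) x) (coord_tvec \<A> (U, \<phi>) (inv_into U \<phi> y) x) \<le> C * (norm x)\<^sup>2"
    using metric_bound[OF c g compact_cball cb] by blast
  have "riemannian_dist X \<A> g (inv_into U \<phi> x) (inv_into U \<phi> y) \<le> ennreal (sqrt C * norm (x - y))"
    if xy: "x \<in> cball y0 \<rho>" "y \<in> cball y0 \<rho>" for x y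
  proof -
    define F where "F t = x + t *\<^sub>R (y - x)" for t :: real
    define \<gamma> where "\<gamma> t = inv_into U \<phi> (F t)" for t
    define D where "D = F -` (\<phi> ` U)"
    have D: "open D" unfolding D_def F_def by (rule open_vimage[OF chart(2)[OF c]]) (intro continuous_intros)
    have Fb: "F t \<in> cball y0 \<rho>" if "t \<in> {0..1}" for t
    proof -
      have "F t = (1 - t) *\<^sub>R x + t *\<^sub>R y" by (simp add: F_def algebra_simps)
      then show ?thesis using convexD_alt[OF convex_cball xy, of t] that by simp
    qed
    have sub: "{0..1} \<subseteq> D" using Fb cb by (force simp: D_def)
    have FU: "\<And>t. t \<in> D \<Longrightarrow> F t \<in> \<phi> ` U" by (simp add: D_def)
    have dF: "\<And>t. t \<in> D \<Longrightarrow> (F has_derivative (\<lambda>h. h *\<^sub>R (y - x))) (at t)" unfolding F_def by (auto intro!: derivative_eq_intros)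
    have cF: "\<And>h::real. continuous_on D (\<lambda>t. h *\<^sub>R (y - x))" by (intro continuous_intros)
    have "C1_map X \<A> D \<gamma>" unfolding \<gamma>_def by (rule C1_map_through_chart(1)[OF c D FU dF cF])
    moreover have "\<gamma> 0 = inv_into U \<phi> x" "\<gamma> 1 = inv_into U \<phi> y" by (simp_all add: \<gamma>_def F_def)
    ultimately have "riemannian_dist X \<A> g (inv_into U \<phi> x) (inv_into U \<phi> y) \<le> curve_length \<A> g \<gamma>"
      unfolding riemannian_dist_def using D sub by (intro Inf_lower) blast
    also have "\<dots> \<le> (\<integral>\<^sup>+t. ennreal (sqrt C * norm (y - x)) * indicator {0..1::real} t \<partial>lborel)"
      unfolding curve_length_def
    proof (rule nn_integral_mono)
      fix t :: real
      show "ennreal (sqrt (g (\<gamma> t) (differential \<A> \<gamma> t 1) (differential \<A> \<gamma> t 1))) * indicator {0..1} t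
        \<le> ennreal (sqrt C * norm (y - x)) * indicator {0..1} t"
      proof (cases "t \<in> {0..1}")
        case True
        then have "t \<in> D" using sub by blast
        have "differential \<A> \<gamma> t 1 = coord_tvec \<A> (U, \<phi>) (\<gamma> t) (1 *\<^sub>R (y - x))"
          unfolding \<gamma>_def by (rule C1_map_through_chart(2)[OF c D FU dF cF \<open>t \<in> D\<close>])
        then have "differential \<A> \<gamma> t 1 = coord_tvec \<A> (U, \<phi>) (\<gamma> t) (y - x)" by simp
        then have "g (\<gamma> t) (differential \<A> \<gamma> t 1) (differential \<A> \<gamma> t 1) \<le> C * (norm (y - x))\<^sup>2"
          using C(2)[OF Fb[OF True], of "y - x"] by (simp add: \<gamma>_def)
        then have "sqrt (g (\<gamma> t) (differential \<A> \<gamma> t 1) (differential \<A> \<gamma> t 1)) \<le> sqrt C * norm (y - x)"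
          using real_sqrt_le_mono[of _ "C * (norm (y - x))\<^sup>2"] by (simp add: real_sqrt_mult)
        then show ?thesis using True by (simp add: ennreal_leI)
      qed simp
    qed
    also have "\<dots> = ennreal (sqrt C * norm (x - y))" by (simp add: nn_integral_cmult_indicator norm_minus_commute)
    finally show ?thesis .
  qed
  then show thesis using that[of "sqrt C"] C(1) by simp
qed

text \<open>
  The balls of \<open>null_cylinder_cover\<close> have radius \<open>\<eta>\<close>, so in the
  Riemannian distance the diameters are bounded by a multiple of \<open>\<eta>\<close>, and
  the covering sum by a multiple of \<open>card F * \<eta>^n\<close>.
\<close>

lemma null_cylinder_hausdorff_null:
  assumes c: "(U, \<phi>) \<in> \<A>" and g: "riemannian_metric X \<A> g" and cb: "cball y0 \<rho> \<subseteq> \<phi> ` U"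
    and rf: "real_form J0 R t0 t1" and n: "dim {v. R v = v} = n" "DIM('e) = 2 * n"
    and Y: "compact Y" "\<And>y. y \<in> Y \<Longrightarrow> R y = y" "\<And>y. y \<in> Y \<Longrightarrow> norm y \<le> 1/2" "\<And>y. y \<in> Y \<Longrightarrow> norm y \<le> \<rho>"
    and null: "negligible {y \<in> cball 0 1. real_form.\<sigma> R y \<in> Y}"
  shows "hausdorff_measure n (topspace X) (riemannian_dist X \<A> g) ((\<lambda>y. inv_into U \<phi> (y0 + y)) ` Y) = 0"
proof -
  interpret real_form J0 R t0 t1 by (rule rf)
  obtain C where C: "0 \<le> C" "\<And>x y. x \<in> cball y0 \<rho> \<Longrightarrow> y \<in> cball y0 \<rho> \<Longrightarrow> riemannian_dist X \<A> g (inv_into U \<phi> x) (inv_into U \<phi> y) \<le> ennreal (C * norm (x - y))"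
    using riemannian_dist_chart[OF c g cb] by blast
  let ?d = "riemannian_dist X \<A> g"
  let ?p = "\<lambda>y. inv_into U \<phi> (y0 + y)"
  have YU: "y0 + y \<in> cball y0 \<rho>" if "y \<in> Y" for y using Y(4)[OF that] by (simp add: dist_norm)
  have diam: "diam_wrt ?d (?p ` (Y \<inter> cball z \<eta>)) \<le> ennreal (C * (2 * \<eta>))" for z \<eta>
    unfolding diam_wrt_def
  proof (rule SUP_least, rule SUP_least)
    fix p q assume "p \<in> ?p ` (Y \<inter> cball z \<eta>)" "q \<in> ?p ` (Y \<inter> cball z \<eta>)"
    then obtain x y where xy: "x \<in> Y" "x \<in> cball z \<eta>" "y \<in> Y" "y \<in> cball z \<eta>" "p = ?p x" "q = ?p y" by blast
    have "dist x y \<le> dist z x + dist z y" by (rule dist_triangle3)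
    then have "norm (x - y) \<le> 2 * \<eta>" using xy by (simp add: dist_norm)
    then have "C * norm (x - y) \<le> C * (2 * \<eta>)" using C(1) by (rule mult_left_mono)
    moreover have "?d p q \<le> ennreal (C * norm (x - y))" using C(2)[OF YU[OF xy(1)] YU[OF xy(3)]] xy by simp
    ultimately show "?d p q \<le> ennreal (C * (2 * \<eta>))" by (meson ennreal_leI order_trans)
  qed
  show ?thesis
    unfolding hausdorff_null_iff
  proof (intro allI impI)
    fix \<delta> \<epsilon> :: ennreal assume \<delta>: "0 < \<delta>" and \<epsilon>: "0 < \<epsilon>"
    have real: "\<exists>e>0. ennreal e < a" if a: "0 < a" for a :: ennreal
    proof -
      obtain r where "0 < r" "r < a" using dense[OF a] by blast
      then show ?thesis by (cases r) auto
    qed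
    obtain d e where d: "0 < d" "ennreal d < \<delta>" and e: "0 < e" "ennreal e < \<epsilon>" using real[OF \<delta>] real[OF \<epsilon>] by blast
    define \<omega> where "\<omega> = unit_ball_vol (real n)"
    have \<omega>: "0 < \<omega>" by (simp add: \<omega>_def unit_ball_vol_pos)
    have pos: "0 < e / (\<omega> * (C + 1)^n)" "0 < d / (2 * (C + 1))" using d e \<omega> C(1) by auto
    obtain F \<eta> where F: "finite F" "F \<subseteq> Y" "0 < \<eta>" "\<eta> \<le> d / (2 * (C + 1))" "Y \<subseteq> (\<Union>y\<in>F. cball y \<eta>)"
        "real (card F) * \<eta>^n \<le> e / (\<omega> * (C + 1)^n)"
      using null_cylinder_cover[OF n Y(1,2,3) null pos] by blast
    obtain l where l: "set l = F" "distinct l" using finite_distinct_list[OF F(1)] by blast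
    have len: "length l = card F" using l distinct_card by force
    define B where "B i = (if i < length l then ?p ` (Y \<inter> cball (l ! i) \<eta>) else {})" for i
    have dm: "diam_wrt ?d (B i) \<le> ennreal (C * (2 * \<eta>))" for i
      using diam[of "l ! i" \<eta>] by (simp add: B_def diam_wrt_def)
    have "C * (2 * \<eta>) \<le> d"
    proof -
      have "2 * (C + 1) * \<eta> \<le> d" using F(4) C(1) by (simp add: field_simps)
      then show ?thesis using F(3) by (simp add: algebra_simps)
    qed
    then have dd: "diam_wrt ?d (B i) \<le> \<delta>" for i using dm[of i] d(2) by (meson ennreal_leI less_imp_le order_trans)
    have BX: "B i \<subseteq> topspace X" for i
    proof -
      have "?p y \<in> topspace X" if "y \<in> Y" for y
        using YU[OF that] cb inv_in[OF c, of "y0 + y"] chart_subset[OF c] by blast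
      then show ?thesis by (auto simp: B_def)
    qed
    have cov: "?p ` Y \<subseteq> (\<Union>i. B i)"
    proof
      fix q assume "q \<in> ?p ` Y"
      then obtain y where y: "y \<in> Y" "q = ?p y" by blast
      then obtain z where "z \<in> F" "y \<in> cball z \<eta>" using F(5) by blast
      then obtain i where "i < length l" "l ! i = z" using l by (metis in_set_conv_nth)
      then have "q \<in> B i" using y \<open>y \<in> cball z \<eta>\<close> by (auto simp: B_def)
      then show "q \<in> (\<Union>i. B i)" by blast
    qed
    let ?t = "\<lambda>i. if B i = {} then 0 else ennreal (unit_ball_vol (real n)) * (diam_wrt ?d (B i) / 2) ^ n"
    have "cover_sum n ?d B = sum ?t {..<length l}"
      unfolding cover_sum_def by (rule suminf_finite) (auto simp: B_def)
    also have "\<dots> \<le> (\<Sum>i<length l. ennreal (\<omega> * (C * \<eta>)^n))"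
    proof (rule sum_mono)
      fix i
      have "diam_wrt ?d (B i) / 2 \<le> ennreal (C * (2 * \<eta>)) / 2" by (rule divide_right_mono_ennreal[OF dm])
      also have "\<dots> = ennreal (C * \<eta>)" using C(1) F(3) by (simp add: divide_ennreal flip: ennreal_numeral)
      finally have "(diam_wrt ?d (B i) / 2)^n \<le> ennreal (C * \<eta>)^n" by (rule power_mono) simp
      also have "\<dots> = ennreal ((C * \<eta>)^n)" using C(1) F(3) by (simp add: ennreal_power)
      finally show "?t i \<le> ennreal (\<omega> * (C * \<eta>)^n)" using \<omega> by (simp add: ennreal_mult' \<omega>_def mult_left_mono)
    qed
    also have "\<dots> = ennreal (real (card F) * (\<omega> * (C * \<eta>)^n))"
      using \<omega> C(1) F(3) by (simp add: len ennreal_mult' ennreal_of_nat_eq_real_of_nat)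
    also have "real (card F) * (\<omega> * (C * \<eta>)^n) \<le> e"
    proof -
      have "real (card F) * (\<omega> * (C * \<eta>)^n) = (real (card F) * \<eta>^n) * (\<omega> * C^n)" by (simp add: power_mult_distrib)
      also have "\<dots> \<le> (real (card F) * \<eta>^n) * (\<omega> * (C + 1)^n)" using \<omega> C(1) F(3) by (intro mult_left_mono power_mono) auto
      also have "\<dots> \<le> e" using F(6) \<omega> C(1) by (simp add: pos_le_divide_eq)
      finally show ?thesis .
    qed
    finally have "cover_sum n ?d B < \<epsilon>" using e by (meson ennreal_leI le_less_trans)
    then show "\<exists>B. (\<forall>i. B i \<subseteq> topspace X \<and> diam_wrt ?d (B i) \<le> \<delta>) \<and> ?p ` Y \<subseteq> (\<Union>i. B i) \<and> cover_sum n ?d B < \<epsilon>"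
      using dd BX cov by blast
  qed
qed

end

section \<open>Non-pluripolarity\<close>

context almost_complex
begin

lemma local_discs_exist:
  assumes ch: "(U, ch) \<in> \<A>" and p: "p \<in> U" and R: "linear R" "\<And>v. R (R v) = v"
    "\<And>v. R (chart_J \<A> J (U, ch) (ch p) v) = - chart_J \<A> J (U, ch) (ch p) (R v)"
  obtains t0 t1 r \<Psi> K where "local_discs X \<A> J (chart_J \<A> J (U, ch) (ch p)) R t0 t1 U ch (ch p) r \<Psi> K"
proof -
  let ?J0 = "chart_J \<A> J (U, ch) (ch p)"
  define t0 where "t0 = Im (\<psi> 0)"
  define t1 where "t1 = t0 + min t0 (1 - t0) / 2"
  have "0 < t0" "t0 < 1" using \<psi>_0 by (simp_all add: t0_def)
  then have t: "0 < t0" "t0 < t1" "t1 < 1" by (auto simp: t1_def min_def field_simps)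
  have cp: "ch p \<in> ch ` U" using p by blast
  interpret real_form ?J0 R t0 t1
  proof (rule real_form.intro)
    show "complex_space ?J0" by (rule complex_space.intro) (rule chart_J_linear[OF ch cp] chart_J_sq[OF ch cp])+
    show "real_form_axioms ?J0 R t0 t1" by (rule real_form_axioms.intro) (use R t in auto)
  qed
  obtain r \<Psi> K where "coordinate_discs (ch ` U) (chart_J \<A> J (U, ch)) (ch p) r \<Psi> K"
    using coordinate_discs_ex[OF chart(2)[OF ch] cp chart_J_linear[OF ch] chart_J_sq[OF ch] refl chart_J_smooth[OF ch]] by blast
  then have "local_discs X \<A> J ?J0 R t0 t1 U ch (ch p) r \<Psi> K"
    by unfold_locales (use ch in \<open>auto simp: t0_def t1_def\<close>)
  then show thesis by (rule that)
qed

lemma complex_space_chart: "(U, ch) \<in> \<A> \<Longrightarrow> p \<in> U \<Longrightarrow> complex_space (chart_J \<A> J (U, ch) (ch p))"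
  by (rule complex_space.intro) (auto intro: chart_J_linear chart_J_sq)

lemma minus_infinity_locally_constant:
  assumes p: "p \<in> topspace X"
  obtains N where "openin X N" "p \<in> N"
    "\<forall>v \<Omega>. plurisubharmonic X \<A> J v \<longrightarrow> openin X \<Omega> \<longrightarrow> \<Omega> \<inter> N \<noteq> {} \<longrightarrow> (\<forall>x\<in>\<Omega>. v x = -\<infinity>) \<longrightarrow> (\<forall>x\<in>N. v x = -\<infinity>)"
proof -
  have "p \<in> (\<Union>(U, \<phi>)\<in>\<A>. U)" using p atlas unfolding maximal_smooth_atlas_def by blast
  then obtain U ch where c: "(U, ch) \<in> \<A>" "p \<in> U" by blast
  interpret C: complex_space "chart_J \<A> J (U, ch) (ch p)" by (rule complex_space_chart[OF c])
  obtain S where S: "C.totally_real_subspace S" "\<And>w. \<exists>s\<in>S. \<exists>s'\<in>S. w = s + chart_J \<A> J (U, ch) (ch p) s'" using C.maximal_totally_real_subspace by blast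
  obtain R where R: "linear R" "\<And>v. R (R v) = v" "\<And>v. R (chart_J \<A> J (U, ch) (ch p) v) = - chart_J \<A> J (U, ch) (ch p) (R v)"
    using C.conjugation_exists[OF S] by metis
  obtain t0 t1 r \<Psi> K where "local_discs X \<A> J (chart_J \<A> J (U, ch) (ch p)) R t0 t1 U ch (ch p) r \<Psi> K"
    using local_discs_exist[OF c R] by blast
  then interpret L: local_discs X \<A> J "chart_J \<A> J (U, ch) (ch p)" R t0 t1 U ch "ch p" r \<Psi> K .
  obtain N \<eta> where N: "openin X N" "inv_into U ch (ch p) \<in> N" "0 < \<eta>"
    "\<forall>v \<Omega>. plurisubharmonic X \<A> J v \<longrightarrow> openin X \<Omega> \<longrightarrow> \<Omega> \<inter> N \<noteq> {} \<longrightarrow> (\<forall>x\<in>\<Omega>. v x = -\<infinity>) \<longrightarrow> (\<forall>x\<in>N. v x = -\<infinity>)"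
    "\<forall>v Z. plurisubharmonic X \<A> J v \<longrightarrow> compact Z \<longrightarrow>
       (\<forall>y\<in>Z. R y = y \<and> norm y \<le> \<eta> \<and> v (inv_into U ch (ch p + y)) = -\<infinity>) \<longrightarrow>
       \<not> negligible {y \<in> cball 0 1. L.\<sigma> y \<in> Z} \<longrightarrow> (\<forall>x\<in>N. v x = -\<infinity>)"
    by (rule L.neighbourhood, rule that)
  have "p \<in> N" using N(2) inv_chart[OF c] by simp
  then show thesis by (rule that[OF N(1) _ N(4)])
qed

text \<open>
  The largest open set on which \<open>v = -\<infinity>\<close> is also closed.
\<close>

lemma minus_infinity_everywhere:
  assumes con: "connected_space X" and v: "plurisubharmonic X \<A> J v" and \<Omega>: "openin X \<Omega>" "\<Omega> \<noteq> {}" "\<And>x. x \<in> \<Omega> \<Longrightarrow> v x = -\<infinity>"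
    and q: "q \<in> topspace X"
  shows "v q = -\<infinity>"
proof -
  define G where "G = \<Union>{\<Omega>. openin X \<Omega> \<and> (\<forall>x\<in>\<Omega>. v x = -\<infinity>)}"
  have oG: "openin X G" unfolding G_def by (rule openin_Union) auto
  have vG: "v x = -\<infinity>" if "x \<in> G" for x using that by (auto simp: G_def)
  have ne: "G \<noteq> {}" using \<Omega> unfolding G_def by blast
  have "openin X (topspace X - G)"
  proof (subst openin_subopen, intro ballI)
    fix p assume p: "p \<in> topspace X - G"
    then obtain N where N: "openin X N" "p \<in> N"
      "\<forall>v \<Omega>. plurisubharmonic X \<A> J v \<longrightarrow> openin X \<Omega> \<longrightarrow> \<Omega> \<inter> N \<noteq> {} \<longrightarrow> (\<forall>x\<in>\<Omega>. v x = -\<infinity>) \<longrightarrow> (\<forall>x\<in>N. v x = -\<infinity>)"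
      using minus_infinity_locally_constant[of p] p by blast
    have "G \<inter> N = {}"
    proof (rule ccontr)
      assume "G \<inter> N \<noteq> {}"
      then have "\<forall>x\<in>N. v x = -\<infinity>" using N(3) v oG vG by simp
      then have "p \<in> G" using N unfolding G_def by blast
      then show False using p by blast
    qed
    then show "\<exists>N. openin X N \<and> p \<in> N \<and> N \<subseteq> topspace X - G" using N(1,2) openin_subset[OF N(1)] by (intro exI[of _ N]) blast
  qed
  then have "closedin X G" using oG openin_subset by (simp add: closedin_def)
  then have "G = topspace X" using con oG ne unfolding connected_space_clopen_in by blast
  then show ?thesis using vG q by simp
qed

text \<open>
  In a slice chart let \<open>Y\<close> be the part of \<open>K\<close> near \<open>p\<close>.
  The two alternatives are whether the cylinder over \<open>Y\<close> is a null set or not.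
\<close>

lemma positive_measure_or_null:
  assumes D: "DIM('e) = 2 * n" and E: "submanifold n X \<A> E" "totally_real X \<A> J E" and K: "closedin (subtopology X E) K"
    and g: "riemannian_metric X \<A> g" and p: "p \<in> K"
  obtains M where "openin X M" "p \<in> M" "hausdorff_measure n (topspace X) (riemannian_dist X \<A> g) (K \<inter> M) = 0"
  | N where "openin X N" "N \<noteq> {}" "\<forall>v. plurisubharmonic X \<A> J v \<longrightarrow> (\<forall>q\<in>K. v q = -\<infinity>) \<longrightarrow> (\<forall>x\<in>N. v x = -\<infinity>)"
proof -
  obtain Cl where Cl: "closedin X Cl" "K = Cl \<inter> E" using K unfolding closedin_subtopology by blast
  have pE: "p \<in> E" using p Cl by blast
  obtain U ch S where c: "(U, ch) \<in> charts_at \<A> p" and S: "subspace S" "dim S = n" "ch ` (U \<inter> E) = ch ` U \<inter> S"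
    using E(1) pE unfolding submanifold_def by blast
  have c: "(U, ch) \<in> \<A>" "p \<in> U" using c by (auto simp: charts_at_def)
  interpret C: complex_space "chart_J \<A> J (U, ch) (ch p)" by (rule complex_space_chart[OF c])
  have tr: "C.totally_real_subspace S" unfolding C.totally_real_subspace_def using S(1) totally_real_slice[OF c(1) S(1,3) pE c(2) E(2)] by blast
  obtain R where R: "linear R" "\<And>v. R (R v) = v" "\<And>v. R (chart_J \<A> J (U, ch) (ch p) v) = - chart_J \<A> J (U, ch) (ch p) (R v)"
      and fixS: "\<And>v. R v = v \<longleftrightarrow> v \<in> S"
    using C.conjugation_exists[OF tr C.half_dim_totally_real_subspace[OF tr S(2) D]] by metis
  obtain t0 t1 r \<Psi> KK where "local_discs X \<A> J (chart_J \<A> J (U, ch) (ch p)) R t0 t1 U ch (ch p) r \<Psi> KK"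
    using local_discs_exist[OF c R] by blast
  then interpret L: local_discs X \<A> J "chart_J \<A> J (U, ch) (ch p)" R t0 t1 U ch "ch p" r \<Psi> KK .
  obtain N \<eta> where N: "openin X N" "inv_into U ch (ch p) \<in> N" "0 < \<eta>"
    "\<forall>v \<Omega>. plurisubharmonic X \<A> J v \<longrightarrow> openin X \<Omega> \<longrightarrow> \<Omega> \<inter> N \<noteq> {} \<longrightarrow> (\<forall>x\<in>\<Omega>. v x = -\<infinity>) \<longrightarrow> (\<forall>x\<in>N. v x = -\<infinity>)"
    "\<forall>v Z. plurisubharmonic X \<A> J v \<longrightarrow> compact Z \<longrightarrow>
       (\<forall>y\<in>Z. R y = y \<and> norm y \<le> \<eta> \<and> v (inv_into U ch (ch p + y)) = -\<infinity>) \<longrightarrow>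
       \<not> negligible {y \<in> cball 0 1. L.\<sigma> y \<in> Z} \<longrightarrow> (\<forall>x\<in>N. v x = -\<infinity>)"
    by (rule L.neighbourhood, rule that)
  obtain \<rho>0 where \<rho>0: "0 < \<rho>0" "cball (ch p) \<rho>0 \<subseteq> ch ` U" using chart(2)[OF c(1)] c(2) unfolding open_contains_cball by blast
  define \<rho> where "\<rho> = min \<rho>0 (min \<eta> (1/2))"
  have \<rho>: "0 < \<rho>" "\<rho> \<le> \<rho>0" "\<rho> \<le> \<eta>" "\<rho> \<le> 1/2" using \<rho>0 N(3) by (auto simp: \<rho>_def)
  have cb: "cball (ch p) \<rho> \<subseteq> ch ` U" using \<rho>0(2) \<rho>(2) subset_cball by blast
  have pS: "ch p \<in> S" using S(3) pE c(2) by blast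
  define Y where "Y = {y. R y = y \<and> norm y \<le> \<rho> \<and> inv_into U ch (ch p + y) \<in> K}"
  have Yin: "inv_into U ch (ch p + y) \<in> E" if "y \<in> S" "norm y \<le> \<rho>" for y
  proof -
    have "ch p + y \<in> cball (ch p) \<rho>" using that by (simp add: dist_norm)
    then have "ch p + y \<in> ch ` (U \<inter> E)" using cb S(3) subspace_add[OF S(1) pS that(1)] by blast
    then show ?thesis using inv_chart[OF c(1)] by auto
  qed
  have Yc: "compact Y"
  proof -
    have "closedin (top_of_set (ch ` U)) {z \<in> topspace (top_of_set (ch ` U)). inv_into U ch z \<in> Cl}"
      by (rule closedin_continuous_map_preimage[OF inv_continuous[OF c(1)] Cl(1)])
    then obtain Q where Q: "closed Q" "{z \<in> ch ` U. inv_into U ch z \<in> Cl} = ch ` U \<inter> Q" by (auto simp: closedin_closed)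
    have "Y = S \<inter> (\<lambda>z. z - ch p) ` (cball (ch p) \<rho> \<inter> Q)"
    proof (intro set_eqI iffI)
      fix y assume y: "y \<in> Y"
      have z: "ch p + y \<in> cball (ch p) \<rho>" using y by (simp add: Y_def dist_norm)
      moreover have "ch p + y \<in> Q" using Q(2) z cb y Cl(2) unfolding Y_def by blast
      ultimately have "y \<in> (\<lambda>z. z - ch p) ` (cball (ch p) \<rho> \<inter> Q)" by (intro image_eqI[of _ _ "ch p + y"]) auto
      then show "y \<in> S \<inter> (\<lambda>z. z - ch p) ` (cball (ch p) \<rho> \<inter> Q)" using y fixS by (simp add: Y_def)
    next
      fix y assume y: "y \<in> S \<inter> (\<lambda>z. z - ch p) ` (cball (ch p) \<rho> \<inter> Q)"
      then have z: "ch p + y \<in> cball (ch p) \<rho>" "ch p + y \<in> Q" by auto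
      have ny: "norm y \<le> \<rho>" using z(1) by (simp add: dist_norm)
      have "inv_into U ch (ch p + y) \<in> Cl" using Q(2) z cb by blast
      then show "y \<in> Y" using y ny Yin[of y] Cl(2) fixS by (simp add: Y_def)
    qed
    moreover have "compact ((\<lambda>z. z - ch p) ` (cball (ch p) \<rho> \<inter> Q))"
      by (intro compact_continuous_image compact_Int_closed compact_cball Q(1) continuous_intros)
    ultimately show ?thesis using closed_subspace[OF S(1)] by (simp add: closed_Int_compact)
  qed
  show thesis
  proof (cases "negligible {y \<in> cball 0 1. L.\<sigma> y \<in> Y}")
    case True
    define M where "M = inv_into U ch ` ball (ch p) \<rho>"
    have "openin X M" unfolding M_def using cb ball_subset_cball by (intro inv_image_open[OF c(1)]) auto
    moreover have "p \<in> M" unfolding M_def using \<rho>(1) inv_chart[OF c] by (intro image_eqI[of _ _ "ch p"]) auto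
    moreover have "K \<inter> M \<subseteq> (\<lambda>y. inv_into U ch (ch p + y)) ` Y"
    proof
      fix q assume q: "q \<in> K \<inter> M"
      then obtain z where z: "z \<in> ball (ch p) \<rho>" "q = inv_into U ch z" by (auto simp: M_def)
      have zU: "z \<in> ch ` U" using z(1) cb ball_subset_cball by blast
      have "ch q = z" "q \<in> U" using z zU chart_inv[OF c(1)] inv_in[OF c(1)] by auto
      then have zS: "z \<in> S" using S(3) q Cl(2) by blast
      have "z - ch p \<in> Y" using subspace_diff[OF S(1) zS pS] fixS z q by (simp add: Y_def dist_norm norm_minus_commute)
      then show "q \<in> (\<lambda>y. inv_into U ch (ch p + y)) ` Y" using z(2) by (intro image_eqI[of _ _ "z - ch p"]) auto
    qed
    moreover have "hausdorff_measure n (topspace X) (riemannian_dist X \<A> g) ((\<lambda>y. inv_into U ch (ch p + y)) ` Y) = 0"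
    proof (rule null_cylinder_hausdorff_null[OF c(1) g cb L.real_form_axioms _ D Yc _ _ _ True])
      have "{v. R v = v} = S" using fixS by blast
      then show "dim {v. R v = v} = n" using S(2) by simp
    qed (use \<rho> in \<open>auto simp: Y_def\<close>)
    ultimately show thesis using that(1)[of M] hausdorff_null_mono by metis
  next
    case False
    have "\<forall>x\<in>N. v x = -\<infinity>" if v: "plurisubharmonic X \<A> J v" and vK: "\<forall>q\<in>K. v q = -\<infinity>" for v
    proof -
      have "\<forall>y\<in>Y. R y = y \<and> norm y \<le> \<eta> \<and> v (inv_into U ch (ch p + y)) = -\<infinity>" using vK \<rho>(3) by (auto simp: Y_def)
      then show ?thesis using N(5) v Yc False by simp
    qed
    then have "\<forall>v. plurisubharmonic X \<A> J v \<longrightarrow> (\<forall>q\<in>K. v q = -\<infinity>) \<longrightarrow> (\<forall>x\<in>N. v x = -\<infinity>)" by simp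
    moreover have "N \<noteq> {}" using N(2) by blast
    ultimately show thesis by (intro that(2)[OF N(1)])
  qed
qed

end

theorem corollary5p3:
  fixes X :: "'a topology"
    and \<A> :: "('a, 'e::euclidean_space) chart set"
    and J :: "'a \<Rightarrow> ('a, 'e) tvec \<Rightarrow> ('a, 'e) tvec"
    and g :: "'a \<Rightarrow> ('a, 'e) tvec \<Rightarrow> ('a, 'e) tvec \<Rightarrow> real"
    and n :: nat
    and E K :: "'a set"
  assumes "almost_complex_manifold n X \<A> J"
    and "connected_space X"
    and "submanifold n X \<A> E"
    and "totally_real X \<A> J E"
    and "closedin (subtopology X E) K"
    and "riemannian_metric X \<A> g"
    and "hausdorff_measure n (topspace X) (riemannian_dist X \<A> g) K \<noteq> 0"
  shows "\<not> (\<exists>S. pluripolar X \<A> J S \<and> K \<subseteq> S)"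
proof
  let ?H = "hausdorff_measure n (topspace X) (riemannian_dist X \<A> g)"
  assume "\<exists>S. pluripolar X \<A> J S \<and> K \<subseteq> S"
  then obtain u q where u: "plurisuperharmonic X \<A> J u" "q \<in> topspace X" "u q \<noteq> \<infinity>" "\<And>p. p \<in> K \<Longrightarrow> u p = \<infinity>"
    unfolding pluripolar_def by blast
  have sm: "DIM('e) = 2 * n" "second_countable X" "maximal_smooth_atlas X \<A>" and "almost_complex_structure X \<A> J"
    using assms(1) by (simp_all add: almost_complex_manifold_def smooth_manifold_def)
  then interpret almost_complex X \<A> J by unfold_locales
  let ?v = "\<lambda>p. - u p"
  have v: "plurisubharmonic X \<A> J ?v" using u(1) by (simp add: plurisuperharmonic_def)
  have vK: "\<And>p. p \<in> K \<Longrightarrow> ?v p = -\<infinity>" using u(4) by simp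
  have no: "\<not> (openin X N \<and> N \<noteq> {} \<and> (\<forall>x\<in>N. ?v x = -\<infinity>))" for N
    using minus_infinity_everywhere[OF assms(2) v _ _ _ u(2), of N] u(3) by auto
  have "\<exists>M. openin X M \<and> p \<in> M \<and> ?H (K \<inter> M) = 0" if p: "p \<in> K" for p
  proof (rule positive_measure_or_null[OF sm(1) assms(3-6) p])
    fix N assume N: "openin X N" "N \<noteq> {}" "\<forall>v. plurisubharmonic X \<A> J v \<longrightarrow> (\<forall>q\<in>K. v q = -\<infinity>) \<longrightarrow> (\<forall>x\<in>N. v x = -\<infinity>)"
    then have "\<forall>x\<in>N. ?v x = -\<infinity>" using spec[OF N(3), of ?v] v vK by blast
    then show ?thesis using no[of N] N(1,2) by blast
  qed blast
  then obtain M where M: "\<And>p. p \<in> K \<Longrightarrow> openin X (M p)" "\<And>p. p \<in> K \<Longrightarrow> p \<in> M p" "\<And>p. p \<in> K \<Longrightarrow> ?H (K \<inter> M p) = 0" by metis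
  have KX: "K \<subseteq> topspace X" using closedin_subset[OF assms(5)] by simp
  have "Lindelof_space (subtopology X K)" by (intro second_countable_imp_Lindelof_space second_countable_subtopology sm(2))
  then obtain \<V> where \<V>: "countable \<V>" "\<V> \<subseteq> (\<lambda>p. K \<inter> M p) ` K" "\<Union>\<V> = K"
  proof -
    have "\<And>C. C \<in> (\<lambda>p. K \<inter> M p) ` K \<Longrightarrow> openin (subtopology X K) C" using M(1) by (auto simp: openin_subtopology_Int2)
    moreover have "\<Union>((\<lambda>p. K \<inter> M p) ` K) = topspace (subtopology X K)" using M(2) KX by auto
    ultimately show ?thesis using \<open>Lindelof_space (subtopology X K)\<close> KX that
      unfolding Lindelof_space_def by (metis topspace_subtopology_subset)
  qed
  have "?H K = 0"
  proof (cases "K = {}")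
    case True
    have "hausdorff_measure n (topspace X) (riemannian_dist X \<A> g) ({}::'a set) = 0"
      by (simp add: hausdorff_null_iff cover_sum_def diam_wrt_def exI[of _ "\<lambda>_. {}"])
    then show ?thesis using True by simp
  next
    case False
    then show ?thesis using hausdorff_null_Union[OF \<V>(1), where K=K] \<V> M(3) by blast
  qed
  then show False using assms(7) by contradiction
qed

end
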